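(* Let $\mathbf R(n)=(\mathbf Z(n);\Phi(n))$, $n\ge 0$, be an $m$-type branching process in random environment counted by a random characteristic (MBPRCRE, defined in the context), with nonrandom initial state $\mathbf Z(0)=\mathbf z\in\mathbb N_0^m\setminus\{\mathbf 0\}$, $\Phi(0)=\varphi_0\ge 0$. Let $A_n$, $\mathbf C_n$, $\alpha$, $\kappa$, $\Xi$, $U_+$ be as in the context. Assume: (1) $\mathbf E\log^+\|A_0\|<\infty$ and $\alpha<0$; there is a positive integer $L$ with $\mathbf P\big(\min_{1\le i,j\le m}(A_{L-1}A_{L-2}\cdots A_0)_{ij}>0\big)=1$, and there is $l\in\{1,\dots,m\}$ such that $\mathbf E\big|\log\big(1-\mathbf P_{\mathbf f}(Z_l(L)=0\mid \mathbf Z(0)=\mathbf e_i)\big)\big|<\infty$ for every $i\in\{1,\dots,m\}$; (2) $\kappa\in(0,\infty)$; if $\kappa>1$, then $$\max_{1\le i\le m}\mathbf E\Big|\sum_{j=1}^m(\xi_{ij}(n)-a_{ij}(n))\Big|^\kappa<\infty\quad\text{and}\quad \mathbf E\Big|\sum_{i=1}^m(\varphi_i(n)-\mathbf E_{\mathbf F}\varphi_i(n))\Big|^\kappa<\infty,$$ while if $\kappa\le 1$, then $$\max_{1\le i\le m}\mathbf E\Big(\sum_{j=1}^m \mathrm{Var}_{\mathbf F}\,\xi_{ij}(n)\Big)^\kappa<\infty\quad\text{and}\quad \mathbf E\Big(\sum_{i=1}^m \mathrm{Var}_{\mathbf F}\,\varphi_i(n)\Big)^\kappa<\infty;$$ (3)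 there exists $\delta>0$ such that $0<\mathbf E\varphi_i^{\kappa+\delta}(n)<\infty$ for $i=1,\dots,m$; (4) there exist a constant $K_0>0$ and a continuous strictly positive function $\ell$ on $U_+$ such that $\lim_{y\to\infty}y^\kappa\mathbf P(\langle\mathbf u,\Xi\rangle>y)=K_0\ell(\mathbf u)$ for all $\mathbf u\in U_+$. Let $\Phi:=\lim_{n\to\infty}\Phi(n)$. Then for $x>0$, $$\mathbf E\Phi^x<\infty\quad\text{if and only if}\quad x<\kappa.$$
   Context: Notation: $m\ge1$ is fixed; $\mathbb N_0=\{0,1,2,\dots\}$; $\mathbf e_i$ is the $i$-th unit vector; $\|A\|=\sum_{i,j}|a_{ij}|$ for matrices, $\|\mathbf u\|=\sum_i|u_i|$ and $\|\mathbf u\|_2=(\sum_i u_i^2)^{1/2}$ for vectors; $\langle\cdot,\cdot\rangle$ is the standard inner product. Random environment. A mixed probability generating function (m.p.g.f.) is $F(\mathbf s;\lambda)=\mathbf E[s_1^{\xi_1}\cdots s_m^{\xi_m}e^{-\lambda\varphi}]$, $\mathbf s\in[0,1]^m$, $\lambda\ge0$, where the $\xi_j$ are $\mathbb N_0$-valued and $\varphi\ge 0$ is a random variable. The random environment is an i.i.d. sequence $\mathbf F_n=(F_n^{(1)},\dots,F_n^{(m)})$, $n\ge0$, of random vectors of m.p.g.f.'s. Write $F_n^{(i)}(\mathbf s;\lambda)=\mathbf E[s_1^{\xi_{i1}(n)}\cdots s_m^{\xi_{im}(n)}e^{-\lambda\varphi_i(n)}]$ (expectation given the environment), $f_n^{(i)}(\mathbf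 s)=F_n^{(i)}(\mathbf s;0)$, $\mathbf f_n=(f_n^{(1)},\dots,f_n^{(m)})$. Given the environment, the vectors $(\xi_{i1}(n),\dots,\xi_{im}(n);\varphi_i(n))$ for different $i$ are independent. $\mathbf E_{\mathbf F},\mathrm{Var}_{\mathbf F},\mathbf P_{\mathbf F}$ (also $\mathbf E_{\mathbf f},\mathbf P_{\mathbf f}$) denote conditional expectation, variance, probability given the environment; $\mathbf E,\mathbf P$ also average over the environment. MBPRCRE. $\mathbf R(n)=(\mathbf Z(n);\Phi(n))\in\mathbb N_0^m\times[0,\infty)$ starts from $(\mathbf Z(0);\Phi(0))$ and $$\mathbf Z(n+1)=\sum_{i=1}^m\sum_{k=1}^{Z_i(n)}\boldsymbol\xi_i(n;k),\qquad \Phi(n+1)=\Phi(n)+\sum_{i=1}^m\sum_{k=1}^{Z_i(n)}\varphi_i(n;k),$$ where, given the environment, all vectors $(\boldsymbol\xi_i(n;k);\varphi_i(n;k))$ are independent (over $i,n,k$), independent of the past, and distributed as $(\xi_{i1}(n),\dots,\xi_{im}(n);\varphi_i(n))$. The process $\mathbf Z(n)$ is the underlying multitype branching process in random environment (MBPRE). Matrices. $A_n=(a_{ij}(n))_{i,j=1}^m$ with $a_{ij}(n)=\mathbf E_{\mathbf F}\xi_{ij}(n)$, and $\mathbf C_n=(\mathbf E_{\mathbf F}\varphi_1(n),\dots,\mathbf E_{\mathbf F}\varphi_m(n))'$; the pairs $(A_n,\mathbf C_n)$ are i.i.d. If $\mathbf E\log^+\|A_0\|<\infty$, put $\alpha=\lim_{n}\frac1n\mathbf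 E\log\|A_{n-1}\cdots A_0\|$; the process is subcritical if $\alpha<0$. For $x\ge0$, $s(x)=\lim_{n}(\mathbf E\|A_{n-1}\cdots A_0\|^x)^{1/n}$, and $\kappa=\inf\{x>0:s(x)>1\}$ ($\kappa=\infty$ if $s(x)\le1$ for all $x>0$). Finally $\Xi=\sum_{k=0}^\infty A_0A_1\cdots A_{k-1}\mathbf C_k$ (empty product $=$ identity) and $U_+=\{\mathbf u\in\mathbb R^m:u_i\ge0,\ \|\mathbf u\|_2=1\}$. *)

theory Defs
  imports "HOL-Probability.Probability"
begin

section \<open>Extended logarithm, powers and expectation\<close>

definition eln :: "ennreal \<Rightarrow> ereal" where
  "eln y = (if y = 0 then -\<infinity> else if y = \<infinity> then \<infinity> else ereal (ln (enn2real y)))"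

definition epowr :: "ennreal \<Rightarrow> real \<Rightarrow> ennreal"  (infixr \<open>epowr\<close> 80) where
  "y epowr p = (if p = 0 then 1 else if y = \<infinity> then \<infinity> else ennreal (enn2real y powr p))"
  \<comment> \<open>meant for exponents \<open>p \<ge> 0\<close>\<close>

text \<open>Expectation with values in the extended reals; it has its usual meaning as soon as one of the
  two parts is finite.  The function \<^const>\<open>e2ennreal\<close> truncates negative values to \<open>0\<close>.\<close>

definition eexpectation :: "'w measure \<Rightarrow> ('w \<Rightarrow> ereal) \<Rightarrow> ereal" where
  "eexpectation M f = enn2ereal (\<integral>\<^sup>+\<omega>. e2ennreal (f \<omega>) \<partial>M) - enn2ereal (\<integral>\<^sup>+\<omega>. e2ennreal (- f \<omega>) \<partial>M)"


section \<open>Random environment\<close>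

text \<open>The types of particles are the elements of the finite type \<open>'m\<close>.  A particle produces a pair
  in \<open>\<nat>\<^sup>m \<times> [0,\<infinity>)\<close>: its offspring vector and its characteristic.\<close>

type_synonym 'm litter = "(nat ^ 'm) \<times> real"

definition litter_space :: "'m::finite litter measure" where
  "litter_space = count_space UNIV \<Otimes>\<^sub>M restrict_space borel {0..}"

text \<open>The mixed probability generating function of a law on \<open>\<nat>\<^sup>m \<times> [0,\<infinity>)\<close>.  It determines the law
  (lemma \<open>mpgf_inject\<close> below), so a random m.p.g.f. is represented by the corresponding random
  law, measurable with respect to the usual \<open>\<sigma>\<close>-algebra on the space of probability laws.\<close>

definition mpgf :: "'m::finite litter measure \<Rightarrow> real ^ 'm \<Rightarrow> real \<Rightarrow> real" where
  "mpgf \<mu> s t = (\<integral>x. (\<Prod>j\<in>UNIV. (s $ j) ^ (fst x $ j)) * exp (- t * snd x) \<partial>\<mu>)"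

definition env_space :: "('m::finite \<Rightarrow> 'm litter measure) measure" where
  "env_space = (\<Pi>\<^sub>M i\<in>UNIV. prob_algebra litter_space)"

definition iid_environment :: "'w measure \<Rightarrow> (nat \<Rightarrow> 'w \<Rightarrow> 'm::finite \<Rightarrow> 'm litter measure) \<Rightarrow> bool" where
  "iid_environment M F \<longleftrightarrow>
     prob_space M \<and>
     prob_space.indep_vars M (\<lambda>n. env_space) F UNIV \<and>
     (\<forall>n. distr M env_space (F n) = distr M env_space (F 0))"

definition env_algebra :: "'w measure \<Rightarrow> (nat \<Rightarrow> 'w \<Rightarrow> 'm::finite \<Rightarrow> 'm litter measure) \<Rightarrow> 'w measure" where
  "env_algebra M F = vimage_algebra (space M) (\<lambda>\<omega> n. F n \<omega>) (\<Pi>\<^sub>M n\<in>UNIV. env_space)"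


section \<open>The branching process counted by a random characteristic\<close>

text \<open>\<open>X n i k\<close> is the pair \<open>(\<xi>\<^sub>i(n;k+1); \<phi>\<^sub>i(n;k+1))\<close>.  The last condition says that, given the
  environment, all these pairs are independent and \<open>X n i k\<close> has the law \<open>F n \<omega> i\<close>.\<close>

definition mbprcre ::
    "'w measure \<Rightarrow> (nat \<Rightarrow> 'w \<Rightarrow> 'm::finite \<Rightarrow> 'm litter measure) \<Rightarrow>
     (nat \<Rightarrow> 'm \<Rightarrow> nat \<Rightarrow> 'w \<Rightarrow> 'm litter) \<Rightarrow> bool" where
  "mbprcre M F X \<longleftrightarrow>
     iid_environment M F \<and>
     (\<forall>n i k. X n i k \<in> M \<rightarrow>\<^sub>M litter_space) \<and>
     (\<forall>J B. finite J \<longrightarrow> (\<forall>j\<in>J. B j \<in> sets litter_space) \<longrightarrow>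
        (AE \<omega> in M.
           real_cond_exp M (env_algebra M F) (\<lambda>\<omega>. \<Prod>(n, i, k)\<in>J. indicator (B (n, i, k)) (X n i k \<omega>)) \<omega>
           = (\<Prod>(n, i, k)\<in>J. measure (F n \<omega> i) (B (n, i, k)))))"

primrec Zproc :: "(nat \<Rightarrow> 'm \<Rightarrow> nat \<Rightarrow> 'w \<Rightarrow> 'm::finite litter) \<Rightarrow> nat ^ 'm \<Rightarrow> nat \<Rightarrow> 'w \<Rightarrow> nat ^ 'm" where
  "Zproc X z 0 \<omega> = z"
| "Zproc X z (Suc n) \<omega> = (\<Sum>i\<in>UNIV. \<Sum>k<Zproc X z n \<omega> $ i. fst (X n i k \<omega>))"

primrec Phi :: "(nat \<Rightarrow> 'm \<Rightarrow> nat \<Rightarrow> 'w \<Rightarrow> 'm::finite litter) \<Rightarrow> nat ^ 'm \<Rightarrow> real \<Rightarrow> nat \<Rightarrow> 'w \<Rightarrow> real" where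
  "Phi X z \<phi>\<^sub>0 0 \<omega> = \<phi>\<^sub>0"
| "Phi X z \<phi>\<^sub>0 (Suc n) \<omega> = Phi X z \<phi>\<^sub>0 n \<omega> + (\<Sum>i\<in>UNIV. \<Sum>k<Zproc X z n \<omega> $ i. snd (X n i k \<omega>))"

definition Phi_lim :: "(nat \<Rightarrow> 'm \<Rightarrow> nat \<Rightarrow> 'w \<Rightarrow> 'm::finite litter) \<Rightarrow> nat ^ 'm \<Rightarrow> real \<Rightarrow> 'w \<Rightarrow> ennreal" where
  "Phi_lim X z \<phi>\<^sub>0 \<omega> = lim (\<lambda>n. ennreal (Phi X z \<phi>\<^sub>0 n \<omega>))"

text \<open>The probability given the environment that no particle of type \<open>l\<close> lives at time \<open>n\<close> when
  the process starts from \<open>z\<close>.  The litters do not depend on the initial state, so conditioning on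
  it amounts to running the recursion from \<open>z\<close>.\<close>

definition no_type_prob ::
    "'w measure \<Rightarrow> (nat \<Rightarrow> 'w \<Rightarrow> 'm::finite \<Rightarrow> 'm litter measure) \<Rightarrow>
     (nat \<Rightarrow> 'm \<Rightarrow> nat \<Rightarrow> 'w \<Rightarrow> 'm litter) \<Rightarrow> nat ^ 'm \<Rightarrow> nat \<Rightarrow> 'm \<Rightarrow> 'w \<Rightarrow> real" where
  "no_type_prob M F X z n l = real_cond_exp M (env_algebra M F) (indicator {\<omega> \<in> space M. Zproc X z n \<omega> $ l = 0})"


section \<open>Means and variances given the environment\<close>

text \<open>All quantities are nonnegative, hence taken in \<^typ>\<open>ennreal\<close>: no integrability or convergence has
  to be presupposed, and \<open>E log\<^sup>+ \<parallel>A\<^sub>0\<parallel> < \<infinity>\<close> includes that the means are almost surely finite.\<close>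

definition mean_matrix :: "(nat \<Rightarrow> 'w \<Rightarrow> 'm::finite \<Rightarrow> 'm litter measure) \<Rightarrow> nat \<Rightarrow> 'w \<Rightarrow> ennreal ^ 'm ^ 'm" where
  "mean_matrix F n \<omega> = (\<chi> i j. \<integral>\<^sup>+x. of_nat (fst x $ j) \<partial>F n \<omega> i)"

definition mean_char :: "(nat \<Rightarrow> 'w \<Rightarrow> 'm::finite \<Rightarrow> 'm litter measure) \<Rightarrow> nat \<Rightarrow> 'w \<Rightarrow> ennreal ^ 'm" where
  "mean_char F n \<omega> = (\<chi> i. \<integral>\<^sup>+x. ennreal (snd x) \<partial>F n \<omega> i)"

text \<open>The variance is infinite if the mean is.\<close>

definition evariance :: "'a measure \<Rightarrow> ('a \<Rightarrow> real) \<Rightarrow> ennreal" where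
  "evariance \<mu> g =
     (if integrable \<mu> g then \<integral>\<^sup>+x. ennreal ((g x - integral\<^sup>L \<mu> g)\<^sup>2) \<partial>\<mu> else \<infinity>)"

definition matnorm :: "ennreal ^ 'm ^ 'm::finite \<Rightarrow> ennreal" where
  "matnorm B = (\<Sum>i\<in>UNIV. \<Sum>j\<in>UNIV. B $ i $ j)"

text \<open>\<open>left_prod F n\<close> is \<open>A\<^sub>n\<^sub>-\<^sub>1 \<cdots> A\<^sub>0\<close> and \<open>right_prod F n\<close> is \<open>A\<^sub>0 \<cdots> A\<^sub>n\<^sub>-\<^sub>1\<close>.\<close>

primrec left_prod :: "(nat \<Rightarrow> 'w \<Rightarrow> 'm::finite \<Rightarrow> 'm litter measure) \<Rightarrow> nat \<Rightarrow> 'w \<Rightarrow> ennreal ^ 'm ^ 'm" where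
  "left_prod F 0 \<omega> = mat 1"
| "left_prod F (Suc n) \<omega> = mean_matrix F n \<omega> ** left_prod F n \<omega>"

primrec right_prod :: "(nat \<Rightarrow> 'w \<Rightarrow> 'm::finite \<Rightarrow> 'm litter measure) \<Rightarrow> nat \<Rightarrow> 'w \<Rightarrow> ennreal ^ 'm ^ 'm" where
  "right_prod F 0 \<omega> = mat 1"
| "right_prod F (Suc n) \<omega> = right_prod F n \<omega> ** mean_matrix F n \<omega>"

definition lyapunov :: "'w measure \<Rightarrow> (nat \<Rightarrow> 'w \<Rightarrow> 'm::finite \<Rightarrow> 'm litter measure) \<Rightarrow> ereal" where
  "lyapunov M F = lim (\<lambda>n. ereal (1 / real n) * eexpectation M (\<lambda>\<omega>. eln (matnorm (left_prod F n \<omega>))))"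

definition moment_growth :: "'w measure \<Rightarrow> (nat \<Rightarrow> 'w \<Rightarrow> 'm::finite \<Rightarrow> 'm litter measure) \<Rightarrow> real \<Rightarrow> ennreal" where
  "moment_growth M F x =
     lim (\<lambda>n. (\<integral>\<^sup>+\<omega>. matnorm (left_prod F n \<omega>) epowr x \<partial>M) epowr (1 / real n))"

definition kappa :: "'w measure \<Rightarrow> (nat \<Rightarrow> 'w \<Rightarrow> 'm::finite \<Rightarrow> 'm litter measure) \<Rightarrow> ereal" where
  "kappa M F = Inf {ereal x | x. x > 0 \<and> moment_growth M F x > 1}"

definition Xi :: "(nat \<Rightarrow> 'w \<Rightarrow> 'm::finite \<Rightarrow> 'm litter measure) \<Rightarrow> 'w \<Rightarrow> ennreal ^ 'm" where
  "Xi F \<omega> = (\<chi> i. \<Sum>k. (right_prod F k \<omega> *v mean_char F k \<omega>) $ i)"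

definition U_plus :: "(real ^ 'm::finite) set" where
  "U_plus = {u. (\<forall>i. u $ i \<ge> 0) \<and> norm u = 1}"


section \<open>A mixed probability generating function determines its law\<close>

text \<open>Linear combinations of monomials in \<open>y\<close>.\<close>

inductive moncomb :: "((real^'m::finite) \<times> real \<Rightarrow> real) \<Rightarrow> bool" where
  mon: "moncomb (\<lambda>y. c * ((\<Prod>j\<in>UNIV. (fst y $ j) ^ (p j)) * snd y ^ q))"
| add: "moncomb f \<Longrightarrow> moncomb g \<Longrightarrow> moncomb (\<lambda>y. f y + g y)"

lemma moncomb_mult_mon:
  fixes f :: "(real^'m::finite) \<times> real \<Rightarrow> real"
  assumes "moncomb f"
  shows "moncomb (\<lambda>y. f y * (c * ((\<Prod>j\<in>UNIV. (fst y $ j) ^ (p j)) * snd y ^ q)))"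
  using assms
proof induction
  case (mon c' p' q')
  have "(\<lambda>y::(real^'m) \<times> real. (c' * ((\<Prod>j\<in>UNIV. (fst y $ j) ^ (p' j)) * snd y ^ q')) * (c * ((\<Prod>j\<in>UNIV. (fst y $ j) ^ (p j)) * snd y ^ q)))
    = (\<lambda>y. (c' * c) * ((\<Prod>j\<in>UNIV. (fst y $ j) ^ (p' j + p j)) * snd y ^ (q' + q)))"
    by (simp add: power_add prod.distrib fun_eq_iff)
  then show ?case by (simp only: moncomb.mon)
next
  case (add f g)
  from add.IH show ?case unfolding distrib_right by (rule moncomb.add)
qed

lemma moncomb_mult:
  assumes "moncomb f" "moncomb g"
  shows "moncomb (\<lambda>y. f y * g y)"
  using assms(2)
proof induction
  case (mon c p q)
  show ?case using moncomb_mult_mon[OF assms(1)] by simp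
next
  case (add f' g')
  from add.IH show ?case unfolding distrib_left by (rule moncomb.add)
qed

lemma moncomb_const: "moncomb (\<lambda>y::(real^'m::finite) \<times> real. c)"
  using moncomb.mon[where c=c and p="\<lambda>_. 0" and q=0] by simp

lemma moncomb_sum: "finite S \<Longrightarrow> (\<And>i. i \<in> S \<Longrightarrow> moncomb (f i)) \<Longrightarrow> moncomb (\<lambda>y. \<Sum>i\<in>S. f i y)"
proof (induction S rule: finite_induct)
  case (insert x S)
  then show ?case by (simp add: moncomb.add)
qed (simp add: moncomb_const)

lemma moncomb_polynomial:
  fixes f :: "(real^'m::finite) \<times> real \<Rightarrow> real"
  assumes "real_polynomial_function f"
  shows "moncomb f"
  using assms
proof induction
  case (linear f)
  interpret bounded_linear f by fact
  have f1: "moncomb (\<lambda>y. fst y $ j * f (axis j 1, 0))" for j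
  proof -
    have "(\<lambda>y::(real^'m) \<times> real. f (axis j 1, 0) * ((\<Prod>i\<in>UNIV. (fst y $ i) ^ (if i = j then 1 else 0)) * snd y ^ 0))
        = (\<lambda>y. fst y $ j * f (axis j 1, 0))"
      by (auto simp: fun_eq_iff if_distrib prod.delta cong: if_cong)
    from this[symmetric] show ?thesis by (simp only: moncomb.mon)
  qed
  have f2: "moncomb (\<lambda>y. snd y * f (0, 1))"
    using moncomb.mon[where c="f (0, 1)" and p="\<lambda>_. 0" and q=1] by (simp add: mult.commute)
  have dec: "y = (\<Sum>j\<in>UNIV. (fst y $ j) *\<^sub>R (axis j 1, 0)) + snd y *\<^sub>R (0, 1)" for y :: "(real^'m) \<times> real"
    using basis_expansion[of "fst y"]
    by (auto simp: prod_eq_iff fst_sum snd_sum scalar_mult_eq_scaleR)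
  have "f y = (\<Sum>j\<in>UNIV. fst y $ j * f (axis j 1, 0)) + snd y * f (0, 1)" for y
    by (subst dec[of y], simp only: add sum scaleR) simp
  then have "f = (\<lambda>y. (\<Sum>j\<in>UNIV. fst y $ j * f (axis j 1, 0)) + snd y * f (0, 1))" by (rule ext)
  then show ?case by (rule ssubst) (rule moncomb.add[OF moncomb_sum[OF finite f1] f2])
qed (auto intro: moncomb_const moncomb.add moncomb_mult)

text \<open>Powers of the coordinates of \<open>litter_emb\<close> are integrands of the m.p.g.f. at \<open>s\<^sub>j = 2^(-p\<^sub>j)\<close>
  and natural \<open>t\<close>, and the law on the compact cube is determined by these mixed moments.\<close>

definition litter_emb :: "'m::finite litter \<Rightarrow> (real^'m) \<times> real" where
  "litter_emb x = ((\<chi> j. (1/2) ^ (fst x $ j)), exp (- snd x))"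

definition litter_emb_inv :: "(real^'m::finite) \<times> real \<Rightarrow> 'm litter" where
  "litter_emb_inv y = ((\<chi> j. nat \<lceil>- log 2 (fst y $ j)\<rceil>), max 0 (- ln (snd y)))"

lemma countable_nat_vec: "countable (UNIV :: (nat^'m::finite) set)"
proof -
  have "countable (range (\<lambda>f::'m\<Rightarrow>nat. \<chi> i. f i))"
    by (intro countable_image countableI_type)
  moreover have "range (\<lambda>f::'m\<Rightarrow>nat. \<chi> i. f i) = UNIV"
    by (metis (mono_tags, lifting) surjI vec_nth_inverse)
  ultimately show ?thesis by simp
qed

lemma space_litter_space: "space litter_space = UNIV \<times> {0..}"
  by (auto simp: litter_space_def space_pair_measure space_restrict_space)

lemma litter_emb_inv_emb: "x \<in> space litter_space \<Longrightarrow> litter_emb_inv (litter_emb x) = x"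
proof -
  assume "x \<in> space litter_space"
  then have "snd x \<ge> 0" by (auto simp: space_litter_space)
  moreover have "log 2 ((1/2) ^ k) = - real k" for k
    by (simp add: log_nat_power log_divide)
  ultimately show ?thesis
    by (auto simp: litter_emb_def litter_emb_inv_def prod_eq_iff vec_eq_iff)
qed

lemma measurable_fst_nth [measurable]:
  "(\<lambda>x. fst x $ j) \<in> litter_space \<rightarrow>\<^sub>M count_space UNIV"
  unfolding litter_space_def by measurable

lemma measurable_snd_litter [measurable]: "snd \<in> litter_space \<rightarrow>\<^sub>M borel"
  unfolding litter_space_def
  by (rule measurable_compose[OF measurable_snd]) (simp add: measurable_restrict_space1)

lemma measurable_litter_emb [measurable]: "litter_emb \<in> litter_space \<rightarrow>\<^sub>M borel"
proof -
  have "(\<lambda>x::'a litter. \<chi> j. (1/2::real) ^ (fst x $ j)) \<in> litter_space \<rightarrow>\<^sub>M borel"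
    by (rule borel_measurable_euclidean_space[THEN iffD2]) 
       (auto simp: Basis_vec_def inner_axis intro!: measurable_compose[OF measurable_fst_nth])
  then show ?thesis unfolding litter_emb_def borel_prod[symmetric] by measurable
qed

lemma measurable_litter_emb_inv [measurable]: "litter_emb_inv \<in> borel \<rightarrow>\<^sub>M litter_space"
proof -
  have nth [measurable]: "(\<lambda>y::(real^'a) \<times> real. fst y $ j) \<in> borel_measurable borel" for j
    by (intro borel_measurable_continuous_onI continuous_intros)
  have snd [measurable]: "(\<lambda>y::(real^'a) \<times> real. snd y) \<in> borel_measurable borel"
    by (intro borel_measurable_continuous_onI continuous_intros)
  have "(\<lambda>y::(real^'a) \<times> real. (\<chi> j. nat \<lceil>- log 2 (fst y $ j)\<rceil>) :: nat^'a) \<in> borel \<rightarrow>\<^sub>M count_space UNIV"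
  proof (subst measurable_count_space_eq_countable[OF countable_nat_vec], safe)
    fix v :: "nat^'a"
    have "(\<lambda>y::(real^'a) \<times> real. (\<chi> j. nat \<lceil>- log 2 (fst y $ j)\<rceil>) :: nat^'a) -` {v} \<inter> space borel
       = {y \<in> space borel. \<forall>j. nat \<lceil>- log 2 (fst y $ j)\<rceil> = v $ j}"
      by (auto simp: vec_eq_iff)
    also have "\<dots> \<in> sets borel" by measurable
    finally show "(\<lambda>y::(real^'a) \<times> real. (\<chi> j. nat \<lceil>- log 2 (fst y $ j)\<rceil>) :: nat^'a) -` {v} \<inter> space borel \<in> sets borel" .
  qed auto
  moreover have "(\<lambda>y::(real^'a) \<times> real. max 0 (- ln (snd y))) \<in> borel \<rightarrow>\<^sub>M restrict_space borel {0..}"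
    by (rule measurable_restrict_space2) auto
  ultimately show ?thesis
    unfolding litter_emb_inv_def litter_space_def by measurable
qed

lemma mpgf_inject:
  fixes \<mu> \<nu> :: "'m::finite litter measure"
  assumes \<mu>: "\<mu> \<in> space (prob_algebra litter_space)" and \<nu>: "\<nu> \<in> space (prob_algebra litter_space)"
    and eq: "\<And>s t. (\<And>j. 0 \<le> s $ j \<and> s $ j \<le> 1) \<Longrightarrow> 0 \<le> t \<Longrightarrow> mpgf \<mu> s t = mpgf \<nu> s t"
  shows "\<mu> = \<nu>"
proof -
  define K :: "((real^'m) \<times> real) set" where "K = cbox (0, 0) (\<chi> j. 1, 1)"
  have K: "compact K" unfolding K_def by simp
  have in_K: "litter_emb x \<in> K" if "x \<in> space litter_space" for x
    using that by (auto simp: K_def litter_emb_def mem_box_cart cbox_Pair_eq space_litter_space power_le_one)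
  have s: "sets \<mu> = sets litter_space" "sets \<nu> = sets litter_space" and p: "prob_space \<mu>" "prob_space \<nu>"
    using \<mu> \<nu> by (auto simp: space_prob_algebra)
  interpret \<mu>: prob_space \<mu> by fact
  interpret \<nu>: prob_space \<nu> by fact
  have sp: "space \<mu> = space litter_space" "space \<nu> = space litter_space"
    using s by (auto dest: sets_eq_imp_space_eq)
  have m [measurable]: "litter_emb \<in> \<mu> \<rightarrow>\<^sub>M borel" "litter_emb \<in> \<nu> \<rightarrow>\<^sub>M borel"
    using measurable_litter_emb s by (simp_all cong: measurable_cong_sets)
  have int: "integrable \<mu> (\<lambda>x. f (litter_emb x))" "integrable \<nu> (\<lambda>x. f (litter_emb x))"
    if f: "continuous_on UNIV f" for f :: "_ \<Rightarrow> real"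
  proof -
    have [measurable]: "f \<in> borel_measurable borel" using f by (rule borel_measurable_continuous_onI)
    have "compact (f ` K)" using K f by (meson compact_continuous_image continuous_on_subset subset_UNIV)
    then obtain b where b: "\<And>y. y \<in> K \<Longrightarrow> norm (f y) \<le> b"
      by (meson bounded_iff compact_imp_bounded image_eqI)
    have "norm (f (litter_emb x)) \<le> b" if "x \<in> space litter_space" for x
      using b[OF in_K[OF that]] .
    then show "integrable \<mu> (\<lambda>x. f (litter_emb x))" "integrable \<nu> (\<lambda>x. f (litter_emb x))"
      by (intro \<mu>.integrable_const_bound[where B=b] \<nu>.integrable_const_bound[where B=b] AE_I2; simp add: sp)+
  qed
  have cont_mon: "moncomb f \<Longrightarrow> continuous_on UNIV f" for f :: "(real^'m) \<times> real \<Rightarrow> real"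
    by (induction rule: moncomb.induct) (auto intro!: continuous_intros)
  have mon: "(\<integral>x. f (litter_emb x) \<partial>\<mu>) = (\<integral>x. f (litter_emb x) \<partial>\<nu>)" if "moncomb f" for f
    using that
  proof induction
    case (mon c p q)
    have "(\<Prod>j\<in>UNIV. (fst (litter_emb x) $ j) ^ p j) * snd (litter_emb x) ^ q
        = (\<Prod>j\<in>UNIV. ((\<chi> j. (1/2) ^ p j) $ j) ^ (fst x $ j)) * exp (- real q * snd x)" for x :: "'m litter"
      by (simp add: litter_emb_def power_mult[symmetric] mult.commute exp_of_nat_mult[symmetric])
    then show ?case
      using eq[of "\<chi> j. (1/2) ^ p j" "real q"] by (simp add: mpgf_def power_le_one)
  next
    case (add f g)
    then show ?case using int[OF cont_mon] by simp
  qed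
  have cont: "(\<integral>x. f (litter_emb x) \<partial>\<mu>) = (\<integral>x. f (litter_emb x) \<partial>\<nu>)" if f: "continuous_on UNIV f" for f :: "_ \<Rightarrow> real"
  proof (rule ccontr)
    assume ne: "\<not> ?thesis"
    define e where "e = \<bar>(\<integral>x. f (litter_emb x) \<partial>\<mu>) - (\<integral>x. f (litter_emb x) \<partial>\<nu>)\<bar> / 3"
    have "e > 0" using ne by (simp add: e_def)
    then obtain g where g: "real_polynomial_function g" "\<And>y. y \<in> K \<Longrightarrow> \<bar>f y - g y\<bar> < e"
      using Stone_Weierstrass_real_polynomial_function[OF K continuous_on_subset[OF f]] by auto
    have gm: "moncomb g" using g(1) by (rule moncomb_polynomial)
    note ints = int[OF f] int[OF cont_mon[OF gm]]
    have "\<bar>(\<integral>x. f (litter_emb x) \<partial>\<mu>) - (\<integral>x. g (litter_emb x) \<partial>\<mu>)\<bar> \<le> (\<integral>x. e \<partial>\<mu>)"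
      unfolding Bochner_Integration.integral_diff[OF ints(1,3), symmetric]
      by (rule order_trans[OF integral_abs_bound integral_mono]) (use ints in_K g(2) in \<open>auto simp: sp less_imp_le\<close>)
    moreover have "\<bar>(\<integral>x. f (litter_emb x) \<partial>\<nu>) - (\<integral>x. g (litter_emb x) \<partial>\<nu>)\<bar> \<le> (\<integral>x. e \<partial>\<nu>)"
      unfolding Bochner_Integration.integral_diff[OF ints(2,4), symmetric]
      by (rule order_trans[OF integral_abs_bound integral_mono]) (use ints in_K g(2) in \<open>auto simp: sp less_imp_le\<close>)
    ultimately have "\<bar>(\<integral>x. f (litter_emb x) \<partial>\<mu>) - (\<integral>x. f (litter_emb x) \<partial>\<nu>)\<bar> \<le> 2 * e"
      using mon[OF gm] by (simp add: \<mu>.prob_space \<nu>.prob_space)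
    then show False using \<open>e > 0\<close> by (simp add: e_def)
  qed
  have closed: "emeasure (distr \<mu> borel litter_emb) S = emeasure (distr \<nu> borel litter_emb) S" if S: "closed S" for S
  proof (cases "S = {}")
    case False
    define h :: "nat \<Rightarrow> _ \<Rightarrow> real" where "h n y = max 0 (1 - real n * infdist y S)" for n y
    have hc: "continuous_on UNIV (h n)" for n unfolding h_def by (intro continuous_intros)
    have [measurable]: "h n \<in> borel_measurable borel" for n using hc by (rule borel_measurable_continuous_onI)
    have [measurable]: "S \<in> sets borel" using S by simp
    have lim: "(\<lambda>n. h n y) \<longlonglongrightarrow> indicator S y" for y
    proof (cases "y \<in> S")
      case True
      then show ?thesis by (simp add: h_def)
    next
      case n: False
      then have pos: "infdist y S > 0" using S False by (metis in_closed_iff_infdist_zero infdist_nonneg less_eq_real_def)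
      obtain N where N: "1 / infdist y S \<le> real N" using real_arch_simple by blast
      have "h n y = 0" if "n \<ge> N" for n
      proof -
        have "1 / infdist y S \<le> real n" using N that by linarith
        then show ?thesis using pos by (simp add: h_def field_simps)
      qed
      then have "eventually (\<lambda>n. h n y = indicator S y) sequentially"
        using n by (auto simp: eventually_sequentially)
      then show ?thesis by (rule tendsto_eventually)
    qed
    have le: "norm (h n y) \<le> 1" for n y
      by (simp add: h_def infdist_nonneg)
    have l: "(\<lambda>n. \<integral>x. h n (litter_emb x) \<partial>\<mu>) \<longlonglongrightarrow> (\<integral>x. indicator S (litter_emb x) \<partial>\<mu>)"
      by (rule integral_dominated_convergence[where w="\<lambda>_. 1"]) (use lim le in auto)
    have l': "(\<lambda>n. \<integral>x. h n (litter_emb x) \<partial>\<nu>) \<longlonglongrightarrow> (\<integral>x. indicator S (litter_emb x) \<partial>\<nu>)"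
      by (rule integral_dominated_convergence[where w="\<lambda>_. 1"]) (use lim le in auto)
    have *: "(\<integral>x. indicator S (litter_emb x) \<partial>\<mu>) = (\<integral>x. indicator S (litter_emb x) \<partial>\<nu> :: real)"
      using LIMSEQ_unique[OF l] l' cont[OF hc] by simp
    have "(\<integral>x. indicator S (litter_emb x) \<partial>N) = measure (distr N borel litter_emb) S" if [measurable]: "litter_emb \<in> N \<rightarrow>\<^sub>M borel" for N
    proof -
      have "(\<integral>y. indicator S y \<partial>distr N borel litter_emb :: real) = (\<integral>x. indicator S (litter_emb x) \<partial>N)"
        by (rule integral_distr) measurable
      moreover have "(\<integral>y. indicator S y \<partial>distr N borel litter_emb :: real) = measure (distr N borel litter_emb) S"
        by (subst Bochner_Integration.integral_indicator) auto
      ultimately show ?thesis by simp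
    qed
    with * m have "measure (distr \<mu> borel litter_emb) S = measure (distr \<nu> borel litter_emb) S" by simp
    then show ?thesis
      using \<mu>.prob_space_distr[OF m(1)] \<nu>.prob_space_distr[OF m(2)]
      by (simp add: finite_measure.emeasure_eq_measure prob_space.finite_measure)
  qed simp
  have d: "distr \<mu> borel litter_emb = distr \<nu> borel litter_emb"
  proof (rule measure_eqI_generator_eq[where E="Collect closed" and \<Omega>=UNIV and A="\<lambda>_. UNIV"])
    show "sets (distr \<mu> borel litter_emb) = sigma_sets UNIV (Collect closed)" "sets (distr \<nu> borel litter_emb) = sigma_sets UNIV (Collect closed)"
      by (simp_all add: borel_eq_closed)
    show "emeasure (distr \<mu> borel litter_emb) UNIV \<noteq> \<infinity>"
      using \<mu>.prob_space_distr[OF m(1)] by (simp add: finite_measure.emeasure_finite prob_space.finite_measure)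
  qed (auto simp: Int_stable_def closed)
  have "N = distr (distr N borel litter_emb) litter_space litter_emb_inv" if N: "sets N = sets litter_space" for N
  proof -
    have [measurable]: "litter_emb \<in> N \<rightarrow>\<^sub>M borel"
      using measurable_litter_emb N by (simp cong: measurable_cong_sets)
    have "distr (distr N borel litter_emb) litter_space litter_emb_inv = distr N litter_space (litter_emb_inv \<circ> litter_emb)"
      by (rule distr_distr) auto
    also have "\<dots> = distr N litter_space (\<lambda>x. x)"
      by (rule distr_cong) (use sets_eq_imp_space_eq[OF N] litter_emb_inv_emb in auto)
    also have "\<dots> = distr N N (\<lambda>x. x)"
      by (rule distr_cong) (use N in auto)
    finally show ?thesis by simp
  qed
  from this[OF s(1)] this[OF s(2)] d show ?thesis by metis
qed

end

theory Submission
  imports Defs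
begin

text \<open>Given the environment, \<open>\<Phi>\<close> has mean \<open>\<phi>\<^sub>0 + \<langle>z, \<Xi>\<rangle>\<close>, and the tail assumption says that
  \<open>\<langle>z, \<Xi>\<rangle>\<close> has moments exactly of the orders below \<open>\<kappa>\<close>. By Jensen's inequality conditionally on the
  environment, finiteness of \<open>E \<langle>z, \<Xi>\<rangle>\<^sup>x\<close> gives that of \<open>E \<Phi>\<^sup>x\<close> if \<open>x \<le> 1\<close>, and conversely if \<open>x \<ge> 1\<close>.

  For \<open>1 < x < \<kappa>\<close> the process is restarted after \<open>n\<^sub>0\<close> generations and Rosenthal's inequality is
  applied to the independent contributions of the individuals alive then. As the \<open>x\<close>-th moment of
  \<open>A\<^sub>0 \<cdots> A\<^sub>n\<close> tends to \<open>0\<close>, the resulting recursion for the \<open>x\<close>-th moments is a contraction for large \<open>n\<^sub>0\<close>.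

  For \<open>x = \<kappa> < 1\<close> the conditional variance \<open>V\<close> and mean \<open>\<mu>\<close> of \<open>\<Phi>\<close> satisfy the reverse Jensen inequality
  \<open>\<mu>\<^sup>y \<le> 2 E \<Phi>\<^sup>y + V\<^bsup>y/2\<^esup>\<close>. If the process starts from \<open>N\<close> individuals, then \<open>\<mu>\<close> is of the order \<open>N\<close> and
  \<open>\<surd>V\<close> of the order \<open>\<surd>N\<close>; so for large \<open>N\<close> the variance term is absorbed uniformly in \<open>y < \<kappa>\<close>, and
  \<open>y \<rightarrow> \<kappa>\<close> yields \<open>E \<Phi>\<^sup>\<kappa> = \<infinity>\<close>. Populations of size \<open>N\<close> are reached with positive probability.\<close>

section \<open>Kernels of the quenched process\<close>

text \<open>All estimates are made on Markov kernels \<open>quenched n e\<close> for a frozen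
  environment \<open>e\<close>; the array of litters enters through one identity, that the state at
  time \<open>n\<close> has this law given the environment. Averages are then taken over the law of
  \<open>e\<close>, where independence of the generations is a splicing rule.

  Below \<kappa> the decay of the matrix products is read off from \<Xi> itself: the terms of an
  almost surely convergent series tend to 0, and in each term the vector of mean characteristics is
  independent of the matrices in front of it, so their moments can be divided out.

  For \<kappa> < 1 the obstacle is that the variance created by the first generation is multiplied
  by the square of a copy of \<Xi>. The y/2-th moment of the variance is therefore of the same order
  as the y-th moment of \<Xi> which has to beat it, and for one ancestor nothing can be absorbed;
  only a power of the population size separates the two terms. Absorption also subtracts a quantity
  that must be finite, which excludes order \<kappa> itself and forces the detour through y <
  \<kappa> with constants free of y.\<close>

lemma space_litter_iff [simp]: "s \<in> space litter_space \<longleftrightarrow> 0 \<le> snd s"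
  by (cases s) (simp add: space_litter_space)

lemma measurable_litterI:
  fixes f :: "'a \<Rightarrow> 'm::finite litter"
  assumes "(\<lambda>x. fst (f x)) \<in> N \<rightarrow>\<^sub>M count_space UNIV" "(\<lambda>x. snd (f x)) \<in> borel_measurable N"
    and "\<And>x. x \<in> space N \<Longrightarrow> 0 \<le> snd (f x)"
  shows "f \<in> N \<rightarrow>\<^sub>M litter_space"
  unfolding litter_space_def
  by (rule measurable_pair) (use assms in \<open>auto simp: comp_def intro!: measurable_restrict_space2\<close>)

lemma measurable_fst_litter [measurable]: "fst \<in> litter_space \<rightarrow>\<^sub>M count_space UNIV"
  unfolding litter_space_def by measurable

text \<open>Population vectors carry the discrete sigma-algebra of a countable type, so one argument
  may be frozen at each of its countably many values.\<close>

lemma measurable_vec_binop: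
  fixes f g :: "'a \<Rightarrow> nat ^ 'm::finite"
  assumes f: "f \<in> N \<rightarrow>\<^sub>M count_space UNIV" and g: "g \<in> N \<rightarrow>\<^sub>M count_space UNIV"
  shows "(\<lambda>x. h (f x) (g x)) \<in> N \<rightarrow>\<^sub>M count_space UNIV"
proof (rule measurable_compose_countable'[OF _ g countable_nat_vec])
  fix i :: "nat ^ 'm"
  show "(\<lambda>x. h (f x) i) \<in> N \<rightarrow>\<^sub>M count_space UNIV"
    by (rule measurable_compose[OF f]) simp
qed

lemma measurable_litter_add [measurable (raw)]:
  fixes f g :: "'a \<Rightarrow> 'm::finite litter"
  assumes [measurable]: "f \<in> N \<rightarrow>\<^sub>M litter_space" "g \<in> N \<rightarrow>\<^sub>M litter_space"
  shows "(\<lambda>x. f x + g x) \<in> N \<rightarrow>\<^sub>M litter_space"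
proof (rule measurable_litterI)
  show "(\<lambda>x. fst (f x + g x)) \<in> N \<rightarrow>\<^sub>M count_space UNIV"
    unfolding fst_add by (rule measurable_vec_binop) measurable
  show "(\<lambda>x. snd (f x + g x)) \<in> borel_measurable N" unfolding snd_add by measurable
  fix x assume "x \<in> space N"
  then show "0 \<le> snd (f x + g x)"
    using measurable_space[OF assms(1), of x] measurable_space[OF assms(2), of x] by simp
qed

section \<open>Environments as points of a sequence space\<close>

definition env :: "('m::finite \<Rightarrow> 'm litter measure) \<Rightarrow> bool" where
  "env \<mu> \<longleftrightarrow> (\<forall>i. \<mu> i \<in> space (prob_algebra litter_space))"

definition env_seqs :: "(nat \<Rightarrow> 'm::finite \<Rightarrow> 'm litter measure) measure" where
  "env_seqs = (\<Pi>\<^sub>M n\<in>UNIV. env_space)"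

lemma space_env_space: "space env_space = {\<mu>. env \<mu>}"
  by (auto simp: env_space_def space_PiM PiE_def env_def)

lemma space_env_seqs: "space env_seqs = {e. \<forall>n. env (e n)}"
  by (auto simp: env_seqs_def space_PiM PiE_def space_env_space)

lemma measurable_env_nth [measurable]: "(\<lambda>\<mu>. \<mu> i) \<in> env_space \<rightarrow>\<^sub>M prob_algebra litter_space"
  unfolding env_space_def by measurable

lemma measurable_env_seq_nth [measurable]: "(\<lambda>e. e n) \<in> env_seqs \<rightarrow>\<^sub>M env_space"
  unfolding env_seqs_def by measurable

lemma measurable_env_seqI:
  assumes "\<And>n. (\<lambda>x. f x n) \<in> N \<rightarrow>\<^sub>M env_space"
  shows "f \<in> N \<rightarrow>\<^sub>M env_seqs"
  unfolding env_seqs_def using assms by (intro measurable_PiM_single') (auto dest: measurable_space)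

lemma sets_env [simp]: "env \<mu> \<Longrightarrow> sets (\<mu> i) = sets litter_space"
  and prob_env: "env \<mu> \<Longrightarrow> prob_space (\<mu> i)"
  by (auto simp: env_def space_prob_algebra)

lemma space_env_law [simp]: "env \<mu> \<Longrightarrow> space (\<mu> i) = space litter_space"
  by (rule sets_eq_imp_space_eq) simp

lemma measurable_env_law [simp]: "env \<mu> \<Longrightarrow> measurable (\<mu> i) = measurable litter_space"
  by (intro ext measurable_cong_sets) auto

text \<open>An arbitrary enumeration of the types. Its order does not affect the laws built from it,
  because these depend only on multisets of individuals
  (\<open>nn_integral_progeny_mset\<close>).\<close>

definition type_list :: "'m::finite list" where
  "type_list = (SOME xs. set xs = UNIV \<and> distinct xs)"

lemma type_list: "set (type_list :: 'm::finite list) = UNIV" "distinct (type_list :: 'm list)"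
proof -
  have "\<exists>xs::'m list. set xs = UNIV \<and> distinct xs"
    using finite_distinct_list[of "UNIV :: 'm set"] by auto
  from someI_ex[OF this] show "set (type_list :: 'm list) = UNIV" "distinct (type_list :: 'm list)"
    unfolding type_list_def by auto
qed

definition indivs :: "nat ^ 'm::finite \<Rightarrow> 'm list" where
  "indivs z = concat (map (\<lambda>i. replicate (z $ i) i) type_list)"

text \<open>Individuals are grouped by type, so those of \<open>z\<close> and \<open>w\<close> are
  interleaved in the list for \<open>z + w\<close>; only the multisets agree.\<close>

lemma mset_indivs_add: "mset (indivs (z + w)) = mset (indivs z) + mset (indivs w)"
proof -
  have "mset (concat (map (\<lambda>i. replicate ((z + w) $ i) i) ts)) =
     mset (concat (map (\<lambda>i. replicate (z $ i) i) ts)) + mset (concat (map (\<lambda>i. replicate (w $ i) i) ts))" for ts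
    by (induction ts) (auto simp: replicate_add)
  then show ?thesis by (simp add: indivs_def)
qed

lemma indivs_axis: "indivs (axis i 1) = [i :: 'm::finite]"
proof -
  have "mset (concat (map (\<lambda>j. replicate ((axis i 1 :: nat ^ 'm) $ j) j) ts)) = replicate_mset (count (mset ts) i) i" for ts
    by (induction ts) (auto simp: axis_def)
  moreover have "count (mset type_list) i = 1"
    using type_list[where ?'m='m] distinct_count_atmost_1[of "type_list :: 'm list"] by auto
  ultimately have "mset (indivs (axis i 1)) = {#i#}" by (simp add: indivs_def)
  then show ?thesis by simp
qed

lemma indivs_0: "indivs 0 = []"
  by (simp add: indivs_def)

text \<open>The law of \<open>s\<close> plus independent litters, one for each list entry. The
  accumulator \<open>s\<close> lets the litters be revealed one by one, which is how
  \<open>nn_integral_progeny_litters\<close> matches this kernel with the process.\<close>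

primrec progeny :: "('m::finite \<Rightarrow> 'm litter measure) \<Rightarrow> 'm list \<Rightarrow> 'm litter \<Rightarrow> 'm litter measure" where
  "progeny \<mu> [] s = return litter_space s"
| "progeny \<mu> (i # ts) s = \<mu> i \<bind> (\<lambda>x. progeny \<mu> ts (s + x))"

text \<open>The population restarts from 0 because the parents die, whereas the characteristic
  accumulates.\<close>

definition step_law :: "('m::finite \<Rightarrow> 'm litter measure) \<Rightarrow> 'm litter \<Rightarrow> 'm litter measure" where
  "step_law \<mu> s = progeny \<mu> (indivs (fst s)) (0, snd s)"

text \<open>The recursion peels off the first generation, as suits the branching property and the
  products that begin with the matrix of generation 0. The process itself grows at the last
  generation; \<open>nn_integral_quenched_add\<close> mediates between the two.\<close>

primrec quenched :: "nat \<Rightarrow> (nat \<Rightarrow> 'm::finite \<Rightarrow> 'm litter measure) \<Rightarrow> 'm litter \<Rightarrow> 'm litter measure" where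
  "quenched 0 e s = return litter_space s"
| "quenched (Suc n) e s = step_law (e 0) s \<bind> quenched n (\<lambda>k. e (Suc k))"

lemma measurable_compose_Pair:
  assumes "(\<lambda>(x, y). f x y) \<in> A \<Otimes>\<^sub>M B \<rightarrow>\<^sub>M C" "g \<in> N \<rightarrow>\<^sub>M A" "h \<in> N \<rightarrow>\<^sub>M B"
  shows "(\<lambda>x. f (g x) (h x)) \<in> N \<rightarrow>\<^sub>M C"
  using measurable_compose[OF measurable_Pair[OF assms(2,3)] assms(1)] by simp

lemma measurable_progeny_pair:
  "(\<lambda>(\<mu>, s). progeny \<mu> ts s) \<in> env_space \<Otimes>\<^sub>M litter_space \<rightarrow>\<^sub>M prob_algebra litter_space"
proof (induction ts)
  case (Cons i ts)
  note [measurable] = measurable_compose_Pair[OF Cons.IH]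
  show ?case
    unfolding progeny.simps case_prod_beta'
    by (rule measurable_bind_prob_space2[where N=litter_space]) measurable
qed (simp add: case_prod_beta', measurable)

lemmas measurable_progeny [measurable (raw)] = measurable_compose_Pair[OF measurable_progeny_pair]

lemma measurable_step_law [measurable (raw)]:
  assumes [measurable]: "\<mu> \<in> N \<rightarrow>\<^sub>M env_space" "s \<in> N \<rightarrow>\<^sub>M litter_space"
  shows "(\<lambda>x. step_law (\<mu> x) (s x)) \<in> N \<rightarrow>\<^sub>M prob_algebra litter_space"
  unfolding step_law_def
proof (rule measurable_compose_countable'[where g="\<lambda>x. fst (s x)", OF _ _ countable_nat_vec])
  have [measurable]: "(\<lambda>x. (0, snd (s x))) \<in> N \<rightarrow>\<^sub>M litter_space"
    by (rule measurable_litterI) (use measurable_space[OF assms(2)] in auto)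
  show "(\<lambda>x. progeny (\<mu> x) (indivs i) (0, snd (s x))) \<in> N \<rightarrow>\<^sub>M prob_algebra litter_space" for i
    by measurable
qed measurable

lemma measurable_env_shift:
  assumes "f \<in> N \<rightarrow>\<^sub>M env_seqs"
  shows "(\<lambda>x k. f x (h k)) \<in> N \<rightarrow>\<^sub>M env_seqs"
  by (rule measurable_env_seqI) (rule measurable_compose[OF assms measurable_env_seq_nth])


lemma measurable_quenched_pair:
  "(\<lambda>(e, s). quenched n e s) \<in> env_seqs \<Otimes>\<^sub>M litter_space \<rightarrow>\<^sub>M prob_algebra litter_space"
proof (induction n)
  case (Suc n)
  have e: "(\<lambda>x. fst x 0) \<in> env_seqs \<Otimes>\<^sub>M litter_space \<rightarrow>\<^sub>M env_space"
    by (rule measurable_compose[OF measurable_fst measurable_env_seq_nth])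
  have e': "(\<lambda>x k. fst (fst x) (Suc k)) \<in> (env_seqs \<Otimes>\<^sub>M litter_space) \<Otimes>\<^sub>M litter_space \<rightarrow>\<^sub>M env_seqs"
    by (rule measurable_env_shift) measurable
  show ?case
    unfolding quenched.simps case_prod_beta'
    by (rule measurable_bind_prob_space2[where N=litter_space, OF measurable_step_law[OF e measurable_snd]])
       (use measurable_compose_Pair[OF Suc.IH e' measurable_snd] in \<open>simp add: case_prod_beta'\<close>)
qed (simp add: case_prod_beta', measurable)

lemmas measurable_quenched [measurable (raw)] = measurable_compose_Pair[OF measurable_quenched_pair]

section \<open>Iterated integrals against the kernels\<close>

lemma prob_space_progeny: "env \<mu> \<Longrightarrow> 0 \<le> snd s \<Longrightarrow> prob_space (progeny \<mu> ts s)"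
  and sets_progeny [simp]: "env \<mu> \<Longrightarrow> 0 \<le> snd s \<Longrightarrow> sets (progeny \<mu> ts s) = sets litter_space"
  using measurable_space[OF measurable_progeny_pair, of "(\<mu>, s)" ts]
  by (auto simp: space_pair_measure space_env_space space_prob_algebra)

lemma prob_space_step_law: "env \<mu> \<Longrightarrow> 0 \<le> snd s \<Longrightarrow> prob_space (step_law \<mu> s)"
  and sets_step_law [simp]: "env \<mu> \<Longrightarrow> 0 \<le> snd s \<Longrightarrow> sets (step_law \<mu> s) = sets litter_space"
  by (simp_all add: step_law_def prob_space_progeny)

lemma env_seq_nth: "e \<in> space env_seqs \<Longrightarrow> env (e n)"
  and env_seq_shift: "e \<in> space env_seqs \<Longrightarrow> (\<lambda>k. e (h k)) \<in> space env_seqs"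
  by (auto simp: space_env_seqs)

lemma prob_space_quenched: "e \<in> space env_seqs \<Longrightarrow> 0 \<le> snd s \<Longrightarrow> prob_space (quenched n e s)"
  and sets_quenched [simp]: "e \<in> space env_seqs \<Longrightarrow> 0 \<le> snd s \<Longrightarrow> sets (quenched n e s) = sets litter_space"
  using measurable_space[OF measurable_quenched_pair, of "(e, s)" n]
  by (auto simp: space_pair_measure space_prob_algebra)

lemma nn_integral_progeny_Nil [simp]:
  "g \<in> borel_measurable litter_space \<Longrightarrow> 0 \<le> snd s \<Longrightarrow> (\<integral>\<^sup>+t. g t \<partial>progeny \<mu> [] s) = g s"
  by (simp add: nn_integral_return)

lemma nn_integral_progeny_Cons:
  assumes e: "env \<mu>" and g: "g \<in> borel_measurable litter_space" and s: "0 \<le> snd s"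
  shows "(\<integral>\<^sup>+t. g t \<partial>progeny \<mu> (i # ts) s) = (\<integral>\<^sup>+x. \<integral>\<^sup>+t. g t \<partial>progeny \<mu> ts (s + x) \<partial>\<mu> i)"
proof -
  have sp: "\<mu> \<in> space env_space" "s \<in> space litter_space" using e s by (auto simp: space_env_space)
  have "(\<lambda>x. progeny \<mu> ts (s + x)) \<in> litter_space \<rightarrow>\<^sub>M prob_algebra litter_space"
    by (intro measurable_progeny measurable_const measurable_litter_add sp measurable_ident_sets refl)
  then show ?thesis
    unfolding progeny.simps by (intro nn_integral_bind[OF g]) (use e in \<open>simp add: measurable_prob_algebraD\<close>)
qed

lemma nn_integral_quenched_0 [simp]:
  "g \<in> borel_measurable litter_space \<Longrightarrow> 0 \<le> snd s \<Longrightarrow> (\<integral>\<^sup>+t. g t \<partial>quenched 0 e s) = g s"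
  by (simp add: nn_integral_return)

lemma nn_integral_quenched_Suc:
  assumes e: "e \<in> space env_seqs" and g: "g \<in> borel_measurable litter_space" and s: "0 \<le> snd s"
  shows "(\<integral>\<^sup>+t. g t \<partial>quenched (Suc n) e s) =
    (\<integral>\<^sup>+x. \<integral>\<^sup>+t. g t \<partial>quenched n (\<lambda>k. e (Suc k)) x \<partial>step_law (e 0) s)"
proof -
  have "(\<lambda>x. quenched n (\<lambda>k. e (Suc k)) x) \<in> litter_space \<rightarrow>\<^sub>M prob_algebra litter_space"
    by (rule measurable_quenched[OF measurable_const[OF env_seq_shift[OF e]] measurable_ident_sets[OF refl]])
  moreover have *: "measurable (step_law (e 0) s) K = measurable litter_space K" for K :: "'a litter measure measure"
    by (intro measurable_cong_sets sets_step_law env_seq_nth e s refl)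
  ultimately show ?thesis
    unfolding quenched.simps by (intro nn_integral_bind[OF g]) (auto simp only: * intro: measurable_prob_algebraD)
qed

lemma space_step_law [simp]: "env \<mu> \<Longrightarrow> 0 \<le> snd s \<Longrightarrow> space (step_law \<mu> s) = space litter_space"
  by (rule sets_eq_imp_space_eq) simp

lemma space_quenched [simp]: "e \<in> space env_seqs \<Longrightarrow> 0 \<le> snd s \<Longrightarrow> space (quenched n e s) = space litter_space"
  by (rule sets_eq_imp_space_eq) simp

lemma space_progeny [simp]: "env \<mu> \<Longrightarrow> 0 \<le> snd s \<Longrightarrow> space (progeny \<mu> ts s) = space litter_space"
  by (rule sets_eq_imp_space_eq) simp

lemma measurable_nn_integral_quenched:
  assumes "g \<in> borel_measurable litter_space" "e \<in> space env_seqs"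
  shows "(\<lambda>x. \<integral>\<^sup>+t. g t \<partial>quenched n e x) \<in> borel_measurable litter_space"
proof (rule nn_integral_measurable_subprob_algebra2[where N=litter_space])
  show "quenched n e \<in> litter_space \<rightarrow>\<^sub>M subprob_algebra litter_space"
    by (intro measurable_prob_algebraD measurable_quenched measurable_const measurable_ident_sets refl assms)
qed (use assms in \<open>simp add: case_prod_beta'\<close>)

text \<open>Chapman-Kolmogorov equation of a time-inhomogeneous chain, whence the shift by
  \<open>n\<close> in the environment of the last \<open>m\<close> generations.\<close>

lemma nn_integral_quenched_add:
  assumes e: "e \<in> space env_seqs" and g [measurable]: "g \<in> borel_measurable litter_space" and s: "0 \<le> snd s"
  shows "(\<integral>\<^sup>+t. g t \<partial>quenched (n + m) e s) =
    (\<integral>\<^sup>+x. \<integral>\<^sup>+t. g t \<partial>quenched m (\<lambda>k. e (k + n)) x \<partial>quenched n e s)"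
  using e s
proof (induction n arbitrary: e s)
  case 0
  then show ?case by (subst nn_integral_quenched_0) (auto intro: measurable_nn_integral_quenched)
next
  case (Suc n)
  let ?e = "\<lambda>k. e (Suc k)"
  have e: "?e \<in> space env_seqs" "(\<lambda>k. e (k + Suc n)) \<in> space env_seqs"
    using Suc.prems by (auto intro!: env_seq_shift)
  have "(\<integral>\<^sup>+t. g t \<partial>quenched (Suc n + m) e s) =
      (\<integral>\<^sup>+x. \<integral>\<^sup>+t. g t \<partial>quenched (n + m) ?e x \<partial>step_law (e 0) s)"
    using Suc.prems by (simp only: add_Suc nn_integral_quenched_Suc g)
  also have "\<dots> = (\<integral>\<^sup>+x. \<integral>\<^sup>+y. \<integral>\<^sup>+t. g t \<partial>quenched m (\<lambda>k. e (k + Suc n)) y \<partial>quenched n ?e x \<partial>step_law (e 0) s)"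
    using Suc.prems Suc.IH[OF e(1)] by (intro nn_integral_cong) (simp add: env_seq_nth)
  also have "\<dots> = (\<integral>\<^sup>+y. \<integral>\<^sup>+t. g t \<partial>quenched m (\<lambda>k. e (k + Suc n)) y \<partial>quenched (Suc n) e s)"
    using Suc.prems by (subst nn_integral_quenched_Suc) (auto simp del: add_Suc_right intro!: measurable_nn_integral_quenched e)
  finally show ?case .
qed

section \<open>The branching property\<close>

lemma nn_integral_swap_litter:
  assumes "prob_space P" "sets P = sets litter_space" "prob_space P'" "sets P' = sets litter_space"
    and h: "(\<lambda>(x, y). h x y) \<in> borel_measurable (litter_space \<Otimes>\<^sub>M litter_space)"
  shows "(\<integral>\<^sup>+x. \<integral>\<^sup>+y. h x y \<partial>P' \<partial>P) = (\<integral>\<^sup>+y. \<integral>\<^sup>+x. h x y \<partial>P \<partial>P')"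
proof -
  interpret P: prob_space P by fact
  interpret P': prob_space P' by fact
  interpret pair_sigma_finite P' P ..
  have "sets (P' \<Otimes>\<^sub>M P) = sets (litter_space \<Otimes>\<^sub>M litter_space)"
    by (intro sets_pair_measure_cong assms)
  then have "(\<lambda>(x, y). h y x) \<in> borel_measurable (P' \<Otimes>\<^sub>M P)"
    using measurable_compose[OF measurable_pair_swap' h] by (simp add: case_prod_beta' cong: measurable_cong_sets)
  from Fubini'[OF this] show ?thesis by simp
qed

lemma measurable_nn_integral_kernel:
  assumes "K \<in> N \<rightarrow>\<^sub>M prob_algebra litter_space" "(\<lambda>(x, t). g x t) \<in> borel_measurable (N \<Otimes>\<^sub>M litter_space)"
  shows "(\<lambda>x. \<integral>\<^sup>+t. g x t \<partial>K x) \<in> borel_measurable N"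
  by (rule nn_integral_measurable_subprob_algebra2[OF assms(2) measurable_prob_algebraD[OF assms(1)]])

lemma env_in_space: "env \<mu> \<Longrightarrow> \<mu> \<in> space env_space"
  by (simp add: space_env_space)

lemma measurable_nn_integral_progeny:
  assumes "env \<mu>" "(\<lambda>(x, t). g x t) \<in> borel_measurable (N \<Otimes>\<^sub>M litter_space)" "f \<in> N \<rightarrow>\<^sub>M litter_space"
  shows "(\<lambda>x. \<integral>\<^sup>+t. g x t \<partial>progeny \<mu> ts (f x)) \<in> borel_measurable N"
  by (rule measurable_nn_integral_kernel[OF measurable_progeny[OF measurable_const[OF env_in_space[OF assms(1)]] assms(3)] assms(2)])

lemma measurable_add_litter_const:
  assumes "0 \<le> snd s" shows "(\<lambda>x. s + x) \<in> litter_space \<rightarrow>\<^sub>M litter_space"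
proof -
  have [measurable]: "s \<in> space litter_space" using assms by simp
  show ?thesis by measurable
qed

lemma borel_measurable_shift_litter:
  assumes "0 \<le> snd s" "g \<in> borel_measurable litter_space"
  shows "(\<lambda>x. g (s + x)) \<in> borel_measurable litter_space"
  by (rule measurable_compose[OF measurable_add_litter_const[OF assms(1)] assms(2)])

lemma borel_measurable_add_pair:
  assumes "g \<in> borel_measurable litter_space"
  shows "(\<lambda>(x, y). g (x + y)) \<in> borel_measurable (litter_space \<Otimes>\<^sub>M litter_space)"
  unfolding case_prod_beta' by (rule measurable_compose[OF _ assms]) measurable

lemma nn_integral_progeny_shift:
  assumes e: "env \<mu>" and g: "g \<in> borel_measurable litter_space" and "0 \<le> snd s" "0 \<le> snd u"
  shows "(\<integral>\<^sup>+t. g t \<partial>progeny \<mu> ts (u + s)) = (\<integral>\<^sup>+t. g (u + t) \<partial>progeny \<mu> ts s)"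
  using assms(3,4)
proof (induction ts arbitrary: s)
  case Nil
  then show ?case using borel_measurable_shift_litter[OF Nil(2) g] g by (simp del: progeny.simps)
next
  case (Cons i ts)
  have "(\<integral>\<^sup>+x. \<integral>\<^sup>+t. g t \<partial>progeny \<mu> ts (u + s + x) \<partial>\<mu> i) = (\<integral>\<^sup>+x. \<integral>\<^sup>+t. g (u + t) \<partial>progeny \<mu> ts (s + x) \<partial>\<mu> i)"
    by (intro nn_integral_cong) (use Cons e in \<open>simp add: add.assoc\<close>)
  then show ?case
    using Cons.prems by (simp only: nn_integral_progeny_Cons[OF e] g borel_measurable_shift_litter snd_add add_nonneg_nonneg)
qed

text \<open>Splitting the list splits the litters into two independent blocks, and the accumulator
  may be divided between them since it enters additively.\<close>

lemma nn_integral_progeny_append: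
  assumes e: "env \<mu>" and g: "g \<in> borel_measurable litter_space" and "0 \<le> snd s" "0 \<le> snd u"
  shows "(\<integral>\<^sup>+t. g t \<partial>progeny \<mu> (ts @ us) (s + u)) =
    (\<integral>\<^sup>+t. \<integral>\<^sup>+t'. g (t + t') \<partial>progeny \<mu> us u \<partial>progeny \<mu> ts s)"
  using assms(3)
proof (induction ts arbitrary: s)
  case Nil
  have m: "(\<lambda>t. \<integral>\<^sup>+t'. g (t + t') \<partial>progeny \<mu> us u) \<in> borel_measurable litter_space"
    by (rule measurable_nn_integral_progeny[OF e borel_measurable_add_pair[OF g]]) (use assms in simp)
  then show ?case using Nil nn_integral_progeny_shift[OF e g] assms(4) by (simp del: progeny.simps)
next
  case (Cons i ts)
  have m: "(\<lambda>t. \<integral>\<^sup>+t'. g (t + t') \<partial>progeny \<mu> us u) \<in> borel_measurable litter_space"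
    by (rule measurable_nn_integral_progeny[OF e borel_measurable_add_pair[OF g]]) (use assms in simp)
  have "(\<integral>\<^sup>+x. \<integral>\<^sup>+t. g t \<partial>progeny \<mu> (ts @ us) (s + u + x) \<partial>\<mu> i) =
      (\<integral>\<^sup>+x. \<integral>\<^sup>+t. \<integral>\<^sup>+t'. g (t + t') \<partial>progeny \<mu> us u \<partial>progeny \<mu> ts (s + x) \<partial>\<mu> i)"
  proof (intro nn_integral_cong)
    fix x assume "x \<in> space (\<mu> i)"
    then show "(\<integral>\<^sup>+t. g t \<partial>progeny \<mu> (ts @ us) (s + u + x)) =
      (\<integral>\<^sup>+t. \<integral>\<^sup>+t'. g (t + t') \<partial>progeny \<mu> us u \<partial>progeny \<mu> ts (s + x))"
      using Cons.IH[of "s + x"] Cons.prems e by (simp add: ac_simps)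
  qed
  then show ?case
    using Cons.prems assms(4) by (simp only: append_Cons nn_integral_progeny_Cons[OF e] g m snd_add add_nonneg_nonneg)
qed

lemma nn_integral_progeny_swap:
  assumes e: "env \<mu>" and g: "g \<in> borel_measurable litter_space" and s: "0 \<le> snd s"
  shows "(\<integral>\<^sup>+t. g t \<partial>progeny \<mu> (i # j # ts) s) = (\<integral>\<^sup>+t. g t \<partial>progeny \<mu> (j # i # ts) s)"
proof -
  have 1: "(\<integral>\<^sup>+t. g t \<partial>progeny \<mu> (i # j # ts) s) = (\<integral>\<^sup>+x. \<integral>\<^sup>+y. \<integral>\<^sup>+t. g t \<partial>progeny \<mu> ts (s + x + y) \<partial>\<mu> j \<partial>\<mu> i)" for i j
    using s by (subst nn_integral_progeny_Cons[OF e g s], intro nn_integral_cong)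
      (use e in \<open>simp add: nn_integral_progeny_Cons[OF e g] del: progeny.simps\<close>)
  have sm: "s \<in> space litter_space" using s by simp
  have "(\<lambda>x. s + fst x + snd x) \<in> litter_space \<Otimes>\<^sub>M litter_space \<rightarrow>\<^sub>M litter_space"
    by (intro measurable_litter_add measurable_const sm) measurable
  then have "(\<lambda>z. \<integral>\<^sup>+t. g t \<partial>progeny \<mu> ts (s + fst z + snd z)) \<in> borel_measurable (litter_space \<Otimes>\<^sub>M litter_space)"
    by (intro measurable_nn_integral_progeny[OF e]) (use g in \<open>simp_all add: case_prod_beta'\<close>)
  then have "(\<integral>\<^sup>+x. \<integral>\<^sup>+y. \<integral>\<^sup>+t. g t \<partial>progeny \<mu> ts (s + x + y) \<partial>\<mu> j \<partial>\<mu> i) =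
    (\<integral>\<^sup>+y. \<integral>\<^sup>+x. \<integral>\<^sup>+t. g t \<partial>progeny \<mu> ts (s + x + y) \<partial>\<mu> i \<partial>\<mu> j)"
    by (intro nn_integral_swap_litter) (use e in \<open>simp_all add: prob_env case_prod_beta'\<close>)
  also have "\<dots> = (\<integral>\<^sup>+y. \<integral>\<^sup>+x. \<integral>\<^sup>+t. g t \<partial>progeny \<mu> ts (s + y + x) \<partial>\<mu> i \<partial>\<mu> j)"
    by (simp add: ac_simps)
  finally show ?thesis by (simp only: 1)
qed

lemma nn_integral_progeny_mset:
  assumes e: "env \<mu>" and g: "g \<in> borel_measurable litter_space"
  shows "mset ts = mset us \<Longrightarrow> 0 \<le> snd s \<Longrightarrow> (\<integral>\<^sup>+t. g t \<partial>progeny \<mu> ts s) = (\<integral>\<^sup>+t. g t \<partial>progeny \<mu> us s)"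
proof (induction ts arbitrary: us s)
  case (Cons i ts)
  \<comment> \<open>Adjacent transpositions, which are instances of Fubini's theorem, carry the
    entry \<open>i\<close> to the front; the induction on the list then deals with the rest.\<close>
  have front: "(\<integral>\<^sup>+t. g t \<partial>progeny \<mu> (as @ i # bs) s) = (\<integral>\<^sup>+t. g t \<partial>progeny \<mu> (i # as @ bs) s)"
    if "0 \<le> snd s" for as bs s
    using that
  proof (induction as arbitrary: s)
    case (Cons a as)
    have "(\<integral>\<^sup>+t. g t \<partial>progeny \<mu> ((a # as) @ i # bs) s) = (\<integral>\<^sup>+t. g t \<partial>progeny \<mu> (a # i # as @ bs) s)"
      unfolding append_Cons nn_integral_progeny_Cons[OF e g Cons.prems]
      by (intro nn_integral_cong) (use Cons e in \<open>simp del: progeny.simps\<close>)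
    then show ?case using nn_integral_progeny_swap[OF e g Cons.prems] by simp
  qed simp
  from Cons.prems(1) have "i \<in> set us" by (metis list.set_intros(1) mset_eq_setD)
  then obtain as bs where us: "us = as @ i # bs" by (meson split_list)
  then have m: "mset ts = mset (as @ bs)" using Cons.prems(1) by simp
  have "(\<integral>\<^sup>+t. g t \<partial>progeny \<mu> (i # ts) s) = (\<integral>\<^sup>+t. g t \<partial>progeny \<mu> (i # as @ bs) s)"
    unfolding nn_integral_progeny_Cons[OF e g Cons.prems(2)]
    by (intro nn_integral_cong Cons.IH[OF m]) (use Cons.prems e in simp)
  then show ?case by (simp only: us front Cons.prems(2))
qed simp

lemma nn_integral_step_law_add:
  fixes s u :: "'m::finite litter"
  assumes e: "env \<mu>" and g: "g \<in> borel_measurable litter_space" and s: "0 \<le> snd s" "0 \<le> snd u"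
  shows "(\<integral>\<^sup>+t. g t \<partial>step_law \<mu> (s + u)) = (\<integral>\<^sup>+t. \<integral>\<^sup>+t'. g (t + t') \<partial>step_law \<mu> u \<partial>step_law \<mu> s)"
proof -
  have "(\<integral>\<^sup>+t. g t \<partial>step_law \<mu> (s + u)) =
     (\<integral>\<^sup>+t. g t \<partial>progeny \<mu> (indivs (fst s) @ indivs (fst u)) (0, snd (s + u)))"
    unfolding step_law_def fst_add
    by (rule nn_integral_progeny_mset[OF e g]) (use s in \<open>simp_all add: mset_indivs_add\<close>)
  also have "(0 :: nat ^ 'm, snd (s + u)) = (0, snd s) + (0, snd u)" by simp
  finally show ?thesis
    unfolding step_law_def using s by (simp add: nn_integral_progeny_append[OF e g] del: add_Pair)
qed

lemma measurable_nn_integral_quenched2: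
  assumes "e \<in> space env_seqs" "(\<lambda>(x, t). g x t) \<in> borel_measurable (N \<Otimes>\<^sub>M litter_space)" "f \<in> N \<rightarrow>\<^sub>M litter_space"
  shows "(\<lambda>x. \<integral>\<^sup>+t. g x t \<partial>quenched n e (f x)) \<in> borel_measurable N"
  by (rule measurable_nn_integral_kernel[OF measurable_quenched[OF measurable_const[OF assms(1)] assms(3)] assms(2)])

text \<open>Given the environment, descendants of different groups evolve independently. This
  reduces every quenched moment to ancestors that are single individuals.\<close>

lemma nn_integral_quenched_branching:
  assumes "e \<in> space env_seqs" and g: "g \<in> borel_measurable litter_space" and "0 \<le> snd s" "0 \<le> snd u"
  shows "(\<integral>\<^sup>+t. g t \<partial>quenched n e (s + u)) = (\<integral>\<^sup>+t. \<integral>\<^sup>+t'. g (t + t') \<partial>quenched n e u \<partial>quenched n e s)"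
  using assms(1,3,4)
proof (induction n arbitrary: e s u)
  case 0
  have "(\<lambda>t. \<integral>\<^sup>+t'. g (t + t') \<partial>quenched 0 e u) \<in> borel_measurable litter_space"
    by (rule measurable_nn_integral_quenched2[OF 0(1) borel_measurable_add_pair[OF g]]) (use 0 in simp)
  then show ?case using 0 by (simp add: borel_measurable_shift_litter g del: quenched.simps)
next
  case (Suc n)
  let ?e = "\<lambda>k. e (Suc k)"
  have e: "?e \<in> space env_seqs" "env (e 0)" using Suc.prems by (auto intro: env_seq_shift env_seq_nth)
  have m: "(\<lambda>t. \<integral>\<^sup>+t'. g (t + t') \<partial>quenched k e u) \<in> borel_measurable litter_space"
    if "e \<in> space env_seqs" "0 \<le> snd u" for k e u
    by (rule measurable_nn_integral_quenched2[OF that(1) borel_measurable_add_pair[OF g]]) (use that in simp)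
  have "(\<integral>\<^sup>+t. g t \<partial>quenched (Suc n) e (s + u)) =
      (\<integral>\<^sup>+s'. \<integral>\<^sup>+u'. \<integral>\<^sup>+t. g t \<partial>quenched n ?e (s' + u') \<partial>step_law (e 0) u \<partial>step_law (e 0) s)"
    using Suc.prems e
    by (simp only: nn_integral_quenched_Suc[OF _ g] nn_integral_step_law_add[OF _ measurable_nn_integral_quenched[OF g]] snd_add add_nonneg_nonneg)
  also have "\<dots> = (\<integral>\<^sup>+s'. \<integral>\<^sup>+u'. \<integral>\<^sup>+t. \<integral>\<^sup>+t'. g (t + t') \<partial>quenched n ?e u' \<partial>quenched n ?e s' \<partial>step_law (e 0) u \<partial>step_law (e 0) s)"
    by (intro nn_integral_cong Suc.IH) (use Suc.prems e in auto)
  \<comment> \<open>Exchanging the first generation of \<open>u\<close> with the later generations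
    of \<open>s\<close> puts the complete history of each group into adjacent integrals.\<close>
  also have "\<dots> = (\<integral>\<^sup>+s'. \<integral>\<^sup>+t. \<integral>\<^sup>+u'. \<integral>\<^sup>+t'. g (t + t') \<partial>quenched n ?e u' \<partial>step_law (e 0) u \<partial>quenched n ?e s' \<partial>step_law (e 0) s)"
  proof (intro nn_integral_cong nn_integral_swap_litter)
    have "(\<lambda>x. g (snd (fst x) + snd x)) \<in> borel_measurable ((litter_space \<Otimes>\<^sub>M litter_space) \<Otimes>\<^sub>M litter_space)"
      by (rule measurable_compose[OF _ g]) measurable
    then show "(\<lambda>(u', t). \<integral>\<^sup>+t'. g (t + t') \<partial>quenched n ?e u') \<in> borel_measurable (litter_space \<Otimes>\<^sub>M litter_space)"
      unfolding case_prod_beta' by (intro measurable_nn_integral_quenched2 e) (simp_all add: case_prod_beta')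
  qed (use Suc.prems e in \<open>auto simp: prob_space_step_law prob_space_quenched\<close>)
  also have "\<dots> = (\<integral>\<^sup>+s'. \<integral>\<^sup>+t. \<integral>\<^sup>+t'. g (t + t') \<partial>quenched (Suc n) e u \<partial>quenched n ?e s' \<partial>step_law (e 0) s)"
    by (intro nn_integral_cong nn_integral_quenched_Suc[symmetric] borel_measurable_shift_litter g)
      (use Suc.prems e in auto)
  also have "\<dots> = (\<integral>\<^sup>+t. \<integral>\<^sup>+t'. g (t + t') \<partial>quenched (Suc n) e u \<partial>quenched (Suc n) e s)"
    using Suc.prems by (intro nn_integral_quenched_Suc[symmetric] m)
  finally show ?case .
qed

section \<open>Powers of extended nonnegative reals\<close>

lemma epowr_ennreal: "0 \<le> r \<Longrightarrow> p \<noteq> 0 \<Longrightarrow> ennreal r epowr p = ennreal (r powr p)"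
  by (simp add: epowr_def)

lemma epowr_top [simp]: "\<infinity> epowr p = (if p = 0 then 1 else \<infinity>)" "top epowr p = (if p = 0 then 1 else top)"
  by (simp_all add: epowr_def)

lemma epowr_0_base [simp]: "p \<noteq> 0 \<Longrightarrow> 0 epowr p = 0"
  by (simp add: epowr_def)

lemma epowr_0 [simp]: "a epowr 0 = 1"
  by (simp add: epowr_def)

lemma epowr_one [simp]: "a epowr 1 = a"
  by (cases a) (simp_all add: epowr_def)

lemma one_epowr [simp]: "1 epowr p = 1"
  by (simp add: epowr_def)

lemma epowr_mono: "0 \<le> p \<Longrightarrow> a \<le> b \<Longrightarrow> a epowr p \<le> b epowr p"
  by (cases a; cases b) (auto simp: epowr_def powr_mono2 top_unique ennreal_leI)

text \<open>For p > 0 the conventions that 0 times infinity is 0 and that 0 has power 0 are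
  compatible, so the rule survives infinite factors; for p = 0 both sides are 1.\<close>

lemma epowr_mult: "0 \<le> p \<Longrightarrow> (a * b) epowr p = a epowr p * b epowr p"
proof (cases "p = 0")
  case False
  assume "0 \<le> p"
  then have p: "p > 0" using False by simp
  consider r s where "0 \<le> r" "0 \<le> s" "a = ennreal r" "b = ennreal s" | "a = \<infinity>" "b = 0" | "a = \<infinity>" "b \<noteq> 0" | "b = \<infinity>" "a = 0" | "b = \<infinity>" "a \<noteq> 0"
    by (cases a; cases b) auto
  then show ?thesis
  proof cases
    case 1
    then show ?thesis using p by (simp add: ennreal_mult[symmetric] epowr_ennreal powr_mult)
  next
    case 3
    moreover have "b epowr p \<noteq> 0" using 3(2) p by (cases b) (auto simp: epowr_def)
    ultimately show ?thesis using p by (simp add: ennreal_top_mult ennreal_mult_top)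
  next
    case 5
    moreover have "a epowr p \<noteq> 0" using 5(2) p by (cases a) (auto simp: epowr_def)
    ultimately show ?thesis using p by (simp add: ennreal_top_mult ennreal_mult_top)
  qed (use p in auto)
qed simp

lemma epowr_epowr: "0 \<le> p \<Longrightarrow> 0 \<le> q \<Longrightarrow> (a epowr p) epowr q = a epowr (p * q)"
  by (cases a) (auto simp: epowr_def powr_powr)

lemma epowr_epowr_inverse: "0 < p \<Longrightarrow> (a epowr p) epowr (1 / p) = a" "0 < p \<Longrightarrow> (a epowr (1 / p)) epowr p = a"
  by (simp_all add: epowr_epowr)

lemma epowr_add_exp: "0 < p \<Longrightarrow> 0 < q \<Longrightarrow> a epowr (p + q) = a epowr p * a epowr q"
  by (cases a) (auto simp: epowr_def powr_add ennreal_mult)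

lemma epowr_le_iff: "0 < p \<Longrightarrow> a epowr p \<le> b \<longleftrightarrow> a \<le> b epowr (1 / p)"
  using epowr_mono[of "1 / p" "a epowr p" b] epowr_mono[of p a "b epowr (1 / p)"]
  by (auto simp: epowr_epowr_inverse)

text \<open>A positive power is an order isomorphism whose inverse is the power 1/p
  (\<open>epowr_le_iff\<close>), hence it commutes with suprema.\<close>

lemma epowr_SUP:
  assumes "0 < p"
  shows "(SUP i\<in>I. f i) epowr p = (SUP i\<in>I. f i epowr p)"
proof (rule antisym)
  show "(SUP i\<in>I. f i) epowr p \<le> (SUP i\<in>I. f i epowr p)"
    unfolding epowr_le_iff[OF assms]
    by (rule SUP_least, subst epowr_le_iff[OF assms, symmetric], rule SUP_upper)
  show "(SUP i\<in>I. f i epowr p) \<le> (SUP i\<in>I. f i) epowr p"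
    using assms by (intro SUP_least epowr_mono SUP_upper) auto
qed

lemma epowr_eq_top_iff: "0 < p \<Longrightarrow> a epowr p = \<infinity> \<longleftrightarrow> a = \<infinity>"
  by (cases a) (auto simp: epowr_def)

lemma epowr_eq_0_iff: "0 < p \<Longrightarrow> a epowr p = 0 \<longleftrightarrow> a = 0"
  by (cases a) (auto simp: epowr_def)

lemma epowr_less_top_iff: "0 < p \<Longrightarrow> a epowr p < \<infinity> \<longleftrightarrow> a < \<infinity>"
  by (metis epowr_eq_top_iff infinity_ennreal_def less_top)

lemma measurable_epowr [measurable (raw)]:
  assumes [measurable]: "f \<in> borel_measurable N"
  shows "(\<lambda>x. f x epowr p) \<in> borel_measurable N"
  unfolding epowr_def by measurable

lemma epowr_le_Suc: "0 < p \<Longrightarrow> p \<le> q \<Longrightarrow> a epowr p \<le> 1 + a epowr q"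
proof (cases a)
  case (real r)
  assume p: "0 < p" "p \<le> q"
  have "r powr p \<le> 1 + r powr q"
  proof (cases "r \<le> 1")
    case True
    then have "r powr p \<le> 1" using real p powr_le1[of p r] by simp
    then show ?thesis by (smt (verit) powr_ge_zero)
  next
    case False
    then show ?thesis using p powr_mono[of p q r] by (smt (verit))
  qed
  then have "ennreal (r powr p) \<le> ennreal (1 + r powr q)" by (rule ennreal_leI)
  then show ?thesis using real p by (simp add: epowr_ennreal ennreal_plus)
qed simp

text \<open>Below 1 the smaller exponent dominates, above 1 the larger one. The two endpoints thus
  control all exponents in between uniformly.\<close>

lemma epowr_le_sum_exps:
  assumes "0 < p" "p \<le> r" "r \<le> q"
  shows "a epowr r \<le> a epowr p + a epowr q"
proof (cases a)
  case (real u)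
  have "u powr r \<le> u powr p + u powr q"
  proof (cases "u \<le> 1")
    case True
    then have "u powr r \<le> u powr p"
      using real assms by (cases "u = 0") (auto intro: powr_mono')
    then show ?thesis by (smt (verit) powr_ge_zero)
  next
    case False
    then show ?thesis using assms powr_mono[of r q u] by (smt (verit) powr_ge_zero)
  qed
  then have "ennreal (u powr r) \<le> ennreal (u powr p + u powr q)" by (rule ennreal_leI)
  then show ?thesis using real assms by (simp add: epowr_ennreal ennreal_plus)
qed (use assms in simp)

text \<open>The shares a/(a+b) and b/(a+b) add up to 1, and a number in [0,1] is at most its p-th
  power for p \<le> 1.\<close>

lemma powr_add_le_one:
  fixes a b p :: real
  assumes "0 \<le> a" "0 \<le> b" "0 < p" "p \<le> 1"
  shows "(a + b) powr p \<le> a powr p + b powr p"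
proof (cases "a + b = 0")
  case False
  then have s: "a + b > 0" using assms by simp
  have le: "u / (a + b) \<le> (u / (a + b)) powr p" if "0 \<le> u" "u \<le> a + b" for u
  proof (cases "u = 0")
    case False
    then show ?thesis using powr_mono'[of p 1 "u / (a + b)"] that assms s by simp
  qed simp
  have "1 = a / (a + b) + b / (a + b)" using s by (simp add: add_divide_distrib[symmetric])
  also have "\<dots> \<le> (a / (a + b)) powr p + (b / (a + b)) powr p"
    using le[of a] le[of b] assms by simp
  also have "\<dots> = (a powr p + b powr p) / (a + b) powr p"
    using assms s by (simp add: powr_divide add_divide_distrib)
  finally show ?thesis using s by (simp add: field_simps)
qed (use assms in simp)

lemma epowr_add_le_one:
  assumes "0 < p" "p \<le> 1"
  shows "(a + b) epowr p \<le> a epowr p + b epowr p"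
proof (cases "a = \<infinity> \<or> b = \<infinity>")
  case False
  then obtain r s where *: "0 \<le> r" "a = ennreal r" "0 \<le> s" "b = ennreal s" by (cases a; cases b) auto
  show ?thesis using powr_add_le_one[OF *(1,3) assms] * assms
    by (simp add: ennreal_plus[symmetric] epowr_ennreal del: ennreal_plus)
qed (use assms in auto)

lemma epowr_sum_le_one:
  assumes "0 < p" "p \<le> 1"
  shows "(\<Sum>i\<in>I. f i) epowr p \<le> (\<Sum>i\<in>I. f i epowr p)"
proof (induction I rule: infinite_finite_induct)
  case (insert i I)
  then show ?case using order_trans[OF epowr_add_le_one[OF assms]] by (simp add: add_left_mono)
qed (use assms in simp_all)

lemma epowr_suminf_le_one:
  fixes f :: "nat \<Rightarrow> ennreal"
  assumes "0 < p" "p \<le> 1"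
  shows "(\<Sum>i. f i) epowr p \<le> (\<Sum>i. f i epowr p)"
proof -
  have "(\<Sum>i. f i) epowr p = (SUP n. (\<Sum>i<n. f i) epowr p)"
    unfolding suminf_eq_SUP by (rule epowr_SUP[OF assms(1)])
  also have "\<dots> \<le> (SUP n. \<Sum>i<n. f i epowr p)"
    by (intro SUP_mono bexI[of _ n for n]) (auto intro: epowr_sum_le_one[OF assms])
  finally show ?thesis by (simp add: suminf_eq_SUP)
qed

text \<open>From a + b \<le> 2 max a b; the constant is crude but the same for exponents below and
  above 1.\<close>

lemma epowr_add_le:
  assumes "0 < p"
  shows "(a + b) epowr p \<le> 2 epowr p * (a epowr p + b epowr p)"
proof -
  have "(a + b) epowr p \<le> (2 * max a b) epowr p"
    using assms by (intro epowr_mono) (auto simp: mult_2 intro!: add_mono)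
  also have "\<dots> = 2 epowr p * max a b epowr p" using assms by (simp add: epowr_mult)
  also have "\<dots> \<le> 2 epowr p * (a epowr p + b epowr p)"
    by (intro mult_left_mono) (auto simp: max_def add_increasing add_increasing2)
  finally show ?thesis .
qed

lemma epowr_sum_le:
  assumes "0 < p" "finite I"
  shows "(\<Sum>i\<in>I. f i) epowr p \<le> of_nat (card I) epowr p * (\<Sum>i\<in>I. f i epowr p)"
proof (cases "I = {}")
  case False
  define m where "m = Max (f ` I)"
  have m: "m \<in> f ` I" "\<And>i. i \<in> I \<Longrightarrow> f i \<le> m" using assms False by (auto simp: m_def)
  have "(\<Sum>i\<in>I. f i) epowr p \<le> (of_nat (card I) * m) epowr p"
    using assms m by (intro epowr_mono sum_bounded_above) auto
  also have "\<dots> = of_nat (card I) epowr p * m epowr p" using assms by (simp add: epowr_mult)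
  also have "\<dots> \<le> of_nat (card I) epowr p * (\<Sum>i\<in>I. f i epowr p)"
    using m(1) assms by (intro mult_left_mono) (auto intro: member_le_sum)
  finally show ?thesis .
qed (use assms in simp)

lemma epowr_numeral_less_top [simp]: "numeral k epowr p < top" "of_nat n epowr p < top"
  by (simp_all add: epowr_def)

lemma epowr_2: "a epowr 2 = a ^ 2"
  by (cases a) (simp_all add: epowr_def ennreal_power)

section \<open>Moment inequalities\<close>

text \<open>The argument is carried out for extended nonnegative functions, so that it applies
  without any integrability; means 0 and infinity are separate cases.\<close>

lemma (in prob_space) jensen_epowr_le:
  assumes p: "0 < p" "p \<le> 1" and [measurable]: "f \<in> borel_measurable M"
  shows "(\<integral>\<^sup>+x. f x epowr p \<partial>M) \<le> (\<integral>\<^sup>+x. f x \<partial>M) epowr p"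
proof -
  let ?m = "\<integral>\<^sup>+x. f x \<partial>M"
  consider "?m = \<infinity>" | "?m = 0" | r where "0 < r" "?m = ennreal r"
    by (cases ?m) (auto simp: le_less)
  then show ?thesis
  proof cases
    case 1
    then show ?thesis using p by simp
  next
    case 2
    then have "AE x in M. f x = 0" by (simp add: nn_integral_0_iff_AE)
    then have "(\<integral>\<^sup>+x. f x epowr p \<partial>M) = (\<integral>\<^sup>+x. 0 \<partial>M)"
      using p by (intro nn_integral_cong_AE) auto
    then show ?thesis by simp
  next
    case 3
    \<comment> \<open>The tangent at the mean \<open>r\<close> of the concave function u^p, which is
      Young's inequality for u/r and 1.\<close>
    have pt: "f x epowr p \<le> ennreal (p * r powr (p - 1)) * f x + ennreal ((1 - p) * r powr p)" for x
    proof (cases "f x")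
      case (real u)
      have "u powr p \<le> p * r powr (p - 1) * u + (1 - p) * r powr p"
      proof (cases "u = 0")
        case False
        then have u: "u > 0" using real by simp
        have "(u / r) powr p * 1 powr (1 - p) \<le> p * (u / r) + (1 - p) * 1"
          by (rule Youngs_inequality_0) (use u 3 p in auto)
        then have "u powr p \<le> r powr p * (p * (u / r) + (1 - p))"
          using u 3 by (simp add: powr_divide field_simps)
        also have "\<dots> = p * r powr (p - 1) * u + (1 - p) * r powr p"
          using 3 by (simp add: powr_diff field_simps)
        finally show ?thesis .
      qed (use p in simp)
      then show ?thesis using real p
        by (simp add: epowr_ennreal ennreal_mult[symmetric] ennreal_plus[symmetric] del: ennreal_plus)
    next
      case top
      then show ?thesis using p 3 by (simp add: ennreal_mult_top)
    qed
    have "(\<integral>\<^sup>+x. f x epowr p \<partial>M) \<le> (\<integral>\<^sup>+x. ennreal (p * r powr (p - 1)) * f x + ennreal ((1 - p) * r powr p) \<partial>M)"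
      by (intro nn_integral_mono pt)
    also have "\<dots> = ennreal (p * r powr (p - 1)) * ?m + ennreal ((1 - p) * r powr p)"
      by (simp add: nn_integral_add nn_integral_cmult emeasure_space_1)
    also have "\<dots> = ennreal (p * r powr (p - 1) * r + (1 - p) * r powr p)"
      using 3 p by (simp add: ennreal_mult[symmetric])
    also have "p * r powr (p - 1) * r + (1 - p) * r powr p = r powr p"
      using 3 by (simp add: powr_diff field_simps)
    finally show ?thesis using 3 p by (simp add: epowr_ennreal)
  qed
qed

lemma (in prob_space) jensen_epowr_ge:
  assumes p: "1 \<le> p" and [measurable]: "f \<in> borel_measurable M"
  shows "(\<integral>\<^sup>+x. f x \<partial>M) epowr p \<le> (\<integral>\<^sup>+x. f x epowr p \<partial>M)"
  using jensen_epowr_le[of "1 / p" "\<lambda>x. f x epowr p"] p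
  by (subst epowr_le_iff) (simp_all add: epowr_epowr_inverse)

text \<open>If m^2 \<le> v for the mean m, the last term suffices. Otherwise t = f/m has mean 1 and
  second moment at most 2, and integrating t \<le> t^y + t^2/4 gives 1 \<le> E t^y + 1/2; this is
  the origin of the factor 2.\<close>

lemma (in prob_space) reverse_jensen:
  assumes y: "0 < y" "y \<le> 1" and [measurable]: "f \<in> borel_measurable M"
    and fin: "(\<integral>\<^sup>+x. f x \<partial>M) < \<infinity>"
    and second: "(\<integral>\<^sup>+x. f x ^ 2 \<partial>M) \<le> (\<integral>\<^sup>+x. f x \<partial>M) ^ 2 + v"
  shows "(\<integral>\<^sup>+x. f x \<partial>M) epowr y \<le> 2 * (\<integral>\<^sup>+x. f x epowr y \<partial>M) + v epowr (y / 2)"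
proof -
  let ?m = "\<integral>\<^sup>+x. f x \<partial>M"
  obtain m where m: "?m = ennreal m" "0 \<le> m" using fin by (cases ?m) auto
  show ?thesis
  proof (cases "?m ^ 2 \<le> v")
    case True
    have "?m epowr y = (?m ^ 2) epowr (y / 2)" using y by (simp add: epowr_2[symmetric] epowr_epowr)
    also have "\<dots> \<le> v epowr (y / 2)" using True y by (intro epowr_mono) auto
    finally show ?thesis by (simp add: add_increasing)
  next
    case False
    then have "v < ?m ^ 2" by simp
    then obtain w where w: "v = ennreal w" "0 \<le> w" "w < m ^ 2"
      using m by (cases v) (auto simp: ennreal_power ennreal_less_iff)
    have m0: "m > 0" using w m(2) by (cases "m = 0") auto
    have pt: "ennreal (m powr (y - 1)) * f x \<le> f x epowr y + ennreal (m powr (y - 2) / 4) * f x ^ 2" for x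
    proof (cases "f x")
      case (real u)
      define t where "t = u / m"
      have t: "t \<ge> 0" using real m0 by (simp add: t_def)
      \<comment> \<open>For t \<le> 1 the power alone suffices; for t > 1 it is at least 1, and (t/2
        - 1)^2 \<ge> 0 does the rest.\<close>
      have "t \<le> t powr y + t\<^sup>2 / 4"
      proof (cases "t \<le> 1")
        case True
        then have "t \<le> t powr y" using t y powr_mono'[of y 1 t] by (cases "t = 0") auto
        then show ?thesis by (simp add: add_increasing2)
      next
        case False
        then have "1 \<le> t powr y" using y by (simp add: ge_one_powr_ge_zero)
        moreover have "t \<le> 1 + t\<^sup>2 / 4" using zero_le_power2[of "t - 2"] by (simp add: power2_eq_square algebra_simps)
        ultimately show ?thesis by simp
      qed
      then have "m powr y * t \<le> m powr y * (t powr y + t\<^sup>2 / 4)" by (intro mult_left_mono) auto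
      also have "m powr y * t = m powr (y - 1) * u" using m0 by (simp add: t_def powr_diff)
      also have "m powr y * (t powr y + t\<^sup>2 / 4) = u powr y + m powr (y - 2) / 4 * u\<^sup>2"
        using m0 real by (simp add: t_def powr_diff powr_divide power_divide field_simps)
      finally show ?thesis using real y
        by (simp add: epowr_ennreal ennreal_mult[symmetric] ennreal_power ennreal_plus[symmetric] del: ennreal_plus)
    next
      case top
      then show ?thesis using y by simp
    qed
    have "ennreal (m powr (y - 1)) * ?m \<le> (\<integral>\<^sup>+x. f x epowr y + ennreal (m powr (y - 2) / 4) * f x ^ 2 \<partial>M)"
      by (subst nn_integral_cmult[symmetric]) (auto intro!: nn_integral_mono pt)
    also have "\<dots> = (\<integral>\<^sup>+x. f x epowr y \<partial>M) + ennreal (m powr (y - 2) / 4) * (\<integral>\<^sup>+x. f x ^ 2 \<partial>M)"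
      by (simp add: nn_integral_add nn_integral_cmult)
    also have "\<dots> \<le> (\<integral>\<^sup>+x. f x epowr y \<partial>M) + ennreal (m powr (y - 2) / 4) * ennreal (m\<^sup>2 + w)"
      using second m w by (intro add_left_mono mult_left_mono) (simp_all add: ennreal_power ennreal_plus)
    finally have *: "ennreal (m powr (y - 1)) * ennreal m \<le> (\<integral>\<^sup>+x. f x epowr y \<partial>M) + ennreal (m powr (y - 2) / 4 * (m\<^sup>2 + w))"
      using m w by (simp add: ennreal_mult[symmetric] del: ennreal_plus)
    show ?thesis
    proof (cases "\<integral>\<^sup>+x. f x epowr y \<partial>M")
      case (real I)
      have "m powr (y - 1) * m \<le> I + m powr (y - 2) / 4 * (m\<^sup>2 + w)"
        using * real m w by (simp add: ennreal_mult[symmetric] ennreal_plus[symmetric] ennreal_le_iff del: ennreal_plus)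
      also have "m powr (y - 2) / 4 * (m\<^sup>2 + w) \<le> m powr (y - 2) / 4 * (m\<^sup>2 + m\<^sup>2)"
        using w by (intro mult_left_mono) auto
      also have "\<dots> = m powr y / 2" using m0 by (simp add: powr_diff field_simps)
      also have "m powr (y - 1) * m = m powr y" using m0 by (simp add: powr_diff)
      finally have "m powr y \<le> 2 * I" by simp
      then have "ennreal (m powr y) \<le> 2 * ennreal I" using real
        by (metis ennreal_leI ennreal_mult ennreal_numeral zero_le_numeral)
      then show ?thesis using real m y by (simp add: epowr_ennreal add_increasing2)
    next
      case top
      then show ?thesis by (simp add: ennreal_mult_top)
    qed
  qed
qed

text \<open>The tangent of the convex function u^x at a + b lies below the function at a. Expanding
  at the larger point keeps all terms nonnegative.\<close>

lemma powr_add_le_tangent: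
  fixes a b x :: real
  assumes "0 \<le> a" "0 \<le> b" "1 \<le> x"
  shows "(a + b) powr x \<le> a powr x + x * b * (a + b) powr (x - 1)"
proof (cases "a = 0 \<or> b = 0")
  case True
  then show ?thesis
  proof
    assume "a = 0"
    moreover have "b powr x \<le> x * (b * b powr (x - 1))"
      using assms by (cases "b = 0") (auto simp: powr_diff)
    ultimately show ?thesis using assms by (simp add: mult.assoc)
  qed simp
next
  case False
  define t where "t = a / (a + b)"
  have ab: "a > 0" "b > 0" using False assms by auto
  then have t: "t > 0" by (simp add: t_def)
  \<comment> \<open>Young's inequality with weights 1/x and 1 - 1/x is the tangent of t^x at
    1.\<close>
  have "(t powr x) powr (1 / x) * 1 powr (1 - 1 / x) \<le> 1 / x * t powr x + (1 - 1 / x) * 1"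
    by (rule Youngs_inequality_0) (use t assms in auto)
  then have "t \<le> 1 / x * t powr x + (1 - 1 / x)" using assms t by (simp add: powr_powr)
  then have "x * t \<le> x * (1 / x * t powr x + (1 - 1 / x))" using assms by (intro mult_left_mono) auto
  also have "\<dots> = t powr x + x - 1" using assms by (simp add: field_simps)
  finally have "x * t \<le> t powr x + x - 1" .
  then have "(a + b) powr x * (x * t) \<le> (a + b) powr x * (t powr x + x - 1)" by (intro mult_left_mono) auto
  also have "(a + b) powr x * (t powr x + x - 1) = a powr x + (x - 1) * (a + b) powr x"
    using ab by (simp add: t_def powr_divide algebra_simps)
  also have "(a + b) powr x * (x * t) = x * a * (a + b) powr (x - 1)"
    using ab by (simp add: t_def powr_diff)
  finally have "(a + b) powr x \<le> a powr x + x * ((a + b) powr x - a * (a + b) powr (x - 1))"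
    by (simp add: algebra_simps)
  also have "(a + b) powr x = (a + b) * (a + b) powr (x - 1)" using ab by (simp add: powr_diff)
  then have "(a + b) powr x - a * (a + b) powr (x - 1) = b * (a + b) powr (x - 1)" by (simp add: algebra_simps)
  finally show ?thesis by (simp add: mult.assoc)
qed

text \<open>The factor x is the derivative in the tangent inequality, and 2^x separates the two
  summands in the (x-1)-th power of a + b.\<close>

definition "rosenthal_step x = ennreal (x * 2 powr x)"

text \<open>The mixed term is linear in the new summand b. For independent a and b its expectation
  therefore factors into the mean of b and the (x-1)-th moment of a, which is what the induction
  over individuals needs.\<close>

lemma epowr_add_le_tangent:
  assumes x: "1 < x"
  shows "(a + b) epowr x \<le> a epowr x + rosenthal_step x * (b * a epowr (x - 1) + b epowr x)"
proof (cases "a = \<infinity> \<or> b = \<infinity>")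
  case True
  then show ?thesis using x by (auto simp: rosenthal_step_def ennreal_mult_top)
next
  case False
  then obtain r s where *: "0 \<le> r" "a = ennreal r" "0 \<le> s" "b = ennreal s" by (cases a; cases b) auto
  have "(r + s) powr (x - 1) \<le> (2 * max r s) powr (x - 1)"
    using * x by (intro powr_mono2) auto
  also have "\<dots> = 2 powr (x - 1) * max r s powr (x - 1)" using * by (simp add: powr_mult)
  also have "\<dots> \<le> 2 powr x * (r powr (x - 1) + s powr (x - 1))"
    by (intro mult_mono) (auto simp: max_def)
  finally have "x * s * (r + s) powr (x - 1) \<le> x * s * (2 powr x * (r powr (x - 1) + s powr (x - 1)))"
    using * x by (intro mult_left_mono) auto
  also have "\<dots> = x * 2 powr x * (s * r powr (x - 1) + s powr x)"
    using * by (cases "s = 0") (auto simp: powr_diff algebra_simps)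
  finally have "(r + s) powr x \<le> r powr x + x * 2 powr x * (s * r powr (x - 1) + s powr x)"
    using powr_add_le_tangent[of r s x] * x by linarith
  then have "ennreal ((r + s) powr x) \<le> ennreal (r powr x + x * 2 powr x * (s * r powr (x - 1) + s powr x))"
    by (rule ennreal_leI)
  then show ?thesis using * x
    by (simp add: rosenthal_step_def epowr_ennreal ennreal_plus[symmetric] ennreal_mult[symmetric] del: ennreal_plus)
qed

text \<open>Either the power term is at most u/2, and then u \<le> 2a, or it exceeds u/2, and then
  u^(1/x) < 2b. An infinite u satisfies the inequality trivially as soon as b > 0, hence the
  finiteness assumption.\<close>

lemma absorb_epowr:
  assumes x: "1 < x" and u: "u < \<infinity>" and le: "u \<le> a + b * u epowr ((x - 1) / x)"
  shows "u \<le> 2 * a + (2 * b) epowr x"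
proof (cases "a = \<infinity> \<or> b = \<infinity>")
  case True
  then show ?thesis using x by (auto simp: ennreal_mult_top)
next
  case False
  then obtain a' b' u' where *: "0 \<le> a'" "a = ennreal a'" "0 \<le> b'" "b = ennreal b'" "0 \<le> u'" "u = ennreal u'"
    using u by (cases a; cases b; cases u) auto
  have "u' \<le> a' + b' * u' powr ((x - 1) / x)"
    using le * x by (simp add: epowr_ennreal ennreal_plus[symmetric] ennreal_mult[symmetric] ennreal_le_iff del: ennreal_plus)
  then have "u' \<le> 2 * a' + (2 * b') powr x"
  proof (cases "u' = 0 \<or> b' * u' powr ((x - 1) / x) \<le> u' / 2")
    case True
    then show ?thesis
      using \<open>u' \<le> a' + b' * u' powr ((x - 1) / x)\<close> * by (smt (verit) powr_ge_zero field_sum_of_halves)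
  next
    case False
    then have u0: "u' > 0" using * by simp
    have "(x - 1) / x = 1 - 1 / x" using x by (simp add: diff_divide_distrib)
    then have "u' powr ((x - 1) / x) = u' / u' powr (1 / x)" using u0 by (simp add: powr_diff)
    moreover have "u' < 2 * (b' * u' powr ((x - 1) / x))" using False by linarith
    ultimately have "u' < 2 * b' * (u' / u' powr (1 / x))" by (simp only: mult.assoc)
    then have "u' * u' powr (1 / x) < u' * (2 * b')" using u0 by (simp add: field_simps)
    then have "u' powr (1 / x) \<le> 2 * b'" using u0 by simp
    then have "(u' powr (1 / x)) powr x \<le> (2 * b') powr x" using x by (intro powr_mono2) auto
    then show ?thesis using u0 x * by (simp add: powr_powr)
  qed
  then have "ennreal u' \<le> ennreal (2 * a' + (2 * b') powr x)" by (rule ennreal_leI)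
  also have "\<dots> = ennreal (2 * a') + ennreal ((2 * b') powr x)" using * by (simp add: ennreal_plus)
  also have "ennreal (2 * a') = 2 * a" using * by (simp add: ennreal_mult)
  also have "ennreal ((2 * b') powr x) = (2 * b) epowr x" 
    using * x epowr_ennreal[of "2 * b'" x] by (simp add: ennreal_mult)
  finally show ?thesis using * by simp
qed

section \<open>From the process to its quenched laws\<close>

lemma measure_eqI_pair:
  assumes "finite_measure P" and sets: "sets P = sets (A \<Otimes>\<^sub>M B)" "sets Q = sets (A \<Otimes>\<^sub>M B)"
    and eq: "\<And>a b. a \<in> sets A \<Longrightarrow> b \<in> sets B \<Longrightarrow> emeasure P (a \<times> b) = emeasure Q (a \<times> b)"
  shows "P = Q"
proof (rule measure_eqI_generator_eq[OF Int_stable_pair_measure_generator[of A B], where A="\<lambda>_. space A \<times> space B"])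
  show "{a \<times> b |a b. a \<in> sets A \<and> b \<in> sets B} \<subseteq> Pow (space A \<times> space B)"
    using sets.space_closed[of A] sets.space_closed[of B] by auto
  show "sets P = sigma_sets (space A \<times> space B) {a \<times> b |a b. a \<in> sets A \<and> b \<in> sets B}"
    "sets Q = sigma_sets (space A \<times> space B) {a \<times> b |a b. a \<in> sets A \<and> b \<in> sets B}"
    by (simp_all add: sets sets_pair_measure)
  show "emeasure P (space A \<times> space B) \<noteq> \<infinity>" using finite_measure.emeasure_finite[OF assms(1)] by simp
qed (use eq in auto)

locale branching_in_environment =
  fixes M :: "'w measure"
    and F :: "nat \<Rightarrow> 'w \<Rightarrow> 'm::finite \<Rightarrow> 'm litter measure"
    and X :: "nat \<Rightarrow> 'm \<Rightarrow> nat \<Rightarrow> 'w \<Rightarrow> 'm litter"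
  assumes process: "mbprcre M F X"

sublocale branching_in_environment \<subseteq> prob_space M
  using process by (simp add: mbprcre_def iid_environment_def)

context branching_in_environment
begin

definition envs :: "'w \<Rightarrow> nat \<Rightarrow> 'm \<Rightarrow> 'm litter measure" where
  "envs \<omega> = (\<lambda>n. F n \<omega>)"

definition litters :: "nat \<times> 'm \<times> nat \<Rightarrow> 'w \<Rightarrow> 'm litter" where
  "litters j = X (fst j) (fst (snd j)) (snd (snd j))"

definition law :: "(nat \<Rightarrow> 'm \<Rightarrow> 'm litter measure) \<Rightarrow> nat \<times> 'm \<times> nat \<Rightarrow> 'm litter measure" where
  "law e j = e (fst j) (fst (snd j))"

definition past_map where
  "past_map I \<omega> = (envs \<omega>, \<lambda>j\<in>I. litters j \<omega>)"

text \<open>Generated by the whole environment, future generations included, and by the litters with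
  index in \<open>I\<close>. With the environment known completely, a litter outside
  \<open>I\<close> has the conditional law \<open>law (envs \<omega>) j\<close>.\<close>

definition past :: "(nat \<times> 'm \<times> nat) set \<Rightarrow> 'w measure" where
  "past I = vimage_algebra (space M) (past_map I) (env_seqs \<Otimes>\<^sub>M (\<Pi>\<^sub>M j\<in>I. litter_space))"

lemma measurable_F: "F n \<in> M \<rightarrow>\<^sub>M env_space"
proof -
  have "indep_vars (\<lambda>n. env_space) F UNIV" using process by (simp add: mbprcre_def iid_environment_def)
  then show ?thesis by (simp add: indep_vars_def)
qed

lemma measurable_envs [measurable]: "envs \<in> M \<rightarrow>\<^sub>M env_seqs"
  by (rule measurable_env_seqI) (simp add: envs_def measurable_F)

lemma measurable_litters [measurable]: "litters j \<in> M \<rightarrow>\<^sub>M litter_space"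
  using process by (simp add: mbprcre_def litters_def)

lemma measurable_law: "(\<lambda>e. law e j) \<in> env_seqs \<rightarrow>\<^sub>M prob_algebra litter_space"
  unfolding law_def by (rule measurable_compose[OF measurable_env_seq_nth measurable_env_nth])

lemma measurable_emeasure_law [measurable]:
  "B \<in> sets litter_space \<Longrightarrow> (\<lambda>e. emeasure (law e j) B) \<in> borel_measurable env_seqs"
  by (rule measurable_compose[OF measurable_prob_algebraD[OF measurable_law] measurable_emeasure_subprob_algebra])

lemma measurable_past_map [measurable]:
  "past_map I \<in> M \<rightarrow>\<^sub>M env_seqs \<Otimes>\<^sub>M (\<Pi>\<^sub>M j\<in>I. litter_space)"
  unfolding past_map_def by measurable

lemma envs_space [simp]: "\<omega> \<in> space M \<Longrightarrow> envs \<omega> \<in> space env_seqs"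
  using measurable_space[OF measurable_envs] .

lemma prob_law: "\<omega> \<in> space M \<Longrightarrow> prob_space (law (envs \<omega>) j)"
  and sets_law [simp]: "\<omega> \<in> space M \<Longrightarrow> sets (law (envs \<omega>) j) = sets litter_space"
  using env_seq_nth[OF envs_space] by (auto simp: law_def prob_env)

lemma space_past [simp]: "space (past I) = space M"
  by (simp add: past_def)

lemma sets_past: "sets (past I) = {past_map I -` A \<inter> space M | A. A \<in> sets (env_seqs \<Otimes>\<^sub>M (\<Pi>\<^sub>M j\<in>I. litter_space))}"
  unfolding past_def by (rule sets_vimage_algebra2) (use measurable_space[OF measurable_past_map] in auto)

lemma subalgebra_past: "subalgebra M (past I)"
  using measurable_sets[OF measurable_past_map] by (auto simp: subalgebra_def sets_past)

lemma measurable_pastD: "f \<in> past I \<rightarrow>\<^sub>M N \<Longrightarrow> f \<in> M \<rightarrow>\<^sub>M N"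
  using measurable_from_subalg[OF subalgebra_past] .

lemma measurable_past_map_past: "past_map I \<in> past I \<rightarrow>\<^sub>M env_seqs \<Otimes>\<^sub>M (\<Pi>\<^sub>M j\<in>I. litter_space)"
  unfolding past_def by (rule measurable_vimage_algebra1) (use measurable_space[OF measurable_past_map] in auto)

lemma measurable_envs_past [measurable]: "envs \<in> past I \<rightarrow>\<^sub>M env_seqs"
  using measurable_compose[OF measurable_past_map_past measurable_fst] by (simp add: past_map_def)

lemma measurable_litters_past: "j \<in> I \<Longrightarrow> litters j \<in> past I \<rightarrow>\<^sub>M litter_space"
  using measurable_compose[OF measurable_compose[OF measurable_past_map_past measurable_snd] measurable_component_singleton[of j I]]
  by (simp add: past_map_def)

lemma past_mono: assumes "I \<subseteq> I'" "f \<in> past I \<rightarrow>\<^sub>M N" shows "f \<in> past I' \<rightarrow>\<^sub>M N"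
proof -
  have "past_map I \<in> past I' \<rightarrow>\<^sub>M env_seqs \<Otimes>\<^sub>M (\<Pi>\<^sub>M j\<in>I. litter_space)"
    unfolding past_map_def using assms(1)
    by (intro measurable_Pair measurable_envs_past measurable_restrict measurable_litters_past) auto
  then have "(\<lambda>\<omega>. \<omega>) \<in> past I' \<rightarrow>\<^sub>M past I"
    unfolding past_def[of I] by (intro measurable_vimage_algebra2) auto
  from measurable_compose[OF this assms(2)] show ?thesis by simp
qed

lemma env_algebra: "env_algebra M F = vimage_algebra (space M) envs env_seqs"
  by (simp add: env_algebra_def env_seqs_def envs_def[abs_def])

text \<open>The conditional independence in \<open>mbprcre\<close>, tested against functions of the
  environment. The bound on \<open>h\<close> makes all integrands integrable, so that the defining
  property of the real conditional expectation applies.\<close>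

lemma conditional_product:
  fixes h :: "(nat \<Rightarrow> 'm \<Rightarrow> 'm litter measure) \<Rightarrow> ennreal"
  assumes J: "finite J" and B: "\<And>j. j \<in> J \<Longrightarrow> B j \<in> sets litter_space"
    and h [measurable]: "h \<in> borel_measurable env_seqs" and h1: "\<And>e. h e \<le> 1"
  shows "(\<integral>\<^sup>+\<omega>. h (envs \<omega>) * (\<Prod>j\<in>J. indicator (B j) (litters j \<omega>)) \<partial>M) =
    (\<integral>\<^sup>+\<omega>. h (envs \<omega>) * (\<Prod>j\<in>J. emeasure (law (envs \<omega>) j) (B j)) \<partial>M)"
proof -
  let ?G = "env_algebra M F"
  have eG: "envs \<in> ?G \<rightarrow>\<^sub>M env_seqs"
    unfolding env_algebra by (rule measurable_vimage_algebra1) (use envs_space in auto)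
  have "subalgebra M ?G"
    unfolding subalgebra_def env_algebra
    using measurable_sets[OF measurable_envs] envs_space by (subst sets_vimage_algebra2) auto
  then interpret finite_measure_subalgebra M ?G
    by unfold_locales
  define r where "r e = enn2real (h e)" for e
  have r: "0 \<le> r e" "r e \<le> 1" "h e = ennreal (r e)" for e
  proof -
    have "h e \<noteq> \<infinity>" using h1[of e] by (auto simp: top_unique)
    then show "h e = ennreal (r e)" by (simp add: r_def less_top)
    then show "r e \<le> 1" using h1[of e] by simp
  qed (simp add: r_def)
  have rG: "(\<lambda>\<omega>. r (envs \<omega>)) \<in> borel_measurable ?G"
    unfolding r_def by (rule measurable_compose[OF eG]) measurable
  have [measurable]: "(\<lambda>\<omega>. r (envs \<omega>)) \<in> borel_measurable M"
    unfolding r_def by measurable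
  have [measurable]: "\<And>j. j \<in> J \<Longrightarrow> B j \<in> sets litter_space" by fact
  let ?p = "\<lambda>\<omega>. \<Prod>j\<in>J. indicator (B j) (litters j \<omega>) :: real"
  let ?q = "\<lambda>\<omega>. \<Prod>j\<in>J. measure (law (envs \<omega>) j) (B j)"
  have p [measurable]: "?p \<in> borel_measurable M" by measurable
  have [measurable]: "?q \<in> borel_measurable M" unfolding measure_def by measurable
  have p01: "0 \<le> ?p \<omega>" "?p \<omega> \<le> 1" for \<omega>
    by (auto intro!: prod_nonneg prod_le_1 simp: indicator_def)
  have q01: "0 \<le> ?q \<omega>" "\<omega> \<in> space M \<Longrightarrow> ?q \<omega> \<le> 1" for \<omega>
    by (auto intro!: prod_nonneg prod_le_1 prob_space.prob_le_1 prob_law)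
  have int_p: "integrable M (\<lambda>\<omega>. r (envs \<omega>) * ?p \<omega>)"
    by (rule integrable_const_bound[where B=1]) (use r p01 in \<open>auto simp: abs_mult intro!: mult_le_one\<close>)
  have int_q: "integrable M (\<lambda>\<omega>. r (envs \<omega>) * ?q \<omega>)"
    by (rule integrable_const_bound[where B=1]) (use r q01 in \<open>auto simp: abs_mult intro!: mult_le_one AE_I2\<close>)
  have "AE \<omega> in M. real_cond_exp M ?G ?p \<omega> = ?q \<omega>"
    using process J B unfolding mbprcre_def
    by (auto simp: case_prod_beta' litters_def law_def envs_def)
  then have "(\<integral>\<omega>. r (envs \<omega>) * real_cond_exp M ?G ?p \<omega> \<partial>M) = (\<integral>\<omega>. r (envs \<omega>) * ?q \<omega> \<partial>M)"
    by (intro integral_cong_AE) (auto elim: AE_mp)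
  then have "(\<integral>\<omega>. r (envs \<omega>) * ?p \<omega> \<partial>M) = (\<integral>\<omega>. r (envs \<omega>) * ?q \<omega> \<partial>M)"
    using real_cond_exp_intg(2)[OF int_p rG p] by simp
  then have *: "(\<integral>\<^sup>+\<omega>. ennreal (r (envs \<omega>) * ?p \<omega>) \<partial>M) = (\<integral>\<^sup>+\<omega>. ennreal (r (envs \<omega>) * ?q \<omega>) \<partial>M)"
    using r p01 q01 by (simp add: nn_integral_eq_integral[OF int_p] nn_integral_eq_integral[OF int_q])
  have "(\<integral>\<^sup>+\<omega>. h (envs \<omega>) * (\<Prod>j\<in>J. indicator (B j) (litters j \<omega>)) \<partial>M) = (\<integral>\<^sup>+\<omega>. ennreal (r (envs \<omega>) * ?p \<omega>) \<partial>M)"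
    using r p01 by (intro nn_integral_cong) (simp add: ennreal_mult prod_ennreal[symmetric] ennreal_indicator)
  also note *
  also have "(\<integral>\<^sup>+\<omega>. ennreal (r (envs \<omega>) * ?q \<omega>) \<partial>M) = (\<integral>\<^sup>+\<omega>. h (envs \<omega>) * (\<Prod>j\<in>J. emeasure (law (envs \<omega>) j) (B j)) \<partial>M)"
    using r q01 by (intro nn_integral_cong)
      (simp add: ennreal_mult prod_ennreal[symmetric] finite_measure.emeasure_eq_measure[OF prob_space.finite_measure[OF prob_law]])
  finally show ?thesis .
qed

text \<open>Finite products determine the measures involved, in two rounds: for a fixed event of the
  environment, cylinders determine a measure on the litters indexed by the possibly infinite
  \<open>I\<close>; then rectangles determine a measure on environments and litters jointly.\<close>

lemma next_litter_rectangle: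
  assumes j: "j \<notin> I" and A: "A \<in> sets (past I)" and C: "C \<in> sets litter_space"
  shows "(\<integral>\<^sup>+\<omega>. indicator A \<omega> * indicator C (litters j \<omega>) \<partial>M) =
    (\<integral>\<^sup>+\<omega>. indicator A \<omega> * emeasure (law (envs \<omega>) j) C \<partial>M)"
proof -
  note C [measurable]
  let ?L = "\<Pi>\<^sub>M j\<in>I. litter_space :: 'm litter measure"
  let ?r = "\<lambda>\<omega>. \<lambda>j\<in>I. litters j \<omega>"
  have le1: "emeasure (law (envs \<omega>) j) C \<le> 1" if "\<omega> \<in> space M" for \<omega> j
    using subprob_space.subprob_emeasure_le_1[OF prob_space_imp_subprob_space[OF prob_law[OF that]]] .
  have fin: "finite_measure (distr (density M (\<lambda>\<omega>. g \<omega> * f \<omega>)) N Y)"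
    if "\<And>\<omega>. g \<omega> \<le> 1" "\<And>\<omega>. \<omega> \<in> space M \<Longrightarrow> f \<omega> \<le> 1" "(\<lambda>\<omega>. g \<omega> * f \<omega>) \<in> borel_measurable M" "Y \<in> M \<rightarrow>\<^sub>M N"
    for g f and Y :: "'w \<Rightarrow> 'c" and N
  proof (rule finite_measureI)
    have "(\<integral>\<^sup>+\<omega>. g \<omega> * f \<omega> \<partial>M) \<le> (\<integral>\<^sup>+\<omega>. 1 \<partial>M)"
      using that mult_mono[of "g \<omega>" 1 "f \<omega>" 1 for \<omega>] by (intro nn_integral_mono) auto
    also have "\<dots> < \<infinity>" by (simp add: emeasure_space_1)
    finally show "emeasure (distr (density M (\<lambda>\<omega>. g \<omega> * f \<omega>)) N Y) (space (distr (density M (\<lambda>\<omega>. g \<omega> * f \<omega>)) N Y)) \<noteq> \<infinity>"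
      using that measurable_space[OF that(4)] by (subst emeasure_distr) (auto simp: emeasure_density top_unique intro!: cong: nn_integral_cong)
  qed
  have emb: "(\<integral>\<^sup>+\<omega>. indicator E (envs \<omega>) * indicator D (?r \<omega>) * indicator C (litters j \<omega>) \<partial>M) =
    (\<integral>\<^sup>+\<omega>. indicator E (envs \<omega>) * indicator D (?r \<omega>) * emeasure (law (envs \<omega>) j) C \<partial>M)"
    if E [measurable]: "E \<in> sets env_seqs" and D [measurable]: "D \<in> sets ?L" for E D
  proof -
    let ?P = "distr (density M (\<lambda>\<omega>. indicator E (envs \<omega>) * indicator C (litters j \<omega>))) ?L ?r"
    let ?Q = "distr (density M (\<lambda>\<omega>. indicator E (envs \<omega>) * emeasure (law (envs \<omega>) j) C)) ?L ?r"
    have "?P = ?Q"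
    proof (rule measure_eqI_PiM_infinite)
      show "finite_measure ?P" by (rule fin) (auto simp: indicator_def)
      fix B :: "nat \<times> 'm \<times> nat \<Rightarrow> 'm litter set" and J assume J: "finite J" "J \<subseteq> I" and B: "\<And>i. i \<in> J \<Longrightarrow> B i \<in> sets litter_space"
      let ?D = "prod_emb I (\<lambda>_. litter_space :: 'm litter measure) J (Pi\<^sub>E J B)"
      have D [measurable]: "?D \<in> sets ?L" using J B by (intro sets_PiM_I) auto
      have jJ: "j \<notin> J" using J j by auto
      have ind: "indicator ?D (?r \<omega>) = (\<Prod>i\<in>J. indicator (B i) (litters i \<omega>) :: ennreal)" if "\<omega> \<in> space M" for \<omega>
      proof -
        have "?r \<omega> \<in> ?D \<longleftrightarrow> (\<forall>i\<in>J. litters i \<omega> \<in> B i)"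
          using J measurable_space[OF measurable_litters that] by (auto simp: prod_emb_iff PiE_iff)
        then show ?thesis using J by (auto simp: indicator_def prod_zero_iff)
      qed
      define B' where "B' = B(j := C)"
      have B': "\<And>i. i \<in> insert j J \<Longrightarrow> B' i \<in> sets litter_space" using B C by (auto simp: B'_def)
      have c1: "indicator E (envs \<omega>) * (\<Prod>i\<in>insert j J. indicator (B' i) (litters i \<omega>)) =
          indicator E (envs \<omega>) * indicator C (litters j \<omega>) * (\<Prod>i\<in>J. indicator (B i) (litters i \<omega>) :: ennreal)" for \<omega>
      proof -
        have "(\<Prod>i\<in>J. indicator (B' i) (litters i \<omega>) :: ennreal) = (\<Prod>i\<in>J. indicator (B i) (litters i \<omega>))"
          by (rule prod.cong) (use jJ in \<open>auto simp: B'_def\<close>)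
        then show ?thesis using jJ J by (simp add: B'_def mult.assoc)
      qed
      have c2: "(\<Prod>i\<in>insert j J. emeasure (law e i) (B' i)) = emeasure (law e j) C * (\<Prod>i\<in>J. emeasure (law e i) (B i))" for e
      proof -
        have "(\<Prod>i\<in>J. emeasure (law e i) (B' i)) = (\<Prod>i\<in>J. emeasure (law e i) (B i))"
          by (rule prod.cong) (use jJ in \<open>auto simp: B'_def\<close>)
        then show ?thesis using jJ J by (simp add: B'_def)
      qed
      have "emeasure ?P ?D = (\<integral>\<^sup>+\<omega>. indicator E (envs \<omega>) * indicator C (litters j \<omega>) * (\<Prod>i\<in>J. indicator (B i) (litters i \<omega>)) \<partial>M)"
        by (subst nn_integral_indicator[symmetric], simp, subst nn_integral_distr, measurable, subst nn_integral_density, measurable)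
          (auto intro!: nn_integral_cong simp: ind)
      also have "\<dots> = (\<integral>\<^sup>+\<omega>. indicator E (envs \<omega>) * (\<Prod>i\<in>insert j J. indicator (B' i) (litters i \<omega>)) \<partial>M)"
        by (simp only: c1)
      also have "\<dots> = (\<integral>\<^sup>+\<omega>. indicator E (envs \<omega>) * (\<Prod>i\<in>insert j J. emeasure (law (envs \<omega>) i) (B' i)) \<partial>M)"
        by (rule conditional_product) (use J B' in \<open>auto simp: indicator_def\<close>)
      \<comment> \<open>\<open>conditional_product\<close> asks for a bound by 1 at every argument,
        but \<open>law e j\<close> is a probability only for genuine environments; the minimum with
        1 makes the bound hold everywhere.\<close>
      also have "\<dots> = (\<integral>\<^sup>+\<omega>. (indicator E (envs \<omega>) * min 1 (emeasure (law (envs \<omega>) j) C)) * (\<Prod>i\<in>J. emeasure (law (envs \<omega>) i) (B i)) \<partial>M)"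
        by (intro nn_integral_cong) (simp add: c2 mult.assoc min_absorb2 le1)
      also have "\<dots> = (\<integral>\<^sup>+\<omega>. (indicator E (envs \<omega>) * min 1 (emeasure (law (envs \<omega>) j) C)) * (\<Prod>i\<in>J. indicator (B i) (litters i \<omega>)) \<partial>M)"
        by (rule conditional_product[symmetric, where h="\<lambda>e. indicator E e * min 1 (emeasure (law e j) C)"])
          (use J B in \<open>auto simp: indicator_def\<close>)
      also have "\<dots> = (\<integral>\<^sup>+\<omega>. indicator E (envs \<omega>) * emeasure (law (envs \<omega>) j) C * (\<Prod>i\<in>J. indicator (B i) (litters i \<omega>)) \<partial>M)"
        by (intro nn_integral_cong) (simp add: mult.assoc min_absorb2 le1)
      also have "\<dots> = emeasure ?Q ?D"
        by (subst (2) nn_integral_indicator[symmetric], simp, subst nn_integral_distr, measurable, subst nn_integral_density, measurable)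
          (auto intro!: nn_integral_cong simp: ind)
      finally show "emeasure ?P ?D = emeasure ?Q ?D" .
    qed simp_all
    then have "emeasure ?P D = emeasure ?Q D" by simp
    then show ?thesis
      by (subst (asm) (1 2) nn_integral_indicator[symmetric], simp, simp, subst (asm) (1 2) nn_integral_distr, measurable, subst (asm) (1 2) nn_integral_density)
        (measurable, simp add: ac_simps)
  qed
  let ?Y = "env_seqs \<Otimes>\<^sub>M ?L"
  \<comment> \<open>The factor 1 gives the density the product form that \<open>fin\<close>
    expects.\<close>
  let ?P = "distr (density M (\<lambda>\<omega>. 1 * indicator C (litters j \<omega>))) ?Y (past_map I)"
  let ?Q = "distr (density M (\<lambda>\<omega>. 1 * emeasure (law (envs \<omega>) j) C)) ?Y (past_map I)"
  have "?P = ?Q"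
  proof (rule measure_eqI_pair)
    show "finite_measure ?P" by (rule fin) (auto simp: indicator_def)
    fix E :: "(nat \<Rightarrow> 'm \<Rightarrow> 'm litter measure) set" and D :: "(nat \<times> 'm \<times> nat \<Rightarrow> 'm litter) set"
    assume [measurable]: "E \<in> sets env_seqs" "D \<in> sets ?L"
    have split: "indicator (E \<times> D) (past_map I \<omega>) = (indicator E (envs \<omega>) * indicator D (?r \<omega>) :: ennreal)" for \<omega>
      by (auto simp: past_map_def indicator_def)
    have "emeasure (distr (density M f) ?Y (past_map I)) (E \<times> D) = (\<integral>\<^sup>+\<omega>. indicator E (envs \<omega>) * indicator D (?r \<omega>) * f \<omega> \<partial>M)"
      if [measurable]: "f \<in> borel_measurable M" for f
      by (subst nn_integral_indicator[symmetric], simp, subst nn_integral_distr, measurable, subst nn_integral_density)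
        (measurable, simp add: split ac_simps)
    from this[of "\<lambda>\<omega>. 1 * indicator C (litters j \<omega>)"] this[of "\<lambda>\<omega>. 1 * emeasure (law (envs \<omega>) j) C"]
    show "emeasure ?P (E \<times> D) = emeasure ?Q (E \<times> D)"
      using emb[of E D] by simp
  qed simp_all
  note PQ = this
  obtain D where D [measurable]: "D \<in> sets ?Y" and AD: "A = past_map I -` D \<inter> space M"
    using A unfolding sets_past by auto
  have "emeasure (distr (density M f) ?Y (past_map I)) D = (\<integral>\<^sup>+\<omega>. indicator A \<omega> * f \<omega> \<partial>M)"
    if [measurable]: "f \<in> borel_measurable M" for f
    by (subst nn_integral_indicator[symmetric], simp, subst nn_integral_distr, measurable, subst nn_integral_density)
      (measurable, auto simp: AD indicator_def intro!: nn_integral_cong)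
  from this[of "\<lambda>\<omega>. 1 * indicator C (litters j \<omega>)"] this[of "\<lambda>\<omega>. 1 * emeasure (law (envs \<omega>) j) C"] PQ
  show ?thesis by simp
qed

text \<open>The joint law of \<open>V\<close> and the new litter is the mixture over \<omega> of the
  laws of \<open>V \<omega>\<close> paired with a sample from \<open>law (envs \<omega>) j\<close>;
  rectangles suffice to identify it. Later arguments use the conditional independence in this
  form.\<close>

lemma next_litter:
  assumes j: "j \<notin> I" and V: "V \<in> past I \<rightarrow>\<^sub>M N"
    and g [measurable]: "(\<lambda>(v, x). g v x) \<in> borel_measurable (N \<Otimes>\<^sub>M litter_space)"
  shows "(\<integral>\<^sup>+\<omega>. g (V \<omega>) (litters j \<omega>) \<partial>M) = (\<integral>\<^sup>+\<omega>. \<integral>\<^sup>+x. g (V \<omega>) x \<partial>law (envs \<omega>) j \<partial>M)"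
proof -
  have VM [measurable]: "V \<in> M \<rightarrow>\<^sub>M N" using V by (rule measurable_pastD)
  have law [measurable]: "(\<lambda>\<omega>. law (envs \<omega>) j) \<in> M \<rightarrow>\<^sub>M prob_algebra litter_space"
    by (rule measurable_compose[OF measurable_envs measurable_law])
  let ?K = "\<lambda>\<omega>. distr (law (envs \<omega>) j) (N \<Otimes>\<^sub>M litter_space) (\<lambda>x. (V \<omega>, x))"
  have K: "?K \<in> M \<rightarrow>\<^sub>M prob_algebra (N \<Otimes>\<^sub>M litter_space)"
    by (rule measurable_distr_prob_space2[OF law]) measurable
  let ?P = "distr M (N \<Otimes>\<^sub>M litter_space) (\<lambda>\<omega>. (V \<omega>, litters j \<omega>))"
  have int_K: "(\<integral>\<^sup>+z. f z \<partial>?K \<omega>) = (\<integral>\<^sup>+x. f (V \<omega>, x) \<partial>law (envs \<omega>) j)"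
    if \<omega>: "\<omega> \<in> space M" and f: "f \<in> borel_measurable (N \<Otimes>\<^sub>M litter_space)" for \<omega> f
  proof -
    have "V \<omega> \<in> space N" using measurable_space[OF VM \<omega>] .
    then have "(\<lambda>x. (V \<omega>, x)) \<in> law (envs \<omega>) j \<rightarrow>\<^sub>M N \<Otimes>\<^sub>M litter_space"
      using \<omega> by (simp cong: measurable_cong_sets)
    then show ?thesis using f by (subst nn_integral_distr) auto
  qed
  have "?P = M \<bind> ?K"
  proof (rule measure_eqI_pair)
    show "finite_measure ?P" by (intro prob_space.finite_measure prob_space_distr) measurable
    show "sets (M \<bind> ?K) = sets (N \<Otimes>\<^sub>M litter_space)"
      by (rule sets_bind) (auto simp: not_empty)
    fix a and c :: "'m litter set" assume [measurable]: "a \<in> sets N" "c \<in> sets litter_space"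
    have "emeasure ?P (a \<times> c) = (\<integral>\<^sup>+\<omega>. indicator (V -` a \<inter> space M) \<omega> * indicator c (litters j \<omega>) \<partial>M)"
      by (subst nn_integral_indicator[symmetric], simp, subst nn_integral_distr)
        (measurable, auto simp: indicator_def intro!: nn_integral_cong)
    also have "\<dots> = (\<integral>\<^sup>+\<omega>. indicator (V -` a \<inter> space M) \<omega> * emeasure (law (envs \<omega>) j) c \<partial>M)"
      using measurable_sets[OF V, of a] by (intro next_litter_rectangle[OF j]) auto
    also have "\<dots> = (\<integral>\<^sup>+\<omega>. \<integral>\<^sup>+x. indicator (a \<times> c) (V \<omega>, x) \<partial>law (envs \<omega>) j \<partial>M)"
    proof (intro nn_integral_cong)
      fix \<omega> assume \<omega>: "\<omega> \<in> space M"
      have "(\<integral>\<^sup>+x. indicator (a \<times> c) (V \<omega>, x) \<partial>law (envs \<omega>) j) = (\<integral>\<^sup>+x. indicator a (V \<omega>) * indicator c x \<partial>law (envs \<omega>) j)"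
        by (simp add: indicator_times)
      also have "\<dots> = indicator a (V \<omega>) * emeasure (law (envs \<omega>) j) c"
        using \<omega> by (subst nn_integral_cmult_indicator) auto
      finally show "indicator (V -` a \<inter> space M) \<omega> * emeasure (law (envs \<omega>) j) c = (\<integral>\<^sup>+x. indicator (a \<times> c) (V \<omega>, x) \<partial>law (envs \<omega>) j)"
        using \<omega> by (auto simp: indicator_def)
    qed
    also have "\<dots> = (\<integral>\<^sup>+\<omega>. \<integral>\<^sup>+z. indicator (a \<times> c) z \<partial>?K \<omega> \<partial>M)"
      by (intro nn_integral_cong int_K[symmetric]) auto
    also have "\<dots> = emeasure (M \<bind> ?K) (a \<times> c)"
      by (subst nn_integral_bind[symmetric, OF _ measurable_prob_algebraD[OF K]], simp, subst nn_integral_indicator)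
        (auto simp: sets_bind[of M ?K] not_empty)
    finally show "emeasure ?P (a \<times> c) = emeasure (M \<bind> ?K) (a \<times> c)" .
  qed simp
  moreover have "(\<integral>\<^sup>+z. case_prod g z \<partial>?P) = (\<integral>\<^sup>+\<omega>. g (V \<omega>) (litters j \<omega>) \<partial>M)"
    by (subst nn_integral_distr) measurable
  moreover have "(\<integral>\<^sup>+z. case_prod g z \<partial>(M \<bind> ?K)) = (\<integral>\<^sup>+\<omega>. \<integral>\<^sup>+x. g (V \<omega>) x \<partial>law (envs \<omega>) j \<partial>M)"
    by (subst nn_integral_bind[OF g measurable_prob_algebraD[OF K]], intro nn_integral_cong) (simp add: int_K g)
  ultimately show ?thesis by simp
qed

end

section \<open>The law of the state given the environment\<close>

context branching_in_environment
begin

lemma measurable_sum_list_litters: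
  assumes "set js \<subseteq> I" and [measurable]: "s \<in> past I \<rightarrow>\<^sub>M litter_space"
  shows "(\<lambda>\<omega>. s \<omega> + (\<Sum>j\<leftarrow>js. litters j \<omega>)) \<in> past I \<rightarrow>\<^sub>M litter_space"
  using assms
proof (induction js arbitrary: s)
  case (Cons j js)
  have "(\<lambda>\<omega>. s \<omega> + litters j \<omega>) \<in> past I \<rightarrow>\<^sub>M litter_space"
    using Cons.prems by (intro measurable_litter_add measurable_litters_past) auto
  from Cons.IH[OF _ this] show ?case using Cons.prems by (simp add: add.assoc)
qed simp

text \<open>The first litter is moved into the past, the others are integrated out by induction, and
  then it is integrated out itself. The list is deterministic here; the weight \<open>h\<close> will
  be the indicator that the population has a prescribed value.\<close>

lemma nn_integral_progeny_litters:
  assumes "distinct js" "set js \<inter> I = {}" "\<And>j. j \<in> set js \<Longrightarrow> fst j = n"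
    and s: "s \<in> past I \<rightarrow>\<^sub>M litter_space" and h: "h \<in> borel_measurable (past I)"
    and g: "(\<lambda>(e, t). g e t) \<in> borel_measurable (env_seqs \<Otimes>\<^sub>M litter_space)"
  shows "(\<integral>\<^sup>+\<omega>. h \<omega> * g (envs \<omega>) (s \<omega> + (\<Sum>j\<leftarrow>js. litters j \<omega>)) \<partial>M) =
    (\<integral>\<^sup>+\<omega>. h \<omega> * (\<integral>\<^sup>+t. g (envs \<omega>) t \<partial>progeny (envs \<omega> n) (map (\<lambda>j. fst (snd j)) js) (s \<omega>)) \<partial>M)"
  using assms(1-5)
proof (induction js arbitrary: I s h)
  case Nil
  have sM: "s \<in> M \<rightarrow>\<^sub>M litter_space" using Nil by (auto intro: measurable_pastD)
  show ?case
  proof (intro nn_integral_cong)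
    fix \<omega> assume \<omega>: "\<omega> \<in> space M"
    have "g (envs \<omega>) \<in> borel_measurable litter_space"
      using measurable_compose[OF measurable_Pair1'[OF envs_space[OF \<omega>]] g] by simp
    then show "h \<omega> * g (envs \<omega>) (s \<omega> + (\<Sum>j\<leftarrow>[]. litters j \<omega>)) =
        h \<omega> * (\<integral>\<^sup>+t. g (envs \<omega>) t \<partial>progeny (envs \<omega> n) (map (\<lambda>j. fst (snd j)) []) (s \<omega>))"
      using measurable_space[OF sM \<omega>] by (simp del: progeny.simps)
  qed
next
  case (Cons j js)
  let ?ts = "map (\<lambda>j. fst (snd j)) js"
  note sm = Cons.prems(4) and hm = Cons.prems(5)
  have sM: "s \<in> M \<rightarrow>\<^sub>M litter_space" using sm by (rule measurable_pastD)
  have gs: "g (envs \<omega>) \<in> borel_measurable litter_space" if \<omega>: "\<omega> \<in> space M" for \<omega>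
    using measurable_compose[OF measurable_Pair1'[OF envs_space[OF \<omega>]] g] by simp
  have s': "(\<lambda>\<omega>. s \<omega> + litters j \<omega>) \<in> past (insert j I) \<rightarrow>\<^sub>M litter_space"
    using past_mono[OF subset_insertI sm] by (intro measurable_litter_add measurable_litters_past) auto
  have h': "h \<in> borel_measurable (past (insert j I))" using past_mono[OF subset_insertI hm] .
  have "(\<integral>\<^sup>+\<omega>. h \<omega> * g (envs \<omega>) (s \<omega> + (\<Sum>j\<leftarrow>j # js. litters j \<omega>)) \<partial>M) =
     (\<integral>\<^sup>+\<omega>. h \<omega> * g (envs \<omega>) ((s \<omega> + litters j \<omega>) + (\<Sum>j\<leftarrow>js. litters j \<omega>)) \<partial>M)"
    by (simp add: add.assoc)
  also have "\<dots> = (\<integral>\<^sup>+\<omega>. h \<omega> * (\<integral>\<^sup>+t. g (envs \<omega>) t \<partial>progeny (envs \<omega> n) ?ts (s \<omega> + litters j \<omega>)) \<partial>M)"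
    using Cons.prems by (intro Cons.IH[OF _ _ _ s' h']) auto
  also have "\<dots> = (\<integral>\<^sup>+\<omega>. \<integral>\<^sup>+x. h \<omega> * (\<integral>\<^sup>+t. g (envs \<omega>) t \<partial>progeny (envs \<omega> n) ?ts (s \<omega> + x)) \<partial>law (envs \<omega>) j \<partial>M)"
  proof (rule next_litter[where V="\<lambda>\<omega>. (h \<omega>, envs \<omega>, s \<omega>)" and I=I and N="borel \<Otimes>\<^sub>M env_seqs \<Otimes>\<^sub>M litter_space"
        and g="\<lambda>(a, e, s) x. a * (\<integral>\<^sup>+t. g e t \<partial>progeny (e n) ?ts (s + x))", simplified])
    let ?N = "(borel \<Otimes>\<^sub>M env_seqs \<Otimes>\<^sub>M litter_space) \<Otimes>\<^sub>M litter_space"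
    show "j \<notin> I" using Cons.prems by auto
    show "(\<lambda>\<omega>. (h \<omega>, envs \<omega>, s \<omega>)) \<in> past I \<rightarrow>\<^sub>M borel \<Otimes>\<^sub>M env_seqs \<Otimes>\<^sub>M litter_space"
      by (intro measurable_Pair hm sm measurable_envs_past)
    have e: "(\<lambda>x. fst (snd (fst x)) n) \<in> ?N \<rightarrow>\<^sub>M env_space"
      by (rule measurable_compose[OF _ measurable_env_seq_nth]) measurable
    have gm: "(\<lambda>x. g (fst (snd (fst (fst x)))) (snd x)) \<in> borel_measurable (?N \<Otimes>\<^sub>M litter_space)"
      by (rule measurable_compose_Pair[OF g]) measurable
    have "(\<lambda>x. fst (fst x) * (\<integral>\<^sup>+t. g (fst (snd (fst x))) t \<partial>progeny (fst (snd (fst x)) n) ?ts (snd (snd (fst x)) + snd x))) \<in> borel_measurable ?N"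
      by (intro borel_measurable_times_ennreal measurable_nn_integral_kernel measurable_progeny e measurable_litter_add)
        (use gm in \<open>simp_all add: case_prod_beta'\<close>)
    then show "(\<lambda>(v, x). (case v of (a, e, s) \<Rightarrow> \<lambda>x. a * (\<integral>\<^sup>+t. g e t \<partial>progeny (e n) ?ts (s + x))) x) \<in> borel_measurable ?N"
      by (simp add: case_prod_beta')
  qed
  also have "\<dots> = (\<integral>\<^sup>+\<omega>. h \<omega> * (\<integral>\<^sup>+t. g (envs \<omega>) t \<partial>progeny (envs \<omega> n) (map (\<lambda>j. fst (snd j)) (j # js)) (s \<omega>)) \<partial>M)"
  proof (intro nn_integral_cong)
    fix \<omega> assume \<omega>: "\<omega> \<in> space M"
    have e: "env (envs \<omega> n)" using \<omega> by (intro env_seq_nth envs_space)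
    have s0: "0 \<le> snd (s \<omega>)" using measurable_space[OF sM \<omega>] by simp
    have lj: "law (envs \<omega>) j = envs \<omega> n (fst (snd j))" using Cons.prems(3)[of j] by (simp add: law_def)
    have m: "(\<lambda>x. \<integral>\<^sup>+t. g (envs \<omega>) t \<partial>progeny (envs \<omega> n) ?ts (s \<omega> + x)) \<in> borel_measurable litter_space"
      using gs[OF \<omega>] s0 by (intro measurable_nn_integral_progeny[OF e] measurable_add_litter_const) (auto simp: case_prod_beta')
    show "(\<integral>\<^sup>+x. h \<omega> * (\<integral>\<^sup>+t. g (envs \<omega>) t \<partial>progeny (envs \<omega> n) ?ts (s \<omega> + x)) \<partial>law (envs \<omega>) j) =
      h \<omega> * (\<integral>\<^sup>+t. g (envs \<omega>) t \<partial>progeny (envs \<omega> n) (map (\<lambda>j. fst (snd j)) (j # js)) (s \<omega>))"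
      unfolding lj list.map nn_integral_progeny_Cons[OF e gs[OF \<omega>] s0]
      by (rule nn_integral_cmult) (use m e in simp)
  qed
  finally show ?case .
qed

text \<open>Listed in the same order as \<open>indivs\<close>, so that \<open>map_parents\<close> is
  an equality of lists.\<close>

definition parents :: "nat \<Rightarrow> nat ^ 'm \<Rightarrow> (nat \<times> 'm \<times> nat) list" where
  "parents n z = concat (map (\<lambda>i. map (\<lambda>k. (n, i, k)) [0..<z $ i]) type_list)"

definition state :: "nat ^ 'm \<Rightarrow> real \<Rightarrow> nat \<Rightarrow> 'w \<Rightarrow> 'm litter" where
  "state z \<phi> n \<omega> = (Zproc X z n \<omega>, Phi X z \<phi> n \<omega>)"

lemma map_parents: "map (\<lambda>j. fst (snd j)) (parents n z) = indivs z"
proof -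
  have "map (\<lambda>j. fst (snd j)) (concat (map (\<lambda>i. map (\<lambda>k. (n, i, k)) [0..<z $ i]) ts)) = concat (map (\<lambda>i. replicate (z $ i) i) ts)" for ts
    by (induction ts) (auto simp: map_replicate_const comp_def)
  then show ?thesis by (simp add: parents_def indivs_def)
qed

lemma distinct_parents: "distinct (parents n z)"
proof -
  have "distinct ts \<Longrightarrow> distinct (concat (map (\<lambda>i. map (\<lambda>k. (n, i, k)) [0..<z $ i]) ts))" for ts :: "'m list"
    by (induction ts) (auto simp: distinct_map inj_on_def)
  then show ?thesis using type_list by (simp add: parents_def)
qed

lemma fst_parents: "j \<in> set (parents n z) \<Longrightarrow> fst j = n"
  by (auto simp: parents_def)

lemma sum_list_parents: "(\<Sum>j\<leftarrow>parents n z. litters j \<omega>) = (\<Sum>i\<in>UNIV. \<Sum>k<z $ i. X n i k \<omega>)"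
proof -
  have "(\<Sum>j\<leftarrow>concat (map (\<lambda>i. map (\<lambda>k. (n, i, k)) [0..<z $ i]) ts). litters j \<omega>) = (\<Sum>i\<leftarrow>ts. \<Sum>k<z $ i. X n i k \<omega>)" for ts
    by (induction ts) (auto simp: comp_def litters_def interv_sum_list_conv_sum_set_nat atLeast0LessThan)
  then have "(\<Sum>j\<leftarrow>parents n z. litters j \<omega>) = (\<Sum>i\<leftarrow>type_list. \<Sum>k<z $ i. X n i k \<omega>)"
    by (simp add: parents_def)
  then show ?thesis by (subst (asm) sum_list_distinct_conv_sum_set) (auto simp: type_list)
qed

lemma state_Suc: "state z \<phi> (Suc n) \<omega> =
    (0, snd (state z \<phi> n \<omega>)) + (\<Sum>j\<leftarrow>parents n (fst (state z \<phi> n \<omega>)). litters j \<omega>)"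
  unfolding sum_list_parents by (simp add: state_def prod_eq_iff fst_sum snd_sum)

lemma measurable_zero_snd:
  "s \<in> N \<rightarrow>\<^sub>M litter_space \<Longrightarrow> (\<lambda>\<omega>. (0, snd (s \<omega>))) \<in> N \<rightarrow>\<^sub>M litter_space"
  by (rule measurable_litterI) (use measurable_space[of s N litter_space] in auto)

lemma measurable_state_past:
  assumes "0 \<le> \<phi>"
  shows "state z \<phi> n \<in> past {j. fst j < n} \<rightarrow>\<^sub>M litter_space"
proof (induction n)
  case 0
  then show ?case using assms by (simp add: state_def[abs_def])
next
  case (Suc n)
  let ?I = "{j. fst j < Suc n} :: (nat \<times> 'm \<times> nat) set"
  have s: "state z \<phi> n \<in> past ?I \<rightarrow>\<^sub>M litter_space" by (rule past_mono[OF _ Suc]) auto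
  show ?case
    unfolding state_Suc
  \<comment> \<open>The number of summands is random, but the population vector takes only countably
    many values.\<close>
  proof (rule measurable_compose_countable'[where g="\<lambda>\<omega>. fst (state z \<phi> n \<omega>)", OF _ _ countable_nat_vec])
    show "(\<lambda>\<omega>. (0, snd (state z \<phi> n \<omega>)) + (\<Sum>j\<leftarrow>parents n v. litters j \<omega>)) \<in> past ?I \<rightarrow>\<^sub>M litter_space" for v
      by (rule measurable_sum_list_litters) (use s in \<open>auto dest: fst_parents intro!: measurable_zero_snd\<close>)
    show "(\<lambda>\<omega>. fst (state z \<phi> n \<omega>)) \<in> past ?I \<rightarrow>\<^sub>M count_space UNIV"
      by (rule measurable_compose[OF s measurable_fst_litter])
  qed
qed

lemma measurable_state [measurable]: "0 \<le> \<phi> \<Longrightarrow> state z \<phi> n \<in> M \<rightarrow>\<^sub>M litter_space"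
  by (rule measurable_pastD[OF measurable_state_past])

text \<open>On each event {V = v} the set of litters entering the next generation is known in
  advance; this is what \<open>nn_integral_progeny_litters\<close> requires.\<close>

lemma nn_integral_split_vec:
  fixes V :: "'w \<Rightarrow> nat ^ 'm"
  assumes [measurable]: "V \<in> M \<rightarrow>\<^sub>M count_space UNIV" "f \<in> borel_measurable M"
  shows "(\<integral>\<^sup>+\<omega>. f \<omega> \<partial>M) = (\<integral>\<^sup>+v. \<integral>\<^sup>+\<omega>. indicator {v} (V \<omega>) * f \<omega> \<partial>M \<partial>count_space UNIV)"
proof -
  have [measurable]: "(\<lambda>\<omega>. indicator {v} (V \<omega>) :: ennreal) \<in> borel_measurable M" for v
    by (rule measurable_compose[OF assms(1)]) simp
  have "(\<integral>\<^sup>+\<omega>. f \<omega> \<partial>M) = (\<integral>\<^sup>+\<omega>. \<integral>\<^sup>+v. indicator {v} (V \<omega>) * f \<omega> \<partial>count_space UNIV \<partial>M)"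
  proof (intro nn_integral_cong)
    fix \<omega>
    have "(\<integral>\<^sup>+v. indicator {v} (V \<omega>) * f \<omega> \<partial>count_space UNIV) = (\<integral>\<^sup>+v. f \<omega> * indicator {V \<omega>} v \<partial>count_space UNIV)"
      by (intro nn_integral_cong) (auto simp: indicator_def)
    also have "\<dots> = f \<omega>" by (subst nn_integral_cmult_indicator) auto
    finally show "f \<omega> = (\<integral>\<^sup>+v. indicator {v} (V \<omega>) * f \<omega> \<partial>count_space UNIV)" by simp
  qed
  also have "\<dots> = (\<integral>\<^sup>+v. \<integral>\<^sup>+\<omega>. indicator {v} (V \<omega>) * f \<omega> \<partial>M \<partial>count_space UNIV)"
    by (rule nn_integral_count_space_nn_integral) (auto simp: countable_nat_vec)
  finally show ?thesis .
qed

lemma nn_integral_state_Suc: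
  assumes \<phi>: "0 \<le> \<phi>" and g: "(\<lambda>(e, t). g e t) \<in> borel_measurable (env_seqs \<Otimes>\<^sub>M litter_space)"
  shows "(\<integral>\<^sup>+\<omega>. g (envs \<omega>) (state z \<phi> (Suc n) \<omega>) \<partial>M) =
    (\<integral>\<^sup>+\<omega>. \<integral>\<^sup>+t. g (envs \<omega>) t \<partial>step_law (envs \<omega> n) (state z \<phi> n \<omega>) \<partial>M)"
proof -
  let ?s = "state z \<phi> n" and ?I = "{j. fst j < n} :: (nat \<times> 'm \<times> nat) set"
  have s: "?s \<in> past ?I \<rightarrow>\<^sub>M litter_space" using \<phi> by (rule measurable_state_past)
  have sM [measurable]: "?s \<in> M \<rightarrow>\<^sub>M litter_space" "state z \<phi> (Suc n) \<in> M \<rightarrow>\<^sub>M litter_space" using \<phi> by (auto intro: measurable_state)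
  have V: "(\<lambda>\<omega>. fst (?s \<omega>)) \<in> M \<rightarrow>\<^sub>M count_space UNIV" by measurable
  have en: "(\<lambda>\<omega>. envs \<omega> n) \<in> M \<rightarrow>\<^sub>M env_space" by (rule measurable_compose[OF measurable_envs measurable_env_seq_nth])
  have m1: "(\<lambda>\<omega>. g (envs \<omega>) (state z \<phi> (Suc n) \<omega>)) \<in> borel_measurable M"
    by (rule measurable_compose_Pair[OF g]) measurable
  have "(\<lambda>x. g (envs (fst x)) (snd x)) \<in> borel_measurable (M \<Otimes>\<^sub>M litter_space)"
    by (rule measurable_compose_Pair[OF g]) measurable
  then have m2: "(\<lambda>\<omega>. \<integral>\<^sup>+t. g (envs \<omega>) t \<partial>step_law (envs \<omega> n) (?s \<omega>)) \<in> borel_measurable M"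
    by (intro measurable_nn_integral_kernel[OF measurable_step_law[OF en sM(1)]]) (simp add: case_prod_beta')
  have "(\<integral>\<^sup>+\<omega>. indicator {v} (fst (?s \<omega>)) * g (envs \<omega>) (state z \<phi> (Suc n) \<omega>) \<partial>M) =
    (\<integral>\<^sup>+\<omega>. indicator {v} (fst (?s \<omega>)) * (\<integral>\<^sup>+t. g (envs \<omega>) t \<partial>step_law (envs \<omega> n) (?s \<omega>)) \<partial>M)" for v
  proof -
    have "(\<integral>\<^sup>+\<omega>. indicator {v} (fst (?s \<omega>)) * g (envs \<omega>) (state z \<phi> (Suc n) \<omega>) \<partial>M) =
       (\<integral>\<^sup>+\<omega>. indicator {v} (fst (?s \<omega>)) * g (envs \<omega>) ((0, snd (?s \<omega>)) + (\<Sum>j\<leftarrow>parents n v. litters j \<omega>)) \<partial>M)"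
      by (intro nn_integral_cong) (auto simp: indicator_def state_Suc)
    also have "\<dots> = (\<integral>\<^sup>+\<omega>. indicator {v} (fst (?s \<omega>)) *
        (\<integral>\<^sup>+t. g (envs \<omega>) t \<partial>progeny (envs \<omega> n) (map (\<lambda>j. fst (snd j)) (parents n v)) (0, snd (?s \<omega>))) \<partial>M)"
    proof (rule nn_integral_progeny_litters[OF distinct_parents _ fst_parents measurable_zero_snd[OF s] _ g])
      show "set (parents n v) \<inter> ?I = {}" by (auto dest: fst_parents)
      show "(\<lambda>\<omega>. indicator {v} (fst (?s \<omega>))) \<in> borel_measurable (past ?I)"
        by (rule measurable_compose[OF measurable_compose[OF s measurable_fst_litter]]) simp
    qed
    also have "\<dots> = (\<integral>\<^sup>+\<omega>. indicator {v} (fst (?s \<omega>)) * (\<integral>\<^sup>+t. g (envs \<omega>) t \<partial>step_law (envs \<omega> n) (?s \<omega>)) \<partial>M)"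
      by (intro nn_integral_cong) (auto simp: map_parents step_law_def indicator_def)
    finally show ?thesis .
  qed
  then show ?thesis
    unfolding nn_integral_split_vec[OF V m1] nn_integral_split_vec[OF V m2] by simp
qed

text \<open>The last generation is integrated out first, leaving a function of the environment and
  the previous state. \<open>g\<close> must therefore be allowed to depend on the environment for
  the induction to go through.\<close>

lemma nn_integral_state:
  assumes \<phi>: "0 \<le> \<phi>" and g: "(\<lambda>(e, t). g e t) \<in> borel_measurable (env_seqs \<Otimes>\<^sub>M litter_space)"
  shows "(\<integral>\<^sup>+\<omega>. g (envs \<omega>) (state z \<phi> n \<omega>) \<partial>M) = (\<integral>\<^sup>+\<omega>. \<integral>\<^sup>+t. g (envs \<omega>) t \<partial>quenched n (envs \<omega>) (z, \<phi>) \<partial>M)"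
  using g
proof (induction n arbitrary: g)
  case 0
  have "g (envs \<omega>) \<in> borel_measurable litter_space" if \<omega>: "\<omega> \<in> space M" for \<omega>
    using measurable_compose[OF measurable_Pair1'[OF envs_space[OF \<omega>]] 0] by simp
  then show ?case using \<phi> by (intro nn_integral_cong) (simp add: state_def del: quenched.simps)
next
  case (Suc n)
  let ?N = "env_seqs \<Otimes>\<^sub>M (litter_space :: 'm litter measure)"
  let ?g = "\<lambda>e s. \<integral>\<^sup>+t. g e t \<partial>step_law (e n) s"
  have en: "(\<lambda>x. fst x n) \<in> ?N \<rightarrow>\<^sub>M env_space" by (rule measurable_compose[OF measurable_fst measurable_env_seq_nth])
  have "(\<lambda>x. g (fst (fst x)) (snd x)) \<in> borel_measurable (?N \<Otimes>\<^sub>M litter_space)"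
    by (rule measurable_compose_Pair[OF Suc.prems]) measurable
  then have m: "(\<lambda>(e, s). ?g e s) \<in> borel_measurable ?N"
    unfolding case_prod_beta'
    by (intro measurable_nn_integral_kernel[OF measurable_step_law[OF en measurable_snd]]) (simp add: case_prod_beta')
  have "(\<integral>\<^sup>+\<omega>. g (envs \<omega>) (state z \<phi> (Suc n) \<omega>) \<partial>M) = (\<integral>\<^sup>+\<omega>. ?g (envs \<omega>) (state z \<phi> n \<omega>) \<partial>M)"
    by (rule nn_integral_state_Suc[OF \<phi> Suc.prems])
  also have "\<dots> = (\<integral>\<^sup>+\<omega>. \<integral>\<^sup>+s. ?g (envs \<omega>) s \<partial>quenched n (envs \<omega>) (z, \<phi>) \<partial>M)"
    by (rule Suc.IH[OF m])
  also have "\<dots> = (\<integral>\<^sup>+\<omega>. \<integral>\<^sup>+t. g (envs \<omega>) t \<partial>quenched (Suc n) (envs \<omega>) (z, \<phi>) \<partial>M)"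
  proof (intro nn_integral_cong)
    fix \<omega> assume \<omega>: "\<omega> \<in> space M"
    let ?e = "envs \<omega>"
    have e: "?e \<in> space env_seqs" "(\<lambda>k. ?e (k + n)) \<in> space env_seqs" using \<omega> by (auto intro: env_seq_shift)
    have gm: "g ?e \<in> borel_measurable litter_space"
      using measurable_compose[OF measurable_Pair1'[OF envs_space[OF \<omega>]] Suc.prems] by simp
    \<comment> \<open>Since \<open>quenched\<close> unfolds at its first generation, the last one is
      split off by Chapman-Kolmogorov with one remaining step.\<close>
    have "(\<integral>\<^sup>+t. g ?e t \<partial>quenched (n + Suc 0) ?e (z, \<phi>)) =
      (\<integral>\<^sup>+s. \<integral>\<^sup>+t. g ?e t \<partial>quenched (Suc 0) (\<lambda>k. ?e (k + n)) s \<partial>quenched n ?e (z, \<phi>))"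
      by (rule nn_integral_quenched_add[OF e(1) gm]) (use \<phi> in simp)
    also have "\<dots> = (\<integral>\<^sup>+s. ?g ?e s \<partial>quenched n ?e (z, \<phi>))"
    proof (intro nn_integral_cong)
      fix s assume "s \<in> space (quenched n ?e (z, \<phi>))"
      then have s: "0 \<le> snd s" using e \<phi> by simp
      have "(\<integral>\<^sup>+t. g ?e t \<partial>quenched (Suc 0) (\<lambda>k. ?e (k + n)) s) =
        (\<integral>\<^sup>+x. \<integral>\<^sup>+t. g ?e t \<partial>quenched 0 (\<lambda>k. ?e (Suc k + n)) x \<partial>step_law (?e n) s)"
        using nn_integral_quenched_Suc[OF e(2) gm s] by simp
      also have "\<dots> = ?g ?e s"
        by (intro nn_integral_cong nn_integral_quenched_0 gm) (use e s in \<open>simp add: env_seq_nth\<close>)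
      finally show "(\<integral>\<^sup>+t. g ?e t \<partial>quenched (Suc 0) (\<lambda>k. ?e (k + n)) s) = ?g ?e s" .
    qed
    finally show "(\<integral>\<^sup>+s. ?g ?e s \<partial>quenched n ?e (z, \<phi>)) = (\<integral>\<^sup>+t. g ?e t \<partial>quenched (Suc n) ?e (z, \<phi>))" by simp
  qed
  finally show ?case .
qed

end

section \<open>Quenched moments\<close>

text \<open>Populations are built one individual at a time, so that each step is one application of
  the branching property.\<close>

lemma nat_vec_induct [case_names zero add]:
  fixes z :: "nat ^ 'm::finite"
  assumes "P 0" "\<And>z i. P z \<Longrightarrow> P (z + axis i 1)"
  shows "P z"
proof (induction "\<Sum>i\<in>UNIV. z $ i" arbitrary: z)
  case 0
  then have "z = 0" by (simp add: vec_eq_iff)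
  then show ?case using assms(1) by simp
next
  case (Suc n)
  then have "\<exists>i. z $ i \<noteq> 0" by (metis finite sum.neutral nat.distinct(1))
  then obtain i where i: "z $ i \<noteq> 0" by auto
  define w where "w = z - axis i 1"
  have z: "z = w + axis i 1" using i by (auto simp: w_def vec_eq_iff axis_def)
  have "(\<Sum>j\<in>UNIV. z $ j) = (\<Sum>j\<in>UNIV. w $ j) + (\<Sum>j\<in>UNIV. (axis i 1 :: nat ^ 'm) $ j)"
    by (simp add: z sum.distrib)
  also have "(\<Sum>j\<in>UNIV. (axis i 1 :: nat ^ 'm) $ j) = 1" by (simp add: axis_def)
  finally have "n = (\<Sum>j\<in>UNIV. w $ j)" using Suc(2) by simp
  from Suc(1)[OF this] show ?case unfolding z by (rule assms(2))
qed

text \<open>Covers the population size, the characteristic and weighted sums of both, so that the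
  moment estimates are proved once for all of them.\<close>

definition additive_functional :: "('m::finite litter \<Rightarrow> ennreal) \<Rightarrow> bool" where
  "additive_functional q \<longleftrightarrow> q \<in> borel_measurable litter_space \<and> q 0 = 0 \<and>
     (\<forall>s t. 0 \<le> snd s \<longrightarrow> 0 \<le> snd t \<longrightarrow> q (s + t) = q s + q t)"

lemma additive_functionalD:
  assumes "additive_functional q"
  shows "q \<in> borel_measurable litter_space" "q 0 = 0" "0 \<le> snd s \<Longrightarrow> 0 \<le> snd t \<Longrightarrow> q (s + t) = q s + q t"
  using assms unfolding additive_functional_def by blast+

text \<open>\<open>w j\<close> is a value attached to each living individual of type
  \<open>j\<close>. If it is the expected later contribution of such an individual and
  \<open>b = 1\<close>, this is the conditional mean of the later characteristic in state
  \<open>t\<close>.\<close>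

definition lin :: "('m::finite \<Rightarrow> ennreal) \<Rightarrow> ennreal \<Rightarrow> 'm litter \<Rightarrow> ennreal" where
  "lin w b t = (\<Sum>j\<in>UNIV. of_nat (fst t $ j) * w j) + b * ennreal (snd t)"

lemma measurable_of_nat_fst [measurable]: "(\<lambda>x. of_nat (fst x $ j) :: ennreal) \<in> borel_measurable litter_space"
  by (rule measurable_compose[OF measurable_fst_nth]) simp

lemma additive_lin: "additive_functional (lin w b)"
proof -
  have "lin w b \<in> borel_measurable litter_space" unfolding lin_def[abs_def] by measurable
  then show ?thesis
    by (auto simp: additive_functional_def lin_def algebra_simps sum.distrib ennreal_plus)
qed

lemma measurable_lin [measurable]: "lin w b \<in> borel_measurable litter_space"
  by (rule additive_functionalD[OF additive_lin])

lemma nn_integral_quenched_zero: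
  assumes e: "e \<in> space env_seqs" and g: "g \<in> borel_measurable litter_space" and \<phi>: "0 \<le> \<phi>"
  shows "(\<integral>\<^sup>+t. g t \<partial>quenched n e (0, \<phi>)) = g (0, \<phi>)"
  using e
proof (induction n arbitrary: e)
  case (Suc n)
  have *: "(\<lambda>x. \<integral>\<^sup>+t. g t \<partial>quenched n (\<lambda>k. e (Suc k)) x) \<in> borel_measurable litter_space"
    by (rule measurable_nn_integral_quenched[OF g env_seq_shift[OF Suc.prems]])
  show ?case
    using \<phi> nn_integral_progeny_Nil[OF *, of "(0, \<phi>)" "e 0"] Suc.IH[OF env_seq_shift[OF Suc.prems, of Suc]]
    by (subst nn_integral_quenched_Suc[OF Suc.prems g]) (simp_all add: step_law_def indivs_0 del: progeny.simps)
qed (use g \<phi> in \<open>simp del: quenched.simps\<close>)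

lemma nn_integral_quenched_shift:
  assumes e: "e \<in> space env_seqs" and g: "g \<in> borel_measurable litter_space" and \<phi>: "0 \<le> \<phi>"
  shows "(\<integral>\<^sup>+t. g t \<partial>quenched n e (z, \<phi>)) = (\<integral>\<^sup>+t. g ((0, \<phi>) + t) \<partial>quenched n e (z, 0))"
proof -
  have "(\<integral>\<^sup>+t. g t \<partial>quenched n e ((0, \<phi>) + (z, 0))) =
      (\<integral>\<^sup>+t. \<integral>\<^sup>+t'. g (t + t') \<partial>quenched n e (z, 0) \<partial>quenched n e (0, \<phi>))"
    by (rule nn_integral_quenched_branching[OF e g]) (use \<phi> in auto)
  also have "\<dots> = (\<integral>\<^sup>+t. g ((0, \<phi>) + t) \<partial>quenched n e (z, 0))"
    by (rule nn_integral_quenched_zero[OF e measurable_nn_integral_quenched2[OF e borel_measurable_add_pair[OF g]] \<phi>])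
      simp
  finally show ?thesis by simp
qed

lemma nn_integral_step_law_axis:
  assumes e: "env \<mu>" and g: "g \<in> borel_measurable litter_space"
  shows "(\<integral>\<^sup>+t. g t \<partial>step_law \<mu> (axis i 1, 0)) = (\<integral>\<^sup>+x. g x \<partial>\<mu> i)"
proof -
  have z: "(0, 0) = (0 :: (nat ^ 'a) \<times> real)" by (simp add: prod_eq_iff)
  have "(\<integral>\<^sup>+t. g t \<partial>step_law \<mu> (axis i 1, 0)) = (\<integral>\<^sup>+x. \<integral>\<^sup>+t. g t \<partial>progeny \<mu> [] ((0, 0) + x) \<partial>\<mu> i)"
    unfolding step_law_def fst_conv snd_conv indivs_axis by (rule nn_integral_progeny_Cons[OF e g]) simp
  also have "\<dots> = (\<integral>\<^sup>+x. g x \<partial>\<mu> i)"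
    by (intro nn_integral_cong) (use e g in \<open>simp add: z del: progeny.simps\<close>)
  finally show ?thesis .
qed

text \<open>Decomposition at the litter of the ancestor. Its characteristic is pulled out as a
  shift, so that the remaining kernel starts with characteristic 0.\<close>

lemma nn_integral_quenched_Suc_axis:
  assumes e: "e \<in> space env_seqs" and g: "g \<in> borel_measurable litter_space"
  shows "(\<integral>\<^sup>+t. g t \<partial>quenched (Suc n) e (axis i 1, 0)) =
    (\<integral>\<^sup>+x. \<integral>\<^sup>+t. g ((0, snd x) + t) \<partial>quenched n (\<lambda>k. e (Suc k)) (fst x, 0) \<partial>e 0 i)"
proof -
  have e': "(\<lambda>k. e (Suc k)) \<in> space env_seqs" "env (e 0)" using e by (auto intro: env_seq_shift env_seq_nth)
  have "(\<integral>\<^sup>+t. g t \<partial>quenched (Suc n) e (axis i 1, 0)) = (\<integral>\<^sup>+x. \<integral>\<^sup>+t. g t \<partial>quenched n (\<lambda>k. e (Suc k)) x \<partial>e 0 i)"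
    by (subst nn_integral_quenched_Suc[OF e g], simp)
      (rule nn_integral_step_law_axis[OF e'(2) measurable_nn_integral_quenched[OF g e'(1)]])
  also have "\<dots> = (\<integral>\<^sup>+x. \<integral>\<^sup>+t. g ((0, snd x) + t) \<partial>quenched n (\<lambda>k. e (Suc k)) (fst x, 0) \<partial>e 0 i)"
    by (intro nn_integral_cong, subst nn_integral_quenched_shift[OF e'(1) g, symmetric]) (use e' in auto)
  finally show ?thesis .
qed

lemma measurable_quenched_law [simp]:
  "e \<in> space env_seqs \<Longrightarrow> 0 \<le> \<phi> \<Longrightarrow> measurable (quenched n e (z, \<phi>)) = measurable litter_space"
  by (intro ext measurable_cong_sets) auto

section \<open>Moments of additive functionals\<close>

context
  fixes e :: "nat \<Rightarrow> 'm::finite \<Rightarrow> 'm litter measure" and q :: "'m litter \<Rightarrow> ennreal" and n :: nat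
  assumes e [simp]: "e \<in> space env_seqs" and q: "additive_functional q"
begin

text \<open>With \<open>G\<close> as a function of two places, evaluated at 0 in the first,
  \<open>measurable_compose_Pair\<close> supplies the measurability of the integrand.\<close>

lemma nn_integral_quenched_axis_add:
  assumes G: "(\<lambda>(a, b). G a b) \<in> borel_measurable (borel \<Otimes>\<^sub>M borel)"
  shows "(\<integral>\<^sup>+t. G 0 (q t) \<partial>quenched n e (z + axis i 1, 0)) =
    (\<integral>\<^sup>+t. \<integral>\<^sup>+t'. G 0 (q t + q t') \<partial>quenched n e (axis i 1, 0) \<partial>quenched n e (z, 0))"
proof -
  have qm: "q \<in> borel_measurable litter_space" using q by (simp add: additive_functional_def)
  have "(\<lambda>t. G 0 (q t)) \<in> borel_measurable litter_space"
    by (rule measurable_compose_Pair[OF G]) (use qm in simp_all)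
  then have "(\<integral>\<^sup>+t. G 0 (q t) \<partial>quenched n e ((z, 0) + (axis i 1, 0))) =
    (\<integral>\<^sup>+t. \<integral>\<^sup>+t'. G 0 (q (t + t')) \<partial>quenched n e (axis i 1, 0) \<partial>quenched n e (z, 0))"
    by (intro nn_integral_quenched_branching[OF e]) auto
  also have "\<dots> = (\<integral>\<^sup>+t. \<integral>\<^sup>+t'. G 0 (q t + q t') \<partial>quenched n e (axis i 1, 0) \<partial>quenched n e (z, 0))"
    by (intro nn_integral_cong) (use e in \<open>simp add: additive_functionalD(3)[OF q]\<close>)
  finally show ?thesis by simp
qed

lemma quenched_mean_additive:
  "(\<integral>\<^sup>+t. q t \<partial>quenched n e (z, 0)) = (\<Sum>i\<in>UNIV. of_nat (z $ i) * (\<integral>\<^sup>+t. q t \<partial>quenched n e (axis i 1, 0)))"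
proof (induction z rule: nat_vec_induct)
  case zero
  have "(0, 0) = (0 :: (nat ^ 'm) \<times> real)" by (simp add: prod_eq_iff)
  then show ?case
    using nn_integral_quenched_zero[OF e additive_functionalD(1)[OF q], of 0 n] additive_functionalD(2)[OF q] by simp
next
  case (add z i)
  have [measurable]: "q \<in> borel_measurable litter_space" using q by (rule additive_functionalD)
  have one: "emeasure (quenched n e (z, 0)) (space (quenched n e (z, 0))) = 1" for z
    using prob_space.emeasure_space_1[OF prob_space_quenched[OF e]] by simp
  have "(\<integral>\<^sup>+t. q t \<partial>quenched n e (z + axis i 1, 0)) =
    (\<integral>\<^sup>+t. \<integral>\<^sup>+t'. q t + q t' \<partial>quenched n e (axis i 1, 0) \<partial>quenched n e (z, 0))"
    by (rule nn_integral_quenched_axis_add[where G="\<lambda>_ b. b"]) simp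
  also have "\<dots> = (\<integral>\<^sup>+t. q t \<partial>quenched n e (z, 0)) + (\<integral>\<^sup>+t. q t \<partial>quenched n e (axis i 1, 0))"
    using one by (simp add: nn_integral_add)
  finally show ?case
    by (simp add: add distrib_right sum.distrib of_nat_add axis_def if_distrib[of of_nat] if_distrib[of "\<lambda>x. x * _"] cong: if_cong)
qed

text \<open>Variances of independent contributions add up. The form "second moment at most squared
  mean plus \<open>v\<close>" avoids subtraction of possibly infinite quantities.\<close>

lemma quenched_second_moment:
  assumes v: "\<And>i. (\<integral>\<^sup>+t. q t ^ 2 \<partial>quenched n e (axis i 1, 0)) \<le> (\<integral>\<^sup>+t. q t \<partial>quenched n e (axis i 1, 0)) ^ 2 + v i"
  shows "(\<integral>\<^sup>+t. q t ^ 2 \<partial>quenched n e (z, 0)) \<le>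
    (\<integral>\<^sup>+t. q t \<partial>quenched n e (z, 0)) ^ 2 + (\<Sum>i\<in>UNIV. of_nat (z $ i) * v i)"
proof (induction z rule: nat_vec_induct)
  case zero
  have z: "(0, 0) = (0 :: (nat ^ 'm) \<times> real)" by (simp add: prod_eq_iff)
  have [measurable]: "q \<in> borel_measurable litter_space" using q by (rule additive_functionalD)
  have "(\<lambda>t. q t ^ 2) \<in> borel_measurable litter_space" by measurable
  from nn_integral_quenched_zero[OF e this, of 0 n] show ?case
    using z additive_functionalD(2)[OF q] by simp
next
  case (add z i)
  have [measurable]: "q \<in> borel_measurable litter_space" using q by (rule additive_functionalD)
  have one: "emeasure (quenched n e (z, 0)) (space (quenched n e (z, 0))) = 1" for z
    using prob_space.emeasure_space_1[OF prob_space_quenched[OF e]] by simp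
  let ?m = "\<integral>\<^sup>+t. q t \<partial>quenched n e (z, 0)" and ?a = "\<integral>\<^sup>+t. q t \<partial>quenched n e (axis i 1, 0)"
  have "(\<integral>\<^sup>+t. q t \<partial>quenched n e (z + axis i 1, 0)) =
    (\<integral>\<^sup>+t. \<integral>\<^sup>+t'. q t + q t' \<partial>quenched n e (axis i 1, 0) \<partial>quenched n e (z, 0))"
    by (rule nn_integral_quenched_axis_add[where G="\<lambda>_ b. b"]) simp
  also have "\<dots> = ?m + ?a"
    using one by (simp add: nn_integral_add)
  finally have mean: "(\<integral>\<^sup>+t. q t \<partial>quenched n e (z + axis i 1, 0)) = ?m + ?a" .
  have "(\<integral>\<^sup>+t. q t ^ 2 \<partial>quenched n e (z + axis i 1, 0)) =
    (\<integral>\<^sup>+t. \<integral>\<^sup>+t'. (q t + q t') ^ 2 \<partial>quenched n e (axis i 1, 0) \<partial>quenched n e (z, 0))"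
    by (rule nn_integral_quenched_axis_add[where G="\<lambda>_ b. b ^ 2"]) simp
  also have "\<dots> = (\<integral>\<^sup>+t. \<integral>\<^sup>+t'. q t ^ 2 + (2 * q t * q t' + q t' ^ 2) \<partial>quenched n e (axis i 1, 0) \<partial>quenched n e (z, 0))"
    by (simp add: power2_sum ac_simps)
  also have "\<dots> = (\<integral>\<^sup>+t. q t ^ 2 \<partial>quenched n e (z, 0)) + (2 * ?m * ?a + (\<integral>\<^sup>+t. q t ^ 2 \<partial>quenched n e (axis i 1, 0)))"
    using one by (simp add: nn_integral_add nn_integral_cmult nn_integral_multc)
  also have "\<dots> \<le> (?m ^ 2 + (\<Sum>i\<in>UNIV. of_nat (z $ i) * v i)) + (2 * ?m * ?a + (?a ^ 2 + v i))"
    by (intro add_mono add v order_refl)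
  also have "\<dots> = (?m + ?a) ^ 2 + ((\<Sum>i\<in>UNIV. of_nat (z $ i) * v i) + v i)"
    by (simp add: power2_sum ac_simps)
  also have "(\<Sum>i\<in>UNIV. of_nat (z $ i) * v i) + v i = (\<Sum>j\<in>UNIV. of_nat ((z + axis i 1) $ j) * v j)"
    by (simp add: distrib_right sum.distrib of_nat_add axis_def if_distrib[of of_nat] if_distrib[of "\<lambda>x. x * _"] cong: if_cong)
  finally show ?case by (simp only: mean)
qed

text \<open>Individuals are added one at a time, and the term with the exponent \<open>x - 1\<close> is absorbed.\<close>

lemma quenched_rosenthal:
  assumes x: "1 < x"
  defines "a \<equiv> \<lambda>i. \<integral>\<^sup>+t. q t epowr x \<partial>quenched n e (axis i 1, 0)"
    and "m \<equiv> \<lambda>i. \<integral>\<^sup>+t. q t \<partial>quenched n e (axis i 1, 0)"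
  shows "(\<integral>\<^sup>+t. q t epowr x \<partial>quenched n e (z, 0)) \<le>
    2 * (rosenthal_step x * (\<Sum>i\<in>UNIV. of_nat (z $ i) * a i)) +
    (2 * (rosenthal_step x * (\<Sum>i\<in>UNIV. of_nat (z $ i) * m i))) epowr x"
proof -
  let ?c = "rosenthal_step x"
  define U where "U z = (\<integral>\<^sup>+t. q t epowr x \<partial>quenched n e (z, 0))" for z
  have qm [measurable]: "q \<in> borel_measurable litter_space" using q by (rule additive_functionalD)
  have one: "emeasure (quenched n e (z, 0)) (space (quenched n e (z, 0))) = 1" for z
    using prob_space.emeasure_space_1[OF prob_space_quenched[OF e]] by simp
  have step: "U (z + axis i 1) = (\<integral>\<^sup>+t. \<integral>\<^sup>+t'. (q t + q t') epowr x \<partial>quenched n e (axis i 1, 0) \<partial>quenched n e (z, 0))" for z i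
    unfolding U_def by (rule nn_integral_quenched_axis_add[where G="\<lambda>_ b. b epowr x"]) simp
  have U0: "U 0 = 0"
  proof -
    have z: "(0, 0) = (0 :: (nat ^ 'm) \<times> real)" by (simp add: prod_eq_iff)
    have "(\<lambda>t. q t epowr x) \<in> borel_measurable litter_space" by measurable
    from nn_integral_quenched_zero[OF e this, of 0 n] show ?thesis
      using z x additive_functionalD(2)[OF q] by (simp add: U_def)
  qed
  have sum_axis: "(\<Sum>j\<in>UNIV. of_nat ((z + axis i 1) $ j) * f j) = (\<Sum>j\<in>UNIV. of_nat (z $ j) * f j) + f i" for z i and f :: "'m \<Rightarrow> ennreal"
    by (simp add: distrib_right sum.distrib of_nat_add axis_def if_distrib[of of_nat] if_distrib[of "\<lambda>x. x * _"] cong: if_cong)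
  \<comment> \<open>Lets the moment of the smaller population on the right be replaced by that of
    the enlarged one, so that the inequality \<open>main\<close> keeps its shape in the
    induction.\<close>
  have incr: "U z \<le> U (z + axis i 1)" for z i
  proof -
    have "U z = (\<integral>\<^sup>+t. \<integral>\<^sup>+t'. q t epowr x \<partial>quenched n e (axis i 1, 0) \<partial>quenched n e (z, 0))"
      using one by (simp add: U_def)
    also have "\<dots> \<le> U (z + axis i 1)"
      unfolding step using x by (intro nn_integral_mono epowr_mono) auto
    finally show ?thesis .
  qed
  \<comment> \<open>A crude bound, growing with each individual, but absorption needs a finite
    left-hand side.\<close>
  have fin: "U z < \<infinity>" if "(\<Sum>i\<in>UNIV. of_nat (z $ i) * a i) < \<infinity>" for z
    using that
  proof (induction z rule: nat_vec_induct)
    case zero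
    then show ?case by (simp add: U0)
  next
    case (add z i)
    have "U (z + axis i 1) \<le> (\<integral>\<^sup>+t. \<integral>\<^sup>+t'. 2 epowr x * (q t epowr x + q t' epowr x) \<partial>quenched n e (axis i 1, 0) \<partial>quenched n e (z, 0))"
      unfolding step using x by (intro nn_integral_mono epowr_add_le) auto
    also have "\<dots> = 2 epowr x * (U z + a i)"
      using one by (simp add: U_def a_def nn_integral_cmult nn_integral_add)
    also have "\<dots> < \<infinity>"
    proof -
      have "(\<Sum>i\<in>UNIV. of_nat (z $ i) * a i) + a i < \<infinity>" using add.prems by (simp only: sum_axis)
      then have "U z < \<infinity>" "a i < \<infinity>"
        by (metis add.IH add_increasing2 le_less_trans order_refl zero_le, metis add_increasing le_less_trans order_refl zero_le)
      then show ?thesis by (simp add: ennreal_mult_less_top)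
    qed
    finally show ?case .
  qed
  \<comment> \<open>The exponent (x-1)/x is produced by Jensen's inequality, which bounds the
    (x-1)-th moment by a power of the x-th.\<close>
  have main: "U z \<le> ?c * (\<Sum>i\<in>UNIV. of_nat (z $ i) * a i) + ?c * (\<Sum>i\<in>UNIV. of_nat (z $ i) * m i) * U z epowr ((x - 1) / x)" for z
  proof (induction z rule: nat_vec_induct)
    case zero
    then show ?case by (simp add: U0)
  next
    case (add z i)
    let ?A = "\<Sum>i\<in>UNIV. of_nat (z $ i) * a i" and ?B = "\<Sum>i\<in>UNIV. of_nat (z $ i) * m i"
    let ?u = "U z epowr ((x - 1) / x)" and ?u' = "U (z + axis i 1) epowr ((x - 1) / x)"
    interpret Q: prob_space "quenched n e (z, 0)" by (rule prob_space_quenched[OF e]) simp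
    have jensen: "(\<integral>\<^sup>+t. q t epowr (x - 1) \<partial>quenched n e (z, 0)) \<le> ?u"
      using Q.jensen_epowr_le[of "(x - 1) / x" "\<lambda>t. q t epowr x"] x by (simp add: U_def epowr_epowr)
    have "U (z + axis i 1) \<le> (\<integral>\<^sup>+t. \<integral>\<^sup>+t'. q t epowr x + ?c * (q t' * q t epowr (x - 1) + q t' epowr x)
        \<partial>quenched n e (axis i 1, 0) \<partial>quenched n e (z, 0))"
      unfolding step using x by (intro nn_integral_mono epowr_add_le_tangent) auto
    also have "\<dots> = U z + ?c * (m i * (\<integral>\<^sup>+t. q t epowr (x - 1) \<partial>quenched n e (z, 0)) + a i)"
      using one by (simp add: U_def a_def m_def nn_integral_cmult nn_integral_multc nn_integral_add)
    also have "\<dots> \<le> (?c * ?A + ?c * ?B * ?u) + ?c * (m i * ?u + a i)"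
      by (intro add_mono add mult_left_mono jensen) auto
    also have "\<dots> \<le> (?c * ?A + ?c * ?B * ?u') + ?c * (m i * ?u' + a i)"
      using x by (intro add_mono mult_left_mono order_refl epowr_mono incr) auto
    also have "\<dots> = ?c * (?A + a i) + ?c * (?B + m i) * ?u'" by (simp add: algebra_simps)
    finally show ?case by (simp only: sum_axis)
  qed
  show ?thesis
  proof (cases "(\<Sum>i\<in>UNIV. of_nat (z $ i) * a i) = \<infinity>")
    case True
    have "?c \<noteq> 0" using x by (simp add: rosenthal_step_def)
    then have "rosenthal_step x * (\<Sum>i\<in>UNIV. of_nat (z $ i) * a i) = top"
      unfolding True by (simp add: ennreal_mult_top)
    then show ?thesis by (simp add: ennreal_mult_top)
  next
    case False
    from absorb_epowr[OF x fin main] False show ?thesis by (simp add: U_def less_top)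
  qed
qed

end

section \<open>Quenched means and variances\<close>

text \<open>Evaluates notions defined for a random environment \<open>F n \<omega>\<close> on the
  sequence space itself, where the sample point is the environment.\<close>

abbreviation (input) coord :: "nat \<Rightarrow> (nat \<Rightarrow> 'm \<Rightarrow> 'm litter measure) \<Rightarrow> 'm::finite \<Rightarrow> 'm litter measure" where
  "coord \<equiv> \<lambda>n e. e n"

lemma mean_matrix_shift: "mean_matrix coord n (\<lambda>k. e (k + m)) = mean_matrix coord (n + m) e"
  and mean_char_shift: "mean_char coord n (\<lambda>k. e (k + m)) = mean_char coord (n + m) e"
  by (simp_all add: mean_matrix_def mean_char_def)

lemma right_prod_add: "right_prod coord (m + n) e = right_prod coord m e ** right_prod coord n (\<lambda>k. e (k + m))"
  by (induction n) (simp_all add: matrix_mul_assoc mean_matrix_shift add.commute)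

text \<open>By \<open>quenched_mean_snd\<close>, the quenched mean of the characteristic accumulated
  in \<open>n\<close> generations from one ancestor of type \<open>i\<close>.\<close>

definition partial_Xi :: "nat \<Rightarrow> (nat \<Rightarrow> 'm::finite \<Rightarrow> 'm litter measure) \<Rightarrow> 'm \<Rightarrow> ennreal" where
  "partial_Xi n e i = (\<Sum>k<n. (right_prod coord k e *v mean_char coord k e) $ i)"

lemma nn_integral_lin:
  assumes "env \<mu>"
  shows "(\<integral>\<^sup>+x. lin w b x \<partial>\<mu> i) = (\<Sum>j\<in>UNIV. (\<integral>\<^sup>+x. of_nat (fst x $ j) \<partial>\<mu> i) * w j) + b * (\<integral>\<^sup>+x. ennreal (snd x) \<partial>\<mu> i)"
  unfolding lin_def using assms by (simp add: nn_integral_add nn_integral_sum nn_integral_multc nn_integral_cmult)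

lemma right_prod_Suc_left: "right_prod coord (Suc n) e = mean_matrix coord 0 e ** right_prod coord n (\<lambda>k. e (Suc k))"
  using right_prod_add[of 1 n e] by simp

lemma partial_Xi_Suc:
  "partial_Xi (Suc n) e i = mean_char coord 0 e $ i + (\<Sum>j\<in>UNIV. mean_matrix coord 0 e $ i $ j * partial_Xi n (\<lambda>k. e (Suc k)) j)"
proof -
  have c: "mean_char coord (Suc k) e = mean_char coord k (\<lambda>k. e (Suc k))" for k by (simp add: mean_char_def)
  have "partial_Xi (Suc n) e i = mean_char coord 0 e $ i +
      (\<Sum>k<n. (right_prod coord (Suc k) e *v mean_char coord (Suc k) e) $ i)"
    unfolding partial_Xi_def sum.lessThan_Suc_shift by simp
  also have "(\<Sum>k<n. (right_prod coord (Suc k) e *v mean_char coord (Suc k) e) $ i) =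
      (\<Sum>k<n. \<Sum>j\<in>UNIV. mean_matrix coord 0 e $ i $ j * (right_prod coord k (\<lambda>k. e (Suc k)) *v mean_char coord k (\<lambda>k. e (Suc k))) $ j)"
    unfolding right_prod_Suc_left c matrix_vector_mul_assoc[symmetric]
    by (simp add: matrix_vector_mult_def[of "mean_matrix _ _ _"])
  also have "\<dots> = (\<Sum>j\<in>UNIV. mean_matrix coord 0 e $ i $ j * partial_Xi n (\<lambda>k. e (Suc k)) j)"
    by (subst sum.swap) (simp add: partial_Xi_def sum_distrib_left)
  finally show ?thesis .
qed

lemma lin_shift:
  "0 \<le> snd t \<Longrightarrow> 0 \<le> \<phi> \<Longrightarrow> lin w b ((0, \<phi>) + t) = b * ennreal \<phi> + lin w b t"
  by (simp add: additive_functionalD(3)[OF additive_lin]) (simp add: lin_def)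

text \<open>The functionals \<open>lin\<close> are closed under quenched averaging: averaging over
  the later generations only replaces the weights by \<open>?m\<close>, after which one litter has
  to be averaged.\<close>

lemma quenched_mean_lin:
  assumes "e \<in> space env_seqs"
  shows "(\<integral>\<^sup>+t. lin w b t \<partial>quenched n e (axis i 1, 0)) = (\<Sum>j\<in>UNIV. right_prod coord n e $ i $ j * w j) + b * partial_Xi n e i"
  using assms
proof (induction n arbitrary: e i)
  case 0
  then show ?case
    by (simp add: lin_def partial_Xi_def mat_def axis_def if_distrib[of of_nat] if_distrib[of "\<lambda>x. x * _"] del: quenched.simps cong: if_cong)
next
  case (Suc n)
  let ?e = "\<lambda>k. e (Suc k)"
  let ?m = "\<lambda>j. (\<Sum>l\<in>UNIV. right_prod coord n ?e $ j $ l * w l) + b * partial_Xi n ?e j"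
  have e: "?e \<in> space env_seqs" "env (e 0)" using Suc.prems by (auto intro: env_seq_shift env_seq_nth)
  have "(\<integral>\<^sup>+t. lin w b t \<partial>quenched (Suc n) e (axis i 1, 0)) =
      (\<integral>\<^sup>+x. \<integral>\<^sup>+t. lin w b ((0, snd x) + t) \<partial>quenched n ?e (fst x, 0) \<partial>e 0 i)"
    by (rule nn_integral_quenched_Suc_axis[OF Suc.prems measurable_lin])
  also have "\<dots> = (\<integral>\<^sup>+x. lin ?m b x \<partial>e 0 i)"
  proof (intro nn_integral_cong)
    fix x assume "x \<in> space (e 0 i)"
    then have x: "0 \<le> snd x" using e by simp
    have "(\<integral>\<^sup>+t. lin w b ((0, snd x) + t) \<partial>quenched n ?e (fst x, 0)) =
       (\<integral>\<^sup>+t. b * ennreal (snd x) + lin w b t \<partial>quenched n ?e (fst x, 0))"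
      using x e by (intro nn_integral_cong lin_shift) auto
    also have "\<dots> = b * ennreal (snd x) + (\<integral>\<^sup>+t. lin w b t \<partial>quenched n ?e (fst x, 0))"
      using prob_space.emeasure_space_1[OF prob_space_quenched[OF e(1)], of "(fst x, 0)" n] e
      by (subst nn_integral_add) (simp_all)
    also have "(\<integral>\<^sup>+t. lin w b t \<partial>quenched n ?e (fst x, 0)) = (\<Sum>j\<in>UNIV. of_nat (fst x $ j) * ?m j)"
      unfolding Suc.IH[OF e(1), symmetric] by (rule quenched_mean_additive[OF e(1) additive_lin])
    finally show "(\<integral>\<^sup>+t. lin w b ((0, snd x) + t) \<partial>quenched n ?e (fst x, 0)) = lin ?m b x"
      by (simp add: lin_def add.commute)
  qed
  also have "\<dots> = (\<Sum>j\<in>UNIV. mean_matrix coord 0 e $ i $ j * ?m j) + b * mean_char coord 0 e $ i"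
    using nn_integral_lin[OF e(2)] by (simp add: mean_matrix_def mean_char_def)
  also have "\<dots> = (\<Sum>j\<in>UNIV. right_prod coord (Suc n) e $ i $ j * w j) + b * partial_Xi (Suc n) e i"
  proof -
    have "(\<Sum>j\<in>UNIV. mean_matrix coord 0 e $ i $ j * (\<Sum>l\<in>UNIV. right_prod coord n ?e $ j $ l * w l)) =
      (\<Sum>l\<in>UNIV. right_prod coord (Suc n) e $ i $ l * w l)"
      unfolding right_prod_Suc_left
      by (simp add: matrix_matrix_mult_def sum_distrib_left sum_distrib_right mult.assoc) (rule sum.swap)
    then show ?thesis unfolding partial_Xi_Suc by (simp add: distrib_left sum.distrib sum_distrib_left ac_simps)
  qed
  finally show ?case .
qed

lemma lin_snd: "lin (\<lambda>_. 0) 1 = (\<lambda>t. ennreal (snd t))"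
  by (simp add: lin_def fun_eq_iff)

lemma quenched_mean_snd:
  assumes e: "e \<in> space env_seqs" and \<phi>: "0 \<le> \<phi>"
  shows "(\<integral>\<^sup>+t. ennreal (snd t) \<partial>quenched n e (z, \<phi>)) = ennreal \<phi> + (\<Sum>i\<in>UNIV. of_nat (z $ i) * partial_Xi n e i)"
proof -
  have "(\<integral>\<^sup>+t. lin (\<lambda>_. 0) 1 t \<partial>quenched n e (z, \<phi>)) = (\<integral>\<^sup>+t. lin (\<lambda>_. 0) 1 ((0, \<phi>) + t) \<partial>quenched n e (z, 0))"
    by (rule nn_integral_quenched_shift[OF e measurable_lin \<phi>])
  also have "\<dots> = (\<integral>\<^sup>+t. ennreal \<phi> + lin (\<lambda>_. 0) 1 t \<partial>quenched n e (z, 0))"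
    by (intro nn_integral_cong) (use e \<phi> lin_shift[of _ \<phi> "\<lambda>_. 0" 1] in simp)
  also have "\<dots> = ennreal \<phi> + (\<integral>\<^sup>+t. lin (\<lambda>_. 0) 1 t \<partial>quenched n e (z, 0))"
    using prob_space.emeasure_space_1[OF prob_space_quenched[OF e], of "(z, 0)" n] e
    by (subst nn_integral_add) (simp_all)
  also have "(\<integral>\<^sup>+t. lin (\<lambda>_. 0) 1 t \<partial>quenched n e (z, 0)) = (\<Sum>i\<in>UNIV. of_nat (z $ i) * partial_Xi n e i)"
    unfolding quenched_mean_additive[OF e additive_lin, where z=z] quenched_mean_lin[OF e] by simp
  finally show ?thesis by (simp add: lin_snd)
qed

section \<open>Products of the mean matrices\<close>

lemma ennreal_tendsto_0_le:
  fixes f g :: "nat \<Rightarrow> ennreal"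
  assumes "\<And>n. f n \<le> g n" "g \<longlonglongrightarrow> 0"
  shows "f \<longlonglongrightarrow> 0"
  by (rule tendsto_sandwich[of "\<lambda>_. 0" f sequentially g 0]) (use assms in simp_all)

text \<open>The rule \<open>comb\<close> expresses independence and stationarity at once: the first
  \<open>n\<close> environments followed by an independent copy of the sequence have the law of the
  sequence.\<close>

locale env_law = prob_space S for S :: "(nat \<Rightarrow> 'm::finite \<Rightarrow> 'm litter measure) measure" +
  assumes sets_S [measurable_cong]: "sets S = sets env_seqs"
    and comb: "h \<in> borel_measurable env_seqs \<Longrightarrow> (\<integral>\<^sup>+e. h e \<partial>S) = (\<integral>\<^sup>+e. \<integral>\<^sup>+e'. h (comb_seq n e e') \<partial>S \<partial>S)"
begin

lemma space_S [simp]: "space S = space env_seqs"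
  by (rule sets_eq_imp_space_eq[OF sets_S])

lemma measurable_S [simp]: "measurable S = measurable env_seqs"
  by (intro ext measurable_cong_sets sets_S refl)

lemma comb_seq_shift: "(\<lambda>k. comb_seq n e e' (k + n)) = e'"
  by (simp add: comb_seq_add fun_eq_iff)

lemma measurable_shift_env: "(\<lambda>e k. e (k + n)) \<in> env_seqs \<rightarrow>\<^sub>M env_seqs"
  using measurable_env_shift[OF measurable_ident_sets[OF refl], where h="\<lambda>k. k + n"] by simp

text \<open>By \<open>loc\<close> the function \<open>f\<close> sees only the first \<open>n\<close>
  environments, so after splicing \<open>f\<close> and the shifted \<open>g\<close> live on
  different copies.\<close>

lemma nn_integral_indep:
  assumes f: "f \<in> borel_measurable env_seqs" and g: "g \<in> borel_measurable env_seqs"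
    and loc: "\<And>e e'. f (comb_seq n e e') = f e"
  shows "(\<integral>\<^sup>+e. f e * g (\<lambda>k. e (k + n)) \<partial>S) = (\<integral>\<^sup>+e. f e \<partial>S) * (\<integral>\<^sup>+e. g e \<partial>S)"
proof -
  have "(\<lambda>e. g (\<lambda>k. e (k + n))) \<in> borel_measurable env_seqs"
    by (rule measurable_compose[OF measurable_shift_env g])
  then have "(\<integral>\<^sup>+e. f e * g (\<lambda>k. e (k + n)) \<partial>S) = (\<integral>\<^sup>+e. \<integral>\<^sup>+e'. f e * g e' \<partial>S \<partial>S)"
    using f by (subst comb[of _ n]) (simp_all add: loc comb_seq_shift)
  then show ?thesis using f g by (simp add: nn_integral_cmult nn_integral_multc)
qed

lemma nn_integral_shift:
  "g \<in> borel_measurable env_seqs \<Longrightarrow> (\<integral>\<^sup>+e. g (\<lambda>k. e (k + n)) \<partial>S) = (\<integral>\<^sup>+e. g e \<partial>S)"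
  using nn_integral_indep[of "\<lambda>_. 1" g n] emeasure_space_1 by simp

end

section \<open>Measurability and elementary bounds for \<Xi> and the matrix products\<close>

lemma measurable_law_nth: "(\<lambda>e. e n i) \<in> env_seqs \<rightarrow>\<^sub>M prob_algebra litter_space"
  by (rule measurable_compose[OF measurable_env_seq_nth measurable_env_nth])

lemma measurable_law_integral:
  "g \<in> borel_measurable litter_space \<Longrightarrow> (\<lambda>e. \<integral>\<^sup>+x. g x \<partial>e n i) \<in> borel_measurable env_seqs"
  by (rule measurable_nn_integral_kernel[OF measurable_law_nth]) (simp add: case_prod_beta')

lemma measurable_mean_matrix [measurable]: "(\<lambda>e. mean_matrix coord n e $ i $ j) \<in> borel_measurable env_seqs"
  unfolding mean_matrix_def by (simp, rule measurable_law_integral) measurable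

lemma measurable_mean_char [measurable]: "(\<lambda>e. mean_char coord n e $ i) \<in> borel_measurable env_seqs"
  unfolding mean_char_def by (simp, rule measurable_law_integral) measurable

lemma measurable_right_prod [measurable]: "(\<lambda>e. right_prod coord n e $ i $ j) \<in> borel_measurable env_seqs"
proof (induction n arbitrary: i j)
  case (Suc n)
  note Suc [measurable]
  show ?case unfolding right_prod.simps matrix_matrix_mult_def by simp
qed simp

lemma measurable_right_prod_char [measurable]:
  "(\<lambda>e. (right_prod coord n e *v mean_char coord n e) $ i) \<in> borel_measurable env_seqs"
  unfolding matrix_vector_mult_def by simp

lemma measurable_partial_Xi [measurable]: "(\<lambda>e. partial_Xi n e i) \<in> borel_measurable env_seqs"
  unfolding partial_Xi_def by measurable

lemma measurable_Xi [measurable]: "(\<lambda>e. Xi coord e $ i) \<in> borel_measurable env_seqs"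
  unfolding Xi_def by simp

lemma Xi_eq_SUP: "Xi coord e $ i = (SUP n. partial_Xi n e i)"
  by (simp add: Xi_def partial_Xi_def suminf_eq_SUP)

lemma partial_Xi_le: "partial_Xi n e i \<le> Xi coord e $ i"
  unfolding Xi_eq_SUP by (rule SUP_upper) simp

lemma partial_Xi_mono: "n \<le> m \<Longrightarrow> partial_Xi n e i \<le> partial_Xi m e i"
  unfolding partial_Xi_def by (rule sum_mono2) auto

lemma Xi_term_le: "(right_prod coord n e *v mean_char coord n e) $ i \<le> Xi coord e $ i"
  by (rule order_trans[OF _ partial_Xi_le[of "Suc n"]]) (simp add: partial_Xi_def)

lemma Xi_ge_char: "mean_char coord 0 e $ i \<le> Xi coord e $ i"
  using Xi_term_le[of 0 e i] by simp

lemma right_prod_local: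
  assumes "\<And>k. k < n \<Longrightarrow> e k = e' k"
  shows "right_prod coord n e = right_prod coord n e'"
  using assms
proof (induction n)
  case (Suc n)
  then have "mean_matrix coord n e = mean_matrix coord n e'" by (simp add: mean_matrix_def)
  moreover have "right_prod coord n e = right_prod coord n e'" using Suc by simp
  ultimately show ?case by simp
qed simp

lemma right_prod_comb_seq: "right_prod coord n (comb_seq n e e') = right_prod coord n e"
  by (rule right_prod_local) (simp add: comb_seq_less)

lemma entry_le_matnorm: "A $ i $ j \<le> matnorm A"
  unfolding matnorm_def
  by (rule order_trans[OF member_le_sum[of j UNIV "\<lambda>j. A $ i $ j"] member_le_sum[of i UNIV "\<lambda>i. \<Sum>j\<in>UNIV. A $ i $ j"]]) auto

lemma row_le_matnorm: "(\<Sum>j\<in>UNIV. A $ i $ j) \<le> matnorm A"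
  unfolding matnorm_def by (rule member_le_sum[of i UNIV "\<lambda>i. \<Sum>j\<in>UNIV. A $ i $ j"]) auto

lemma matnorm_mult: "matnorm (A ** B) \<le> matnorm A * matnorm B"
proof -
  have "matnorm (A ** B) = (\<Sum>i\<in>UNIV. \<Sum>k\<in>UNIV. A $ i $ k * (\<Sum>j\<in>UNIV. B $ k $ j))"
    unfolding matnorm_def by (simp add: matrix_matrix_mult_def sum_distrib_left) (intro sum.cong refl sum.swap)
  also have "\<dots> \<le> (\<Sum>i\<in>UNIV. \<Sum>k\<in>UNIV. A $ i $ k * matnorm B)"
    by (intro sum_mono mult_left_mono row_le_matnorm) auto
  also have "\<dots> = matnorm A * matnorm B" by (simp add: matnorm_def sum_distrib_right)
  finally show ?thesis .
qed

lemma measurable_matnorm [measurable]: "(\<lambda>e. matnorm (right_prod coord n e)) \<in> borel_measurable env_seqs"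
  unfolding matnorm_def by measurable

definition (in env_law) growth :: "real \<Rightarrow> nat \<Rightarrow> ennreal" where
  "growth y n = (\<integral>\<^sup>+e. matnorm (right_prod coord n e) epowr y \<partial>S)"

context env_law
begin

lemma growth_submult:
  assumes "0 < y"
  shows "growth y (n + m) \<le> growth y n * growth y m"
proof -
  have "growth y (n + m) \<le> (\<integral>\<^sup>+e. matnorm (right_prod coord n e) epowr y * matnorm (right_prod coord m (\<lambda>k. e (k + n))) epowr y \<partial>S)"
    unfolding growth_def right_prod_add using assms
    by (intro nn_integral_mono, subst epowr_mult[symmetric]) (auto intro!: epowr_mono matnorm_mult)
  also have "\<dots> = growth y n * growth y m"
    unfolding growth_def by (rule nn_integral_indep) (simp_all add: right_prod_comb_seq)
  finally show ?thesis .
qed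

text \<open>The mean characteristics of generation \<open>n\<close> are independent of the first
  \<open>n\<close> matrices, and entry times characteristic is a part of the \<open>n\<close>-th
  term of \<Xi>. Moments of \<Xi> thereby control moments of the products.\<close>

lemma growth_entry:
  assumes y: "0 < y"
  shows "(\<integral>\<^sup>+e. right_prod coord n e $ i $ j epowr y \<partial>S) * (\<integral>\<^sup>+e. mean_char coord 0 e $ j epowr y \<partial>S) \<le>
     (\<integral>\<^sup>+e. (right_prod coord n e *v mean_char coord n e) $ i epowr y \<partial>S)"
proof -
  have "(\<integral>\<^sup>+e. right_prod coord n e $ i $ j epowr y \<partial>S) * (\<integral>\<^sup>+e. mean_char coord 0 e $ j epowr y \<partial>S) =
      (\<integral>\<^sup>+e. right_prod coord n e $ i $ j epowr y * mean_char coord 0 (\<lambda>k. e (k + n)) $ j epowr y \<partial>S)"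
    by (rule nn_integral_indep[symmetric]) (simp_all add: right_prod_comb_seq)
  also have "\<dots> \<le> (\<integral>\<^sup>+e. (right_prod coord n e *v mean_char coord n e) $ i epowr y \<partial>S)"
  proof (intro nn_integral_mono)
    fix e
    have "right_prod coord n e $ i $ j * mean_char coord n e $ j \<le> (right_prod coord n e *v mean_char coord n e) $ i"
      unfolding matrix_vector_mult_def by simp (rule member_le_sum, auto)
    then show "right_prod coord n e $ i $ j epowr y * mean_char coord 0 (\<lambda>k. e (k + n)) $ j epowr y
        \<le> (right_prod coord n e *v mean_char coord n e) $ i epowr y"
      using y unfolding mean_char_shift by (subst epowr_mult[symmetric]) (auto intro!: epowr_mono)
  qed
  finally show ?thesis .
qed

end

text \<open>\<open>Xi_moment\<close> is what the tail asymptotics give below \<kappa>, and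
  \<open>char_pos\<close> allows the moment of the characteristic to be divided out in
  \<open>growth_entry\<close>.\<close>

locale moment_env = env_law S for S :: "(nat \<Rightarrow> 'm::finite \<Rightarrow> 'm litter measure) measure" +
  fixes \<kappa> :: real
  assumes \<kappa>: "0 < \<kappa>"
    and Xi_moment: "0 < y \<Longrightarrow> y < \<kappa> \<Longrightarrow> (\<integral>\<^sup>+e. Xi coord e $ i epowr y \<partial>S) < \<infinity>"
    and char_pos: "(\<integral>\<^sup>+e. mean_char coord 0 e $ i \<partial>S) \<noteq> 0"
begin

lemma char_moment_pos: "0 < y \<Longrightarrow> (\<integral>\<^sup>+e. mean_char coord 0 e $ i epowr y \<partial>S) \<noteq> 0"
  using char_pos[of i] by (simp add: nn_integral_0_iff_AE epowr_eq_0_iff)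

lemma char_moment: "0 < y \<Longrightarrow> y < \<kappa> \<Longrightarrow> (\<integral>\<^sup>+e. mean_char coord 0 e $ i epowr y \<partial>S) < \<infinity>"
  by (rule le_less_trans[OF nn_integral_mono[OF epowr_mono[OF _ Xi_ge_char]] Xi_moment]) auto

lemma growth_le_entries:
  assumes y: "0 < y"
  shows "growth y n \<le> of_nat (CARD('m)) epowr y * (of_nat (CARD('m)) epowr y *
    (\<Sum>i\<in>UNIV. \<Sum>j\<in>UNIV. \<integral>\<^sup>+e. right_prod coord n e $ i $ j epowr y \<partial>S))"
proof -
  have "matnorm A epowr y \<le> of_nat (CARD('m)) epowr y * (of_nat (CARD('m)) epowr y * (\<Sum>i\<in>UNIV. \<Sum>j\<in>UNIV. A $ i $ j epowr y))"
    for A :: "ennreal ^ 'm ^ 'm"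
  proof -
    have "matnorm A epowr y \<le> of_nat (CARD('m)) epowr y * (\<Sum>i\<in>UNIV. (\<Sum>j\<in>UNIV. A $ i $ j) epowr y)"
      unfolding matnorm_def using y by (rule epowr_sum_le) simp
    also have "\<dots> \<le> of_nat (CARD('m)) epowr y * (\<Sum>i\<in>UNIV. of_nat (CARD('m)) epowr y * (\<Sum>j\<in>UNIV. A $ i $ j epowr y))"
      using y by (intro mult_left_mono sum_mono epowr_sum_le) auto
    finally show ?thesis by (simp add: sum_distrib_left)
  qed
  then have "growth y n \<le> (\<integral>\<^sup>+e. of_nat (CARD('m)) epowr y * (of_nat (CARD('m)) epowr y *
      (\<Sum>i\<in>UNIV. \<Sum>j\<in>UNIV. right_prod coord n e $ i $ j epowr y)) \<partial>S)"
    unfolding growth_def by (intro nn_integral_mono)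
  then show ?thesis by (simp add: nn_integral_cmult nn_integral_sum)
qed

lemma growth_finite:
  assumes y: "0 < y" "y < \<kappa>"
  shows "growth y n < \<infinity>"
proof -
  have "(\<integral>\<^sup>+e. right_prod coord n e $ i $ j epowr y \<partial>S) < top" for i j
  proof -
    have "(\<integral>\<^sup>+e. right_prod coord n e $ i $ j epowr y \<partial>S) * (\<integral>\<^sup>+e. mean_char coord 0 e $ j epowr y \<partial>S) \<le>
        (\<integral>\<^sup>+e. Xi coord e $ i epowr y \<partial>S)"
      using y by (intro order_trans[OF growth_entry] nn_integral_mono epowr_mono Xi_term_le) auto
    also have "\<dots> < top" using Xi_moment[OF y] by simp
    finally show ?thesis using char_moment_pos[OF y(1), of j] by (auto simp: ennreal_mult_less_top)
  qed
  then show ?thesis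
    using y by (intro le_less_trans[OF growth_le_entries]) (auto simp: ennreal_mult_less_top)
qed

text \<open>\<Xi> is almost surely a convergent series, so its terms tend to 0; they are dominated
  by \<Xi>, whose y-th moment is finite. \<open>growth_entry\<close> passes from the terms to the
  matrix entries.\<close>

lemma growth_tendsto_0:
  assumes y: "0 < y" "y < \<kappa>"
  shows "growth y \<longlonglongrightarrow> 0"
proof -
  have entry: "(\<lambda>n. \<integral>\<^sup>+e. right_prod coord n e $ i $ j epowr y \<partial>S) \<longlonglongrightarrow> 0" for i j
  proof -
    let ?c = "\<integral>\<^sup>+e. mean_char coord 0 e $ j epowr y \<partial>S"
    have "(\<lambda>n. \<integral>\<^sup>+e. (right_prod coord n e *v mean_char coord n e) $ i epowr y \<partial>S) \<longlonglongrightarrow> (\<integral>\<^sup>+e. 0 \<partial>S)"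
    proof (rule nn_integral_dominated_convergence[where w="\<lambda>e. Xi coord e $ i epowr y"])
      show "(\<integral>\<^sup>+e. Xi coord e $ i epowr y \<partial>S) < \<infinity>" by (rule Xi_moment[OF y])
      then have "AE e in S. Xi coord e $ i epowr y \<noteq> \<infinity>" by (intro nn_integral_noteq_infinite) auto
      then show "AE e in S. (\<lambda>n. (right_prod coord n e *v mean_char coord n e) $ i epowr y) \<longlonglongrightarrow> 0"
      proof eventually_elim
        case (elim e)
        let ?a = "\<lambda>n. (right_prod coord n e *v mean_char coord n e) $ i"
        have fin: "(\<Sum>n. ?a n) \<noteq> \<infinity>" using elim epowr_eq_top_iff[OF y(1), of "Xi coord e $ i"] by (simp add: Xi_def)
        have ne: "?a n \<noteq> \<infinity>" for n
          using Xi_term_le[of n e i] fin by (auto simp: Xi_def top_unique)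
        have "summable (\<lambda>n. enn2real (?a n))"
          using fin ne by (intro summable_suminf_not_top) (auto simp: less_top)
        then have "(\<lambda>n. enn2real (?a n)) \<longlonglongrightarrow> 0" by (rule summable_LIMSEQ_zero)
        then have "(\<lambda>n. enn2real (?a n) powr y) \<longlonglongrightarrow> 0 powr y"
          using y by (intro tendsto_powr2) auto
        then have "(\<lambda>n. ennreal (enn2real (?a n) powr y)) \<longlonglongrightarrow> ennreal 0"
          using y by (intro tendsto_ennrealI) simp
        moreover have "ennreal (enn2real (?a n) powr y) = ?a n epowr y" for n
          using ne[of n] y by (simp add: epowr_def)
        ultimately show ?case by simp
      qed
      show "AE e in S. (right_prod coord n e *v mean_char coord n e) $ i epowr y \<le> Xi coord e $ i epowr y" for n
        using y by (intro AE_I2 epowr_mono Xi_term_le) auto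
    qed simp_all
    then have "(\<lambda>n. (\<integral>\<^sup>+e. right_prod coord n e $ i $ j epowr y \<partial>S) * ?c) \<longlonglongrightarrow> 0"
      by (intro ennreal_tendsto_0_le[OF growth_entry[OF y(1)]]) simp
    then have "(\<lambda>n. inverse ?c * ((\<integral>\<^sup>+e. right_prod coord n e $ i $ j epowr y \<partial>S) * ?c)) \<longlonglongrightarrow> inverse ?c * 0"
      using char_moment_pos[OF y(1), of j] by (intro ennreal_tendsto_cmult) (auto simp: less_top[symmetric])
    moreover have "inverse ?c * (a * ?c) = a" for a
      using char_moment_pos[OF y(1), of j] char_moment[OF y, of j] ennreal_mult_divide_eq[of ?c a]
      by (simp add: divide_ennreal_def mult.commute)
    ultimately show ?thesis by simp
  qed
  have "(\<lambda>n. of_nat (CARD('m)) epowr y * (of_nat (CARD('m)) epowr y *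
    (\<Sum>i\<in>UNIV. \<Sum>j\<in>UNIV. \<integral>\<^sup>+e. right_prod coord n e $ i $ j epowr y \<partial>S))) \<longlonglongrightarrow>
     of_nat (CARD('m)) epowr y * (of_nat (CARD('m)) epowr y * (\<Sum>i\<in>(UNIV::'m set). \<Sum>j\<in>(UNIV::'m set). 0))"
    by (intro ennreal_tendsto_cmult tendsto_sum entry epowr_numeral_less_top)
  then have "(\<lambda>n. of_nat (CARD('m)) epowr y * (of_nat (CARD('m)) epowr y *
    (\<Sum>i\<in>UNIV. \<Sum>j\<in>UNIV. \<integral>\<^sup>+e. right_prod coord n e $ i $ j epowr y \<partial>S))) \<longlonglongrightarrow> 0" by simp
  then show ?thesis
    by (intro ennreal_tendsto_0_le[OF growth_le_entries[OF y(1)]])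
qed

text \<open>Once some \<open>growth y N\<close> is at most 1/2, submultiplicativity makes the
  sequence decay geometrically.\<close>

lemma growth_summable:
  assumes y: "0 < y" "y < \<kappa>"
  shows "(\<Sum>n. growth y n) < \<infinity>"
proof -
  have "(\<lambda>n. 2 * growth y n) \<longlonglongrightarrow> 2 * 0"
    by (intro ennreal_tendsto_cmult growth_tendsto_0 y) simp
  then have "eventually (\<lambda>n. 2 * growth y n < 1) sequentially"
    using order_tendstoD(2)[of "\<lambda>n. 2 * growth y n" 0 sequentially 1] by simp
  then obtain N where N: "2 * growth y N \<le> 1" by (auto simp: eventually_sequentially intro: less_imp_le)
  define D where "D = (\<Sum>k<N. growth y k)"
  have D: "D < top" unfolding D_def using growth_finite[OF y] by simp
  \<comment> \<open>A partial sum u satisfies u \<le> D + u/2, where D collects the first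
    \<open>N\<close> terms; as u is finite, u \<le> 2D.\<close>
  have bound: "(\<Sum>k<M. growth y k) \<le> 2 * D" for M
  proof -
    let ?u = "\<Sum>k<M. growth y k"
    have u: "?u < top" using growth_finite[OF y] by simp
    have "?u \<le> (\<Sum>k<N + M. growth y k)" by (rule sum_mono2) auto
    also have "\<dots> = D + (\<Sum>k<M. growth y (N + k))" unfolding D_def by (induction M) (simp_all add: add.assoc)
    also have "\<dots> \<le> D + (\<Sum>k<M. growth y N * growth y k)"
      by (intro add_left_mono sum_mono growth_submult[OF y(1)])
    finally have "2 * ?u \<le> 2 * (D + growth y N * ?u)" by (intro mult_left_mono) (simp_all add: sum_distrib_left)
    also have "\<dots> = 2 * D + (2 * growth y N) * ?u" by (simp add: distrib_left mult.assoc)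
    also have "\<dots> \<le> 2 * D + 1 * ?u" by (intro add_left_mono mult_right_mono N) simp
    finally have "?u + ?u \<le> ?u + 2 * D" by (simp add: mult_2 add.commute)
    then show ?thesis using u by (metis ennreal_add_left_cancel_le infinity_ennreal_def less_irrefl)
  qed
  have "(\<Sum>n. growth y n) \<le> 2 * D"
    unfolding suminf_eq_SUP by (rule SUP_least) (rule bound)
  also have "\<dots> < \<infinity>" using D by (simp add: ennreal_mult_less_top)
  finally show ?thesis .
qed

end

section \<open>Annealed moments below the critical exponent\<close>

text \<open>Keeps the index in \<open>lin_moment x w b 1\<close> and \<open>growth 1 1\<close> as 1,
  instead of rewriting it to \<open>Suc 0\<close>.\<close>

declare One_nat_def [simp del]

lemma quenched_local:
  assumes "\<And>k. k < n \<Longrightarrow> e k = e' k"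
  shows "quenched n e s = quenched n e' s"
  using assms
proof (induction n arbitrary: e e' s)
  case (Suc n)
  have "quenched n (\<lambda>k. e (Suc k)) = quenched n (\<lambda>k. e' (Suc k))"
    by (rule ext, rule Suc.IH) (use Suc.prems in auto)
  then show ?case using Suc.prems[of 0] by simp
qed simp

definition pop :: "nat ^ 'm::finite \<Rightarrow> ennreal" where
  "pop z = (\<Sum>i\<in>UNIV. of_nat (z $ i))"

lemma lin_pop: "lin (\<lambda>_. 1) 0 = (\<lambda>t. pop (fst t))"
  by (simp add: lin_def pop_def fun_eq_iff)

lemma measurable_pop [measurable]: "(\<lambda>t. pop (fst t)) \<in> borel_measurable litter_space"
  using measurable_lin[of "\<lambda>_. 1" 0] by (simp add: lin_pop)

lemma pop_less_top [simp]: "pop z < top"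
  by (simp add: pop_def ennreal_of_nat_eq_real_of_nat)

lemma weighted_sum_le_pop: "(\<Sum>i\<in>UNIV. of_nat (z $ i) * f i) \<le> pop z * (\<Sum>i\<in>UNIV. f i)"
  unfolding pop_def sum_distrib_right by (intro sum_mono mult_left_mono) (auto intro: member_le_sum)

lemma measurable_quenched_integral:
  assumes "(\<lambda>(e, t). g e t) \<in> borel_measurable (env_seqs \<Otimes>\<^sub>M litter_space)" "0 \<le> snd s"
  shows "(\<lambda>e. \<integral>\<^sup>+t. g e t \<partial>quenched n e s) \<in> borel_measurable env_seqs"
proof (rule measurable_nn_integral_kernel[OF _ assms(1)])
  show "(\<lambda>e. quenched n e s) \<in> env_seqs \<rightarrow>\<^sub>M prob_algebra litter_space"
    by (rule measurable_quenched[OF measurable_ident_sets[OF refl] measurable_const]) (use assms in simp)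
qed

lemma measurable_quenched_integral':
  assumes "g \<in> borel_measurable litter_space" "0 \<le> snd s"
  shows "(\<lambda>e. \<integral>\<^sup>+t. g t \<partial>quenched n e s) \<in> borel_measurable env_seqs"
  by (rule measurable_quenched_integral) (use assms in \<open>simp_all add: case_prod_beta'\<close>)

text \<open>The factor 2 comes from \<open>absorb_epowr\<close>, on both of its terms.\<close>

definition rosenthal_const :: "real \<Rightarrow> ennreal" where
  "rosenthal_const x = 2 * rosenthal_step x"

lemma rosenthal_const_less_top [simp]: "rosenthal_const x < top" "rosenthal_const x epowr y < top"
proof -
  show *: "rosenthal_const x < top"
    by (simp add: rosenthal_const_def rosenthal_step_def ennreal_mult_less_top)
  then show "rosenthal_const x epowr y < top"
    by (simp add: epowr_def)
qed

text \<open>Sums over individuals are coarsened to the population size times a sum over types, so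
  that the quantities left to average over the environment no longer depend on
  \<open>z\<close>.\<close>

lemma quenched_lin_moment_le:
  assumes e: "e \<in> space env_seqs" and x: "1 < x" and \<phi>: "0 \<le> \<phi>" and b: "b \<le> 1"
  shows "(\<integral>\<^sup>+t. lin w b t epowr x \<partial>quenched n e (z, \<phi>)) \<le> 2 epowr x * (ennreal \<phi> epowr x +
    (rosenthal_const x * (pop z * (\<Sum>i\<in>UNIV. \<integral>\<^sup>+t. lin w b t epowr x \<partial>quenched n e (axis i 1, 0))) +
     rosenthal_const x epowr x * (pop z epowr x * (\<Sum>i\<in>UNIV. \<integral>\<^sup>+t. lin w b t \<partial>quenched n e (axis i 1, 0)) epowr x)))"
proof -
  let ?a = "\<lambda>i. \<integral>\<^sup>+t. lin w b t epowr x \<partial>quenched n e (axis i 1, 0)"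
  let ?m = "\<lambda>i. \<integral>\<^sup>+t. lin w b t \<partial>quenched n e (axis i 1, 0)"
  have "(\<integral>\<^sup>+t. lin w b t epowr x \<partial>quenched n e (z, \<phi>)) = (\<integral>\<^sup>+t. lin w b ((0, \<phi>) + t) epowr x \<partial>quenched n e (z, 0))"
    by (rule nn_integral_quenched_shift[OF e _ \<phi>]) measurable
  also have "\<dots> \<le> (\<integral>\<^sup>+t. 2 epowr x * (ennreal \<phi> epowr x + lin w b t epowr x) \<partial>quenched n e (z, 0))"
  proof (intro nn_integral_mono)
    fix t assume "t \<in> space (quenched n e (z, 0))"
    then have t: "0 \<le> snd t" using e by simp
    have "lin w b ((0, \<phi>) + t) \<le> ennreal \<phi> + lin w b t"
      unfolding lin_shift[OF t \<phi>] using mult_right_mono[OF b, of "ennreal \<phi>"] by (intro add_right_mono) simp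
    then have "lin w b ((0, \<phi>) + t) epowr x \<le> (ennreal \<phi> + lin w b t) epowr x"
      using x by (intro epowr_mono) auto
    also have "\<dots> \<le> 2 epowr x * (ennreal \<phi> epowr x + lin w b t epowr x)" using x by (intro epowr_add_le) auto
    finally show "lin w b ((0, \<phi>) + t) epowr x \<le> 2 epowr x * (ennreal \<phi> epowr x + lin w b t epowr x)" .
  qed
  also have "\<dots> = 2 epowr x * (ennreal \<phi> epowr x + (\<integral>\<^sup>+t. lin w b t epowr x \<partial>quenched n e (z, 0)))"
    using e prob_space.emeasure_space_1[OF prob_space_quenched[OF e], of "(z, 0)" n]
    by (simp add: nn_integral_cmult nn_integral_add)
  also have "(\<integral>\<^sup>+t. lin w b t epowr x \<partial>quenched n e (z, 0)) \<le>
      rosenthal_const x * (\<Sum>i\<in>UNIV. of_nat (z $ i) * ?a i) +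
      (rosenthal_const x * (\<Sum>i\<in>UNIV. of_nat (z $ i) * ?m i)) epowr x"
    using quenched_rosenthal[OF e additive_lin[of w b] x, where n=n and z=z] by (simp add: rosenthal_const_def mult.assoc)
  also have "\<dots> \<le> rosenthal_const x * (pop z * (\<Sum>i\<in>UNIV. ?a i)) + (rosenthal_const x * (pop z * (\<Sum>i\<in>UNIV. ?m i))) epowr x"
    using x by (intro add_mono mult_left_mono epowr_mono weighted_sum_le_pop) auto
  also have "(rosenthal_const x * (pop z * (\<Sum>i\<in>UNIV. ?m i))) epowr x =
      rosenthal_const x epowr x * (pop z epowr x * (\<Sum>i\<in>UNIV. ?m i) epowr x)"
    using x by (simp add: epowr_mult)
  finally show ?thesis by (simp add: add_left_mono mult_left_mono)
qed

context env_law
begin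

lemma emeasure_S [simp]: "emeasure S (space env_seqs) = 1"
  using emeasure_space_1 by simp

text \<open>The environments from generation \<open>n\<close> on are independent of the state at
  time \<open>n\<close>, so the later generations can be averaged over a fresh copy of the
  environment.\<close>

lemma annealed_markov:
  assumes g: "g \<in> borel_measurable litter_space" and s: "0 \<le> snd s"
  shows "(\<integral>\<^sup>+e. \<integral>\<^sup>+t. g t \<partial>quenched (n + m) e s \<partial>S) =
    (\<integral>\<^sup>+e. \<integral>\<^sup>+s'. \<integral>\<^sup>+e'. \<integral>\<^sup>+t. g t \<partial>quenched m e' s' \<partial>S \<partial>quenched n e s \<partial>S)"
proof -
  have "(\<integral>\<^sup>+e. \<integral>\<^sup>+t. g t \<partial>quenched (n + m) e s \<partial>S) =
      (\<integral>\<^sup>+e. \<integral>\<^sup>+e'. \<integral>\<^sup>+t. g t \<partial>quenched (n + m) (comb_seq n e e') s \<partial>S \<partial>S)"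
    by (rule comb[OF measurable_quenched_integral'[OF g s]])
  also have "\<dots> = (\<integral>\<^sup>+e. \<integral>\<^sup>+s'. \<integral>\<^sup>+e'. \<integral>\<^sup>+t. g t \<partial>quenched m e' s' \<partial>S \<partial>quenched n e s \<partial>S)"
  proof (intro nn_integral_cong)
    fix e assume "e \<in> space S"
    then have e: "e \<in> space env_seqs" by simp
    have "(\<integral>\<^sup>+t. g t \<partial>quenched (n + m) (comb_seq n e e') s) = (\<integral>\<^sup>+s'. \<integral>\<^sup>+t. g t \<partial>quenched m e' s' \<partial>quenched n e s)"
      if e': "e' \<in> space S" for e'
    proof -
      have c: "comb_seq n e e' \<in> space env_seqs" using e e' by (auto simp: space_env_seqs comb_seq_def)
      have "quenched n (comb_seq n e e') s = quenched n e s"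
        by (rule quenched_local) (simp add: comb_seq_less)
      then show ?thesis using nn_integral_quenched_add[OF c g s] by (simp add: comb_seq_shift)
    qed
    then have "(\<integral>\<^sup>+e'. \<integral>\<^sup>+t. g t \<partial>quenched (n + m) (comb_seq n e e') s \<partial>S) =
      (\<integral>\<^sup>+e'. \<integral>\<^sup>+s'. \<integral>\<^sup>+t. g t \<partial>quenched m e' s' \<partial>quenched n e s \<partial>S)"
      by (intro nn_integral_cong)
    also have "\<dots> = (\<integral>\<^sup>+s'. \<integral>\<^sup>+e'. \<integral>\<^sup>+t. g t \<partial>quenched m e' s' \<partial>S \<partial>quenched n e s)"
    proof -
      interpret Q: prob_space "quenched n e s" by (rule prob_space_quenched[OF e s])
      interpret pair_sigma_finite "quenched n e s" S ..
      have "(\<lambda>x. \<integral>\<^sup>+t. g t \<partial>quenched m (snd x) (fst x)) \<in> borel_measurable (litter_space \<Otimes>\<^sub>M env_seqs)"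
        by (rule measurable_nn_integral_kernel[OF measurable_quenched[OF measurable_snd measurable_fst]])
          (use g in \<open>simp add: case_prod_beta'\<close>)
      moreover have "sets (quenched n e s \<Otimes>\<^sub>M S) = sets (litter_space \<Otimes>\<^sub>M env_seqs)"
        by (intro sets_pair_measure_cong sets_S sets_quenched e s)
      ultimately have "(\<lambda>(s', e'). \<integral>\<^sup>+t. g t \<partial>quenched m e' s') \<in> borel_measurable (quenched n e s \<Otimes>\<^sub>M S)"
        by (simp add: case_prod_beta' cong: measurable_cong_sets)
      from Fubini'[OF this] show ?thesis by simp
    qed
    finally show "(\<integral>\<^sup>+e'. \<integral>\<^sup>+t. g t \<partial>quenched (n + m) (comb_seq n e e') s \<partial>S) =
      (\<integral>\<^sup>+s'. \<integral>\<^sup>+e'. \<integral>\<^sup>+t. g t \<partial>quenched m e' s' \<partial>S \<partial>quenched n e s)" .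
  qed
  finally show ?thesis .
qed

text \<open>This and \<open>mean_moment\<close> are the averages of the two terms of Rosenthal's
  inequality: the moments of single contributions, and the moment of the quenched mean.\<close>

definition lin_moment :: "real \<Rightarrow> ('m \<Rightarrow> ennreal) \<Rightarrow> ennreal \<Rightarrow> nat \<Rightarrow> ennreal" where
  "lin_moment x w b n = (\<Sum>i\<in>UNIV. \<integral>\<^sup>+e. \<integral>\<^sup>+t. lin w b t epowr x \<partial>quenched n e (axis i 1, 0) \<partial>S)"

definition mean_moment :: "real \<Rightarrow> ('m \<Rightarrow> ennreal) \<Rightarrow> ennreal \<Rightarrow> nat \<Rightarrow> ennreal" where
  "mean_moment x w b n = (\<integral>\<^sup>+e. (\<Sum>i\<in>UNIV. \<integral>\<^sup>+t. lin w b t \<partial>quenched n e (axis i 1, 0)) epowr x \<partial>S)"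

lemma annealed_lin_moment_le:
  assumes x: "1 < x" and \<phi>: "0 \<le> \<phi>" and b: "b \<le> 1"
  shows "(\<integral>\<^sup>+e. \<integral>\<^sup>+t. lin w b t epowr x \<partial>quenched n e (z, \<phi>) \<partial>S) \<le> 2 epowr x * (ennreal \<phi> epowr x +
    (rosenthal_const x * lin_moment x w b n * pop z + rosenthal_const x epowr x * mean_moment x w b n * pop z epowr x))"
proof -
  have [measurable]: "(\<lambda>e. \<integral>\<^sup>+t. lin w b t epowr x \<partial>quenched n e (axis i 1, 0)) \<in> borel_measurable env_seqs"
    "(\<lambda>e. \<integral>\<^sup>+t. lin w b t \<partial>quenched n e (axis i 1, 0)) \<in> borel_measurable env_seqs" for i
    by (rule measurable_quenched_integral'; simp)+
  have "(\<integral>\<^sup>+e. \<integral>\<^sup>+t. lin w b t epowr x \<partial>quenched n e (z, \<phi>) \<partial>S) \<le>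
    (\<integral>\<^sup>+e. 2 epowr x * (ennreal \<phi> epowr x +
    (rosenthal_const x * (pop z * (\<Sum>i\<in>UNIV. \<integral>\<^sup>+t. lin w b t epowr x \<partial>quenched n e (axis i 1, 0))) +
     rosenthal_const x epowr x * (pop z epowr x * (\<Sum>i\<in>UNIV. \<integral>\<^sup>+t. lin w b t \<partial>quenched n e (axis i 1, 0)) epowr x))) \<partial>S)"
    by (intro nn_integral_mono quenched_lin_moment_le x \<phi> b) simp
  also have "\<dots> = 2 epowr x * (ennreal \<phi> epowr x +
    (rosenthal_const x * (pop z * lin_moment x w b n) + rosenthal_const x epowr x * (pop z epowr x * mean_moment x w b n)))"
    by (simp add: lin_moment_def mean_moment_def nn_integral_add nn_integral_cmult nn_integral_sum emeasure_space_1 del: One_nat_def)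
  finally show ?thesis by (simp add: mult_ac)
qed

text \<open>The process is restarted at time \<open>n\<close>. The unknown moment
  \<open>lin_moment x w b m\<close> is multiplied by the first moment of the population at time
  \<open>n\<close>, which becomes small; the x-th moment of the population multiplies only the
  moment of the quenched mean, which \<Xi> controls.\<close>

lemma lin_moment_add_le:
  assumes x: "1 < x" and b: "b \<le> 1"
  shows "lin_moment x w b (n + m) \<le> 2 epowr x * (lin_moment x (\<lambda>_. 0) 1 n +
    (rosenthal_const x * lin_moment x w b m * (\<Sum>i\<in>UNIV. \<integral>\<^sup>+e. \<integral>\<^sup>+t. pop (fst t) \<partial>quenched n e (axis i 1, 0) \<partial>S) +
     rosenthal_const x epowr x * mean_moment x w b m * lin_moment x (\<lambda>_. 1) 0 n))"
proof -
  let ?c = "rosenthal_const x * lin_moment x w b m" and ?d = "rosenthal_const x epowr x * mean_moment x w b m"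
  have [measurable]: "(\<lambda>e. \<integral>\<^sup>+t. g t \<partial>quenched n e (axis i 1, 0)) \<in> borel_measurable env_seqs"
    if "g \<in> borel_measurable litter_space" for g and i :: 'm
    by (rule measurable_quenched_integral'; simp add: that)
  have "(\<integral>\<^sup>+e. \<integral>\<^sup>+t. lin w b t epowr x \<partial>quenched (n + m) e (axis i 1, 0) \<partial>S) \<le>
    2 epowr x * ((\<integral>\<^sup>+e. \<integral>\<^sup>+t. lin (\<lambda>_. 0) 1 t epowr x \<partial>quenched n e (axis i 1, 0) \<partial>S) +
    (?c * (\<integral>\<^sup>+e. \<integral>\<^sup>+t. pop (fst t) \<partial>quenched n e (axis i 1, 0) \<partial>S) +
     ?d * (\<integral>\<^sup>+e. \<integral>\<^sup>+t. lin (\<lambda>_. 1) 0 t epowr x \<partial>quenched n e (axis i 1, 0) \<partial>S)))" for i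
  proof -
    have "(\<integral>\<^sup>+e. \<integral>\<^sup>+t. lin w b t epowr x \<partial>quenched (n + m) e (axis i 1, 0) \<partial>S) =
      (\<integral>\<^sup>+e. \<integral>\<^sup>+s. \<integral>\<^sup>+e'. \<integral>\<^sup>+t. lin w b t epowr x \<partial>quenched m e' s \<partial>S \<partial>quenched n e (axis i 1, 0) \<partial>S)"
      by (rule annealed_markov) (simp, simp)
    also have "\<dots> \<le> (\<integral>\<^sup>+e. \<integral>\<^sup>+s. 2 epowr x * (ennreal (snd s) epowr x + (?c * pop (fst s) + ?d * pop (fst s) epowr x)) \<partial>quenched n e (axis i 1, 0) \<partial>S)"
    proof (intro nn_integral_mono)
      fix e s assume "e \<in> space S" "s \<in> space (quenched n e (axis i 1, 0))"
      then have s: "0 \<le> snd s" by simp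
      show "(\<integral>\<^sup>+e'. \<integral>\<^sup>+t. lin w b t epowr x \<partial>quenched m e' s \<partial>S) \<le>
          2 epowr x * (ennreal (snd s) epowr x + (?c * pop (fst s) + ?d * pop (fst s) epowr x))"
        using annealed_lin_moment_le[OF x s b, where w=w and n=m and z="fst s"] by simp
    qed
    also have "\<dots> = (\<integral>\<^sup>+e. 2 epowr x * ((\<integral>\<^sup>+s. ennreal (snd s) epowr x \<partial>quenched n e (axis i 1, 0)) +
        (?c * (\<integral>\<^sup>+s. pop (fst s) \<partial>quenched n e (axis i 1, 0)) + ?d * (\<integral>\<^sup>+s. pop (fst s) epowr x \<partial>quenched n e (axis i 1, 0)))) \<partial>S)"
      by (intro nn_integral_cong) (simp add: nn_integral_add nn_integral_cmult del: One_nat_def)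
    also have "\<dots> = 2 epowr x * ((\<integral>\<^sup>+e. \<integral>\<^sup>+s. ennreal (snd s) epowr x \<partial>quenched n e (axis i 1, 0) \<partial>S) +
        (?c * (\<integral>\<^sup>+e. \<integral>\<^sup>+s. pop (fst s) \<partial>quenched n e (axis i 1, 0) \<partial>S) + ?d * (\<integral>\<^sup>+e. \<integral>\<^sup>+s. pop (fst s) epowr x \<partial>quenched n e (axis i 1, 0) \<partial>S)))"
      by (simp add: nn_integral_add nn_integral_cmult del: One_nat_def)
    finally show ?thesis by (simp add: lin_pop lin_snd)
  qed
  then have "lin_moment x w b (n + m) \<le> (\<Sum>i\<in>UNIV. 2 epowr x * ((\<integral>\<^sup>+e. \<integral>\<^sup>+t. lin (\<lambda>_. 0) 1 t epowr x \<partial>quenched n e (axis i 1, 0) \<partial>S) +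
    (?c * (\<integral>\<^sup>+e. \<integral>\<^sup>+t. pop (fst t) \<partial>quenched n e (axis i 1, 0) \<partial>S) +
     ?d * (\<integral>\<^sup>+e. \<integral>\<^sup>+t. lin (\<lambda>_. 1) 0 t epowr x \<partial>quenched n e (axis i 1, 0) \<partial>S))))"
    unfolding lin_moment_def[of x w b "n + m"] by (rule sum_mono)
  then show ?thesis by (simp add: lin_moment_def sum.distrib sum_distrib_left[symmetric])
qed

lemma lin_moment_mono:
  assumes "\<And>t. lin w b t \<le> lin w' b' t" "0 < x"
  shows "lin_moment x w b n \<le> lin_moment x w' b' n"
  unfolding lin_moment_def using assms by (intro sum_mono nn_integral_mono epowr_mono) auto

lemma lin_moment_le_full:
  assumes "0 < x"
  shows "lin_moment x (\<lambda>_. 0) 1 n \<le> lin_moment x (\<lambda>_. 1) 1 n" "lin_moment x (\<lambda>_. 1) 0 n \<le> lin_moment x (\<lambda>_. 1) 1 n"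
  by (rule lin_moment_mono[OF _ assms], simp add: lin_def)+

lemma lin_moment_one:
  "lin_moment x w b 1 = (\<Sum>i\<in>UNIV. \<integral>\<^sup>+e. \<integral>\<^sup>+t. lin w b t epowr x \<partial>e 0 i \<partial>S)"
proof -
  have "(\<integral>\<^sup>+t. g t \<partial>quenched 1 e (axis i 1, 0)) = (\<integral>\<^sup>+t. g t \<partial>e 0 i)"
    if e: "e \<in> space env_seqs" and g: "g \<in> borel_measurable litter_space" for e g and i :: 'm
  proof -
    have "quenched 1 e = quenched (Suc 0) e" by (simp only: One_nat_def)
    then have "(\<integral>\<^sup>+t. g t \<partial>quenched 1 e (axis i 1, 0)) =
      (\<integral>\<^sup>+x. \<integral>\<^sup>+t. g ((0, snd x) + t) \<partial>quenched 0 (\<lambda>k. e (Suc k)) (fst x, 0) \<partial>e 0 i)"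
      by (simp only: nn_integral_quenched_Suc_axis[OF e g])
    also have "\<dots> = (\<integral>\<^sup>+x. g x \<partial>e 0 i)"
    proof (intro nn_integral_cong)
      fix x assume "x \<in> space (e 0 i)"
      then have x: "0 \<le> snd x" using env_seq_nth[OF e, of 0] by simp
      have "(\<integral>\<^sup>+t. g ((0, snd x) + t) \<partial>quenched 0 (\<lambda>k. e (Suc k)) (fst x, 0)) = g ((0, snd x) + (fst x, 0))"
        by (rule nn_integral_quenched_0) (use x borel_measurable_shift_litter[OF _ g] in auto)
      then show "(\<integral>\<^sup>+t. g ((0, snd x) + t) \<partial>quenched 0 (\<lambda>k. e (Suc k)) (fst x, 0)) = g x" by simp
    qed
    finally show ?thesis .
  qed
  then show ?thesis
    unfolding lin_moment_def by (intro sum.cong refl nn_integral_cong) simp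
qed

text \<open>Characteristics are nonnegative, so further generations can only increase the
  accumulated one.\<close>

lemma lin_moment_snd_mono:
  assumes x: "0 < x"
  shows "lin_moment x (\<lambda>_. 0) 1 n \<le> lin_moment x (\<lambda>_. 0) 1 (m + n)"
proof -
  have "lin_moment x (\<lambda>_. 0) 1 n \<le> lin_moment x (\<lambda>_. 0) 1 (n + m)"
    unfolding lin_moment_def lin_snd
  proof (intro sum_mono nn_integral_mono)
    fix i e assume "e \<in> space S"
    then have e: "e \<in> space env_seqs" "(\<lambda>k. e (k + n)) \<in> space env_seqs" by (auto intro: env_seq_shift)
    have g: "(\<lambda>t. ennreal (snd t) epowr x) \<in> borel_measurable litter_space" by measurable
    have "(\<integral>\<^sup>+t. ennreal (snd t) epowr x \<partial>quenched n e (axis i 1, 0)) \<le>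
      (\<integral>\<^sup>+s. \<integral>\<^sup>+t. ennreal (snd t) epowr x \<partial>quenched m (\<lambda>k. e (k + n)) s \<partial>quenched n e (axis i 1, 0))"
    proof (intro nn_integral_mono)
      fix s assume "s \<in> space (quenched n e (axis i 1, 0))"
      then have s: "0 \<le> snd s" using e by simp
      have "(\<integral>\<^sup>+t. ennreal (snd t) epowr x \<partial>quenched m (\<lambda>k. e (k + n)) (fst s, snd s)) =
        (\<integral>\<^sup>+t. ennreal (snd ((0, snd s) + t)) epowr x \<partial>quenched m (\<lambda>k. e (k + n)) (fst s, 0))"
        by (rule nn_integral_quenched_shift[OF e(2) g s])
      also have "\<dots> \<ge> (\<integral>\<^sup>+t. ennreal (snd s) epowr x \<partial>quenched m (\<lambda>k. e (k + n)) (fst s, 0))"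
        using x e by (intro nn_integral_mono epowr_mono ennreal_leI) auto
      also have "(\<integral>\<^sup>+t. ennreal (snd s) epowr x \<partial>quenched m (\<lambda>k. e (k + n)) (fst s, 0)) = ennreal (snd s) epowr x"
        using prob_space.emeasure_space_1[OF prob_space_quenched[OF e(2)], of "(fst s, 0)" m] by simp
      finally show "ennreal (snd s) epowr x \<le> (\<integral>\<^sup>+t. ennreal (snd t) epowr x \<partial>quenched m (\<lambda>k. e (k + n)) s)" by simp
    qed
    also have "\<dots> = (\<integral>\<^sup>+t. ennreal (snd t) epowr x \<partial>quenched (n + m) e (axis i 1, 0))"
      by (rule nn_integral_quenched_add[OF e(1) g, symmetric]) simp
    finally show "(\<integral>\<^sup>+t. ennreal (snd t) epowr x \<partial>quenched n e (axis i 1, 0)) \<le>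
       (\<integral>\<^sup>+t. ennreal (snd t) epowr x \<partial>quenched (n + m) e (axis i 1, 0))" .
  qed
  then show ?thesis by (simp add: add.commute)
qed

end

context moment_env
begin

lemma Xi_sum_moment:
  assumes y: "0 < y" "y < \<kappa>"
  shows "(\<integral>\<^sup>+e. (\<Sum>i\<in>UNIV. Xi coord e $ i) epowr y \<partial>S) < \<infinity>"
proof -
  have "(\<integral>\<^sup>+e. (\<Sum>i\<in>UNIV. Xi coord e $ i) epowr y \<partial>S) \<le>
      (\<integral>\<^sup>+e. of_nat CARD('m) epowr y * (\<Sum>i\<in>UNIV. Xi coord e $ i epowr y) \<partial>S)"
    using y by (intro nn_integral_mono epowr_sum_le) auto
  also have "\<dots> = of_nat CARD('m) epowr y * (\<Sum>i\<in>UNIV. \<integral>\<^sup>+e. Xi coord e $ i epowr y \<partial>S)"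
    by (simp add: nn_integral_cmult nn_integral_sum)
  also have "\<dots> < \<infinity>" using Xi_moment[OF y] by (simp add: ennreal_mult_less_top)
  finally show ?thesis .
qed

lemma mean_moment_finite:
  assumes y: "0 < y" "y < \<kappa>" and "\<And>i. w i \<le> 1" "b \<le> 1"
  shows "mean_moment y w b n < \<infinity>"
proof -
  have "mean_moment y w b n \<le> (\<integral>\<^sup>+e. 2 epowr y * (matnorm (right_prod coord n e) epowr y + (\<Sum>i\<in>UNIV. Xi coord e $ i) epowr y) \<partial>S)"
    unfolding mean_moment_def
  proof (intro nn_integral_mono)
    fix e assume "e \<in> space S"
    then have e: "e \<in> space env_seqs" by simp
    have "(\<Sum>i\<in>UNIV. \<integral>\<^sup>+t. lin w b t \<partial>quenched n e (axis i 1, 0)) \<le>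
        (\<Sum>i\<in>UNIV. (\<Sum>j\<in>UNIV. right_prod coord n e $ i $ j * 1) + 1 * Xi coord e $ i)"
      unfolding quenched_mean_lin[OF e]
      by (intro sum_mono add_mono mult_mono assms partial_Xi_le order_refl) auto
    also have "\<dots> = matnorm (right_prod coord n e) + (\<Sum>i\<in>UNIV. Xi coord e $ i)"
      by (simp add: matnorm_def sum.distrib)
    finally have "(\<Sum>i\<in>UNIV. \<integral>\<^sup>+t. lin w b t \<partial>quenched n e (axis i 1, 0)) epowr y \<le>
        (matnorm (right_prod coord n e) + (\<Sum>i\<in>UNIV. Xi coord e $ i)) epowr y"
      using y by (intro epowr_mono) auto
    also have "\<dots> \<le> 2 epowr y * (matnorm (right_prod coord n e) epowr y + (\<Sum>i\<in>UNIV. Xi coord e $ i) epowr y)"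
      using y by (intro epowr_add_le)
    finally show "(\<Sum>i\<in>UNIV. \<integral>\<^sup>+t. lin w b t \<partial>quenched n e (axis i 1, 0)) epowr y \<le>
        2 epowr y * (matnorm (right_prod coord n e) epowr y + (\<Sum>i\<in>UNIV. Xi coord e $ i) epowr y)" .
  qed
  also have "\<dots> = 2 epowr y * (growth y n + (\<integral>\<^sup>+e. (\<Sum>i\<in>UNIV. Xi coord e $ i) epowr y \<partial>S))"
    by (simp add: growth_def nn_integral_cmult nn_integral_add)
  also have "\<dots> < \<infinity>"
    using growth_finite[OF y] Xi_sum_moment[OF y] by (simp add: ennreal_mult_less_top)
  finally show ?thesis .
qed

lemma mean_moment_snd_le: "0 < y \<Longrightarrow> mean_moment y (\<lambda>_. 0) 1 n \<le> (\<integral>\<^sup>+e. (\<Sum>i\<in>UNIV. Xi coord e $ i) epowr y \<partial>S)"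
  unfolding mean_moment_def
  by (intro nn_integral_mono epowr_mono sum_mono) (simp_all add: quenched_mean_lin partial_Xi_le)

lemma annealed_pop_le: "(\<Sum>i\<in>UNIV. \<integral>\<^sup>+e. \<integral>\<^sup>+t. pop (fst t) \<partial>quenched n e (axis i 1, 0) \<partial>S) = growth 1 n"
proof -
  have "(\<integral>\<^sup>+t. pop (fst t) \<partial>quenched n e (axis i 1, 0)) = (\<Sum>j\<in>UNIV. right_prod coord n e $ i $ j)"
    if "e \<in> space S" for e i
    using quenched_mean_lin[where w="\<lambda>_. 1" and e=e and b=0 and n=n and i=i] that by (simp add: lin_pop)
  then have "(\<Sum>i\<in>UNIV. \<integral>\<^sup>+e. \<integral>\<^sup>+t. pop (fst t) \<partial>quenched n e (axis i 1, 0) \<partial>S) =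
      (\<Sum>i\<in>UNIV. \<integral>\<^sup>+e. (\<Sum>j\<in>UNIV. right_prod coord n e $ i $ j) \<partial>S)"
    by (intro sum.cong refl nn_integral_cong)
  also have "\<dots> = growth 1 n"
    unfolding growth_def matnorm_def by (simp add: nn_integral_sum)
  finally show ?thesis .
qed

text \<open>The bound from the recursion is not uniform in \<open>n\<close>, but finiteness for each
  \<open>n\<close> is what permits the subtraction in \<open>lin_moment_snd_bounded\<close>.\<close>

lemma lin_moment_finite:
  assumes x: "1 < x" "x < \<kappa>"
    and litter: "\<And>i. (\<integral>\<^sup>+e. \<integral>\<^sup>+t. lin (\<lambda>_. 1) 1 t epowr x \<partial>e 0 i \<partial>S) < \<infinity>"
  shows "lin_moment x (\<lambda>_. 1) 1 n < \<infinity>"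
proof (induction n)
  case 0
  have "(\<integral>\<^sup>+t. lin (\<lambda>_. 1) 1 t epowr x \<partial>quenched 0 e (axis i 1, 0)) = 1" for e and i :: 'm
    by (subst nn_integral_quenched_0)
      (simp_all add: lin_def axis_def if_distrib[of of_nat] cong: if_cong)
  then show ?case unfolding lin_moment_def by (simp add: ennreal_of_nat_eq_real_of_nat del: quenched.simps)
next
  case (Suc n)
  have 1: "lin_moment x (\<lambda>_. 1) 1 1 < top" unfolding lin_moment_one using litter by simp
  have "lin_moment x (\<lambda>_. 1) 1 (1 + n) \<le> 2 epowr x * (lin_moment x (\<lambda>_. 0) 1 1 +
    (rosenthal_const x * lin_moment x (\<lambda>_. 1) 1 n * growth 1 1 +
     rosenthal_const x epowr x * mean_moment x (\<lambda>_. 1) 1 n * lin_moment x (\<lambda>_. 1) 0 1))"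
    unfolding annealed_pop_le[symmetric] by (rule lin_moment_add_le[OF x(1) order_refl])
  also have "\<dots> < \<infinity>"
  proof -
    have "lin_moment x (\<lambda>_. 0) 1 1 < top" "lin_moment x (\<lambda>_. 1) 0 1 < top"
      using x 1 lin_moment_le_full[of x 1] by (auto intro: le_less_trans)
    moreover have "growth 1 1 < top" using growth_finite[of 1 1] x by simp
    moreover have "mean_moment x (\<lambda>_. 1) 1 n < top" using mean_moment_finite[of x "\<lambda>_. 1" 1 n] x by simp
    ultimately show ?thesis using Suc by (simp add: ennreal_mult_less_top)
  qed
  finally show ?case unfolding Suc_eq_plus1_left .
qed

text \<open>With \<open>N\<close> so large that the recursion has contraction factor at most 1/2,
  monotonicity gives h n \<le> h (N + n) \<le> D + h n / 2, where D is free of n because the moment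
  of \<Xi> bounds every \<open>mean_moment\<close>.\<close>

lemma lin_moment_snd_bounded:
  assumes x: "1 < x" "x < \<kappa>"
    and litter: "\<And>i. (\<integral>\<^sup>+e. \<integral>\<^sup>+t. lin (\<lambda>_. 1) 1 t epowr x \<partial>e 0 i \<partial>S) < \<infinity>"
  shows "\<exists>D<top. \<forall>n. lin_moment x (\<lambda>_. 0) 1 n \<le> D"
proof -
  let ?h = "lin_moment x (\<lambda>_. 0) 1"
  have fin: "?h n < top" "lin_moment x (\<lambda>_. 1) 0 n < top" for n
    using x lin_moment_finite[OF x litter, of n]
    using lin_moment_le_full[of x n] by (auto intro: le_less_trans)
  let ?c = "2 * (2 epowr x * rosenthal_const x)"
  have "(\<lambda>n. ?c * growth 1 n) \<longlonglongrightarrow> ?c * 0"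
    using x by (intro ennreal_tendsto_cmult growth_tendsto_0) (auto simp: ennreal_mult_less_top)
  then have "eventually (\<lambda>n. ?c * growth 1 n < 1) sequentially"
    using order_tendstoD(2)[of "\<lambda>n. ?c * growth 1 n" 0 sequentially 1] by simp
  then obtain N where N: "?c * growth 1 N \<le> 1" by (auto simp: eventually_sequentially intro: less_imp_le)
  let ?K = "\<integral>\<^sup>+e. (\<Sum>i\<in>UNIV. Xi coord e $ i) epowr x \<partial>S"
  define D where "D = 2 epowr x * (?h N + rosenthal_const x epowr x * ?K * lin_moment x (\<lambda>_. 1) 0 N)"
  have D: "D < top"
    unfolding D_def using fin Xi_sum_moment[of x] x by (simp add: ennreal_mult_less_top)
  have "?h n \<le> 2 * D" for n
  proof -
    have "?h n \<le> ?h (N + n)" using x by (intro lin_moment_snd_mono) auto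
    also have "\<dots> \<le> 2 epowr x * (?h N + (rosenthal_const x * ?h n * growth 1 N +
       rosenthal_const x epowr x * mean_moment x (\<lambda>_. 0) 1 n * lin_moment x (\<lambda>_. 1) 0 N))"
      unfolding annealed_pop_le[symmetric] by (rule lin_moment_add_le[OF x(1) order_refl])
    also have "\<dots> \<le> 2 epowr x * (?h N + (rosenthal_const x * ?h n * growth 1 N +
       rosenthal_const x epowr x * ?K * lin_moment x (\<lambda>_. 1) 0 N))"
      using x by (intro mult_left_mono add_left_mono mult_right_mono mean_moment_snd_le) auto
    also have "\<dots> = D + 2 epowr x * rosenthal_const x * growth 1 N * ?h n"
      unfolding D_def by (simp add: distrib_left mult_ac add_ac)
    finally have "2 * ?h n \<le> 2 * (D + 2 epowr x * rosenthal_const x * growth 1 N * ?h n)"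
      by (rule mult_left_mono) simp
    also have "\<dots> = 2 * D + (?c * growth 1 N) * ?h n" by (simp add: distrib_left mult.assoc)
    also have "\<dots> \<le> 2 * D + 1 * ?h n" by (intro add_left_mono mult_right_mono N) simp
    finally have "?h n + ?h n \<le> ?h n + 2 * D" by (simp add: mult_2 add.commute)
    then show ?thesis using fin by (metis ennreal_add_left_cancel_le infinity_ennreal_def less_irrefl)
  qed
  then show ?thesis using D by (intro exI[of _ "2 * D"]) (simp add: ennreal_mult_less_top)
qed

lemma annealed_moment_bounded_gt1:
  assumes x: "1 < x" "x < \<kappa>" and \<phi>: "0 \<le> \<phi>"
    and litter: "\<And>i. (\<integral>\<^sup>+e. \<integral>\<^sup>+t. lin (\<lambda>_. 1) 1 t epowr x \<partial>e 0 i \<partial>S) < \<infinity>"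
  shows "\<exists>B<top. \<forall>n. (\<integral>\<^sup>+e. \<integral>\<^sup>+t. ennreal (snd t) epowr x \<partial>quenched n e (z, \<phi>) \<partial>S) \<le> B"
proof -
  obtain D where D: "D < top" "\<And>n. lin_moment x (\<lambda>_. 0) 1 n \<le> D"
    using lin_moment_snd_bounded[OF x litter] by blast
  let ?K = "\<integral>\<^sup>+e. (\<Sum>i\<in>UNIV. Xi coord e $ i) epowr x \<partial>S"
  let ?B = "2 epowr x * (ennreal \<phi> epowr x + (rosenthal_const x * D * pop z + rosenthal_const x epowr x * ?K * pop z epowr x))"
  have "(\<integral>\<^sup>+e. \<integral>\<^sup>+t. ennreal (snd t) epowr x \<partial>quenched n e (z, \<phi>) \<partial>S) \<le> ?B" for n
  proof -
    have "(\<integral>\<^sup>+e. \<integral>\<^sup>+t. ennreal (snd t) epowr x \<partial>quenched n e (z, \<phi>) \<partial>S) \<le> 2 epowr x * (ennreal \<phi> epowr x +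
        (rosenthal_const x * lin_moment x (\<lambda>_. 0) 1 n * pop z + rosenthal_const x epowr x * mean_moment x (\<lambda>_. 0) 1 n * pop z epowr x))"
      using annealed_lin_moment_le[OF x(1) \<phi> order_refl, where w="\<lambda>_. 0" and n=n and z=z] by (simp add: lin_snd)
    also have "\<dots> \<le> ?B"
      using x by (intro mult_left_mono add_left_mono add_mono mult_right_mono D(2) mean_moment_snd_le) auto
    finally show ?thesis .
  qed
  moreover have "?B < top"
    using D(1) Xi_sum_moment[of x] x epowr_less_top_iff[of x "pop z"]
    by (simp add: ennreal_mult_less_top epowr_ennreal \<phi>)
  ultimately show ?thesis by blast
qed

lemma annealed_moment_bounded_le1:
  assumes x: "0 < x" "x \<le> 1" "x < \<kappa>" and \<phi>: "0 \<le> \<phi>"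
  shows "\<exists>B<top. \<forall>n. (\<integral>\<^sup>+e. \<integral>\<^sup>+t. ennreal (snd t) epowr x \<partial>quenched n e (z, \<phi>) \<partial>S) \<le> B"
proof -
  let ?K = "\<integral>\<^sup>+e. (\<Sum>i\<in>UNIV. Xi coord e $ i) epowr x \<partial>S"
  let ?B = "ennreal \<phi> epowr x + pop z epowr x * ?K"
  have "(\<integral>\<^sup>+e. \<integral>\<^sup>+t. ennreal (snd t) epowr x \<partial>quenched n e (z, \<phi>) \<partial>S) \<le> ?B" for n
  proof -
    have "(\<integral>\<^sup>+e. \<integral>\<^sup>+t. ennreal (snd t) epowr x \<partial>quenched n e (z, \<phi>) \<partial>S) \<le>
      (\<integral>\<^sup>+e. ennreal \<phi> epowr x + pop z epowr x * (\<Sum>i\<in>UNIV. Xi coord e $ i) epowr x \<partial>S)"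
    proof (intro nn_integral_mono)
      fix e assume "e \<in> space S"
      then have e: "e \<in> space env_seqs" by simp
      interpret Q: prob_space "quenched n e (z, \<phi>)" by (rule prob_space_quenched[OF e]) (use \<phi> in simp)
      have "(\<integral>\<^sup>+t. ennreal (snd t) epowr x \<partial>quenched n e (z, \<phi>)) \<le> (\<integral>\<^sup>+t. ennreal (snd t) \<partial>quenched n e (z, \<phi>)) epowr x"
        using x e \<phi> by (intro Q.jensen_epowr_le) auto
      also have "\<dots> \<le> (ennreal \<phi> + pop z * (\<Sum>i\<in>UNIV. Xi coord e $ i)) epowr x"
        unfolding quenched_mean_snd[OF e \<phi>] using x
        by (intro epowr_mono add_left_mono order_trans[OF weighted_sum_le_pop] mult_left_mono sum_mono partial_Xi_le) auto
      also have "\<dots> \<le> ennreal \<phi> epowr x + (pop z * (\<Sum>i\<in>UNIV. Xi coord e $ i)) epowr x"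
        using x by (intro epowr_add_le_one)
      finally show "(\<integral>\<^sup>+t. ennreal (snd t) epowr x \<partial>quenched n e (z, \<phi>)) \<le>
          ennreal \<phi> epowr x + pop z epowr x * (\<Sum>i\<in>UNIV. Xi coord e $ i) epowr x"
        using x by (simp add: epowr_mult)
    qed
    also have "\<dots> = ?B" by (simp add: nn_integral_add nn_integral_cmult emeasure_space_1)
    finally show ?thesis .
  qed
  moreover have "?B < top"
    using Xi_sum_moment[of x] x epowr_less_top_iff[of x "pop z"]
    by (simp add: ennreal_mult_less_top epowr_ennreal \<phi>)
  ultimately show ?thesis by blast
qed

lemma annealed_moment_ge:
  assumes x: "1 \<le> x" and \<phi>: "0 \<le> \<phi>" and z: "z $ i \<noteq> 0"
  shows "(\<integral>\<^sup>+e. Xi coord e $ i epowr x \<partial>S) \<le> (SUP n. \<integral>\<^sup>+e. \<integral>\<^sup>+t. ennreal (snd t) epowr x \<partial>quenched n e (z, \<phi>) \<partial>S)"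
proof -
  have "(\<integral>\<^sup>+e. Xi coord e $ i epowr x \<partial>S) = (\<integral>\<^sup>+e. (SUP n. partial_Xi n e i epowr x) \<partial>S)"
    using x by (simp add: Xi_eq_SUP epowr_SUP)
  also have "\<dots> = (SUP n. \<integral>\<^sup>+e. partial_Xi n e i epowr x \<partial>S)"
    using x by (intro nn_integral_monotone_convergence_SUP) (auto simp: incseq_def le_fun_def intro!: epowr_mono partial_Xi_mono)
  also have "\<dots> \<le> (SUP n. \<integral>\<^sup>+e. \<integral>\<^sup>+t. ennreal (snd t) epowr x \<partial>quenched n e (z, \<phi>) \<partial>S)"
  proof (intro SUP_mono bexI[of _ n for n] nn_integral_mono)
    fix n e assume "e \<in> space S"
    then have e: "e \<in> space env_seqs" by simp
    interpret Q: prob_space "quenched n e (z, \<phi>)" by (rule prob_space_quenched[OF e]) (use \<phi> in simp)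
    have "partial_Xi n e i \<le> of_nat (z $ i) * partial_Xi n e i"
      using z mult_right_mono[of 1 "of_nat (z $ i)" "partial_Xi n e i"] by (cases "z $ i") auto
    also have "\<dots> \<le> (\<Sum>i\<in>UNIV. of_nat (z $ i) * partial_Xi n e i)" by (rule member_le_sum) auto
    also have "\<dots> \<le> (\<integral>\<^sup>+t. ennreal (snd t) \<partial>quenched n e (z, \<phi>))"
      unfolding quenched_mean_snd[OF e \<phi>] by simp
    finally have "partial_Xi n e i epowr x \<le> (\<integral>\<^sup>+t. ennreal (snd t) \<partial>quenched n e (z, \<phi>)) epowr x"
      using x by (intro epowr_mono) auto
    also have "\<dots> \<le> (\<integral>\<^sup>+t. ennreal (snd t) epowr x \<partial>quenched n e (z, \<phi>))"
      using x e \<phi> by (intro Q.jensen_epowr_ge) auto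
    finally show "partial_Xi n e i epowr x \<le> (\<integral>\<^sup>+t. ennreal (snd t) epowr x \<partial>quenched n e (z, \<phi>))" .
  qed simp
  finally show ?thesis .
qed

end

section \<open>Variances\<close>

lemma (in prob_space) second_moment_evariance:
  assumes [measurable]: "g \<in> borel_measurable M" and g: "\<And>x. x \<in> space M \<Longrightarrow> 0 \<le> g x"
  shows "(\<integral>\<^sup>+x. ennreal (g x) ^ 2 \<partial>M) \<le> (\<integral>\<^sup>+x. ennreal (g x) \<partial>M) ^ 2 + evariance M g"
proof (cases "evariance M g = \<infinity>")
  case False
  then have int: "integrable M g" by (auto simp: evariance_def split: if_splits)
  define r where "r = expectation g"
  have r: "0 \<le> r" unfolding r_def by (rule Bochner_Integration.integral_nonneg) (use g in auto)
  have v: "evariance M g = (\<integral>\<^sup>+x. ennreal ((g x - r)\<^sup>2) \<partial>M)" using int by (simp add: evariance_def r_def)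
  then have int2: "integrable M (\<lambda>x. (g x - r)\<^sup>2)"
    using False by (intro integrableI_nonneg) (auto simp: less_top)
  have eq: "(g x)\<^sup>2 = (g x - r)\<^sup>2 + (2 * r * g x - r\<^sup>2)" for x by (simp add: power2_eq_square algebra_simps)
  have int3: "integrable M (\<lambda>x. (g x)\<^sup>2)"
    unfolding eq using int int2 by (intro Bochner_Integration.integrable_add Bochner_Integration.integrable_diff) auto
  have "expectation (\<lambda>x. (g x)\<^sup>2) = expectation (\<lambda>x. (g x - r)\<^sup>2) + r\<^sup>2"
    unfolding eq using int int2 by (simp add: prob_space r_def[symmetric] power2_eq_square)
  then have "ennreal (expectation (\<lambda>x. (g x)\<^sup>2)) = ennreal (expectation (\<lambda>x. (g x - r)\<^sup>2)) + ennreal r ^ 2"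
    using r by (simp add: ennreal_plus ennreal_power integral_nonneg_AE)
  moreover have "(\<integral>\<^sup>+x. ennreal (g x) ^ 2 \<partial>M) = ennreal (expectation (\<lambda>x. (g x)\<^sup>2))"
    using int3 by (subst nn_integral_eq_integral[symmetric]) (auto intro!: nn_integral_cong simp: ennreal_power g)
  moreover have "(\<integral>\<^sup>+x. ennreal (g x) \<partial>M) = ennreal r"
    unfolding r_def using int g by (intro nn_integral_eq_integral) auto
  moreover have "evariance M g = ennreal (expectation (\<lambda>x. (g x - r)\<^sup>2))"
    unfolding v using int2 by (intro nn_integral_eq_integral) auto
  ultimately show ?thesis by (simp add: add.commute)
qed simp

text \<open>The coordinates of one litter may be dependent; Cauchy-Schwarz replaces additivity of
  variances at the price of the factor \<open>card K\<close>.\<close>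

lemma (in prob_space) evariance_sum_le:
  assumes K: "finite K" and g [measurable]: "\<And>k. k \<in> K \<Longrightarrow> g k \<in> borel_measurable M" and a: "\<And>k. k \<in> K \<Longrightarrow> (0::real) \<le> a k"
  shows "evariance M (\<lambda>x. \<Sum>k\<in>K. a k * g k x) \<le> of_nat (card K) * (\<Sum>k\<in>K. ennreal (a k) ^ 2 * evariance M (g k))"
proof (cases "\<exists>k\<in>K. a k > 0 \<and> evariance M (g k) = \<infinity>")
  case True
  then obtain k where k: "k \<in> K" "a k > 0" "evariance M (g k) = \<infinity>" by auto
  have "top = ennreal (a k) ^ 2 * evariance M (g k)" using k by (simp add: ennreal_mult_top)
  also have "\<dots> \<le> (\<Sum>k\<in>K. ennreal (a k) ^ 2 * evariance M (g k))" using k K by (intro member_le_sum) auto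
  finally have "(\<Sum>k\<in>K. ennreal (a k) ^ 2 * evariance M (g k)) = top" by (simp add: top_unique)
  moreover have "card K \<noteq> 0" using K k by auto
  ultimately show ?thesis by (simp add: ennreal_mult_top)
next
  case False
  have int: "integrable M (\<lambda>x. a k * g k x)" if "k \<in> K" for k
  proof (cases "a k = 0")
    case False
    then have "integrable M (g k)"
      using that a[OF that] \<open>\<not> (\<exists>k\<in>K. _ k)\<close> by (auto simp: evariance_def less_le split: if_splits)
    then show ?thesis by simp
  qed simp
  have int_sum: "integrable M (\<lambda>x. \<Sum>k\<in>K. a k * g k x)" using int by (intro Bochner_Integration.integrable_sum)
  have E: "expectation (\<lambda>x. \<Sum>k\<in>K. a k * g k x) = (\<Sum>k\<in>K. a k * expectation (g k))"
    using int by (subst Bochner_Integration.integral_sum) auto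
  have "evariance M (\<lambda>x. \<Sum>k\<in>K. a k * g k x) = (\<integral>\<^sup>+x. ennreal ((\<Sum>k\<in>K. a k * (g k x - expectation (g k)))\<^sup>2) \<partial>M)"
    unfolding evariance_def using int_sum by (simp add: E sum_subtractf right_diff_distrib)
  also have "\<dots> \<le> (\<integral>\<^sup>+x. of_nat (card K) * (\<Sum>k\<in>K. ennreal (a k) ^ 2 * ennreal ((g k x - expectation (g k))\<^sup>2)) \<partial>M)"
  proof (intro nn_integral_mono)
    fix x
    have "(\<Sum>k\<in>K. 1 * (a k * (g k x - expectation (g k))))\<^sup>2 \<le> (\<Sum>k\<in>K. 1\<^sup>2) * (\<Sum>k\<in>K. (a k * (g k x - expectation (g k)))\<^sup>2)"
      by (rule Cauchy_Schwarz_ineq_sum)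
    then have "(\<Sum>k\<in>K. a k * (g k x - expectation (g k)))\<^sup>2 \<le> real (card K) * (\<Sum>k\<in>K. (a k)\<^sup>2 * (g k x - expectation (g k))\<^sup>2)"
      by (simp add: power_mult_distrib)
    then have "ennreal ((\<Sum>k\<in>K. a k * (g k x - expectation (g k)))\<^sup>2) \<le> ennreal (real (card K) * (\<Sum>k\<in>K. (a k)\<^sup>2 * (g k x - expectation (g k))\<^sup>2))"
      by (rule ennreal_leI)
    also have "\<dots> = of_nat (card K) * (\<Sum>k\<in>K. ennreal (a k) ^ 2 * ennreal ((g k x - expectation (g k))\<^sup>2))"
      using a by (simp add: ennreal_mult sum_nonneg sum_ennreal[symmetric] ennreal_power ennreal_of_nat_eq_real_of_nat)
    finally show "ennreal ((\<Sum>k\<in>K. a k * (g k x - expectation (g k)))\<^sup>2) \<le>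
      of_nat (card K) * (\<Sum>k\<in>K. ennreal (a k) ^ 2 * ennreal ((g k x - expectation (g k))\<^sup>2))" .
  qed
  also have "\<dots> = of_nat (card K) * (\<Sum>k\<in>K. ennreal (a k) ^ 2 * (\<integral>\<^sup>+x. ennreal ((g k x - expectation (g k))\<^sup>2) \<partial>M))"
    by (simp add: nn_integral_cmult nn_integral_sum)
  also have "\<dots> \<le> of_nat (card K) * (\<Sum>k\<in>K. ennreal (a k) ^ 2 * evariance M (g k))"
    by (intro mult_left_mono sum_mono) (auto simp: evariance_def)
  finally show ?thesis .
qed

section \<open>Conditional variance of the characteristic\<close>

definition offspring_var :: "('m::finite \<Rightarrow> 'm litter measure) \<Rightarrow> 'm \<Rightarrow> ennreal" where
  "offspring_var \<mu> i = (\<Sum>j\<in>UNIV. evariance (\<mu> i) (\<lambda>x. real (fst x $ j)))"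

definition char_var :: "('m::finite \<Rightarrow> 'm litter measure) \<Rightarrow> 'm \<Rightarrow> ennreal" where
  "char_var \<mu> i = evariance (\<mu> i) snd"

lemma lin_second_moment:
  assumes e: "env (\<mu> :: 'm::finite \<Rightarrow> 'm litter measure)" and m: "\<And>j. m j < top"
  shows "(\<integral>\<^sup>+x. lin m 1 x ^ 2 \<partial>\<mu> i) \<le> (\<integral>\<^sup>+x. lin m 1 x \<partial>\<mu> i) ^ 2 +
    of_nat (CARD('m) + 1) * (offspring_var \<mu> i * (\<Sum>j\<in>UNIV. m j) ^ 2 + char_var \<mu> i)"
proof -
  interpret P: prob_space "\<mu> i" using e by (rule prob_env)
  \<comment> \<open>\<open>None\<close> stands for the characteristic and \<open>Some j\<close> for
    the offspring of type \<open>j\<close>, which makes \<open>lin m 1\<close> a single sum of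
    CARD('m) + 1 terms.\<close>
  define a where "a = case_option 1 (\<lambda>j. enn2real (m j))"
  define g where "g = case_option snd (\<lambda>j x. real (fst (x :: 'm litter) $ j))"
  have a0: "0 \<le> a k" for k by (auto simp: a_def split: option.split)
  have gm: "g k \<in> borel_measurable (\<mu> i)" for k :: "'m option"
    using e measurable_compose[OF measurable_fst_nth] by (auto simp: g_def split: option.split)
  have U: "(\<Sum>k\<in>UNIV. f k) = f None + (\<Sum>j\<in>UNIV. f (Some j))" for f :: "'m option \<Rightarrow> 'c::comm_monoid_add"
    by (simp add: UNIV_option_conv sum.reindex)
  have lin: "lin m 1 x = ennreal (\<Sum>k\<in>UNIV. a k * g k x)" and pos: "0 \<le> (\<Sum>k\<in>UNIV. a k * g k x)"
    if x: "x \<in> space (\<mu> i)" for x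
  proof -
    have x: "0 \<le> snd x" using x e by simp
    have "of_nat (fst x $ j) * m j = ennreal (enn2real (m j) * real (fst x $ j))" for j
      using m[of j] by (simp add: ennreal_mult ennreal_of_nat_eq_real_of_nat mult.commute)
    then have "lin m 1 x = (\<Sum>j\<in>UNIV. ennreal (enn2real (m j) * real (fst x $ j))) + ennreal (snd x)"
      by (simp add: lin_def)
    also have "\<dots> = ennreal ((\<Sum>j\<in>UNIV. enn2real (m j) * real (fst x $ j)) + snd x)"
      using x by (simp add: sum_ennreal ennreal_plus[symmetric] sum_nonneg del: ennreal_plus)
    finally show "lin m 1 x = ennreal (\<Sum>k\<in>UNIV. a k * g k x)"
      by (simp add: U a_def g_def add.commute)
    show "0 \<le> (\<Sum>k\<in>UNIV. a k * g k x)"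
      using x by (simp add: U a_def g_def sum_nonneg)
  qed
  have "(\<integral>\<^sup>+x. lin m 1 x ^ 2 \<partial>\<mu> i) = (\<integral>\<^sup>+x. ennreal (\<Sum>k\<in>UNIV. a k * g k x) ^ 2 \<partial>\<mu> i)"
    by (intro nn_integral_cong) (simp only: lin)
  also have "\<dots> \<le> (\<integral>\<^sup>+x. ennreal (\<Sum>k\<in>UNIV. a k * g k x) \<partial>\<mu> i) ^ 2 + evariance (\<mu> i) (\<lambda>x. \<Sum>k\<in>UNIV. a k * g k x)"
    using gm pos by (intro P.second_moment_evariance borel_measurable_sum borel_measurable_times) auto
  also have "(\<integral>\<^sup>+x. ennreal (\<Sum>k\<in>UNIV. a k * g k x) \<partial>\<mu> i) = (\<integral>\<^sup>+x. lin m 1 x \<partial>\<mu> i)"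
    by (intro nn_integral_cong) (simp only: lin)
  also have "evariance (\<mu> i) (\<lambda>x. \<Sum>k\<in>UNIV. a k * g k x) \<le>
      of_nat (card (UNIV :: 'm option set)) * (\<Sum>k\<in>UNIV. ennreal (a k) ^ 2 * evariance (\<mu> i) (g k))"
    using gm a0 by (intro P.evariance_sum_le) auto
  also have "card (UNIV :: 'm option set) = CARD('m) + 1"
    by (simp add: UNIV_option_conv card_image)
  also have "(\<Sum>k\<in>UNIV. ennreal (a k) ^ 2 * evariance (\<mu> i) (g k)) =
      char_var \<mu> i + (\<Sum>j\<in>UNIV. m j ^ 2 * evariance (\<mu> i) (\<lambda>x. real (fst x $ j)))"
    using m by (simp add: U a_def g_def char_var_def)
  also have "(\<Sum>j\<in>UNIV. m j ^ 2 * evariance (\<mu> i) (\<lambda>x. real (fst x $ j))) \<le> (\<Sum>j\<in>UNIV. (\<Sum>j\<in>UNIV. m j) ^ 2 * evariance (\<mu> i) (\<lambda>x. real (fst x $ j)))"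
    by (intro sum_mono mult_right_mono power_mono member_le_sum) auto
  also have "\<dots> = offspring_var \<mu> i * (\<Sum>j\<in>UNIV. m j) ^ 2"
    by (simp add: offspring_var_def sum_distrib_left[symmetric] mult.commute)
  finally show ?thesis by (simp add: add.commute add_left_mono mult_left_mono)
qed

text \<open>Bounds the variance created by the litter of an ancestor of type \<open>i\<close> when
  each child is credited with the expected characteristic of its descendants, itself at most \<Xi>
  of the shifted environment.\<close>

definition noise :: "(nat \<Rightarrow> 'm::finite \<Rightarrow> 'm litter measure) \<Rightarrow> 'm \<Rightarrow> ennreal" where
  "noise e i = of_nat (CARD('m) + 1) * (offspring_var (e 0) i * (\<Sum>j\<in>UNIV. Xi coord (\<lambda>k. e (k + 1)) $ j) ^ 2 + char_var (e 0) i)"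

text \<open>Law of total variance, iterated: in each generation \<open>k\<close> the expected number
  of individuals of type \<open>j\<close>, times the variance that one of them creates.\<close>

definition var_bound :: "nat \<Rightarrow> (nat \<Rightarrow> 'm::finite \<Rightarrow> 'm litter measure) \<Rightarrow> 'm \<Rightarrow> ennreal" where
  "var_bound n e i = (\<Sum>k<n. \<Sum>j\<in>UNIV. right_prod coord k e $ i $ j * noise (\<lambda>l. e (l + k)) j)"

lemma var_bound_Suc:
  "var_bound (Suc n) e i = noise e i + (\<Sum>j\<in>UNIV. mean_matrix coord 0 e $ i $ j * var_bound n (\<lambda>k. e (Suc k)) j)"
proof -
  have "var_bound (Suc n) e i = (\<Sum>j\<in>UNIV. right_prod coord 0 e $ i $ j * noise e j) +
      (\<Sum>k<n. \<Sum>j\<in>UNIV. right_prod coord (Suc k) e $ i $ j * noise (\<lambda>l. e (Suc (l + k))) j)"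
    unfolding var_bound_def sum.lessThan_Suc_shift by simp
  also have "(\<Sum>j\<in>UNIV. right_prod coord 0 e $ i $ j * noise e j) = noise e i"
    by (simp add: mat_def if_distrib[of "\<lambda>x. x * _"] cong: if_cong)
  also have "(\<Sum>k<n. \<Sum>j\<in>UNIV. right_prod coord (Suc k) e $ i $ j * noise (\<lambda>l. e (Suc (l + k))) j) =
      (\<Sum>k<n. \<Sum>j\<in>UNIV. mean_matrix coord 0 e $ i $ j * (\<Sum>l\<in>UNIV. right_prod coord k (\<lambda>k. e (Suc k)) $ j $ l * noise (\<lambda>l. e (Suc (l + k))) l))"
    unfolding right_prod_Suc_left matrix_matrix_mult_def
    by (simp add: sum_distrib_left sum_distrib_right mult.assoc) (intro sum.cong refl sum.swap)
  also have "\<dots> = (\<Sum>j\<in>UNIV. mean_matrix coord 0 e $ i $ j * var_bound n (\<lambda>k. e (Suc k)) j)"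
    by (subst sum.swap) (simp add: var_bound_def sum_distrib_left)
  finally show ?thesis .
qed

text \<open>All shifts are included because the children in generation \<open>k\<close> are credited
  with \<Xi> of a shifted environment.\<close>

definition finite_Xi :: "(nat \<Rightarrow> 'm::finite \<Rightarrow> 'm litter measure) \<Rightarrow> bool" where
  "finite_Xi e \<longleftrightarrow> (\<forall>k j. Xi coord (\<lambda>l. e (l + k)) $ j < top)"

lemma finite_Xi_Suc: "finite_Xi e \<Longrightarrow> finite_Xi (\<lambda>k. e (Suc k))"
  unfolding finite_Xi_def
proof safe
  fix k j assume *: "\<forall>k j. Xi coord (\<lambda>l. e (l + k)) $ j < top"
  show "Xi coord (\<lambda>l. e (Suc (l + k))) $ j < top"
    using spec[OF spec[OF *, of "Suc k"], of j] by (simp only: add_Suc_right)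
qed

lemma partial_Xi_finite: "finite_Xi e \<Longrightarrow> partial_Xi n e j < top"
  unfolding finite_Xi_def using partial_Xi_le[of n e j]
  by (elim allE[of _ 0] allE[of _ j]) (simp add: le_less_trans)

lemma additive_snd: "additive_functional (\<lambda>t. ennreal (snd t))"
  using additive_lin[of "\<lambda>_. 0" 1] by (simp add: lin_snd)

text \<open>Law of total variance at the first generation: \<open>noise\<close> bounds the variance
  of the conditional mean, and the remaining part of \<open>var_bound_Suc\<close> is the mean of the
  bounds for the conditional variance.\<close>

lemma quenched_variance:
  assumes "e \<in> space env_seqs" "finite_Xi e"
  shows "(\<integral>\<^sup>+t. ennreal (snd t) ^ 2 \<partial>quenched n e (axis i 1, 0)) \<le> (\<integral>\<^sup>+t. ennreal (snd t) \<partial>quenched n e (axis i 1, 0)) ^ 2 + var_bound n e i"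
  using assms
proof (induction n arbitrary: e i)
  case 0
  have "(\<lambda>t. ennreal (snd t) ^ 2) \<in> borel_measurable litter_space" by measurable
  then have "(\<integral>\<^sup>+t. ennreal (snd t) ^ 2 \<partial>quenched 0 e (axis i 1, 0)) = 0"
    by (subst nn_integral_quenched_0) simp_all
  then show ?case by (simp del: quenched.simps)
next
  case (Suc n)
  let ?e = "\<lambda>k. e (Suc k)"
  have e: "?e \<in> space env_seqs" "env (e 0)" using Suc.prems by (auto intro: env_seq_shift env_seq_nth)
  let ?m = "partial_Xi n ?e" and ?v = "var_bound n ?e"
  have fin: "?m j < top" for j
    by (rule partial_Xi_finite[OF finite_Xi_Suc[OF Suc.prems(2)]])
  have mean: "(\<integral>\<^sup>+t. ennreal (snd t) \<partial>quenched n ?e (z, 0)) = (\<Sum>j\<in>UNIV. of_nat (z $ j) * ?m j)" for z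
    using quenched_mean_snd[OF e(1), of 0 n z] by simp
  have "(\<integral>\<^sup>+t. ennreal (snd t) ^ 2 \<partial>quenched (Suc n) e (axis i 1, 0)) =
    (\<integral>\<^sup>+x. \<integral>\<^sup>+t. ennreal (snd ((0, snd x) + t)) ^ 2 \<partial>quenched n ?e (fst x, 0) \<partial>e 0 i)"
    by (rule nn_integral_quenched_Suc_axis[OF Suc.prems(1)]) measurable
  also have "\<dots> \<le> (\<integral>\<^sup>+x. lin ?m 1 x ^ 2 + lin ?v 0 x \<partial>e 0 i)"
  proof (intro nn_integral_mono)
    fix x assume "x \<in> space (e 0 i)"
    then have x: "0 \<le> snd x" using e by simp
    let ?Q = "quenched n ?e (fst x, 0)"
    let ?M = "\<Sum>j\<in>UNIV. of_nat (fst x $ j) * ?m j"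
    have one: "emeasure ?Q (space litter_space) = 1"
      using prob_space.emeasure_space_1[OF prob_space_quenched[OF e(1)], of "(fst x, 0)" n] e by simp
    have "(\<integral>\<^sup>+t. ennreal (snd ((0, snd x) + t)) ^ 2 \<partial>?Q) =
      (\<integral>\<^sup>+t. ennreal (snd x) ^ 2 + (2 * ennreal (snd x) * ennreal (snd t) + ennreal (snd t) ^ 2) \<partial>?Q)"
      using e x by (intro nn_integral_cong) (simp add: ennreal_plus power2_sum ac_simps)
    also have "\<dots> = ennreal (snd x) ^ 2 + (2 * ennreal (snd x) * ?M + (\<integral>\<^sup>+t. ennreal (snd t) ^ 2 \<partial>?Q))"
      using e one by (simp add: nn_integral_add nn_integral_cmult mean)
    also have "(\<integral>\<^sup>+t. ennreal (snd t) ^ 2 \<partial>?Q) \<le> ?M ^ 2 + (\<Sum>j\<in>UNIV. of_nat (fst x $ j) * ?v j)"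
      using quenched_second_moment[OF e(1) additive_snd Suc.IH[OF e(1) finite_Xi_Suc[OF Suc.prems(2)]], of "fst x"]
      by (simp add: mean)
    finally have "(\<integral>\<^sup>+t. ennreal (snd ((0, snd x) + t)) ^ 2 \<partial>?Q) \<le>
       ennreal (snd x) ^ 2 + (2 * ennreal (snd x) * ?M + (?M ^ 2 + (\<Sum>j\<in>UNIV. of_nat (fst x $ j) * ?v j)))"
      by (simp add: add_left_mono)
    also have "\<dots> = lin ?m 1 x ^ 2 + lin ?v 0 x"
      by (simp add: lin_def power2_sum ac_simps)
    finally show "(\<integral>\<^sup>+t. ennreal (snd ((0, snd x) + t)) ^ 2 \<partial>?Q) \<le> lin ?m 1 x ^ 2 + lin ?v 0 x" .
  qed
  also have "\<dots> = (\<integral>\<^sup>+x. lin ?m 1 x ^ 2 \<partial>e 0 i) + (\<integral>\<^sup>+x. lin ?v 0 x \<partial>e 0 i)"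
    using e by (intro nn_integral_add) simp_all
  also have "(\<integral>\<^sup>+x. lin ?v 0 x \<partial>e 0 i) = (\<Sum>j\<in>UNIV. mean_matrix coord 0 e $ i $ j * ?v j)"
    using nn_integral_lin[OF e(2)] by (simp add: mean_matrix_def)
  also have "(\<integral>\<^sup>+x. lin ?m 1 x ^ 2 \<partial>e 0 i) \<le> (\<integral>\<^sup>+x. lin ?m 1 x \<partial>e 0 i) ^ 2 + noise e i"
  proof -
    have "(\<integral>\<^sup>+x. lin ?m 1 x ^ 2 \<partial>e 0 i) \<le> (\<integral>\<^sup>+x. lin ?m 1 x \<partial>e 0 i) ^ 2 +
      of_nat (CARD('a) + 1) * (offspring_var (e 0) i * (\<Sum>j\<in>UNIV. ?m j) ^ 2 + char_var (e 0) i)"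
      by (rule lin_second_moment[OF e(2) fin])
    also have "\<dots> \<le> (\<integral>\<^sup>+x. lin ?m 1 x \<partial>e 0 i) ^ 2 + noise e i"
      unfolding noise_def Suc_eq_plus1[symmetric]
      by (intro add_left_mono mult_left_mono add_right_mono power_mono sum_mono partial_Xi_le) auto
    finally show ?thesis .
  qed
  also have "(\<integral>\<^sup>+x. lin ?m 1 x \<partial>e 0 i) = partial_Xi (Suc n) e i"
    unfolding nn_integral_lin[OF e(2)] partial_Xi_Suc by (simp add: mean_matrix_def mean_char_def add.commute)
  also have "partial_Xi (Suc n) e i = (\<integral>\<^sup>+t. ennreal (snd t) \<partial>quenched (Suc n) e (axis i 1, 0))"
    using quenched_mean_lin[OF Suc.prems(1), where w="\<lambda>_. 0" and b=1 and n="Suc n" and i=i] by (simp add: lin_snd del: quenched.simps)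
  finally show ?case
    unfolding var_bound_Suc by (simp add: add.assoc add_right_mono)
qed

lemma quenched_reverse_jensen:
  assumes e: "e \<in> space env_seqs" "finite_Xi e" and y: "0 < y" "y \<le> 1"
  shows "(\<Sum>i\<in>UNIV. of_nat (z $ i) * partial_Xi n e i) epowr y \<le>
    2 * (\<integral>\<^sup>+t. ennreal (snd t) epowr y \<partial>quenched n e (z, 0)) + (\<Sum>i\<in>UNIV. of_nat (z $ i) * var_bound n e i) epowr (y / 2)"
proof -
  interpret Q: prob_space "quenched n e (z, 0)" by (rule prob_space_quenched[OF e(1)]) simp
  have mean: "(\<integral>\<^sup>+t. ennreal (snd t) \<partial>quenched n e (z, 0)) = (\<Sum>i\<in>UNIV. of_nat (z $ i) * partial_Xi n e i)"
    using quenched_mean_snd[OF e(1), of 0 n z] by simp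
  have "partial_Xi n e i < top" for i
    by (rule partial_Xi_finite[OF e(2)])
  then have "(\<integral>\<^sup>+t. ennreal (snd t) \<partial>quenched n e (z, 0)) < \<infinity>"
    unfolding mean by (simp add: ennreal_mult_less_top of_nat_less_top)
  from Q.reverse_jensen[OF y _ this quenched_second_moment[OF e(1) additive_snd quenched_variance[OF e]]]
  show ?thesis using e by (simp add: mean)
qed

text \<open>Only nonnegative integrals remain on the right; these depend measurably on the law,
  which is used in \<open>measurable_evariance_law\<close>.\<close>

lemma (in prob_space) evariance_nonneg_eq:
  assumes [measurable]: "g \<in> borel_measurable M" and g: "\<And>x. x \<in> space M \<Longrightarrow> 0 \<le> g x"
  shows "evariance M g = (if (\<integral>\<^sup>+x. ennreal (g x) \<partial>M) < \<infinity>
    then \<integral>\<^sup>+x. ennreal ((g x - enn2real (\<integral>\<^sup>+x. ennreal (g x) \<partial>M))\<^sup>2) \<partial>M else \<infinity>)"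
proof -
  have "integrable M g \<longleftrightarrow> (\<integral>\<^sup>+x. ennreal (g x) \<partial>M) < \<infinity>"
  proof
    assume "integrable M g"
    then show "(\<integral>\<^sup>+x. ennreal (g x) \<partial>M) < \<infinity>" using g by (subst nn_integral_eq_integral) auto
  qed (use g in \<open>auto intro: integrableI_nonneg\<close>)
  moreover have "integral\<^sup>L M g = enn2real (\<integral>\<^sup>+x. ennreal (g x) \<partial>M)"
    using g by (intro integral_eq_nn_integral) auto
  ultimately show ?thesis by (simp add: evariance_def)
qed

lemma measurable_evariance_law:
  assumes g [measurable]: "g \<in> borel_measurable litter_space" and g0: "\<And>x. 0 \<le> snd x \<Longrightarrow> 0 \<le> g x"
  shows "(\<lambda>e. evariance (e n i) g) \<in> borel_measurable env_seqs"
proof -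
  let ?I = "\<lambda>e. \<integral>\<^sup>+x. ennreal (g x) \<partial>e n i"
  let ?f = "\<lambda>e. if ?I e < \<infinity> then \<integral>\<^sup>+x. ennreal ((g x - enn2real (?I e))\<^sup>2) \<partial>e n i else \<infinity>"
  have I [measurable]: "?I \<in> borel_measurable env_seqs" by (rule measurable_law_integral) measurable
  have "(\<lambda>e. \<integral>\<^sup>+x. ennreal ((g x - enn2real (?I e))\<^sup>2) \<partial>e n i) \<in> borel_measurable env_seqs"
    by (rule measurable_nn_integral_kernel[OF measurable_law_nth]) measurable
  then have "?f \<in> borel_measurable env_seqs" by measurable
  moreover have "evariance (e n i) g = ?f e" if "e \<in> space env_seqs" for e
  proof -
    have "env (e n)" using that by (rule env_seq_nth)
    then show ?thesis
      using g0 by (intro prob_space.evariance_nonneg_eq prob_env) auto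
  qed
  ultimately show ?thesis by (simp cong: measurable_cong)
qed

lemma measurable_offspring_var [measurable]: "(\<lambda>e. offspring_var (e n) i) \<in> borel_measurable env_seqs"
  unfolding offspring_var_def
  by (intro borel_measurable_sum measurable_evariance_law)
    (auto intro: measurable_compose[OF measurable_fst_nth])

lemma measurable_char_var [measurable]: "(\<lambda>e. char_var (e n) i) \<in> borel_measurable env_seqs"
  unfolding char_var_def by (intro measurable_evariance_law) auto

context env_law
begin

lemma measurable_shifted: "g \<in> borel_measurable env_seqs \<Longrightarrow> (\<lambda>e. g (\<lambda>k. e (k + n))) \<in> borel_measurable env_seqs"
  by (rule measurable_compose[OF measurable_shift_env])

lemma measurable_Xi_shift [measurable]: "(\<lambda>e. Xi coord (\<lambda>k. e (k + n)) $ j) \<in> borel_measurable env_seqs"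
  by (rule measurable_shifted[of "\<lambda>e. Xi coord e $ j"]) measurable

lemma measurable_noise [measurable]: "(\<lambda>e. noise e i) \<in> borel_measurable env_seqs"
  unfolding noise_def by measurable

lemma measurable_noise_shift [measurable]: "(\<lambda>e. noise (\<lambda>k. e (k + n)) j) \<in> borel_measurable env_seqs"
  by (rule measurable_shifted[of "\<lambda>e. noise e j"]) measurable

lemma measurable_var_bound [measurable]: "(\<lambda>e. var_bound n e i) \<in> borel_measurable env_seqs"
  unfolding var_bound_def by measurable

end

section \<open>Moments of the variance bound\<close>

context moment_env
begin

lemma AE_finite_Xi: "AE e in S. finite_Xi e"
proof -
  have "AE e in S. Xi coord (\<lambda>l. e (l + k)) $ j < top" for k j
  proof -
    have m: "(\<lambda>e. Xi coord (\<lambda>l. e (l + k)) $ j epowr (\<kappa> / 2)) \<in> borel_measurable env_seqs"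
      by (rule measurable_shifted[of "\<lambda>e. Xi coord e $ j epowr (\<kappa> / 2)"]) measurable
    have "(\<integral>\<^sup>+e. Xi coord (\<lambda>l. e (l + k)) $ j epowr (\<kappa> / 2) \<partial>S) = (\<integral>\<^sup>+e. Xi coord e $ j epowr (\<kappa> / 2) \<partial>S)"
      by (rule nn_integral_shift[of "\<lambda>e. Xi coord e $ j epowr (\<kappa> / 2)"]) measurable
    also have "\<dots> < \<infinity>" using \<kappa> by (intro Xi_moment) auto
    finally have "AE e in S. Xi coord (\<lambda>l. e (l + k)) $ j epowr (\<kappa> / 2) \<noteq> \<infinity>"
      using m by (intro nn_integral_noteq_infinite) auto
    then show ?thesis
    proof eventually_elim
      case (elim e)
      then show ?case using \<kappa> epowr_eq_top_iff[of "\<kappa> / 2" "Xi coord (\<lambda>l. e (l + k)) $ j"] by (simp add: less_top[symmetric])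
    qed
  qed
  then show ?thesis unfolding finite_Xi_def by (simp add: AE_all_countable AE_finite_all)
qed

text \<open>The variances of generation 0 are independent of \<Xi> started at generation 1. For h =
  y/2 the square of \<Xi> turns into its y-th power, so the moment of the noise stays finite for y <
  \<kappa>.\<close>

lemma noise_moment_le:
  assumes h: "0 < h" "h \<le> 1"
  shows "(\<integral>\<^sup>+e. noise e i epowr h \<partial>S) \<le> of_nat (CARD('m) + 1) epowr h *
    ((\<integral>\<^sup>+e. offspring_var (e 0) i epowr h \<partial>S) * (\<integral>\<^sup>+e. (\<Sum>j\<in>UNIV. Xi coord e $ j) epowr (2 * h) \<partial>S) +
     (\<integral>\<^sup>+e. char_var (e 0) i epowr h \<partial>S))"
proof -
  let ?X = "\<lambda>e. \<Sum>j\<in>UNIV. Xi coord e $ j"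
  have m: "(\<lambda>e. ?X (\<lambda>k. e (k + 1)) epowr (2 * h)) \<in> borel_measurable env_seqs"
    by (rule measurable_shifted[of "\<lambda>e. ?X e epowr (2 * h)"]) measurable
  have "(\<integral>\<^sup>+e. noise e i epowr h \<partial>S) \<le> (\<integral>\<^sup>+e. of_nat (CARD('m) + 1) epowr h *
      (offspring_var (e 0) i epowr h * ?X (\<lambda>k. e (k + 1)) epowr (2 * h) + char_var (e 0) i epowr h) \<partial>S)"
  proof (intro nn_integral_mono)
    fix e
    have "noise e i epowr h \<le> of_nat (CARD('m) + 1) epowr h *
      ((offspring_var (e 0) i * ?X (\<lambda>k. e (k + 1)) ^ 2) epowr h + char_var (e 0) i epowr h)"
      unfolding noise_def using h by (subst epowr_mult) (auto intro!: mult_left_mono epowr_add_le_one)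
    also have "(offspring_var (e 0) i * ?X (\<lambda>k. e (k + 1)) ^ 2) epowr h = offspring_var (e 0) i epowr h * ?X (\<lambda>k. e (k + 1)) epowr (2 * h)"
      using h by (simp add: epowr_mult epowr_2[symmetric] epowr_epowr)
    finally show "noise e i epowr h \<le> of_nat (CARD('m) + 1) epowr h *
      (offspring_var (e 0) i epowr h * ?X (\<lambda>k. e (k + 1)) epowr (2 * h) + char_var (e 0) i epowr h)" .
  qed
  also have "\<dots> = of_nat (CARD('m) + 1) epowr h *
      ((\<integral>\<^sup>+e. offspring_var (e 0) i epowr h * ?X (\<lambda>k. e (k + 1)) epowr (2 * h) \<partial>S) + (\<integral>\<^sup>+e. char_var (e 0) i epowr h \<partial>S))"
    using m by (simp add: nn_integral_cmult nn_integral_add)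
  also have "(\<integral>\<^sup>+e. offspring_var (e 0) i epowr h * ?X (\<lambda>k. e (k + 1)) epowr (2 * h) \<partial>S) =
      (\<integral>\<^sup>+e. offspring_var (e 0) i epowr h \<partial>S) * (\<integral>\<^sup>+e. ?X e epowr (2 * h) \<partial>S)"
    by (rule nn_integral_indep[where g="\<lambda>e. ?X e epowr (2 * h)" and n=1]) (simp_all add: comb_seq_less)
  finally show ?thesis .
qed

text \<open>Subadditivity of the h-th power separates the generations, and the product up to
  generation \<open>k\<close> is independent of the noise after it.\<close>

lemma var_bound_moment_le:
  assumes h: "0 < h" "h \<le> 1"
  shows "(\<integral>\<^sup>+e. (\<Sum>i\<in>UNIV. var_bound n e i) epowr h \<partial>S) \<le>
    of_nat CARD('m) * ((\<Sum>k<n. growth h k) * (\<Sum>j\<in>UNIV. \<integral>\<^sup>+e. noise e j epowr h \<partial>S))"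
proof -
  have m: "(\<lambda>e. noise (\<lambda>l. e (l + k)) j epowr h) \<in> borel_measurable env_seqs" for k j
    by (rule measurable_shifted[of "\<lambda>e. noise e j epowr h"]) measurable
  have "(\<integral>\<^sup>+e. (\<Sum>i\<in>UNIV. var_bound n e i) epowr h \<partial>S) \<le>
    (\<integral>\<^sup>+e. (\<Sum>i\<in>UNIV. \<Sum>k<n. \<Sum>j\<in>UNIV. right_prod coord k e $ i $ j epowr h * noise (\<lambda>l. e (l + k)) j epowr h) \<partial>S)"
  proof (intro nn_integral_mono)
    fix e
    have "(\<Sum>i\<in>UNIV. var_bound n e i) epowr h \<le> (\<Sum>i\<in>UNIV. \<Sum>k<n. \<Sum>j\<in>UNIV. (right_prod coord k e $ i $ j * noise (\<lambda>l. e (l + k)) j) epowr h)"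
      unfolding var_bound_def
      by (intro order_trans[OF epowr_sum_le_one[OF h]] sum_mono order_refl)
    then show "(\<Sum>i\<in>UNIV. var_bound n e i) epowr h \<le> (\<Sum>i\<in>UNIV. \<Sum>k<n. \<Sum>j\<in>UNIV. right_prod coord k e $ i $ j epowr h * noise (\<lambda>l. e (l + k)) j epowr h)"
      using h by (simp add: epowr_mult)
  qed
  also have "\<dots> = (\<Sum>i\<in>UNIV. \<Sum>k<n. \<Sum>j\<in>UNIV. \<integral>\<^sup>+e. right_prod coord k e $ i $ j epowr h * noise (\<lambda>l. e (l + k)) j epowr h \<partial>S)"
    using m by (simp add: nn_integral_sum)
  also have "\<dots> = (\<Sum>i\<in>UNIV. \<Sum>k<n. \<Sum>j\<in>UNIV. (\<integral>\<^sup>+e. right_prod coord k e $ i $ j epowr h \<partial>S) * (\<integral>\<^sup>+e. noise e j epowr h \<partial>S))"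
    by (intro sum.cong refl nn_integral_indep[where g="\<lambda>e. noise e j epowr h" for j]) (simp_all add: right_prod_comb_seq)
  also have "\<dots> \<le> (\<Sum>i\<in>(UNIV::'m set). \<Sum>k<n. \<Sum>j\<in>UNIV. growth h k * (\<integral>\<^sup>+e. noise e j epowr h \<partial>S))"
    unfolding growth_def using h
    by (intro sum_mono mult_right_mono nn_integral_mono epowr_mono entry_le_matnorm) auto
  also have "\<dots> = of_nat CARD('m) * ((\<Sum>k<n. growth h k) * (\<Sum>j\<in>UNIV. \<integral>\<^sup>+e. noise e j epowr h \<partial>S))"
    by (simp add: sum_distrib_left[symmetric] sum_distrib_right[symmetric])
  finally show ?thesis .
qed

end

text \<open>\<open>Xi_comparable\<close> says that no type dominates: one component of \<Xi> stands
  for their sum, with a constant that does not depend on the order y. It reflects tails of the same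
  order for all types.\<close>

locale var_env = moment_env S \<kappa> for S :: "(nat \<Rightarrow> 'm::finite \<Rightarrow> 'm litter measure) measure" and \<kappa> +
  assumes kappa_lt_1: "\<kappa> < 1"
    and offspring_var_moment: "(\<integral>\<^sup>+e. offspring_var (e 0) i epowr \<kappa> \<partial>S) < top"
    and char_var_moment: "(\<integral>\<^sup>+e. char_var (e 0) i epowr \<kappa> \<partial>S) < top"
    and litter_char_moment: "\<exists>\<delta>>0. \<forall>i. (\<integral>\<^sup>+e. \<integral>\<^sup>+t. ennreal (snd t) epowr (\<kappa> + \<delta>) \<partial>e 0 i \<partial>S) < top"
    and Xi_critical: "(\<integral>\<^sup>+e. Xi coord e $ i epowr \<kappa> \<partial>S) = top"
    and Xi_comparable: "\<exists>C<top. \<forall>i y. \<kappa> / 2 \<le> y \<longrightarrow> y < \<kappa> \<longrightarrow>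
        (\<integral>\<^sup>+e. (\<Sum>j\<in>UNIV. Xi coord e $ j) epowr y \<partial>S) \<le> C * (1 + (\<integral>\<^sup>+e. Xi coord e $ i epowr y \<partial>S))"
begin

lemma var_bound_moment_uniform:
  "\<exists>C<top. \<forall>n y. \<kappa> / 2 \<le> y \<longrightarrow> y < \<kappa> \<longrightarrow>
    (\<integral>\<^sup>+e. (\<Sum>i\<in>UNIV. var_bound n e i) epowr (y / 2) \<partial>S) \<le> C * (1 + (\<integral>\<^sup>+e. (\<Sum>j\<in>UNIV. Xi coord e $ j) epowr y \<partial>S))"
proof -
  let ?d = "of_nat (CARD('m) + 1) :: ennreal"
  \<comment> \<open>The summands 1 come from bounding moments of order y/2 by moments of order
    \<kappa>.\<close>
  define W where "W j = 1 + (\<integral>\<^sup>+e. offspring_var (e 0) j epowr \<kappa> \<partial>S) + (1 + (\<integral>\<^sup>+e. char_var (e 0) j epowr \<kappa> \<partial>S))" for j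
  \<comment> \<open>The orders y/2 lie between \<kappa>/4 and \<kappa>/2, and the two endpoints
    control them all by \<open>epowr_le_sum_exps\<close>.\<close>
  define G where "G = (\<Sum>k. growth (\<kappa> / 4) k) + (\<Sum>k. growth (\<kappa> / 2) k)"
  let ?C = "of_nat CARD('m) * (G * (\<Sum>j\<in>UNIV. (1 + ?d) * W j))"
  have "G < top" using growth_summable[of "\<kappa> / 4"] growth_summable[of "\<kappa> / 2"] \<kappa> by (simp add: G_def)
  moreover have "W j < top" for j
    using offspring_var_moment[of j] char_var_moment[of j] by (simp add: W_def)
  ultimately have "?C < top" by (simp add: ennreal_mult_less_top of_nat_less_top)
  moreover have "(\<integral>\<^sup>+e. (\<Sum>i\<in>UNIV. var_bound n e i) epowr (y / 2) \<partial>S) \<le> ?C * (1 + (\<integral>\<^sup>+e. (\<Sum>j\<in>UNIV. Xi coord e $ j) epowr y \<partial>S))"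
    if y: "\<kappa> / 2 \<le> y" "y < \<kappa>" for n y
  proof -
    let ?X = "\<integral>\<^sup>+e. (\<Sum>j\<in>UNIV. Xi coord e $ j) epowr y \<partial>S"
    have h: "0 < y / 2" "y / 2 \<le> 1" "y / 2 \<le> \<kappa>" "y > 0" using y \<kappa> kappa_lt_1 by auto
    have "growth (y / 2) k \<le> growth (\<kappa> / 4) k + growth (\<kappa> / 2) k" for k
    proof -
      have "growth (y / 2) k \<le> (\<integral>\<^sup>+e. matnorm (right_prod coord k e) epowr (\<kappa> / 4) + matnorm (right_prod coord k e) epowr (\<kappa> / 2) \<partial>S)"
        unfolding growth_def using y \<kappa> by (intro nn_integral_mono epowr_le_sum_exps) auto
      then show ?thesis by (simp add: growth_def nn_integral_add)
    qed
    then have "(\<Sum>k<n. growth (y / 2) k) \<le> (\<Sum>k<n. growth (\<kappa> / 4) k) + (\<Sum>k<n. growth (\<kappa> / 2) k)"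
      by (simp add: sum.distrib[symmetric] sum_mono)
    also have "\<dots> \<le> G" unfolding G_def by (intro add_mono sum_le_suminf) auto
    finally have growth: "(\<Sum>k<n. growth (y / 2) k) \<le> G" .
    have le: "(\<integral>\<^sup>+e. f e epowr (y / 2) \<partial>S) \<le> 1 + (\<integral>\<^sup>+e. f e epowr \<kappa> \<partial>S)" if [measurable]: "f \<in> borel_measurable env_seqs" for f
    proof -
      have "(\<integral>\<^sup>+e. f e epowr (y / 2) \<partial>S) \<le> (\<integral>\<^sup>+e. 1 + f e epowr \<kappa> \<partial>S)"
        using h by (intro nn_integral_mono epowr_le_Suc)
      then show ?thesis by (simp add: nn_integral_add)
    qed
    have noise: "(\<integral>\<^sup>+e. noise e j epowr (y / 2) \<partial>S) \<le> (1 + ?d) * W j * (1 + ?X)" for j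
    proof -
      have "(\<integral>\<^sup>+e. noise e j epowr (y / 2) \<partial>S) \<le> ?d epowr (y / 2) *
        ((\<integral>\<^sup>+e. offspring_var (e 0) j epowr (y / 2) \<partial>S) * ?X + (\<integral>\<^sup>+e. char_var (e 0) j epowr (y / 2) \<partial>S))"
        using noise_moment_le[OF h(1,2), of j] by simp
      also have "\<dots> \<le> (1 + ?d) * ((1 + (\<integral>\<^sup>+e. offspring_var (e 0) j epowr \<kappa> \<partial>S)) * ?X + (1 + (\<integral>\<^sup>+e. char_var (e 0) j epowr \<kappa> \<partial>S)))"
        using epowr_le_Suc[OF h(1,2), of ?d] by (intro mult_mono add_mono le) simp_all
      also have "\<dots> \<le> (1 + ?d) * (W j * ?X + W j * 1)"
      proof (intro mult_left_mono add_mono mult_right_mono)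
        show "1 + (\<integral>\<^sup>+e. offspring_var (e 0) j epowr \<kappa> \<partial>S) \<le> W j"
          unfolding W_def by (rule add_increasing2) auto
        show "1 + (\<integral>\<^sup>+e. char_var (e 0) j epowr \<kappa> \<partial>S) \<le> W j * 1"
          unfolding W_def mult_1_right by (rule add_increasing) auto
      qed simp_all
      finally show ?thesis by (simp add: distrib_left mult.assoc add.commute)
    qed
    have "(\<integral>\<^sup>+e. (\<Sum>i\<in>UNIV. var_bound n e i) epowr (y / 2) \<partial>S) \<le>
      of_nat CARD('m) * ((\<Sum>k<n. growth (y / 2) k) * (\<Sum>j\<in>UNIV. \<integral>\<^sup>+e. noise e j epowr (y / 2) \<partial>S))"
      by (rule var_bound_moment_le[OF h(1,2)])
    also have "\<dots> \<le> of_nat CARD('m) * (G * (\<Sum>j\<in>UNIV. (1 + ?d) * W j * (1 + ?X)))"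
      by (intro mult_left_mono mult_mono growth sum_mono noise) auto
    also have "\<dots> = ?C * (1 + ?X)" unfolding sum_distrib_right[symmetric] by (simp only: mult.assoc)
    finally show ?thesis .
  qed
  ultimately show ?thesis by blast
qed

text \<open>The mean scales with the y-th power of the population, the variance term only with its
  y/2-th power; this gap is what large populations exploit.\<close>

lemma annealed_lower:
  assumes y: "0 < y" "y < \<kappa>"
  shows "of_nat (z $ i) epowr y * (\<integral>\<^sup>+e. Xi coord e $ i epowr y \<partial>S) \<le>
    2 * (SUP n. \<integral>\<^sup>+e. \<integral>\<^sup>+t. ennreal (snd t) epowr y \<partial>quenched n e (z, 0) \<partial>S) +
    pop z epowr (y / 2) * (SUP n. \<integral>\<^sup>+e. (\<Sum>i\<in>UNIV. var_bound n e i) epowr (y / 2) \<partial>S)"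
proof -
  let ?A = "\<lambda>n. \<integral>\<^sup>+e. \<integral>\<^sup>+t. ennreal (snd t) epowr y \<partial>quenched n e (z, 0) \<partial>S"
  let ?V = "\<lambda>n. \<integral>\<^sup>+e. (\<Sum>i\<in>UNIV. var_bound n e i) epowr (y / 2) \<partial>S"
  have y1: "y \<le> 1" using y kappa_lt_1 by simp
  have [measurable]: "(\<lambda>e. \<integral>\<^sup>+t. ennreal (snd t) epowr y \<partial>quenched n e (z, 0)) \<in> borel_measurable env_seqs" for n
    by (rule measurable_quenched_integral') simp_all
  have "of_nat (z $ i) epowr y * (\<integral>\<^sup>+e. Xi coord e $ i epowr y \<partial>S) = of_nat (z $ i) epowr y * (\<integral>\<^sup>+e. (SUP n. partial_Xi n e i epowr y) \<partial>S)"
    using y by (simp add: Xi_eq_SUP epowr_SUP)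
  also have "\<dots> = of_nat (z $ i) epowr y * (SUP n. \<integral>\<^sup>+e. partial_Xi n e i epowr y \<partial>S)"
    using y by (subst nn_integral_monotone_convergence_SUP) (auto simp: incseq_def le_fun_def intro!: epowr_mono partial_Xi_mono)
  also have "\<dots> = (SUP n. of_nat (z $ i) epowr y * (\<integral>\<^sup>+e. partial_Xi n e i epowr y \<partial>S))"
    by (rule SUP_mult_left_ennreal)
  also have "\<dots> \<le> 2 * (SUP n. ?A n) + pop z epowr (y / 2) * (SUP n. ?V n)"
  proof (rule SUP_least)
    fix n
    have "of_nat (z $ i) epowr y * (\<integral>\<^sup>+e. partial_Xi n e i epowr y \<partial>S) = (\<integral>\<^sup>+e. of_nat (z $ i) epowr y * partial_Xi n e i epowr y \<partial>S)"
      by (simp add: nn_integral_cmult)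
    also have "\<dots> \<le> (\<integral>\<^sup>+e. 2 * (\<integral>\<^sup>+t. ennreal (snd t) epowr y \<partial>quenched n e (z, 0)) +
      pop z epowr (y / 2) * (\<Sum>i\<in>UNIV. var_bound n e i) epowr (y / 2) \<partial>S)"
    proof (rule nn_integral_mono_AE, use AE_finite_Xi AE_space in eventually_elim)
      case (elim e)
      then have e: "e \<in> space env_seqs" by simp
      have "of_nat (z $ i) epowr y * partial_Xi n e i epowr y = (of_nat (z $ i) * partial_Xi n e i) epowr y"
        using y by (simp add: epowr_mult)
      also have "\<dots> \<le> (\<Sum>i\<in>UNIV. of_nat (z $ i) * partial_Xi n e i) epowr y"
        using y by (intro epowr_mono member_le_sum) auto
      also have "\<dots> \<le> 2 * (\<integral>\<^sup>+t. ennreal (snd t) epowr y \<partial>quenched n e (z, 0)) +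
          (\<Sum>i\<in>UNIV. of_nat (z $ i) * var_bound n e i) epowr (y / 2)"
        by (rule quenched_reverse_jensen[OF e elim(1) y(1) y1])
      also have "(\<Sum>i\<in>UNIV. of_nat (z $ i) * var_bound n e i) epowr (y / 2) \<le> (pop z * (\<Sum>i\<in>UNIV. var_bound n e i)) epowr (y / 2)"
        using y by (intro epowr_mono weighted_sum_le_pop) auto
      also have "\<dots> = pop z epowr (y / 2) * (\<Sum>i\<in>UNIV. var_bound n e i) epowr (y / 2)"
        using y by (intro epowr_mult) auto
      finally show ?case by (simp add: add_left_mono)
    qed
    also have "\<dots> = 2 * ?A n + pop z epowr (y / 2) * ?V n"
      by (simp add: nn_integral_add nn_integral_cmult)
    also have "\<dots> \<le> 2 * (SUP n. ?A n) + pop z epowr (y / 2) * (SUP n. ?V n)"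
      by (intro add_mono mult_left_mono SUP_upper) auto
    finally show "of_nat (z $ i) epowr y * (\<integral>\<^sup>+e. partial_Xi n e i epowr y \<partial>S) \<le> 2 * (SUP n. ?A n) + pop z epowr (y / 2) * (SUP n. ?V n)" .
  qed
  finally show ?thesis .
qed

text \<open>By Fatou's lemma a bound on the moments of orders y < \<kappa> passes to order \<kappa>,
  where the moment of \<Xi> is infinite.\<close>

lemma Xi_moments_unbounded:
  assumes D: "\<And>y. \<kappa> / 2 \<le> y \<Longrightarrow> y < \<kappa> \<Longrightarrow> (\<integral>\<^sup>+e. (\<Sum>j\<in>UNIV. Xi coord e $ j) epowr y \<partial>S) \<le> D"
  shows "D = top"
proof -
  fix i :: 'm
  \<comment> \<open>Orders that increase to \<kappa> and start at \<kappa>/2, so that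
    \<open>D\<close> applies to each of them.\<close>
  define y where "y n = \<kappa> - \<kappa> / 2 / real (Suc n)" for n
  have y: "\<kappa> / 2 \<le> y n" "y n < \<kappa>" for n
  proof -
    have "\<kappa> / 2 / real (Suc n) \<le> \<kappa> / 2 / 1" using \<kappa> by (intro divide_left_mono) auto
    then show "\<kappa> / 2 \<le> y n" by (simp add: y_def)
    show "y n < \<kappa>" using \<kappa> by (simp add: y_def)
  qed
  have "(\<lambda>n. \<kappa> / 2 * inverse (real (Suc n))) \<longlonglongrightarrow> \<kappa> / 2 * 0"
    by (intro tendsto_intros LIMSEQ_inverse_real_of_nat)
  from tendsto_diff[OF tendsto_const[of \<kappa>] this]
  have ylim: "y \<longlonglongrightarrow> \<kappa>"
    unfolding y_def[abs_def] divide_inverse by (simp only: mult_zero_right diff_zero)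
  have lim: "(\<lambda>n. a epowr y n) \<longlonglongrightarrow> a epowr \<kappa>" for a
  proof (cases a)
    case (real r)
    have yp: "y n \<noteq> 0" for n using y[of n] \<kappa> by auto
    show ?thesis
    proof (cases "r = 0")
      case True
      then show ?thesis using real yp \<kappa> by (simp add: epowr_ennreal)
    next
      case False
      then have "(\<lambda>n. ennreal (r powr y n)) \<longlonglongrightarrow> ennreal (r powr \<kappa>)"
        by (intro tendsto_ennrealI tendsto_powr tendsto_const ylim)
      then show ?thesis using real yp \<kappa> by (simp add: epowr_ennreal)
    qed
  next
    case top
    have "y n \<noteq> 0" for n using y[of n] \<kappa> by auto
    then show ?thesis using top \<kappa> by simp
  qed
  let ?X = "\<lambda>e. \<Sum>j\<in>UNIV. Xi coord e $ j"
  have "top = (\<integral>\<^sup>+e. Xi coord e $ i epowr \<kappa> \<partial>S)" by (simp add: Xi_critical)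
  also have "\<dots> \<le> (\<integral>\<^sup>+e. ?X e epowr \<kappa> \<partial>S)"
    using \<kappa> by (intro nn_integral_mono epowr_mono member_le_sum) auto
  also have "\<dots> = (\<integral>\<^sup>+e. liminf (\<lambda>n. ?X e epowr y n) \<partial>S)"
    by (intro nn_integral_cong lim_imp_Liminf[symmetric] lim) simp
  also have "\<dots> \<le> liminf (\<lambda>n. \<integral>\<^sup>+e. ?X e epowr y n \<partial>S)"
    by (rule nn_integral_liminf) measurable
  also have "\<dots> \<le> liminf (\<lambda>n. D)"
    by (rule Liminf_mono) (use D y in auto)
  also have "\<dots> = D" by (simp add: Liminf_const)
  finally show ?thesis by (simp add: top_unique)
qed

end

section \<open>The critical moment when the critical exponent is less than one\<close>

text \<open>Here \<open>a\<close> is the largest number of individuals of one type, \<open>m\<close>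
  the number of types and \<open>p\<close> the population; \<open>x\<close> and \<open>i\<close> are
  the y-th moments of the sum of \<Xi> and of one component, and \<open>c\<close>, \<open>d\<close>
  come from \<open>Xi_comparable\<close> and \<open>var_bound_moment_uniform\<close>. By
  \<open>large\<close> the variance term has coefficient at most half of a^y in front of
  \<open>x\<close> and can be absorbed. The bound reached is free of y.\<close>

lemma critical_moment_bound:
  fixes a b c d m p x i y :: real
  assumes "1 \<le> a" "1 \<le> m" "0 < y" "y \<le> 1" "0 \<le> x" "0 \<le> i" "0 \<le> b" "0 \<le> c" "0 \<le> d" "0 \<le> p"
    and p: "p \<le> m * a" and x: "x \<le> c * (1 + i)"
    and i: "a powr y * i \<le> 2 * (1 + b) + p powr (y / 2) * (d * (1 + x))"
    and large: "2 * (c * d * m) \<le> a powr (y / 2)"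
  shows "x \<le> 2 * c * a + 4 * c * (1 + b) + a"
proof -
  let ?A = "a powr y" and ?h = "a powr (y / 2)"
  have A1: "1 \<le> ?A" using assms by (simp add: ge_one_powr_ge_zero)
  have Aa: "?A \<le> a" using powr_mono[of y 1 a] assms by simp
  have hh: "?h * ?h = ?A" using assms by (simp add: powr_add[symmetric])
  have "p powr (y / 2) \<le> (m * a) powr (y / 2)" using assms by (intro powr_mono2) auto
  also have "\<dots> = m powr (y / 2) * ?h" using assms by (simp add: powr_mult)
  also have "\<dots> \<le> m * ?h" using powr_mono[of "y / 2" 1 m] assms by (intro mult_right_mono) auto
  finally have ph: "p powr (y / 2) \<le> m * ?h" .
  have "c * d * (p powr (y / 2)) \<le> c * d * (m * ?h)" using ph assms by (intro mult_left_mono) auto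
  also have "\<dots> = (c * d * m) * ?h" by simp
  also have "\<dots> \<le> (?h / 2) * ?h" using large by (intro mult_right_mono) auto
  finally have cd: "c * d * (p powr (y / 2)) \<le> ?A / 2" using hh by simp
  have "?A * x \<le> ?A * (c * (1 + i))" using x by (intro mult_left_mono) auto
  also have "\<dots> = c * ?A + c * (?A * i)" by (simp add: algebra_simps)
  also have "\<dots> \<le> c * ?A + c * (2 * (1 + b) + p powr (y / 2) * (d * (1 + x)))"
    using i assms by (intro add_left_mono mult_left_mono) auto
  also have "\<dots> = c * ?A + 2 * c * (1 + b) + (c * d * (p powr (y / 2))) * (1 + x)" by (simp add: algebra_simps)
  also have "\<dots> \<le> c * ?A + 2 * c * (1 + b) + ?A / 2 * (1 + x)"
    using cd assms by (intro add_left_mono mult_right_mono) auto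
  finally have "?A * x \<le> c * ?A + 2 * c * (1 + b) + ?A / 2 * (1 + x)" .
  moreover have "?A / 2 * (1 + x) = ?A / 2 + (?A * x) / 2" by (simp add: field_simps)
  moreover have "4 * c * (1 + b) = 2 * (2 * c * (1 + b))" "2 * c * ?A = 2 * (c * ?A)" by simp_all
  ultimately have "?A * x \<le> 2 * c * ?A + 4 * c * (1 + b) + ?A" by linarith
  moreover have "x \<le> ?A * x" using A1 assms mult_right_mono[of 1 ?A x] by simp
  moreover have "2 * c * ?A \<le> 2 * c * a" using Aa assms by (intro mult_left_mono) auto
  ultimately show ?thesis using Aa by linarith
qed

lemma nn_integral_quenched_pop:
  assumes e: "e \<in> space env_seqs" and \<phi>: "0 \<le> \<phi>" and z: "z $ i \<noteq> 0"
  shows "(\<Sum>j\<in>UNIV. right_prod coord n e $ i $ j) \<le> (\<integral>\<^sup>+t. pop (fst t) \<partial>quenched n e (z, \<phi>))"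
proof -
  have "(\<Sum>j\<in>UNIV. right_prod coord n e $ i $ j) = (\<integral>\<^sup>+t. lin (\<lambda>_. 1) 0 t \<partial>quenched n e (axis i 1, 0))"
    using quenched_mean_lin[OF e, where w="\<lambda>_. 1" and b=0 and n=n and i=i] by simp
  also have "\<dots> \<le> of_nat (z $ i) * (\<integral>\<^sup>+t. lin (\<lambda>_. 1) 0 t \<partial>quenched n e (axis i 1, 0))"
    using z mult_right_mono[of 1 "of_nat (z $ i)" "\<integral>\<^sup>+t. lin (\<lambda>_. 1) 0 t \<partial>quenched n e (axis i 1, 0)"] by (cases "z $ i") auto
  also have "\<dots> \<le> (\<Sum>i\<in>UNIV. of_nat (z $ i) * (\<integral>\<^sup>+t. lin (\<lambda>_. 1) 0 t \<partial>quenched n e (axis i 1, 0)))"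
    by (rule member_le_sum) auto
  also have "\<dots> = (\<integral>\<^sup>+t. lin (\<lambda>_. 1) 0 t \<partial>quenched n e (z, 0))"
    by (rule quenched_mean_additive[OF e additive_lin, symmetric])
  also have "\<dots> = (\<integral>\<^sup>+t. lin (\<lambda>_. 1) 0 ((0, \<phi>) + t) \<partial>quenched n e (z, 0))"
    by (simp add: lin_def)
  also have "\<dots> = (\<integral>\<^sup>+t. lin (\<lambda>_. 1) 0 t \<partial>quenched n e (z, \<phi>))"
    by (rule nn_integral_quenched_shift[OF e measurable_lin \<phi>, symmetric])
  finally show ?thesis by (simp add: lin_pop)
qed

context var_env
begin

text \<open>If the \<kappa>-th moments were bounded, all y-th moments would be bounded with the same
  constants, and \<open>critical_moment_bound\<close> would bound the moments of \<Xi> uniformly in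
  y < \<kappa>.\<close>

lemma large_start_infinite:
  "\<exists>N::nat. \<forall>z. of_nat N \<le> pop z \<longrightarrow>
    (SUP n. \<integral>\<^sup>+e. \<integral>\<^sup>+t. ennreal (snd t) epowr \<kappa> \<partial>quenched n e (z, 0) \<partial>S) = top"
proof -
  obtain C where C: "C < top" "\<And>i y. \<kappa> / 2 \<le> y \<Longrightarrow> y < \<kappa> \<Longrightarrow>
      (\<integral>\<^sup>+e. (\<Sum>j\<in>UNIV. Xi coord e $ j) epowr y \<partial>S) \<le> C * (1 + (\<integral>\<^sup>+e. Xi coord e $ i epowr y \<partial>S))"
    using Xi_comparable by blast
  obtain D where D: "D < top" "\<And>n y. \<kappa> / 2 \<le> y \<Longrightarrow> y < \<kappa> \<Longrightarrow>
      (\<integral>\<^sup>+e. (\<Sum>i\<in>UNIV. var_bound n e i) epowr (y / 2) \<partial>S) \<le> D * (1 + (\<integral>\<^sup>+e. (\<Sum>j\<in>UNIV. Xi coord e $ j) epowr y \<partial>S))"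
    using var_bound_moment_uniform by blast
  obtain c d where cd: "0 \<le> c" "C = ennreal c" "0 \<le> d" "D = ennreal d" using C D by (cases C; cases D) auto
  define m where "m = real CARD('m)"
  have m1: "1 \<le> m" unfolding m_def using zero_less_card_finite[where 'a='m] by linarith
  \<comment> \<open>The exponent 4/\<kappa> inverts \<kappa>/4, the smallest value of y/2; so
    \<open>large\<close> holds for all y at once.\<close>
  define a0 where "a0 = max 1 ((2 * (c * d * m)) powr (4 / \<kappa>))"
  \<comment> \<open>Among at least m a0 individuals some type occurs at least a0 times.\<close>
  obtain N :: nat where N: "m * a0 \<le> real N" using real_arch_simple by blast
  have "(SUP n. \<integral>\<^sup>+e. \<integral>\<^sup>+t. ennreal (snd t) epowr \<kappa> \<partial>quenched n e (z, 0) \<partial>S) = top"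
    if z: "of_nat N \<le> pop z" for z
  proof (rule ccontr)
    let ?B = "SUP n. \<integral>\<^sup>+e. \<integral>\<^sup>+t. ennreal (snd t) epowr \<kappa> \<partial>quenched n e (z, 0) \<partial>S"
    assume "?B \<noteq> top"
    then obtain b where b: "0 \<le> b" "?B = ennreal b" by (cases ?B) auto
    define M where "M = Max (range (\<lambda>i. z $ i))"
    have "M \<in> range (\<lambda>i. z $ i)" unfolding M_def by (rule Max_in) auto
    then obtain i where i: "z $ i = M" by auto
    have zM: "z $ j \<le> M" for j unfolding M_def by (rule Max_ge) auto
    define p where "p = (\<Sum>j\<in>UNIV. real (z $ j))"
    have p: "pop z = ennreal p" "0 \<le> p" by (simp_all add: pop_def p_def ennreal_of_nat_eq_real_of_nat sum_ennreal sum_nonneg)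
    define a where "a = real M"
    have pm: "p \<le> m * a"
      unfolding p_def m_def a_def using sum_bounded_above[of UNIV "\<lambda>j. real (z $ j)" "real M"] zM by simp
    have "real N \<le> p" using z p by (simp add: ennreal_of_nat_eq_real_of_nat)
    then have "m * a0 \<le> m * a" using N pm by linarith
    then have aa0: "a0 \<le> a" using m1 by simp
    then have a1: "1 \<le> a" by (simp add: a0_def)
    have "(\<integral>\<^sup>+e. (\<Sum>j\<in>UNIV. Xi coord e $ j) epowr y \<partial>S) \<le> ennreal (2 * c * a + 4 * c * (1 + b) + a)"
      if y: "\<kappa> / 2 \<le> y" "y < \<kappa>" for y
    proof -
      let ?X = "\<integral>\<^sup>+e. (\<Sum>j\<in>UNIV. Xi coord e $ j) epowr y \<partial>S" and ?I = "\<integral>\<^sup>+e. Xi coord e $ i epowr y \<partial>S"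
      have y0: "0 < y" "y \<le> 1" using y \<kappa> kappa_lt_1 by auto
      have "?X < top" "?I < top" using Xi_sum_moment[OF y0(1) y(2)] Xi_moment[OF y0(1) y(2), of i] by auto
      then obtain X I where XI: "0 \<le> X" "?X = ennreal X" "0 \<le> I" "?I = ennreal I" by (cases ?X; cases ?I) auto
      have "ennreal X \<le> ennreal c * (1 + ennreal I)" using C(2)[OF y, of i] XI cd by simp
      also have "\<dots> = ennreal (c * (1 + I))" using XI cd by (simp add: ennreal_mult ennreal_plus)
      finally have 1: "X \<le> c * (1 + I)" using XI cd by (subst (asm) ennreal_le_iff) auto
      have "(\<integral>\<^sup>+e. \<integral>\<^sup>+t. ennreal (snd t) epowr y \<partial>quenched n e (z, 0) \<partial>S) \<le> 1 + ?B" for n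
      proof -
        have [measurable]: "(\<lambda>e. \<integral>\<^sup>+t. ennreal (snd t) epowr \<kappa> \<partial>quenched n e (z, 0)) \<in> borel_measurable env_seqs"
          by (rule measurable_quenched_integral') simp_all
        have "(\<integral>\<^sup>+e. \<integral>\<^sup>+t. ennreal (snd t) epowr y \<partial>quenched n e (z, 0) \<partial>S) \<le>
          (\<integral>\<^sup>+e. \<integral>\<^sup>+t. 1 + ennreal (snd t) epowr \<kappa> \<partial>quenched n e (z, 0) \<partial>S)"
          using y y0 by (intro nn_integral_mono epowr_le_Suc) auto
        also have "\<dots> = (\<integral>\<^sup>+e. 1 + (\<integral>\<^sup>+t. ennreal (snd t) epowr \<kappa> \<partial>quenched n e (z, 0)) \<partial>S)"
        proof (intro nn_integral_cong)
          fix e assume "e \<in> space S"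
          then have e: "e \<in> space env_seqs" by simp
          show "(\<integral>\<^sup>+t. 1 + ennreal (snd t) epowr \<kappa> \<partial>quenched n e (z, 0)) = 1 + (\<integral>\<^sup>+t. ennreal (snd t) epowr \<kappa> \<partial>quenched n e (z, 0))"
            using e prob_space.emeasure_space_1[OF prob_space_quenched[OF e], of "(z, 0)" n] by (simp add: nn_integral_add)
        qed
        also have "\<dots> = 1 + (\<integral>\<^sup>+e. \<integral>\<^sup>+t. ennreal (snd t) epowr \<kappa> \<partial>quenched n e (z, 0) \<partial>S)"
          by (simp add: nn_integral_add)
        also have "\<dots> \<le> 1 + ?B" by (intro add_left_mono SUP_upper) simp
        finally show ?thesis .
      qed
      then have A: "(SUP n. \<integral>\<^sup>+e. \<integral>\<^sup>+t. ennreal (snd t) epowr y \<partial>quenched n e (z, 0) \<partial>S) \<le> 1 + ?B"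
        by (rule SUP_least)
      have V: "(SUP n. \<integral>\<^sup>+e. (\<Sum>i\<in>UNIV. var_bound n e i) epowr (y / 2) \<partial>S) \<le> D * (1 + ?X)"
        using D(2)[OF y] by (rule SUP_least)
      have "of_nat (z $ i) epowr y * ?I \<le> 2 * (1 + ?B) + pop z epowr (y / 2) * (D * (1 + ?X))"
        by (rule order_trans[OF annealed_lower[OF y0(1) y(2)] add_mono[OF mult_left_mono[OF A] mult_left_mono[OF V]]]) auto
      also have "of_nat (z $ i) epowr y = ennreal (a powr y)"
        using y0 by (simp add: i a_def ennreal_of_nat_eq_real_of_nat epowr_ennreal)
      also have "pop z epowr (y / 2) = ennreal (p powr (y / 2))" using y0 p by (simp add: epowr_ennreal)
      also have "2 * (1 + ?B) + ennreal (p powr (y / 2)) * (D * (1 + ?X)) = ennreal (2 * (1 + b) + p powr (y / 2) * (d * (1 + X)))"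
        using b cd XI by (simp add: ennreal_mult ennreal_plus)
      also have "ennreal (a powr y) * ?I = ennreal (a powr y * I)" using XI by (simp add: ennreal_mult)
      finally have 2: "a powr y * I \<le> 2 * (1 + b) + p powr (y / 2) * (d * (1 + X))"
        using b cd XI by (subst (asm) ennreal_le_iff) auto
      have cdm: "0 \<le> 2 * (c * d * m)" using cd m1 by simp
      have "2 * (c * d * m) = ((2 * (c * d * m)) powr (4 / \<kappa>)) powr (\<kappa> / 4)"
        using \<kappa> cdm by (simp add: powr_powr)
      also have "\<dots> \<le> a powr (\<kappa> / 4)" using aa0 \<kappa> by (intro powr_mono2) (auto simp: a0_def)
      also have "\<dots> \<le> a powr (y / 2)" using a1 y by (intro powr_mono) auto
      finally have 3: "2 * (c * d * m) \<le> a powr (y / 2)" .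
      have "X \<le> 2 * c * a + 4 * c * (1 + b) + a"
        by (rule critical_moment_bound[OF a1 m1 y0 XI(1) XI(3) b(1) cd(1) cd(3) p(2) pm 1 2 3])
      then show ?thesis using XI by (simp add: ennreal_leI)
    qed
    then have "ennreal (2 * c * a + 4 * c * (1 + b) + a) = top" by (rule Xi_moments_unbounded)
    then show False by simp
  qed
  then show ?thesis by blast
qed

text \<open>The assumption concerns moments of the characteristic itself. For orders at most 1
  Jensen's inequality does not carry them over to its quenched mean, so the reverse inequality is
  used, with the moment of the variance.\<close>

lemma char_moment_above:
  "\<exists>x>\<kappa>. x \<le> 1 \<and> (\<forall>i. (\<integral>\<^sup>+e. mean_char coord 0 e $ i epowr x \<partial>S) < top)"
proof -
  obtain \<delta> where \<delta>: "\<delta> > 0" "\<And>i. (\<integral>\<^sup>+e. \<integral>\<^sup>+t. ennreal (snd t) epowr (\<kappa> + \<delta>) \<partial>e 0 i \<partial>S) < top"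
    using litter_char_moment by blast
  \<comment> \<open>The bound 2\<kappa> keeps x/2 \<le> \<kappa>, the order at which the variance
    has a moment; the bound 1 is required by the reverse Jensen inequality and by
    subadditivity.\<close>
  define x where "x = min (\<kappa> + \<delta>) (min (2 * \<kappa>) 1)"
  have x: "\<kappa> < x" "x \<le> 1" "x \<le> \<kappa> + \<delta>" "x / 2 \<le> \<kappa>" "0 < x"
    using \<delta> \<kappa> kappa_lt_1 by (auto simp: x_def)
  have "(\<integral>\<^sup>+e. mean_char coord 0 e $ i epowr x \<partial>S) < top" for i
  proof -
    have [measurable]: "(\<lambda>e. \<integral>\<^sup>+t. ennreal (snd t) epowr (\<kappa> + \<delta>) \<partial>e 0 i) \<in> borel_measurable env_seqs"
      by (rule measurable_law_integral) measurable
    have fin: "AE e in S. mean_char coord 0 e $ i \<noteq> \<infinity>"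
      using AE_finite_Xi
    proof eventually_elim
      case (elim e)
      have "mean_char coord 0 e $ i = partial_Xi 1 e i" by (simp add: partial_Xi_def One_nat_def)
      then show ?case using partial_Xi_finite[OF elim, of 1 i] by simp
    qed
    have "(\<integral>\<^sup>+e. mean_char coord 0 e $ i epowr x \<partial>S) \<le>
      (\<integral>\<^sup>+e. 2 * (1 + (\<integral>\<^sup>+t. ennreal (snd t) epowr (\<kappa> + \<delta>) \<partial>e 0 i)) + (1 + char_var (e 0) i epowr \<kappa>) \<partial>S)"
    proof (rule nn_integral_mono_AE, use fin AE_space in eventually_elim)
      case (elim e)
      then have e: "env (e 0)" by (auto intro: env_seq_nth)
      interpret P: prob_space "e 0 i" using e by (rule prob_env)
      have [measurable]: "(\<lambda>t. ennreal (snd t)) \<in> borel_measurable (e 0 i)" "snd \<in> borel_measurable (e 0 i)" using e by simp_all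
      have "mean_char coord 0 e $ i epowr x = (\<integral>\<^sup>+t. ennreal (snd t) \<partial>e 0 i) epowr x"
        by (simp add: mean_char_def)
      also have "\<dots> \<le> 2 * (\<integral>\<^sup>+t. ennreal (snd t) epowr x \<partial>e 0 i) + char_var (e 0) i epowr (x / 2)"
        using elim e unfolding char_var_def
        by (intro P.reverse_jensen P.second_moment_evariance x) (auto simp: mean_char_def less_top)
      also have "\<dots> \<le> 2 * (\<integral>\<^sup>+t. 1 + ennreal (snd t) epowr (\<kappa> + \<delta>) \<partial>e 0 i) + (1 + char_var (e 0) i epowr \<kappa>)"
        using x by (intro add_mono mult_left_mono nn_integral_mono epowr_le_Suc) auto
      also have "(\<integral>\<^sup>+t. 1 + ennreal (snd t) epowr (\<kappa> + \<delta>) \<partial>e 0 i) = 1 + (\<integral>\<^sup>+t. ennreal (snd t) epowr (\<kappa> + \<delta>) \<partial>e 0 i)"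
        using P.emeasure_space_1 by (subst nn_integral_add) simp_all
      finally show ?case .
    qed
    also have "\<dots> = 2 * (1 + (\<integral>\<^sup>+e. \<integral>\<^sup>+t. ennreal (snd t) epowr (\<kappa> + \<delta>) \<partial>e 0 i \<partial>S)) + (1 + (\<integral>\<^sup>+e. char_var (e 0) i epowr \<kappa> \<partial>S))"
      by (simp add: nn_integral_add nn_integral_cmult)
    also have "\<dots> < top" using \<delta>(2)[of i] char_var_moment[of i] by (simp add: ennreal_mult_less_top)
    finally show ?thesis .
  qed
  then show ?thesis using x by blast
qed

text \<open>If the population stayed below \<open>N\<close> forever, then so would its quenched mean, and the terms of
  \<open>\<Xi>\<close> would have summable moments of some order above \<open>\<kappa>\<close>.\<close>

lemma reach_large:
  assumes z: "z \<noteq> 0" and \<phi>: "0 \<le> \<phi>"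
  shows "\<exists>n w. of_nat N \<le> pop w \<and> (\<integral>\<^sup>+e. \<integral>\<^sup>+t. indicator {w} (fst t) \<partial>quenched n e (z, \<phi>) \<partial>S) \<noteq> 0"
proof (rule ccontr)
  assume no: "\<not> ?thesis"
  obtain i where i: "z $ i \<noteq> 0" using z by (auto simp: vec_eq_iff)
  have mi: "(\<lambda>t. indicator {w} (fst t) :: ennreal) \<in> borel_measurable litter_space" for w :: "nat ^ 'm"
    by (rule measurable_compose[OF measurable_fst_litter]) simp
  let ?R = "\<lambda>n e j. right_prod coord n e $ i $ j"
  have "AE e in S. ?R n e j \<le> of_nat N" for n j
  proof -
    let ?W = "{w :: nat ^ 'm. of_nat N \<le> pop w}"
    have W: "countable ?W" by (rule countable_subset[OF subset_UNIV countable_nat_vec])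
    have "AE e in S. (\<integral>\<^sup>+t. indicator {w} (fst t) \<partial>quenched n e (z, \<phi>)) = 0" if "w \<in> ?W" for w
    proof -
      have "(\<lambda>e. \<integral>\<^sup>+t. indicator {w} (fst t) \<partial>quenched n e (z, \<phi>)) \<in> borel_measurable env_seqs"
        by (rule measurable_quenched_integral'[OF mi]) (use \<phi> in simp)
      then show ?thesis using no that by (subst nn_integral_0_iff_AE[symmetric]) auto
    qed
    then have "AE e in S. \<forall>w\<in>?W. (\<integral>\<^sup>+t. indicator {w} (fst t) \<partial>quenched n e (z, \<phi>)) = 0"
      using W by (subst AE_ball_countable) auto
    then show ?thesis
      using AE_space
    proof eventually_elim
      case (elim e)
      then have e: "e \<in> space env_seqs" by simp
      interpret Q: prob_space "quenched n e (z, \<phi>)" by (rule prob_space_quenched[OF e]) (use \<phi> in simp)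
      have "AE t in quenched n e (z, \<phi>). fst t \<noteq> w" if "w \<in> ?W" for w
      proof -
        have "AE t in quenched n e (z, \<phi>). indicator {w} (fst t) = (0::ennreal)"
          using elim(1) that mi[of w] e \<phi> by (subst nn_integral_0_iff_AE[symmetric]) auto
        then show ?thesis by eventually_elim (auto simp: indicator_def split: if_splits)
      qed
      then have "AE t in quenched n e (z, \<phi>). \<forall>w\<in>?W. fst t \<noteq> w" using W by (subst AE_ball_countable) auto
      then have "AE t in quenched n e (z, \<phi>). pop (fst t) \<le> of_nat N"
        by eventually_elim (metis linear mem_Collect_eq)
      then have "(\<integral>\<^sup>+t. pop (fst t) \<partial>quenched n e (z, \<phi>)) \<le> (\<integral>\<^sup>+t. of_nat N \<partial>quenched n e (z, \<phi>))"
        by (rule nn_integral_mono_AE)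
      also have "\<dots> = of_nat N" using Q.emeasure_space_1 by simp
      finally have "(\<Sum>j\<in>UNIV. ?R n e j) \<le> of_nat N"
        using nn_integral_quenched_pop[OF e \<phi> i] by (rule order_trans[rotated])
      moreover have "?R n e j \<le> (\<Sum>j\<in>UNIV. ?R n e j)" by (rule member_le_sum) auto
      ultimately show ?case by (rule order_trans[rotated])
    qed
  qed
  note R = this
  obtain x where x: "\<kappa> < x" "x \<le> 1" "\<And>i. (\<integral>\<^sup>+e. mean_char coord 0 e $ i epowr x \<partial>S) < top"
    using char_moment_above by blast
  have x0: "0 < x" using x \<kappa> by simp
  let ?c = "\<Sum>j\<in>UNIV. \<integral>\<^sup>+e. mean_char coord 0 e $ j epowr x \<partial>S"
  \<comment> \<open>An entry to the power x is split into the power x - \<kappa>/2, bounded because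
    the entry is at most \<open>N\<close>, and the power \<kappa>/2, whose moments are summable over
    the generations.\<close>
  let ?N = "of_nat N epowr (x - \<kappa> / 2) :: ennreal"
  have summand: "(\<integral>\<^sup>+e. (right_prod coord k e *v mean_char coord k e) $ i epowr x \<partial>S) \<le> ?N * (growth (\<kappa> / 2) k * ?c)" for k
  proof -
    have [measurable]: "(\<lambda>e. mean_char coord 0 (\<lambda>l. e (l + k)) $ j) \<in> borel_measurable env_seqs" for j
      by (rule measurable_shifted[of "\<lambda>e. mean_char coord 0 e $ j"]) measurable
    have "(\<integral>\<^sup>+e. (right_prod coord k e *v mean_char coord k e) $ i epowr x \<partial>S) \<le>
      (\<integral>\<^sup>+e. (\<Sum>j\<in>UNIV. ?R k e j epowr x * mean_char coord 0 (\<lambda>l. e (l + k)) $ j epowr x) \<partial>S)"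
    proof (intro nn_integral_mono)
      fix e
      have "(right_prod coord k e *v mean_char coord k e) $ i epowr x \<le> (\<Sum>j\<in>UNIV. (?R k e j * mean_char coord k e $ j) epowr x)"
        unfolding matrix_vector_mult_def using epowr_sum_le_one[OF x0 x(2)] by simp
      then show "(right_prod coord k e *v mean_char coord k e) $ i epowr x \<le> (\<Sum>j\<in>UNIV. ?R k e j epowr x * mean_char coord 0 (\<lambda>l. e (l + k)) $ j epowr x)"
        using x0 by (simp add: epowr_mult mean_char_shift)
    qed
    also have "\<dots> = (\<Sum>j\<in>UNIV. \<integral>\<^sup>+e. ?R k e j epowr x * mean_char coord 0 (\<lambda>l. e (l + k)) $ j epowr x \<partial>S)"
      by (simp add: nn_integral_sum)
    also have "\<dots> = (\<Sum>j\<in>UNIV. (\<integral>\<^sup>+e. ?R k e j epowr x \<partial>S) * (\<integral>\<^sup>+e. mean_char coord 0 e $ j epowr x \<partial>S))"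
      by (intro sum.cong refl nn_integral_indep[where g="\<lambda>e. mean_char coord 0 e $ j epowr x" for j]) (simp_all add: right_prod_comb_seq)
    also have "\<dots> \<le> (\<Sum>j\<in>UNIV. (?N * growth (\<kappa> / 2) k) * (\<integral>\<^sup>+e. mean_char coord 0 e $ j epowr x \<partial>S))"
    proof (intro sum_mono mult_right_mono)
      fix j :: 'm
      have "(\<integral>\<^sup>+e. ?R k e j epowr x \<partial>S) \<le> (\<integral>\<^sup>+e. ?N * matnorm (right_prod coord k e) epowr (\<kappa> / 2) \<partial>S)"
      proof (rule nn_integral_mono_AE, use R[of k j] in eventually_elim)
        case (elim e)
        have "?R k e j epowr x = ?R k e j epowr (x - \<kappa> / 2) * ?R k e j epowr (\<kappa> / 2)"
          using epowr_add_exp[of "x - \<kappa> / 2" "\<kappa> / 2" "?R k e j"] x \<kappa> by simp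
        also have "\<dots> \<le> ?N * matnorm (right_prod coord k e) epowr (\<kappa> / 2)"
          using x \<kappa> elim by (intro mult_mono epowr_mono entry_le_matnorm) auto
        finally show ?case .
      qed
      then show "(\<integral>\<^sup>+e. ?R k e j epowr x \<partial>S) \<le> ?N * growth (\<kappa> / 2) k" by (simp add: growth_def nn_integral_cmult)
    qed simp
    also have "\<dots> = ?N * (growth (\<kappa> / 2) k * ?c)" by (simp add: sum_distrib_left mult.assoc)
    finally show ?thesis .
  qed
  have "(\<integral>\<^sup>+e. Xi coord e $ i epowr \<kappa> \<partial>S) \<le> (\<integral>\<^sup>+e. 1 + (\<Sum>k. (right_prod coord k e *v mean_char coord k e) $ i epowr x) \<partial>S)"
  proof (intro nn_integral_mono)
    fix e
    have "Xi coord e $ i epowr \<kappa> \<le> 1 + Xi coord e $ i epowr x" using x \<kappa> by (intro epowr_le_Suc) auto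
    also have "\<dots> \<le> 1 + (\<Sum>k. (right_prod coord k e *v mean_char coord k e) $ i epowr x)"
      unfolding Xi_def using x0 x by (simp add: add_left_mono epowr_suminf_le_one)
    finally show "Xi coord e $ i epowr \<kappa> \<le> 1 + (\<Sum>k. (right_prod coord k e *v mean_char coord k e) $ i epowr x)" .
  qed
  also have "\<dots> = 1 + (\<Sum>k. \<integral>\<^sup>+e. (right_prod coord k e *v mean_char coord k e) $ i epowr x \<partial>S)"
    by (simp add: nn_integral_add nn_integral_suminf)
  also have "\<dots> \<le> 1 + (\<Sum>k. ?N * (growth (\<kappa> / 2) k * ?c))"
    by (intro add_left_mono suminf_le summand) auto
  also have "\<dots> = 1 + ?N * ((\<Sum>k. growth (\<kappa> / 2) k) * ?c)" by simp
  also have "\<dots> < top"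
    using growth_summable[of "\<kappa> / 2"] \<kappa> x(3) by (simp add: ennreal_mult_less_top)
  finally show False by (simp add: Xi_critical)
qed

text \<open>With positive probability the population reaches some large \<open>w\<close>; restarted
  there in a fresh environment, the process has unbounded \<kappa>-th moments, and the
  characteristic accumulated before only increases them.\<close>

lemma annealed_critical_infinite:
  assumes z: "z \<noteq> 0" and \<phi>: "0 \<le> \<phi>"
  shows "(SUP n. \<integral>\<^sup>+e. \<integral>\<^sup>+t. ennreal (snd t) epowr \<kappa> \<partial>quenched n e (z, \<phi>) \<partial>S) = top"
proof -
  let ?A = "\<lambda>n z \<phi>. \<integral>\<^sup>+e. \<integral>\<^sup>+t. ennreal (snd t) epowr \<kappa> \<partial>quenched n e (z, \<phi>) \<partial>S"
  obtain N where N: "\<And>w. of_nat N \<le> pop w \<Longrightarrow> (SUP n. ?A n w 0) = top"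
    using large_start_infinite by blast
  obtain n w where w: "of_nat N \<le> pop w"
    and p: "(\<integral>\<^sup>+e. \<integral>\<^sup>+t. indicator {w} (fst t) \<partial>quenched n e (z, \<phi>) \<partial>S) \<noteq> 0" (is "?p \<noteq> 0")
    using reach_large[OF z \<phi>] by blast
  have mi [measurable]: "(\<lambda>t. indicator {w} (fst t) :: ennreal) \<in> borel_measurable litter_space"
    by (rule measurable_compose[OF measurable_fst_litter]) simp
  have gm: "(\<lambda>t. ennreal (snd t) epowr \<kappa>) \<in> borel_measurable litter_space" by measurable
  have "?p * ?A k w 0 \<le> ?A (n + k) z \<phi>" for k
  proof -
    have [measurable]: "(\<lambda>e. \<integral>\<^sup>+t. indicator {w} (fst t) \<partial>quenched n e (z, \<phi>)) \<in> borel_measurable env_seqs"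
      by (rule measurable_quenched_integral'[OF mi]) (use \<phi> in simp)
    have "?p * ?A k w 0 = (\<integral>\<^sup>+e. (\<integral>\<^sup>+t. indicator {w} (fst t) \<partial>quenched n e (z, \<phi>)) * ?A k w 0 \<partial>S)"
      by (simp add: nn_integral_multc)
    also have "\<dots> = (\<integral>\<^sup>+e. \<integral>\<^sup>+t. indicator {w} (fst t) * ?A k w 0 \<partial>quenched n e (z, \<phi>) \<partial>S)"
      using \<phi> by (intro nn_integral_cong) (simp add: nn_integral_multc)
    also have "\<dots> \<le> (\<integral>\<^sup>+e. \<integral>\<^sup>+s. \<integral>\<^sup>+e'. \<integral>\<^sup>+t. ennreal (snd t) epowr \<kappa> \<partial>quenched k e' s \<partial>S \<partial>quenched n e (z, \<phi>) \<partial>S)"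
    proof (intro nn_integral_mono)
      fix e s assume "e \<in> space S" "s \<in> space (quenched n e (z, \<phi>))"
      then have s: "0 \<le> snd s" using \<phi> by simp
      have "?A k w 0 \<le> ?A k w (snd s)"
      proof (intro nn_integral_mono)
        fix e' assume "e' \<in> space S"
        then have e': "e' \<in> space env_seqs" by simp
        have "(\<integral>\<^sup>+t. ennreal (snd t) epowr \<kappa> \<partial>quenched k e' (w, 0)) \<le>
           (\<integral>\<^sup>+t. ennreal (snd ((0, snd s) + t)) epowr \<kappa> \<partial>quenched k e' (w, 0))"
          using s \<kappa> by (intro nn_integral_mono epowr_mono ennreal_leI) auto
        also have "\<dots> = (\<integral>\<^sup>+t. ennreal (snd t) epowr \<kappa> \<partial>quenched k e' (w, snd s))"
          by (rule nn_integral_quenched_shift[OF e' gm s, symmetric])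
        finally show "(\<integral>\<^sup>+t. ennreal (snd t) epowr \<kappa> \<partial>quenched k e' (w, 0)) \<le> (\<integral>\<^sup>+t. ennreal (snd t) epowr \<kappa> \<partial>quenched k e' (w, snd s))" .
      qed
      then show "indicator {w} (fst s) * ?A k w 0 \<le> (\<integral>\<^sup>+e'. \<integral>\<^sup>+t. ennreal (snd t) epowr \<kappa> \<partial>quenched k e' s \<partial>S)"
        by (cases s) (auto simp: indicator_def)
    qed
    also have "\<dots> = ?A (n + k) z \<phi>"
      by (rule annealed_markov[symmetric]) (use \<phi> in simp_all)
    finally show ?thesis .
  qed
  then have "(SUP k. ?p * ?A k w 0) \<le> (SUP n. ?A n z \<phi>)"
    by (intro SUP_mono bexI[of _ "n + k" for k]) auto
  also have "(SUP k. ?p * ?A k w 0) = ?p * (SUP k. ?A k w 0)" by (rule SUP_mult_left_ennreal[symmetric])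
  also have "\<dots> = top" unfolding N[OF w] using p by (simp add: ennreal_mult_top)
  finally show ?thesis by (simp add: top_unique)
qed

end

section \<open>Moments from tails\<close>

definition dyadic_incr :: "real \<Rightarrow> nat \<Rightarrow> real" where
  "dyadic_incr y n = (2 ^ Suc n) powr y - (2 ^ n) powr y"

lemma dyadic_incr_nonneg: "0 < y \<Longrightarrow> 0 \<le> dyadic_incr y n"
  by (simp add: dyadic_incr_def powr_mono2)

lemma sum_dyadic_incr: "(\<Sum>n<N. dyadic_incr y n) = (2 ^ N) powr y - 1"
  unfolding dyadic_incr_def by (subst sum_lessThan_telescope) simp

text \<open>A layer-cake formula with thresholds 2^n: it sees the tail along one sequence only.
  Rounding up to a power of 2 costs the factor 2^y in the second bound.\<close>

lemma dyadic_decomposition: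
  fixes a :: ennreal
  assumes y: "0 < y"
  shows "a epowr y \<le> 1 + (\<Sum>n. ennreal (dyadic_incr y n) * indicator {b. ennreal (2 ^ n) < b} a)" (is "?U a")
    and "(\<Sum>n. ennreal (dyadic_incr y n) * indicator {b. ennreal (2 ^ n) < b} a) \<le> ennreal (2 powr y) * a epowr y" (is "?L a")
proof -
  let ?t = "\<lambda>a n. ennreal (dyadic_incr y n) * indicator {b. ennreal (2 ^ n) < b} a"
  have real: "?U (ennreal r) \<and> ?L (ennreal r)" if r: "0 \<le> r" for r
  proof -
    obtain n0 where "r < 2 ^ n0" using real_arch_pow[of 2 r] by auto
    then have ex: "\<exists>n. r \<le> 2 ^ n" by (auto intro: less_imp_le)
    \<comment> \<open>The thresholds below r are exactly those with n < K, so the series telescopes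
      to a power of 2^K; minimality of K gives 2^K \<le> 2r if K > 0.\<close>
    define K where "K = (LEAST n. r \<le> 2 ^ n)"
    have K: "r \<le> 2 ^ K" unfolding K_def using ex by (rule LeastI_ex)
    have lt: "2 ^ n < r \<longleftrightarrow> n < K" for n
    proof
      show "n < K \<Longrightarrow> 2 ^ n < r" unfolding K_def using not_less_Least by (metis not_le)
      show "n < K" if "2 ^ n < r"
      proof (rule ccontr)
        assume "\<not> n < K"
        then have "(2::real) ^ K \<le> 2 ^ n" by (intro power_increasing) auto
        then show False using K that by linarith
      qed
    qed
    have "(\<Sum>n. ?t (ennreal r) n) = (\<Sum>n<K. ?t (ennreal r) n)"
      by (rule suminf_finite) (auto simp: indicator_def ennreal_less_iff lt)
    also have "\<dots> = (\<Sum>n<K. ennreal (dyadic_incr y n))"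
      by (intro sum.cong refl) (auto simp: indicator_def ennreal_less_iff lt)
    also have "\<dots> = ennreal ((2 ^ K) powr y - 1)"
      using dyadic_incr_nonneg[OF y] by (simp add: sum_ennreal sum_dyadic_incr)
    finally have sum: "(\<Sum>n. ?t (ennreal r) n) = ennreal ((2 ^ K) powr y - 1)" .
    have K1: "1 \<le> (2 ^ K) powr y" using y by (simp add: ge_one_powr_ge_zero)
    have "ennreal (r powr y) \<le> ennreal (1 + ((2 ^ K) powr y - 1))"
      using K r y by (intro ennreal_leI) (simp add: powr_mono2)
    then have U: "?U (ennreal r)"
      unfolding sum using K1 y r by (subst (asm) ennreal_plus) (simp_all add: epowr_ennreal)
    have "(2 ^ K) powr y - 1 \<le> 2 powr y * r powr y"
    proof (cases K)
      case (Suc k)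
      then have "2 ^ K \<le> 2 * r" using lt[of k] by simp
      then have "(2 ^ K) powr y \<le> (2 * r) powr y" using y by (intro powr_mono2) auto
      then show ?thesis using r by (simp add: powr_mult)
    qed simp
    then have "ennreal ((2 ^ K) powr y - 1) \<le> ennreal (2 powr y * r powr y)" by (rule ennreal_leI)
    then have "?L (ennreal r)" unfolding sum using y r by (simp add: epowr_ennreal ennreal_mult)
    with U show ?thesis by simp
  qed
  \<comment> \<open>The finite case at r = k^(1/y), whose y-th power is k, shows that the series at
    infinity exceeds every k.\<close>
  have "?U top"
  proof -
    have "of_nat k \<le> 1 + (\<Sum>n. ?t top n)" for k
    proof -
      have "ennreal (real k powr (1 / y)) epowr y \<le> 1 + (\<Sum>n. ?t (ennreal (real k powr (1 / y))) n)"
        using real[of "real k powr (1 / y)"] by simp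
      also have "\<dots> \<le> 1 + (\<Sum>n. ?t top n)"
        by (intro add_left_mono suminf_le mult_left_mono) (auto simp: indicator_def)
      also have "ennreal (real k powr (1 / y)) epowr y = of_nat k"
        using y by (simp add: epowr_ennreal powr_powr ennreal_of_nat_eq_real_of_nat)
      finally show ?thesis .
    qed
    then have "1 + (\<Sum>n. ?t top n) = top"
      using ennreal_Ex_less_of_nat by (metis less_top not_le)
    then show ?thesis by (metis top_greatest)
  qed
  moreover have "?L top" using y by (simp add: ennreal_mult_top)
  ultimately show "?U a" "?L a" using real by (cases a; simp)+
qed

context prob_space
begin

lemma tail_nn_integral:
  assumes [measurable]: "f \<in> borel_measurable M" and y: "0 < y"
  shows "(\<integral>\<^sup>+x. f x epowr y \<partial>M) \<le> 1 + (\<Sum>n. ennreal (dyadic_incr y n * prob {x \<in> space M. ennreal (2 ^ n) < f x}))"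
    and "(\<Sum>n. ennreal (dyadic_incr y n * prob {x \<in> space M. ennreal (2 ^ n) < f x})) \<le> ennreal (2 powr y) * (\<integral>\<^sup>+x. f x epowr y \<partial>M)"
proof -
  have eq: "(\<integral>\<^sup>+x. (\<Sum>n. ennreal (dyadic_incr y n) * indicator {b. ennreal (2 ^ n) < b} (f x)) \<partial>M) =
    (\<Sum>n. ennreal (dyadic_incr y n * prob {x \<in> space M. ennreal (2 ^ n) < f x}))"
  proof -
    have [measurable]: "(\<lambda>x. indicator {b. ennreal (2 ^ n) < b} (f x) :: ennreal) \<in> borel_measurable M" for n
      by (rule measurable_compose[OF assms(1)]) simp
    have "(\<integral>\<^sup>+x. indicator {b. ennreal (2 ^ n) < b} (f x) \<partial>M) = ennreal (prob {x \<in> space M. ennreal (2 ^ n) < f x})" for n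
    proof -
      have "(\<integral>\<^sup>+x. indicator {b. ennreal (2 ^ n) < b} (f x) \<partial>M) = (\<integral>\<^sup>+x. indicator {x \<in> space M. ennreal (2 ^ n) < f x} x \<partial>M)"
        by (intro nn_integral_cong) (simp add: indicator_def)
      then show ?thesis by (simp add: emeasure_eq_measure)
    qed
    then show ?thesis
      using dyadic_incr_nonneg[OF y] by (simp add: nn_integral_suminf nn_integral_cmult ennreal_mult)
  qed
  have [measurable]: "(\<lambda>x. indicator {b. ennreal (2 ^ n) < b} (f x) :: ennreal) \<in> borel_measurable M" for n
    by (rule measurable_compose[OF assms(1)]) simp
  have "(\<integral>\<^sup>+x. f x epowr y \<partial>M) \<le> (\<integral>\<^sup>+x. 1 + (\<Sum>n. ennreal (dyadic_incr y n) * indicator {b. ennreal (2 ^ n) < b} (f x)) \<partial>M)"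
    by (intro nn_integral_mono dyadic_decomposition(1) y)
  also have "\<dots> = 1 + (\<integral>\<^sup>+x. (\<Sum>n. ennreal (dyadic_incr y n) * indicator {b. ennreal (2 ^ n) < b} (f x)) \<partial>M)"
    by (simp add: nn_integral_add emeasure_space_1)
  finally show "(\<integral>\<^sup>+x. f x epowr y \<partial>M) \<le> 1 + (\<Sum>n. ennreal (dyadic_incr y n * prob {x \<in> space M. ennreal (2 ^ n) < f x}))"
    by (simp only: eq)
  have "(\<integral>\<^sup>+x. (\<Sum>n. ennreal (dyadic_incr y n) * indicator {b. ennreal (2 ^ n) < b} (f x)) \<partial>M) \<le> (\<integral>\<^sup>+x. ennreal (2 powr y) * f x epowr y \<partial>M)"
    by (intro nn_integral_mono dyadic_decomposition(2) y)
  then show "(\<Sum>n. ennreal (dyadic_incr y n * prob {x \<in> space M. ennreal (2 ^ n) < f x})) \<le> ennreal (2 powr y) * (\<integral>\<^sup>+x. f x epowr y \<partial>M)"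
    unfolding eq by (simp add: nn_integral_cmult)
qed

lemma tail_moment_finite:
  assumes f: "f \<in> borel_measurable M" and y: "0 < y" "y < \<kappa>"
    and tail: "(\<lambda>n. (2 ^ n) powr \<kappa> * prob {x \<in> space M. ennreal (2 ^ n) < f x}) \<longlonglongrightarrow> L"
  shows "(\<integral>\<^sup>+x. f x epowr y \<partial>M) < \<infinity>"
proof -
  let ?p = "\<lambda>n. prob {x \<in> space M. ennreal (2 ^ n) < f x}"
  obtain B where B: "\<And>n. norm ((2 ^ n) powr \<kappa> * ?p n) \<le> B"
    using convergent_imp_Bseq[OF convergentI[OF tail]] by (auto simp: Bseq_def)
  have B0: "0 \<le> B" using order_trans[OF norm_ge_zero B[of 0]] .
  \<comment> \<open>The dyadic terms of order y are bounded by a constant times the n-th power of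
    this ratio, which is less than 1 because y < \<kappa>.\<close>
  define q :: real where "q = 2 powr (y - \<kappa>)"
  have q: "0 \<le> q" "q < 1" using y powr_less_mono[of "y - \<kappa>" 0 2] by (auto simp: q_def)
  have le: "dyadic_incr y n * ?p n \<le> 2 powr y * B * q ^ n" for n
  proof -
    have p2: "(2 ^ n :: real) powr a = (2 powr a) ^ n" for a
      by (simp add: powr_realpow[symmetric] powr_powr mult.commute)
    have "(2 ^ n) powr y = (2 ^ n) powr \<kappa> * q ^ n"
      unfolding p2 q_def by (simp add: power_mult_distrib[symmetric] powr_add[symmetric])
    then have "dyadic_incr y n * ?p n \<le> (2 powr y * ((2 ^ n) powr \<kappa> * q ^ n)) * ?p n"
      unfolding dyadic_incr_def using q by (intro mult_right_mono) (auto simp: powr_mult)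
    also have "\<dots> = 2 powr y * ((2 ^ n) powr \<kappa> * ?p n) * q ^ n" by simp
    also have "\<dots> \<le> 2 powr y * B * q ^ n"
      using B[of n] q by (intro mult_right_mono mult_left_mono) auto
    finally show ?thesis .
  qed
  have "(\<integral>\<^sup>+x. f x epowr y \<partial>M) \<le> 1 + (\<Sum>n. ennreal (dyadic_incr y n * ?p n))"
    by (rule tail_nn_integral[OF f y(1)])
  also have "\<dots> \<le> 1 + (\<Sum>n. ennreal (2 powr y * B * q ^ n))"
    by (intro add_left_mono suminf_le ennreal_leI le) auto
  also have "(\<Sum>n. ennreal (2 powr y * B * q ^ n)) = ennreal (\<Sum>n. 2 powr y * B * q ^ n)"
    using q B0 by (intro suminf_ennreal2 summable_mult summable_geometric) auto
  finally show ?thesis by (simp add: le_less_trans)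
qed

text \<open>If the moment were finite, it would dominate 2^(n\<kappa>) times the indicator of {f >
  2^n}, which tends to 0 where f is finite; the tail limit would then be 0.\<close>

lemma tail_moment_infinite:
  assumes f [measurable]: "f \<in> borel_measurable M" and \<kappa>: "0 < \<kappa>" and L: "L \<noteq> 0"
    and tail: "(\<lambda>n. (2 ^ n) powr \<kappa> * prob {x \<in> space M. ennreal (2 ^ n) < f x}) \<longlonglongrightarrow> L"
  shows "(\<integral>\<^sup>+x. f x epowr \<kappa> \<partial>M) = top"
proof (rule ccontr)
  assume fin: "(\<integral>\<^sup>+x. f x epowr \<kappa> \<partial>M) \<noteq> top"
  let ?p = "\<lambda>n. prob {x \<in> space M. ennreal (2 ^ n) < f x}"
  let ?g = "\<lambda>n x. ennreal ((2 ^ n) powr \<kappa>) * indicator {x \<in> space M. ennreal (2 ^ n) < f x} x"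
  have "(\<lambda>n. \<integral>\<^sup>+x. ?g n x \<partial>M) \<longlonglongrightarrow> (\<integral>\<^sup>+x. 0 \<partial>M)"
  proof (rule nn_integral_dominated_convergence[where w="\<lambda>x. f x epowr \<kappa>"])
    show "(\<integral>\<^sup>+x. f x epowr \<kappa> \<partial>M) < \<infinity>" using fin by (simp add: less_top)
    have "AE x in M. f x epowr \<kappa> \<noteq> \<infinity>" using fin by (intro nn_integral_noteq_infinite) auto
    then show "AE x in M. (\<lambda>n. ?g n x) \<longlonglongrightarrow> 0"
    proof eventually_elim
      case (elim x)
      then have "f x \<noteq> \<infinity>" using epowr_eq_top_iff[OF \<kappa>, of "f x"] by simp
      then obtain r where r: "0 \<le> r" "f x = ennreal r" by (cases "f x") auto
      obtain n0 where n0: "r < 2 ^ n0" using real_arch_pow[of 2 r] by auto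
      have "?g n x = 0" if "n \<ge> n0" for n
      proof -
        have "(2::real) ^ n0 \<le> 2 ^ n" using that by (intro power_increasing) auto
        then have "\<not> 2 ^ n < r" using n0 by linarith
        then show ?thesis using r by (simp add: indicator_def ennreal_less_iff)
      qed
      then have "eventually (\<lambda>n. ?g n x = 0) sequentially" by (auto simp: eventually_sequentially)
      then show ?case by (rule tendsto_eventually)
    qed
    show "AE x in M. ?g n x \<le> f x epowr \<kappa>" for n
    proof (rule AE_I2)
      fix x
      have "ennreal ((2 ^ n) powr \<kappa>) \<le> f x epowr \<kappa>" if "ennreal (2 ^ n) < f x"
        using epowr_mono[of \<kappa> "ennreal (2 ^ n)" "f x"] that \<kappa> by (simp add: epowr_ennreal less_imp_le)
      then show "?g n x \<le> f x epowr \<kappa>" by (simp add: indicator_def)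
    qed
  qed measurable
  moreover have "(\<integral>\<^sup>+x. ?g n x \<partial>M) = ennreal ((2 ^ n) powr \<kappa> * ?p n)" for n
    by (simp add: nn_integral_cmult_indicator emeasure_eq_measure ennreal_mult)
  ultimately have "(\<lambda>n. ennreal ((2 ^ n) powr \<kappa> * ?p n)) \<longlonglongrightarrow> ennreal 0" by simp
  then have "(\<lambda>n. (2 ^ n) powr \<kappa> * ?p n) \<longlonglongrightarrow> 0" by (subst (asm) tendsto_ennreal_iff) auto
  then show False using tail L LIMSEQ_unique by blast
qed

text \<open>From some threshold on, the two tails differ at most by a constant factor. The terms
  before it contribute at most 2^N, since y \<le> 1, so that the constant does not depend on
  y.\<close>

lemma tail_moment_comparable:
  assumes f: "f \<in> borel_measurable M" and g: "g \<in> borel_measurable M" and \<kappa>: "\<kappa> \<le> 1" and K: "0 < K"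
    and tf: "(\<lambda>n. (2 ^ n) powr \<kappa> * prob {x \<in> space M. ennreal (2 ^ n) < f x}) \<longlonglongrightarrow> L"
    and tg: "(\<lambda>n. (2 ^ n) powr \<kappa> * prob {x \<in> space M. ennreal (2 ^ n) < g x}) \<longlonglongrightarrow> K"
  shows "\<exists>C<top. \<forall>y. 0 < y \<longrightarrow> y < \<kappa> \<longrightarrow> (\<integral>\<^sup>+x. f x epowr y \<partial>M) \<le> C * (1 + (\<integral>\<^sup>+x. g x epowr y \<partial>M))"
proof -
  let ?p = "\<lambda>n. prob {x \<in> space M. ennreal (2 ^ n) < f x}" and ?q = "\<lambda>n. prob {x \<in> space M. ennreal (2 ^ n) < g x}"
  obtain B where B: "\<And>n. norm ((2 ^ n) powr \<kappa> * ?p n) \<le> B"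
    using convergent_imp_Bseq[OF convergentI[OF tf]] by (auto simp: Bseq_def)
  have B0: "0 \<le> B" using order_trans[OF norm_ge_zero B[of 0]] .
  have "eventually (\<lambda>n. K / 2 < (2 ^ n) powr \<kappa> * ?q n) sequentially"
    using K by (intro order_tendstoD(1)[OF tg]) simp
  then obtain N where N: "\<And>n. N \<le> n \<Longrightarrow> K / 2 < (2 ^ n) powr \<kappa> * ?q n" by (auto simp: eventually_sequentially)
  \<comment> \<open>\<open>B\<close> bounds the normalized tail of \<open>f\<close> from above, and
    K/2 bounds that of \<open>g\<close> from below for large thresholds.\<close>
  define c where "c = 2 * B / K"
  have c0: "0 \<le> c" using B0 K by (simp add: c_def)
  have le: "?p n \<le> c * ?q n" if "N \<le> n" for n
  proof -
    have "(2 ^ n) powr \<kappa> * ?p n \<le> B" using B[of n] by simp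
    also have "B = c * (K / 2)" using K by (simp add: c_def)
    also have "\<dots> \<le> c * ((2 ^ n) powr \<kappa> * ?q n)" using N[OF that] c0 by (intro mult_left_mono) auto
    finally have "(2 ^ n) powr \<kappa> * ?p n \<le> (2 ^ n) powr \<kappa> * (c * ?q n)" by (simp add: mult_ac)
    then show ?thesis by (simp add: mult_le_cancel_left_pos)
  qed
  define C where "C = 1 + ennreal (2 ^ N) + ennreal c * ennreal 2"
  have "(\<integral>\<^sup>+x. f x epowr y \<partial>M) \<le> C * (1 + (\<integral>\<^sup>+x. g x epowr y \<partial>M))" if y: "0 < y" "y < \<kappa>" for y
  proof -
    note d0 = dyadic_incr_nonneg[OF y(1)]
    have y1: "y \<le> 1" using y \<kappa> by simp
    have term_le: "ennreal (dyadic_incr y n * ?p n) \<le> ennreal (dyadic_incr y n) * indicator {..<N} n + ennreal c * ennreal (dyadic_incr y n * ?q n)" for n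
    proof (cases "n < N")
      case True
      have "dyadic_incr y n * ?p n \<le> dyadic_incr y n" using d0[of n] by (intro mult_right_le_one_le) auto
      then show ?thesis using True by (simp add: add_increasing2 ennreal_leI)
    next
      case False
      then have "dyadic_incr y n * ?p n \<le> c * (dyadic_incr y n * ?q n)"
        using mult_left_mono[OF le d0[of n]] by (simp add: mult_ac)
      then have "ennreal (dyadic_incr y n * ?p n) \<le> ennreal (c * (dyadic_incr y n * ?q n))" by (rule ennreal_leI)
      then show ?thesis using False c0 d0[of n] by (simp add: ennreal_mult)
    qed
    have "(\<Sum>n. ennreal (dyadic_incr y n) * indicator {..<N} n) = (\<Sum>n<N. ennreal (dyadic_incr y n) * indicator {..<N} n)"
      by (rule suminf_finite) auto
    also have "\<dots> = ennreal ((2 ^ N) powr y - 1)"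
      using d0 by (simp add: sum_ennreal sum_dyadic_incr)
    also have "\<dots> \<le> ennreal (2 ^ N)"
    proof -
      have "(2 ^ N) powr y \<le> (2 ^ N :: real) powr 1" using y1 by (intro powr_mono) auto
      then have "(2 ^ N :: real) powr y - 1 \<le> 2 ^ N" by simp
      then show ?thesis by (rule ennreal_leI)
    qed
    finally have head: "(\<Sum>n. ennreal (dyadic_incr y n) * indicator {..<N} n) \<le> ennreal (2 ^ N)" .
    have "(\<integral>\<^sup>+x. f x epowr y \<partial>M) \<le> 1 + (\<Sum>n. ennreal (dyadic_incr y n * ?p n))"
      by (rule tail_nn_integral[OF f y(1)])
    also have "\<dots> \<le> 1 + (\<Sum>n. ennreal (dyadic_incr y n) * indicator {..<N} n + ennreal c * ennreal (dyadic_incr y n * ?q n))"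
      by (intro add_left_mono suminf_le term_le) auto
    also have "\<dots> = 1 + ((\<Sum>n. ennreal (dyadic_incr y n) * indicator {..<N} n) + ennreal c * (\<Sum>n. ennreal (dyadic_incr y n * ?q n)))"
      by (simp add: suminf_add[symmetric])
    also have "\<dots> \<le> 1 + (ennreal (2 ^ N) + ennreal c * (ennreal 2 * (\<integral>\<^sup>+x. g x epowr y \<partial>M)))"
    proof (intro add_left_mono add_mono head mult_left_mono)
      have "ennreal (2 powr y) \<le> ennreal 2" using powr_mono[of y 1 2] y1 by (intro ennreal_leI) simp
      then show "(\<Sum>n. ennreal (dyadic_incr y n * ?q n)) \<le> ennreal 2 * (\<integral>\<^sup>+x. g x epowr y \<partial>M)"
        by (intro order_trans[OF tail_nn_integral(2)[OF g y(1)]] mult_right_mono) auto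
    qed simp
    also have "\<dots> = (1 + ennreal (2 ^ N)) * 1 + (ennreal c * ennreal 2) * (\<integral>\<^sup>+x. g x epowr y \<partial>M)"
      by (simp add: mult.assoc add.assoc)
    also have "\<dots> \<le> C * 1 + C * (\<integral>\<^sup>+x. g x epowr y \<partial>M)"
    proof (intro add_mono mult_right_mono)
      show "1 + ennreal (2 ^ N) \<le> C" unfolding C_def by (rule add_increasing2) auto
      show "ennreal c * ennreal 2 \<le> C" unfolding C_def by (rule add_increasing) auto
    qed simp_all
    finally show ?thesis by (simp only: distrib_left)
  qed
  moreover have "C < top" by (simp add: C_def ennreal_mult_less_top)
  ultimately show ?thesis by blast
qed

end

section \<open>Transfer to the process\<close>

context branching_in_environment
begin

definition env_dist :: "(nat \<Rightarrow> 'm \<Rightarrow> 'm litter measure) measure" where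
  "env_dist = distr M env_seqs envs"

lemma nn_integral_env_dist:
  "g \<in> borel_measurable env_seqs \<Longrightarrow> (\<integral>\<^sup>+e. g e \<partial>env_dist) = (\<integral>\<^sup>+\<omega>. g (envs \<omega>) \<partial>M)"
  unfolding env_dist_def by (rule nn_integral_distr) measurable

lemma prob_env_dist: "prob_space env_dist"
  unfolding env_dist_def by (rule prob_space_distr) measurable

text \<open>An i.i.d. sequence has a product law with equal factors, and \<open>PiM_comb_seq\<close>
  says that such a law is invariant under splicing.\<close>

lemma env_law_env_dist: "env_law env_dist"
proof -
  let ?R = "distr M env_space (F 0)"
  have iid: "indep_vars (\<lambda>n. env_space) F UNIV" "\<And>n. distr M env_space (F n) = ?R"
    using process unfolding mbprcre_def iid_environment_def by blast+
  have "distr M (\<Pi>\<^sub>M i\<in>UNIV. env_space) (\<lambda>\<omega>. \<lambda>i\<in>UNIV. F i \<omega>) = (\<Pi>\<^sub>M i\<in>UNIV. distr M env_space (F i))"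
    by (rule indep_vars_iff_distr_eq_PiM[THEN iffD1, OF _ measurable_F iid(1)]) simp
  also have "\<dots> = (\<Pi>\<^sub>M i\<in>UNIV. ?R)" by (intro PiM_cong refl iid(2))
  finally have S_eq: "env_dist = (\<Pi>\<^sub>M i\<in>UNIV. ?R)"
    by (simp add: env_dist_def env_seqs_def envs_def[abs_def] restrict_UNIV)
  interpret R: prob_space ?R by (rule prob_space_distr[OF measurable_F])
  interpret sequence_space ?R ..
  have sets_eq: "sets (\<Pi>\<^sub>M i\<in>(UNIV::nat set). ?R) = sets env_seqs"
    unfolding env_seqs_def by (rule sets_PiM_cong) auto
  have meas: "measurable (\<Pi>\<^sub>M i\<in>(UNIV::nat set). ?R) (borel :: ennreal measure) = measurable env_seqs borel"
    by (rule measurable_cong_sets[OF sets_eq refl])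
  show ?thesis
  proof (intro env_law.intro env_law_axioms.intro)
    show "prob_space env_dist" by (rule prob_env_dist)
    show "sets env_dist = sets env_seqs" by (simp add: env_dist_def)
    fix h :: "(nat \<Rightarrow> 'm \<Rightarrow> 'm litter measure) \<Rightarrow> ennreal" and n assume "h \<in> borel_measurable env_seqs"
    then have h: "h \<in> borel_measurable (\<Pi>\<^sub>M i\<in>(UNIV::nat set). ?R)" by (simp only: meas)
    have "(\<integral>\<^sup>+e. h e \<partial>(\<Pi>\<^sub>M i\<in>(UNIV::nat set). ?R)) = (\<integral>\<^sup>+x. (\<lambda>(e, e'). h (comb_seq n e e')) x \<partial>((\<Pi>\<^sub>M i\<in>UNIV. ?R) \<Otimes>\<^sub>M (\<Pi>\<^sub>M i\<in>UNIV. ?R)))"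
      by (subst PiM_comb_seq[symmetric, of n], subst nn_integral_distr[OF measurable_comb_seq])
        (use h in \<open>simp_all add: case_prod_beta'\<close>)
    also have "\<dots> = (\<integral>\<^sup>+e. \<integral>\<^sup>+e'. h (comb_seq n e e') \<partial>(\<Pi>\<^sub>M i\<in>UNIV. ?R) \<partial>(\<Pi>\<^sub>M i\<in>UNIV. ?R))"
      by (subst P.nn_integral_fst[symmetric]) (use measurable_compose[OF measurable_comb_seq h] in \<open>simp_all add: case_prod_beta'\<close>)
    finally show "(\<integral>\<^sup>+e. h e \<partial>env_dist) = (\<integral>\<^sup>+e. \<integral>\<^sup>+e'. h (comb_seq n e e') \<partial>env_dist \<partial>env_dist)"
      by (simp only: S_eq)
  qed
qed

lemma mean_matrix_envs: "mean_matrix F n \<omega> = mean_matrix coord n (envs \<omega>)"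
  and mean_char_envs: "mean_char F n \<omega> = mean_char coord n (envs \<omega>)"
  by (simp_all add: mean_matrix_def mean_char_def envs_def)

lemma Xi_envs: "Xi F \<omega> = Xi coord (envs \<omega>)"
proof -
  have "right_prod F n \<omega> = right_prod coord n (envs \<omega>)" for n
    by (induction n) (simp_all add: mean_matrix_envs)
  then show ?thesis by (simp add: Xi_def mean_char_envs)
qed

lemma nn_integral_litter:
  assumes g: "g \<in> borel_measurable litter_space"
  shows "(\<integral>\<^sup>+\<omega>. g (X 0 i k \<omega>) \<partial>M) = (\<integral>\<^sup>+e. \<integral>\<^sup>+x. g x \<partial>e 0 i \<partial>env_dist)"
proof -
  have "(\<lambda>(v, x). g x) \<in> borel_measurable (env_seqs \<Otimes>\<^sub>M litter_space)"
    using measurable_compose[OF measurable_snd g] by (simp add: case_prod_beta')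
  from next_litter[OF _ measurable_envs_past this, of "(0, i, k)" "{}"]
  have "(\<integral>\<^sup>+\<omega>. g (X 0 i k \<omega>) \<partial>M) = (\<integral>\<^sup>+\<omega>. \<integral>\<^sup>+x. g x \<partial>envs \<omega> 0 i \<partial>M)"
    by (simp add: litters_def law_def)
  also have "\<dots> = (\<integral>\<^sup>+e. \<integral>\<^sup>+x. g x \<partial>e 0 i \<partial>env_dist)"
    by (rule nn_integral_env_dist[symmetric, OF measurable_law_integral[OF g]])
  finally show ?thesis .
qed

lemma litter_nonneg: "\<omega> \<in> space M \<Longrightarrow> 0 \<le> snd (X n i k \<omega>)"
  using measurable_space[OF measurable_litters, of \<omega> "(n, i, k)"] by (simp add: litters_def)

lemma Phi_lim_SUP:
  assumes \<omega>: "\<omega> \<in> space M"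
  shows "Phi_lim X z \<phi> \<omega> = (SUP n. ennreal (Phi X z \<phi> n \<omega>))" "incseq (\<lambda>n. ennreal (Phi X z \<phi> n \<omega>))"
proof -
  show inc: "incseq (\<lambda>n. ennreal (Phi X z \<phi> n \<omega>))"
    by (rule incseq_SucI, rule ennreal_leI) (simp add: sum_nonneg litter_nonneg[OF \<omega>])
  show "Phi_lim X z \<phi> \<omega> = (SUP n. ennreal (Phi X z \<phi> n \<omega>))"
    unfolding Phi_lim_def by (rule limI[OF LIMSEQ_SUP[OF inc]])
qed

lemma measurable_Phi [measurable]: "0 \<le> \<phi> \<Longrightarrow> Phi X z \<phi> n \<in> borel_measurable M"
  using measurable_compose[OF measurable_state measurable_snd_litter, of \<phi> z n] by (simp add: state_def)

text \<open>The bridge from the process to the kernels: the characteristic increases with time, so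
  monotone convergence reduces its limit to the states at finite times.\<close>

lemma Phi_lim_moment:
  assumes \<phi>: "0 \<le> \<phi>" and x: "0 < x"
  shows "(\<integral>\<^sup>+\<omega>. Phi_lim X z \<phi> \<omega> epowr x \<partial>M) =
    (SUP n. \<integral>\<^sup>+e. \<integral>\<^sup>+t. ennreal (snd t) epowr x \<partial>quenched n e (z, \<phi>) \<partial>env_dist)"
proof -
  note [measurable] = measurable_Phi[OF \<phi>]
  have "(\<integral>\<^sup>+\<omega>. Phi_lim X z \<phi> \<omega> epowr x \<partial>M) = (\<integral>\<^sup>+\<omega>. (SUP n. ennreal (Phi X z \<phi> n \<omega>) epowr x) \<partial>M)"
    using x by (intro nn_integral_cong) (simp add: Phi_lim_SUP(1) epowr_SUP)
  also have "\<dots> = (SUP n. \<integral>\<^sup>+\<omega>. ennreal (Phi X z \<phi> n \<omega>) epowr x \<partial>M)"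
  proof (rule nn_integral_monotone_convergence_SUP_AE)
    show "AE \<omega> in M. ennreal (Phi X z \<phi> n \<omega>) epowr x \<le> ennreal (Phi X z \<phi> (Suc n) \<omega>) epowr x" for n
      using x by (intro AE_I2 epowr_mono incseq_SucD[OF Phi_lim_SUP(2)]) auto
  qed measurable
  also have "\<dots> = (SUP n. \<integral>\<^sup>+e. \<integral>\<^sup>+t. ennreal (snd t) epowr x \<partial>quenched n e (z, \<phi>) \<partial>env_dist)"
  proof (intro SUP_cong refl)
    fix n
    have gm: "(\<lambda>t. ennreal (snd t) epowr x) \<in> borel_measurable litter_space" by measurable
    have "(\<integral>\<^sup>+\<omega>. ennreal (Phi X z \<phi> n \<omega>) epowr x \<partial>M) = (\<integral>\<^sup>+\<omega>. \<integral>\<^sup>+t. ennreal (snd t) epowr x \<partial>quenched n (envs \<omega>) (z, \<phi>) \<partial>M)"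
      using nn_integral_state[OF \<phi>, of "\<lambda>e t. ennreal (snd t) epowr x" z n] by (simp add: case_prod_beta' state_def)
    also have "\<dots> = (\<integral>\<^sup>+e. \<integral>\<^sup>+t. ennreal (snd t) epowr x \<partial>quenched n e (z, \<phi>) \<partial>env_dist)"
      by (rule nn_integral_env_dist[symmetric, OF measurable_quenched_integral'[OF gm]]) (use \<phi> in simp)
    finally show "(\<integral>\<^sup>+\<omega>. ennreal (Phi X z \<phi> n \<omega>) epowr x \<partial>M) = (\<integral>\<^sup>+e. \<integral>\<^sup>+t. ennreal (snd t) epowr x \<partial>quenched n e (z, \<phi>) \<partial>env_dist)" .
  qed
  finally show ?thesis .
qed

lemma Phi_lim_moment_mono:
  assumes "0 \<le> \<phi>" "0 < y" "y \<le> x"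
  shows "(\<integral>\<^sup>+\<omega>. Phi_lim X z \<phi> \<omega> epowr y \<partial>M) \<le> 1 + (\<integral>\<^sup>+\<omega>. Phi_lim X z \<phi> \<omega> epowr x \<partial>M)"
proof -
  note [measurable] = measurable_Phi[OF assms(1)]
  have m: "Phi_lim X z \<phi> \<in> borel_measurable M"
    by (subst measurable_cong[OF Phi_lim_SUP(1)]) measurable
  have "(\<integral>\<^sup>+\<omega>. Phi_lim X z \<phi> \<omega> epowr y \<partial>M) \<le> (\<integral>\<^sup>+\<omega>. 1 + Phi_lim X z \<phi> \<omega> epowr x \<partial>M)"
    using assms by (intro nn_integral_mono epowr_le_Suc)
  also have "\<dots> = 1 + (\<integral>\<^sup>+\<omega>. Phi_lim X z \<phi> \<omega> epowr x \<partial>M)"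
    using m by (subst nn_integral_add) (simp_all add: emeasure_space_1)
  finally show ?thesis .
qed

end

section \<open>The assumptions in terms of the law of the environment\<close>

context branching_in_environment
begin

lemma measurable_snd_X [measurable]: "(\<lambda>\<omega>. snd (X n i k \<omega>)) \<in> borel_measurable M"
  using measurable_compose[OF measurable_litters measurable_snd_litter, of "(n, i, k)"] by (simp add: litters_def)

lemma measurable_Xi_F [measurable]: "(\<lambda>\<omega>. Xi F \<omega> $ i) \<in> borel_measurable M"
  unfolding Xi_envs by (rule measurable_compose[OF measurable_envs measurable_Xi])

lemma nn_integral_Xi: "(\<integral>\<^sup>+e. Xi coord e $ i epowr y \<partial>env_dist) = (\<integral>\<^sup>+\<omega>. Xi F \<omega> $ i epowr y \<partial>M)"
  unfolding Xi_envs by (rule nn_integral_env_dist) measurable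

text \<open>The tail asymptotics in the direction of a unit coordinate vector, which lies in
  \<open>U_plus\<close>, along y = 2^n.\<close>

lemma Xi_dyadic_tail:
  assumes tail: "\<exists>K\<^sub>0>0. \<exists>h. continuous_on U_plus h \<and> (\<forall>u\<in>U_plus. h u > 0) \<and>
          (\<forall>u\<in>U_plus. ((\<lambda>y. y powr \<kappa> *
              measure M {\<omega> \<in> space M. (\<Sum>i\<in>UNIV. ennreal (u $ i) * Xi F \<omega> $ i) > ennreal y})
            \<longlongrightarrow> K\<^sub>0 * h u) at_top)"
  shows "\<exists>L>0. (\<lambda>n. (2 ^ n) powr \<kappa> * prob {\<omega> \<in> space M. ennreal (2 ^ n) < Xi F \<omega> $ i}) \<longlonglongrightarrow> L"
  proof -
    obtain K h where K: "K > 0" "\<And>u. u \<in> U_plus \<Longrightarrow> h u > 0" and lim: "\<And>u. u \<in> U_plus \<Longrightarrow> ((\<lambda>y. y powr \<kappa> *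
              prob {\<omega> \<in> space M. (\<Sum>i\<in>UNIV. ennreal (u $ i) * Xi F \<omega> $ i) > ennreal y}) \<longlongrightarrow> K * h u) at_top"
      using tail by blast
    have u: "axis i 1 \<in> U_plus" by (simp add: U_plus_def axis_def norm_axis_1 [unfolded axis_def])
    have "(\<Sum>j\<in>UNIV. ennreal ((axis i 1 :: real ^ 'm) $ j) * Xi F \<omega> $ j) = Xi F \<omega> $ i" for \<omega>
      by (simp add: axis_def if_distrib[of ennreal] if_distrib[of "\<lambda>x. x * _"] cong: if_cong)
    then have "((\<lambda>y. y powr \<kappa> * prob {\<omega> \<in> space M. ennreal y < Xi F \<omega> $ i}) \<longlongrightarrow> K * h (axis i 1)) at_top"
      using lim[OF u] by simp
    moreover have "filterlim (\<lambda>n. 2 ^ n :: real) at_top sequentially"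
      using filterlim_realpow_sequentially_gt1[of "2 :: real"] by (simp add: filterlim_at_infinity_imp_filterlim_at_top)
    ultimately have "(\<lambda>n. (2 ^ n) powr \<kappa> * prob {\<omega> \<in> space M. ennreal (2 ^ n) < Xi F \<omega> $ i}) \<longlonglongrightarrow> K * h (axis i 1)"
      by (rule filterlim_compose)
    then show ?thesis using K(1) K(2)[OF u] by (intro exI[of _ "K * h (axis i 1)"]) simp
  qed

text \<open>If the mean vanished, the characteristic would be 0 almost surely, and so would its p-th
  power.\<close>

lemma char_pos_env_dist:
  assumes "0 < (\<integral>\<^sup>+\<omega>. ennreal (snd (X 0 i 0 \<omega>) powr p) \<partial>M)"
  shows "(\<integral>\<^sup>+e. mean_char coord 0 e $ i \<partial>env_dist) \<noteq> 0"
  proof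
    assume 0: "(\<integral>\<^sup>+e. mean_char coord 0 e $ i \<partial>env_dist) = 0"
    have "(\<integral>\<^sup>+\<omega>. ennreal (snd (X 0 i 0 \<omega>)) \<partial>M) = (\<integral>\<^sup>+e. mean_char coord 0 e $ i \<partial>env_dist)"
      using nn_integral_litter[of "\<lambda>t. ennreal (snd t)" i 0] by (simp add: mean_char_def)
    then have "AE \<omega> in M. ennreal (snd (X 0 i 0 \<omega>)) = 0"
      using 0 by (simp add: nn_integral_0_iff_AE)
    then have "AE \<omega> in M. ennreal (snd (X 0 i 0 \<omega>) powr p) = 0"
      using AE_space
    proof eventually_elim
      case (elim \<omega>)
      then have "snd (X 0 i 0 \<omega>) = 0" using litter_nonneg[of \<omega> 0 i 0] by (simp add: ennreal_eq_0_iff)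
      then show ?case by simp
    qed
    then have "(\<integral>\<^sup>+\<omega>. ennreal (snd (X 0 i 0 \<omega>) powr p) \<partial>M) = 0"
      by (subst nn_integral_0_iff_AE) auto
    then show False using assms by simp
  qed

lemma moment_env_env_dist:
  assumes \<kappa>: "0 < \<kappa>"
    and char: "\<And>i. (\<integral>\<^sup>+e. mean_char coord 0 e $ i \<partial>env_dist) \<noteq> 0"
    and L: "\<And>i. \<exists>L>0. (\<lambda>n. (2 ^ n) powr \<kappa> * prob {\<omega> \<in> space M. ennreal (2 ^ n) < Xi F \<omega> $ i}) \<longlonglongrightarrow> L"
  shows "moment_env env_dist \<kappa>"
proof (intro moment_env.intro env_law_env_dist moment_env_axioms.intro \<kappa> char)
  fix y i assume y: "0 < y" "y < \<kappa>"
  obtain l where "(\<lambda>n. (2 ^ n) powr \<kappa> * prob {\<omega> \<in> space M. ennreal (2 ^ n) < Xi F \<omega> $ i}) \<longlonglongrightarrow> l" using L by blast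
  then show "(\<integral>\<^sup>+e. Xi coord e $ i epowr y \<partial>env_dist) < \<infinity>"
    unfolding nn_integral_Xi using y by (intro tail_moment_finite) auto
qed

lemma Xi_critical_env_dist:
  assumes "0 < \<kappa>" "\<exists>L>0. (\<lambda>n. (2 ^ n) powr \<kappa> * prob {\<omega> \<in> space M. ennreal (2 ^ n) < Xi F \<omega> $ i}) \<longlonglongrightarrow> L"
  shows "(\<integral>\<^sup>+e. Xi coord e $ i epowr \<kappa> \<partial>env_dist) = top"
proof -
  obtain l where "0 < l" "(\<lambda>n. (2 ^ n) powr \<kappa> * prob {\<omega> \<in> space M. ennreal (2 ^ n) < Xi F \<omega> $ i}) \<longlonglongrightarrow> l" using assms(2) by blast
  then show ?thesis unfolding nn_integral_Xi using assms(1) by (intro tail_moment_infinite) auto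
qed

lemma Xi_comparable_env_dist:
  assumes \<kappa>: "0 < \<kappa>" "\<kappa> < 1"
    and L: "\<And>i. \<exists>L>0. (\<lambda>n. (2 ^ n) powr \<kappa> * prob {\<omega> \<in> space M. ennreal (2 ^ n) < Xi F \<omega> $ i}) \<longlonglongrightarrow> L"
  shows "\<exists>C<top. \<forall>i y. \<kappa> / 2 \<le> y \<longrightarrow> y < \<kappa> \<longrightarrow>
    (\<integral>\<^sup>+e. (\<Sum>j\<in>UNIV. Xi coord e $ j) epowr y \<partial>env_dist) \<le> C * (1 + (\<integral>\<^sup>+e. Xi coord e $ i epowr y \<partial>env_dist))"
proof -
  have m: "\<And>f. f \<in> borel_measurable env_seqs \<Longrightarrow> f \<in> borel_measurable env_dist"
    by (simp add: env_dist_def)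
  have "\<exists>C<top. \<forall>y. 0 < y \<longrightarrow> y < \<kappa> \<longrightarrow>
      (\<integral>\<^sup>+\<omega>. Xi F \<omega> $ j epowr y \<partial>M) \<le> C * (1 + (\<integral>\<^sup>+\<omega>. Xi F \<omega> $ i epowr y \<partial>M))" for i j
  proof -
    obtain k where k: "0 < k" "(\<lambda>n. (2 ^ n) powr \<kappa> * prob {\<omega> \<in> space M. ennreal (2 ^ n) < Xi F \<omega> $ i}) \<longlonglongrightarrow> k" using L by blast
    obtain l where l: "(\<lambda>n. (2 ^ n) powr \<kappa> * prob {\<omega> \<in> space M. ennreal (2 ^ n) < Xi F \<omega> $ j}) \<longlonglongrightarrow> l" using L by blast
    show ?thesis by (rule tail_moment_comparable[OF _ _ _ k(1) l k(2)]) (use \<kappa> in auto)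
  qed
  then have "\<forall>p. \<exists>C<top. \<forall>y. 0 < y \<longrightarrow> y < \<kappa> \<longrightarrow>
      (\<integral>\<^sup>+\<omega>. Xi F \<omega> $ snd p epowr y \<partial>M) \<le> C * (1 + (\<integral>\<^sup>+\<omega>. Xi F \<omega> $ fst p epowr y \<partial>M))"
    by blast
  from choice[OF this] obtain c where c: "\<And>p. c p < top \<and> (\<forall>y. 0 < y \<longrightarrow> y < \<kappa> \<longrightarrow>
      (\<integral>\<^sup>+\<omega>. Xi F \<omega> $ snd p epowr y \<partial>M) \<le> c p * (1 + (\<integral>\<^sup>+\<omega>. Xi F \<omega> $ fst p epowr y \<partial>M)))"
    by blast
  define C where "C i j = c (i, j)" for i j
  have C: "C i j < top" "0 < y \<Longrightarrow> y < \<kappa> \<Longrightarrow>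
      (\<integral>\<^sup>+\<omega>. Xi F \<omega> $ j epowr y \<partial>M) \<le> C i j * (1 + (\<integral>\<^sup>+\<omega>. Xi F \<omega> $ i epowr y \<partial>M))" for i j y
    using c[of "(i, j)"] by (simp_all add: C_def)
  show ?thesis
  proof (intro exI[of _ "\<Sum>i\<in>UNIV. \<Sum>j\<in>UNIV. C i j"] conjI allI impI)
    show "(\<Sum>i\<in>UNIV. \<Sum>j\<in>UNIV. C i j) < top" using C(1) by simp
    fix i y assume y: "\<kappa> / 2 \<le> y" "y < \<kappa>"
    have y0: "0 < y" "y \<le> 1" using y \<kappa> by auto
    have "(\<integral>\<^sup>+e. (\<Sum>j\<in>UNIV. Xi coord e $ j) epowr y \<partial>env_dist) \<le> (\<integral>\<^sup>+e. (\<Sum>j\<in>UNIV. Xi coord e $ j epowr y) \<partial>env_dist)"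
      by (intro nn_integral_mono epowr_sum_le_one y0)
    also have "\<dots> = (\<Sum>j\<in>UNIV. \<integral>\<^sup>+e. Xi coord e $ j epowr y \<partial>env_dist)"
      by (rule nn_integral_sum) (simp add: m)
    also have "\<dots> \<le> (\<Sum>j\<in>UNIV. C i j * (1 + (\<integral>\<^sup>+e. Xi coord e $ i epowr y \<partial>env_dist)))"
      unfolding nn_integral_Xi by (intro sum_mono C(2) y0 y)
    also have "\<dots> = (\<Sum>j\<in>UNIV. C i j) * (1 + (\<integral>\<^sup>+e. Xi coord e $ i epowr y \<partial>env_dist))"
      by (simp only: sum_distrib_right)
    also have "\<dots> \<le> (\<Sum>i\<in>UNIV. \<Sum>j\<in>UNIV. C i j) * (1 + (\<integral>\<^sup>+e. Xi coord e $ i epowr y \<partial>env_dist))"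
      by (intro mult_right_mono member_le_sum[of i UNIV "\<lambda>i. \<Sum>j\<in>UNIV. C i j"]) auto
    finally show "(\<integral>\<^sup>+e. (\<Sum>j\<in>UNIV. Xi coord e $ j) epowr y \<partial>env_dist) \<le>
      (\<Sum>i\<in>UNIV. \<Sum>j\<in>UNIV. C i j) * (1 + (\<integral>\<^sup>+e. Xi coord e $ i epowr y \<partial>env_dist))" .
  qed
qed

lemma var_env_env_dist:
  assumes me: "moment_env env_dist \<kappa>" and \<kappa>: "\<kappa> < 1"
    and offspring: "\<And>i. (\<integral>\<^sup>+\<omega>. (\<Sum>j\<in>UNIV. evariance (F 0 \<omega> i) (\<lambda>x. real (fst x $ j))) epowr \<kappa> \<partial>M) < \<infinity>"
    and char: "(\<integral>\<^sup>+\<omega>. (\<Sum>i\<in>UNIV. evariance (F 0 \<omega> i) snd) epowr \<kappa> \<partial>M) < \<infinity>"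
    and \<delta>: "0 < \<delta>" "\<And>i. (\<integral>\<^sup>+\<omega>. ennreal (snd (X 0 i 0 \<omega>) powr (\<kappa> + \<delta>)) \<partial>M) < \<infinity>"
    and L: "\<And>i. \<exists>L>0. (\<lambda>n. (2 ^ n) powr \<kappa> * prob {\<omega> \<in> space M. ennreal (2 ^ n) < Xi F \<omega> $ i}) \<longlonglongrightarrow> L"
  shows "var_env env_dist \<kappa>"
proof -
  have \<kappa>0: "0 < \<kappa>" by (rule moment_env.\<kappa>[OF me])
  have offspring': "(\<integral>\<^sup>+e. offspring_var (e 0) i epowr \<kappa> \<partial>env_dist) < top" for i
  proof -
    have "(\<integral>\<^sup>+e. offspring_var (e 0) i epowr \<kappa> \<partial>env_dist) = (\<integral>\<^sup>+\<omega>. offspring_var (envs \<omega> 0) i epowr \<kappa> \<partial>M)"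
      by (rule nn_integral_env_dist) measurable
    then show ?thesis using offspring[of i] by (simp add: offspring_var_def envs_def)
  qed
  have char': "(\<integral>\<^sup>+e. char_var (e 0) i epowr \<kappa> \<partial>env_dist) < top" for i
  proof -
    have "(\<integral>\<^sup>+e. char_var (e 0) i epowr \<kappa> \<partial>env_dist) = (\<integral>\<^sup>+\<omega>. char_var (envs \<omega> 0) i epowr \<kappa> \<partial>M)"
      by (rule nn_integral_env_dist) measurable
    also have "\<dots> \<le> (\<integral>\<^sup>+\<omega>. (\<Sum>i\<in>UNIV. evariance (F 0 \<omega> i) snd) epowr \<kappa> \<partial>M)"
      unfolding char_var_def envs_def using \<kappa>0 by (intro nn_integral_mono epowr_mono member_le_sum) auto
    also have "\<dots> < top" using char by simp
    finally show ?thesis .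
  qed
  have "(\<integral>\<^sup>+e. \<integral>\<^sup>+t. ennreal (snd t) epowr (\<kappa> + \<delta>) \<partial>e 0 i \<partial>env_dist) < top" for i
  proof -
    have "(\<integral>\<^sup>+e. \<integral>\<^sup>+t. ennreal (snd t) epowr (\<kappa> + \<delta>) \<partial>e 0 i \<partial>env_dist) =
        (\<integral>\<^sup>+\<omega>. ennreal (snd (X 0 i 0 \<omega>)) epowr (\<kappa> + \<delta>) \<partial>M)"
      by (rule nn_integral_litter[symmetric]) measurable
    also have "\<dots> = (\<integral>\<^sup>+\<omega>. ennreal (snd (X 0 i 0 \<omega>) powr (\<kappa> + \<delta>)) \<partial>M)"
      using \<kappa>0 \<delta>(1) by (intro nn_integral_cong) (simp add: epowr_ennreal litter_nonneg)
    finally show ?thesis using \<delta>(2)[of i] by simp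
  qed
  with \<delta>(1) have "\<exists>\<delta>>0. \<forall>i. (\<integral>\<^sup>+e. \<integral>\<^sup>+t. ennreal (snd t) epowr (\<kappa> + \<delta>) \<partial>e 0 i \<partial>env_dist) < top" by blast
  then show ?thesis
    by (intro var_env.intro var_env_axioms.intro me \<kappa> offspring' char' Xi_comparable_env_dist Xi_critical_env_dist \<kappa>0 L)
qed

text \<open>The assumption controls only the centred offspring number. Its quenched mean is a row
  sum of the first mean matrix, whose x-th moment is finite by \<open>growth_finite\<close> because
  x < \<kappa>.\<close>

lemma litter_moment_env_dist:
  assumes me: "moment_env env_dist \<kappa>" and x: "1 < x" "x < \<kappa>"
    and offspring: "(\<integral>\<^sup>+\<omega>. ennreal (\<bar>\<Sum>j\<in>UNIV. real (fst (X 0 i 0 \<omega>) $ j) - enn2real (mean_matrix F 0 \<omega> $ i $ j)\<bar> powr \<kappa>) \<partial>M) < \<infinity>"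
    and \<delta>: "0 < \<delta>" "(\<integral>\<^sup>+\<omega>. ennreal (snd (X 0 i 0 \<omega>) powr (\<kappa> + \<delta>)) \<partial>M) < \<infinity>"
  shows "(\<integral>\<^sup>+e. \<integral>\<^sup>+t. lin (\<lambda>_. 1) 1 t epowr x \<partial>e 0 i \<partial>env_dist) < \<infinity>"
proof -
  have x0: "0 < x" using x by simp
  let ?xi = "\<lambda>\<omega>. \<Sum>j\<in>UNIV. real (fst (X 0 i 0 \<omega>) $ j)"
  let ?d = "\<lambda>\<omega>. \<bar>\<Sum>j\<in>UNIV. real (fst (X 0 i 0 \<omega>) $ j) - enn2real (mean_matrix F 0 \<omega> $ i $ j)\<bar>"
  let ?a = "\<lambda>\<omega>. matnorm (right_prod coord 1 (envs \<omega>))"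
  have [measurable]: "(\<lambda>\<omega>. real (fst (X 0 i 0 \<omega>) $ j)) \<in> borel_measurable M" for j
    using measurable_compose[OF measurable_compose[OF measurable_litters[of "(0, i, 0)"] measurable_fst_nth[of j]], of real borel]
    by (simp add: litters_def)
  have [measurable]: "(\<lambda>\<omega>. mean_matrix F 0 \<omega> $ i $ j) \<in> borel_measurable M" for j
    unfolding mean_matrix_envs by (rule measurable_compose[OF measurable_envs measurable_mean_matrix])
  have [measurable]: "?a \<in> borel_measurable M" by (rule measurable_compose[OF measurable_envs measurable_matnorm])
  have pt: "lin (\<lambda>_. 1) 1 (X 0 i 0 \<omega>) epowr x \<le> 2 epowr x * (2 epowr x * (1 + ennreal (?d \<omega> powr \<kappa>) + ?a \<omega> epowr x) +
      (1 + ennreal (snd (X 0 i 0 \<omega>) powr (\<kappa> + \<delta>))))" if \<omega>: "\<omega> \<in> space M" for \<omega>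
  proof -
    have "?xi \<omega> = (\<Sum>j\<in>UNIV. real (fst (X 0 i 0 \<omega>) $ j) - enn2real (mean_matrix F 0 \<omega> $ i $ j)) + (\<Sum>j\<in>UNIV. enn2real (mean_matrix F 0 \<omega> $ i $ j))"
      by (simp add: sum_subtractf)
    also have "\<dots> \<le> ?d \<omega> + (\<Sum>j\<in>UNIV. enn2real (mean_matrix F 0 \<omega> $ i $ j))" by simp
    finally have "ennreal (?xi \<omega>) \<le> ennreal (?d \<omega> + (\<Sum>j\<in>UNIV. enn2real (mean_matrix F 0 \<omega> $ i $ j)))" by (rule ennreal_leI)
    also have "\<dots> = ennreal (?d \<omega>) + (\<Sum>j\<in>UNIV. ennreal (enn2real (mean_matrix F 0 \<omega> $ i $ j)))"
      by (simp add: ennreal_plus sum_nonneg)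
    \<comment> \<open>\<open>enn2real\<close> sends an infinite mean to 0, so converting back can
      only decrease it and the inequality holds in that case as well.\<close>
    also have "\<dots> \<le> ennreal (?d \<omega>) + (\<Sum>j\<in>UNIV. mean_matrix F 0 \<omega> $ i $ j)"
      by (intro add_left_mono sum_mono) (simp add: ennreal_enn2real_if)
    also have "(\<Sum>j\<in>UNIV. mean_matrix F 0 \<omega> $ i $ j) \<le> ?a \<omega>"
      using row_le_matnorm[of "right_prod coord 1 (envs \<omega>)" i] by (simp add: One_nat_def mean_matrix_envs)
    finally have "ennreal (?xi \<omega>) \<le> ennreal (?d \<omega>) + ?a \<omega>" by (simp add: add_left_mono)
    then have "ennreal (?xi \<omega>) epowr x \<le> (ennreal (?d \<omega>) + ?a \<omega>) epowr x" using x0 by (intro epowr_mono) auto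
    also have "\<dots> \<le> 2 epowr x * (ennreal (?d \<omega>) epowr x + ?a \<omega> epowr x)" by (rule epowr_add_le[OF x0])
    also have "ennreal (?d \<omega>) epowr x \<le> 1 + ennreal (?d \<omega> powr \<kappa>)"
      using epowr_le_Suc[of x \<kappa> "ennreal (?d \<omega>)"] x x0 by (simp add: epowr_ennreal)
    finally have xi: "ennreal (?xi \<omega>) epowr x \<le> 2 epowr x * (1 + ennreal (?d \<omega> powr \<kappa>) + ?a \<omega> epowr x)"
      by (simp add: add_right_mono mult_left_mono)
    have phi: "ennreal (snd (X 0 i 0 \<omega>)) epowr x \<le> 1 + ennreal (snd (X 0 i 0 \<omega>) powr (\<kappa> + \<delta>))"
      using epowr_le_Suc[of x "\<kappa> + \<delta>" "ennreal (snd (X 0 i 0 \<omega>))"] x x0 \<delta>(1) litter_nonneg[OF \<omega>, of 0 i 0]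
      by (simp add: epowr_ennreal)
    have "lin (\<lambda>_. 1) 1 (X 0 i 0 \<omega>) = ennreal (?xi \<omega>) + ennreal (snd (X 0 i 0 \<omega>))"
      by (simp add: lin_def ennreal_of_nat_eq_real_of_nat sum_ennreal)
    then have "lin (\<lambda>_. 1) 1 (X 0 i 0 \<omega>) epowr x \<le> 2 epowr x * (ennreal (?xi \<omega>) epowr x + ennreal (snd (X 0 i 0 \<omega>)) epowr x)"
      using epowr_add_le[OF x0] by simp
    also have "\<dots> \<le> 2 epowr x * (2 epowr x * (1 + ennreal (?d \<omega> powr \<kappa>) + ?a \<omega> epowr x) +
      (1 + ennreal (snd (X 0 i 0 \<omega>) powr (\<kappa> + \<delta>))))"
      by (intro mult_left_mono add_mono xi phi) simp
    finally show ?thesis .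
  qed
  have "(\<integral>\<^sup>+e. \<integral>\<^sup>+t. lin (\<lambda>_. 1) 1 t epowr x \<partial>e 0 i \<partial>env_dist) = (\<integral>\<^sup>+\<omega>. lin (\<lambda>_. 1) 1 (X 0 i 0 \<omega>) epowr x \<partial>M)"
    by (rule nn_integral_litter[symmetric]) measurable
  also have "\<dots> \<le> (\<integral>\<^sup>+\<omega>. 2 epowr x * (2 epowr x * (1 + ennreal (?d \<omega> powr \<kappa>) + ?a \<omega> epowr x) +
      (1 + ennreal (snd (X 0 i 0 \<omega>) powr (\<kappa> + \<delta>)))) \<partial>M)"
    by (rule nn_integral_mono) (rule pt)
  also have "\<dots> = 2 epowr x * (2 epowr x * (1 + (\<integral>\<^sup>+\<omega>. ennreal (?d \<omega> powr \<kappa>) \<partial>M) + (\<integral>\<^sup>+\<omega>. ?a \<omega> epowr x \<partial>M)) +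
      (1 + (\<integral>\<^sup>+\<omega>. ennreal (snd (X 0 i 0 \<omega>) powr (\<kappa> + \<delta>)) \<partial>M)))"
    by (simp add: nn_integral_add nn_integral_cmult emeasure_space_1)
  also have "(\<integral>\<^sup>+\<omega>. ?a \<omega> epowr x \<partial>M) = env_law.growth env_dist x 1"
    unfolding env_law.growth_def[OF env_law_env_dist] by (rule nn_integral_env_dist[symmetric]) measurable
  also have "2 epowr x * (2 epowr x * (1 + (\<integral>\<^sup>+\<omega>. ennreal (?d \<omega> powr \<kappa>) \<partial>M) + env_law.growth env_dist x 1) +
      (1 + (\<integral>\<^sup>+\<omega>. ennreal (snd (X 0 i 0 \<omega>) powr (\<kappa> + \<delta>)) \<partial>M))) < \<infinity>"
  proof -
    have "(\<integral>\<^sup>+\<omega>. ennreal (?d \<omega> powr \<kappa>) \<partial>M) < top" using offspring by simp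
    then show ?thesis using moment_env.growth_finite[OF me x0 x(2), of 1] \<delta>(2) by (simp add: ennreal_mult_less_top)
  qed
  finally show ?thesis .
qed

end

theorem theorem7:
  fixes M :: "'w measure"
    and F :: "nat \<Rightarrow> 'w \<Rightarrow> 'm::finite \<Rightarrow> 'm litter measure"
    and X :: "nat \<Rightarrow> 'm \<Rightarrow> nat \<Rightarrow> 'w \<Rightarrow> 'm litter"
    and z :: "nat ^ 'm" and \<phi>\<^sub>0 \<kappa> :: real
  assumes process: "mbprcre M F X"
    and initial: "z \<noteq> 0" "\<phi>\<^sub>0 \<ge> 0"
    and log_moment: "(\<integral>\<^sup>+\<omega>. e2ennreal (max 0 (eln (matnorm (mean_matrix F 0 \<omega>)))) \<partial>M) < \<infinity>"
    and subcritical: "lyapunov M F < 0"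
    and positivity: "\<exists>L>0. (AE \<omega> in M. \<forall>i j. left_prod F L \<omega> $ i $ j > 0) \<and>
          (\<exists>l. \<forall>i. (\<integral>\<^sup>+\<omega>. e2ennreal \<bar>eln (ennreal (1 - no_type_prob M F X (axis i 1) L l \<omega>))\<bar> \<partial>M) < \<infinity>)"
    and exponent: "kappa M F = ereal \<kappa>" "0 < \<kappa>"
    and moments_gt1: "\<kappa> > 1 \<Longrightarrow>
          (\<forall>n i. (\<integral>\<^sup>+\<omega>. ennreal (\<bar>\<Sum>j\<in>UNIV. real (fst (X n i 0 \<omega>) $ j) - enn2real (mean_matrix F n \<omega> $ i $ j)\<bar> powr \<kappa>) \<partial>M) < \<infinity>) \<and>
          (\<forall>n. (\<integral>\<^sup>+\<omega>. ennreal (\<bar>\<Sum>i\<in>UNIV. snd (X n i 0 \<omega>) - enn2real (mean_char F n \<omega> $ i)\<bar> powr \<kappa>) \<partial>M) < \<infinity>)"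
    and moments_le1: "\<kappa> \<le> 1 \<Longrightarrow>
          (\<forall>n i. (\<integral>\<^sup>+\<omega>. (\<Sum>j\<in>UNIV. evariance (F n \<omega> i) (\<lambda>x. real (fst x $ j))) epowr \<kappa> \<partial>M) < \<infinity>) \<and>
          (\<forall>n. (\<integral>\<^sup>+\<omega>. (\<Sum>i\<in>UNIV. evariance (F n \<omega> i) snd) epowr \<kappa> \<partial>M) < \<infinity>)"
    and characteristic: "\<exists>\<delta>>0. \<forall>n i. 0 < (\<integral>\<^sup>+\<omega>. ennreal (snd (X n i 0 \<omega>) powr (\<kappa> + \<delta>)) \<partial>M) \<and>
          (\<integral>\<^sup>+\<omega>. ennreal (snd (X n i 0 \<omega>) powr (\<kappa> + \<delta>)) \<partial>M) < \<infinity>"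
    and tail: "\<exists>K\<^sub>0>0. \<exists>h. continuous_on U_plus h \<and> (\<forall>u\<in>U_plus. h u > 0) \<and>
          (\<forall>u\<in>U_plus. ((\<lambda>y. y powr \<kappa> *
              measure M {\<omega> \<in> space M. (\<Sum>i\<in>UNIV. ennreal (u $ i) * Xi F \<omega> $ i) > ennreal y})
            \<longlongrightarrow> K\<^sub>0 * h u) at_top)"
  shows "\<forall>x>0. (\<integral>\<^sup>+\<omega>. Phi_lim X z \<phi>\<^sub>0 \<omega> epowr x \<partial>M) < \<infinity> \<longleftrightarrow> x < \<kappa>"
proof -
  have B: "branching_in_environment M F X" by (rule branching_in_environment.intro[OF process])
  note env_dist = branching_in_environment.env_dist_def[OF B]
  let ?E = "branching_in_environment.env_dist M F"
  obtain \<delta> where \<delta>: "\<delta> > 0"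
    "\<And>i. 0 < (\<integral>\<^sup>+\<omega>. ennreal (snd (X 0 i 0 \<omega>) powr (\<kappa> + \<delta>)) \<partial>M)"
    "\<And>i. (\<integral>\<^sup>+\<omega>. ennreal (snd (X 0 i 0 \<omega>) powr (\<kappa> + \<delta>)) \<partial>M) < \<infinity>"
    using characteristic by blast
  note L = branching_in_environment.Xi_dyadic_tail[OF B tail]
  have me: "moment_env ?E \<kappa>"
    by (intro branching_in_environment.moment_env_env_dist[OF B] exponent L
        branching_in_environment.char_pos_env_dist[OF B \<delta>(2)])
  have infinite: "(SUP n. \<integral>\<^sup>+e. \<integral>\<^sup>+t. ennreal (snd t) epowr \<kappa> \<partial>quenched n e (z, \<phi>\<^sub>0) \<partial>?E) = top"
  proof (cases "1 \<le> \<kappa>")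
    case True
    obtain i where i: "z $ i \<noteq> 0" using initial(1) by (auto simp: vec_eq_iff)
    show ?thesis
      using moment_env.annealed_moment_ge[OF me True initial(2) i]
      unfolding branching_in_environment.Xi_critical_env_dist[OF B exponent(2) L] by (simp add: top_unique)
  next
    case False
    then have "var_env ?E \<kappa>"
      by (intro branching_in_environment.var_env_env_dist[OF B me _ _ _ \<delta>(1,3) L]) (use moments_le1 in auto)
    then show ?thesis by (rule var_env.annealed_critical_infinite[OF _ initial])
  qed
  note Phi_lim = branching_in_environment.Phi_lim_moment[OF B initial(2)]
  show ?thesis
  proof (intro allI impI)
    fix x :: real assume x: "0 < x"
    show "(\<integral>\<^sup>+\<omega>. Phi_lim X z \<phi>\<^sub>0 \<omega> epowr x \<partial>M) < \<infinity> \<longleftrightarrow> x < \<kappa>"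
    proof
      assume lt: "x < \<kappa>"
      have "\<exists>B<top. \<forall>n. (\<integral>\<^sup>+e. \<integral>\<^sup>+t. ennreal (snd t) epowr x \<partial>quenched n e (z, \<phi>\<^sub>0) \<partial>?E) \<le> B"
      proof (cases "1 < x")
        case True
        show ?thesis
          by (intro moment_env.annealed_moment_bounded_gt1[OF me] True lt initial
              branching_in_environment.litter_moment_env_dist[OF B me True lt _ \<delta>(1,3)])
            (use moments_gt1 True lt in auto)
      next
        case False
        then show ?thesis by (intro moment_env.annealed_moment_bounded_le1[OF me x _ lt initial(2)]) simp
      qed
      then obtain B where B: "B < top" "\<And>n. (\<integral>\<^sup>+e. \<integral>\<^sup>+t. ennreal (snd t) epowr x \<partial>quenched n e (z, \<phi>\<^sub>0) \<partial>?E) \<le> B"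
        by blast
      have "(\<integral>\<^sup>+\<omega>. Phi_lim X z \<phi>\<^sub>0 \<omega> epowr x \<partial>M) \<le> B"
        unfolding Phi_lim[OF x] by (rule SUP_least) (rule B)
      then show "(\<integral>\<^sup>+\<omega>. Phi_lim X z \<phi>\<^sub>0 \<omega> epowr x \<partial>M) < \<infinity>" using B(1) by (simp add: le_less_trans)
    next
      assume fin: "(\<integral>\<^sup>+\<omega>. Phi_lim X z \<phi>\<^sub>0 \<omega> epowr x \<partial>M) < \<infinity>"
      show "x < \<kappa>"
      proof (rule ccontr)
        assume "\<not> x < \<kappa>"
        \<comment> \<open>For x \<ge> \<kappa> a finite x-th moment entails a finite \<kappa>-th
          moment, so only the critical order needs to be excluded.\<close>
        then have "(\<integral>\<^sup>+\<omega>. Phi_lim X z \<phi>\<^sub>0 \<omega> epowr \<kappa> \<partial>M) \<le> 1 + (\<integral>\<^sup>+\<omega>. Phi_lim X z \<phi>\<^sub>0 \<omega> epowr x \<partial>M)"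
          using exponent(2) initial(2) by (intro branching_in_environment.Phi_lim_moment_mono[OF B]) auto
        then show False using fin unfolding Phi_lim[OF exponent(2)] infinite by (simp add: top_unique)
      qed
    qed
  qed
qed

end
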